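(* Let $(X,\rho,\mu)$ be a space of homogeneous type (with the standing assumptions listed in the context). (i) Let $f\in\mathrm{PBMO}^+(X\times\mathbb R)$. Then there exist a $\gamma\in(0,1)$, two constants $\alpha,\beta\in(0,\infty)$, a function $b\in L^\infty(X\times\mathbb R)$, and two nonnegative Borel regular measures $\nu_1$ and $\nu_2$ on $X\times\mathbb R$ such that $$f=-\alpha\log\mathcal M^{\gamma-}\nu_1+\beta\log\mathcal M^{\gamma+}\nu_2+b.$$ (ii) Let $\alpha,\beta\in(0,\infty)$, $b\in L^\infty(X\times\mathbb R)$, and let $\nu_1$ and $\nu_2$ be two locally finite nonnegative measures on $X\times\mathbb R$, each defined on a $\sigma$-algebra which contains $\{B(x,l)\times(t-l^p,t):\ (x,t)\in X\times\mathbb R,\ l\in(0,\infty)\}$, such that, for each $i\in\{1,2\}$, $\mathcal M^-\nu_i(x,t)<\infty$ for $\lambda$-almost every $(x,t)\in X\times\mathbb R$. Then $$-\alpha\log\mathcal M^{-}\nu_1+\beta\log\mathcal M^{+}\nu_2+b\in\mathrm{PBMO}^+(X\times\mathbb R).$$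
   Context: Setting. $(X,\rho)$ is a quasi-metric space: $\rho:X\times X\to[0,\infty)$, $\rho(x,y)=0$ iff $x=y$, $\rho(x,y)=\rho(y,x)$, and $\rho(x,y)\le K_0[\rho(x,z)+\rho(z,y)]$ for all $x,y,z\in X$, with a constant $K_0\in[1,\infty)$. Balls are $B(x,r)=\{y\in X:\rho(x,y)<r\}$, and $\operatorname{diam}(E)=\sup\{\rho(x,y):x,y\in E\}$. $\mu$ is a nonnegative measure on a $\sigma$-algebra containing the balls which is doubling: $\mu(B(x,2r))\le C_\mu\mu(B(x,r))$ for all $x\in X$, $r\in(0,\infty)$; then $(X,\rho,\mu)$ is called a space of homogeneous type. Standing assumptions: (a) for each $x$ the balls $\{B(x,r)\}_{r>0}$ form a basis of open neighborhoods of $x$; (b) $\mu$ is Borel regular (open sets are measurable and every $A\subset X$ lies in a Borel set $E$ with $\mu(A)=\mu(E)$); (c) $0<\mu(B(x,r))<\infty$ for all balls; (d) $\operatorname{diam}(X)=\infty$ and $\mu(\{x\})=0$ for all $x$; (e) monotone geodesic property: there is a constant $\widetilde K>0$ such that for all $s\in(0,\infty)$ and $x,y\in X$ with $\rho(x,y)\ge s$ there are $m\in\mathbb N$ and points $x_0=x,x_1,\dots,x_m=y$ with $\rho(x_i,x_{i+1})\le\widetilde K s$ and $\rho(x_{i+1},x_m)\le\rho(x_i,x_m)-s$ for $i=0,\dots,m-1$. Fix $p\in(1,\infty)$. $X\times\mathbb R$ carries the quasi-metric $d((x,t),(y,s))=\max\{\rho(x,y),|t-s|^{1/p}\}$ and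 the product measure $\lambda=\mu\times m$, $m$ being Lebesgue measure on $\mathbb R$; the same basic assumptions (a)-(d) are made for $(X\times\mathbb R,d,\lambda)$. Integrals of functions are with respect to $\lambda$, and equalities between functions are understood $\lambda$-almost everywhere. For $r\in\mathbb R$, $r_+=\max\{0,r\}$. A measure $\nu$ on $X\times\mathbb R$ is Borel regular if open sets are $\nu$-measurable and every $A\subset X\times\mathbb R$ is contained in a Borel set $E$ with $\nu(A)=\nu(E)$. Parabolic BMO. For $x\in X$, $t\in\mathbb R$, $l\in(0,\infty)$, $\gamma\in[0,1)$ put $R=R(x,t,l)=B(x,l)\times(t-l^p,t+l^p)$, $R^-(\gamma)=B(x,l)\times(t-l^p,t-\gamma l^p)$, $R^+(\gamma)=B(x,l)\times(t+\gamma l^p,t+l^p)$ (parabolic cylinders). $L^1_{\rm loc}(X\times\mathbb R)$ is the set of $\lambda$-measurable functions that are integrable on some $R(x,t,r)$, $r\in(0,\infty)$, around each point $(x,t)$. $\mathrm{PBMO}^+(X\times\mathbb R)$ is the set of all (real-valued) $u\in L^1_{\rm loc}(X\times\mathbb R)$ for which there exist $\gamma\in(0,1)$ and constants $a_R\in\mathbb R$ (which may depend on $R$) with $$\sup_R\left[\frac1{\lambda(R^+(\gamma))}\int_{R^+(\gamma)}(u-a_R)_+ +\frac1{\lambda(R^-(\gamma))}\int_{R^-(\gamma)}(a_R-u)_+\right]<\infty,$$ the supremum being over all parabolic cylinders $R=R(x,t,l)$. Adjacent dyadic systems and parabolic rectangles. Fix $\delta\in(0,1)$ with $96K_0^6\delta\le1$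 and constants $0<c_0\le C_0<\infty$ with $12K_0^3C_0\delta\le c_0$; let $c_1=(3K_0^2)^{-1}c_0$, $C_1=2K_0C_0$. Fix (they exist by a theorem of Hytönen and Kairema) $K\in\mathbb N$ and, for $\tau\in\{1,\dots,K\}$, points $\{z^{k,\tau}_\alpha\}$ and families $\mathfrak D^\tau=\{Q^{k,\tau}_\alpha: k\in\mathbb Z,\alpha\in I_{k,\tau}\}$ of subsets of $X$ (dyadic cubes) such that for each $\tau$: $\rho(z^{k,\tau}_\alpha,z^{k,\tau}_\beta)\ge c_0\delta^k$ for $\alpha\ne\beta$ and $\min_\alpha\rho(x,z^{k,\tau}_\alpha)<C_0\delta^k$ for all $x\in X$; if $l\ge k$, then either $Q^{l,\tau}_\beta\subset Q^{k,\tau}_\alpha$ or they are disjoint; for each $k$, $X$ is the disjoint union of $Q^{k,\tau}_\alpha$, $\alpha\in I_{k,\tau}$; $B(z^{k,\tau}_\alpha,c_1\delta^k)\subset Q^{k,\tau}_\alpha\subset B(z^{k,\tau}_\alpha,C_1\delta^k)$; if $l\ge k$ and $Q^{l,\tau}_\beta\subset Q^{k,\tau}_\alpha$, then $B(z^{l,\tau}_\beta,C_1\delta^l)\subset B(z^{k,\tau}_\alpha,C_1\delta^k)$; moreover there is a constant $C_*>0$, depending only on $K_0$ and $\delta$, such that every ball $B(x,r)$ is contained in some $Q^{k,\tau}_\alpha$ (for some $\tau$) with $\operatorname{diam}(Q^{k,\tau}_\alpha)\le C_*r$. A parabolic rectangle is $P=P(\tau,k,\alpha,t)=Q^{k,\tau}_\alpha\times(t-\delta^{kp},t+\delta^{kp})$,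 with $P^-(\gamma)=Q^{k,\tau}_\alpha\times(t-\delta^{kp},t-\gamma\delta^{kp})$ and $P^+(\gamma)=Q^{k,\tau}_\alpha\times(t+\gamma\delta^{kp},t+\delta^{kp})$ for $\gamma\in[0,1)$. Maximal functions. For a nonnegative measure $\nu$ on $X\times\mathbb R$, $\mathcal M^{\gamma\pm}\nu(x,t)=\sup\frac{\nu(P^\pm(\gamma))}{\lambda(P^\pm(\gamma))}$, the supremum being over all $\tau,k,\alpha$ with $(x,t)\in P=P(\tau,k,\alpha,t)$ (i.e. $x\in Q^{k,\tau}_\alpha$; the same $t$); $\mathcal M^\pm=\mathcal M^{0\pm}$.
   Formalization: In (ii) the expression is additionally assumed real-valued almost everywhere (it fails e.g. for ν₁=0, where it is +∞); then every real-valued function a.e. equal to it is in PBMO⁺. The dyadic cubes are assumed Borel, so that measures of parabolic rectangles are defined. *)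

theory Defs
  imports "HOL-Analysis.Analysis"
begin

section \<open>Quasi-metric spaces of homogeneous type\<close>

text \<open>The underlying set \<open>X\<close> is the whole type \<open>'a\<close>.\<close>

definition quasi_metric :: "('a \<Rightarrow> 'a \<Rightarrow> real) \<Rightarrow> real \<Rightarrow> bool" where
  "quasi_metric \<rho> K0 \<longleftrightarrow>
     1 \<le> K0 \<and>
     (\<forall>x y. 0 \<le> \<rho> x y) \<and>
     (\<forall>x y. \<rho> x y = 0 \<longleftrightarrow> x = y) \<and>
     (\<forall>x y. \<rho> x y = \<rho> y x) \<and>
     (\<forall>x y z. \<rho> x y \<le> K0 * (\<rho> x z + \<rho> z y))"

definition qball :: "('a \<Rightarrow> 'a \<Rightarrow> real) \<Rightarrow> 'a \<Rightarrow> real \<Rightarrow> 'a set" where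
  "qball \<rho> x r = {y. \<rho> x y < r}"

definition qdiam :: "('a \<Rightarrow> 'a \<Rightarrow> real) \<Rightarrow> 'a set \<Rightarrow> ennreal" where
  "qdiam \<rho> E = (SUP x\<in>E. SUP y\<in>E. ennreal (\<rho> x y))"

text \<open>A topology for which the balls centred at each point form a basis of
  neighbourhoods of that point is necessarily the following one. Balls of a quasi-metric
  need not be open in it.\<close>

definition qtopology :: "('a \<Rightarrow> 'a \<Rightarrow> real) \<Rightarrow> 'a topology" where
  "qtopology \<rho> = topology (\<lambda>U. \<forall>x\<in>U. \<exists>r>0. qball \<rho> x r \<subseteq> U)"

lemma openin_qtopology:
  "openin (qtopology \<rho>) U \<longleftrightarrow> (\<forall>x\<in>U. \<exists>r>0. qball \<rho> x r \<subseteq> U)"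
proof -
  have "istopology (\<lambda>U. \<forall>x\<in>U. \<exists>r>0. qball \<rho> x r \<subseteq> U)"
    unfolding istopology_def
  proof (intro conjI allI impI ballI)
    fix S T x
    assume S: "\<forall>x\<in>S. \<exists>r>0. qball \<rho> x r \<subseteq> S" and T: "\<forall>x\<in>T. \<exists>r>0. qball \<rho> x r \<subseteq> T"
      and "x \<in> S \<inter> T"
    then obtain r s where rs: "r > 0" "s > 0" "qball \<rho> x r \<subseteq> S" "qball \<rho> x s \<subseteq> T"
      by blast
    moreover have "qball \<rho> x (min r s) \<subseteq> qball \<rho> x r \<inter> qball \<rho> x s"
      by (auto simp: qball_def)
    ultimately show "\<exists>r>0. qball \<rho> x r \<subseteq> S \<inter> T"
      by (intro exI[of _ "min r s"]) auto
  next
    fix \<K> x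
    assume "\<forall>U\<in>\<K>. \<forall>x\<in>U. \<exists>r>0. qball \<rho> x r \<subseteq> U" and "x \<in> \<Union>\<K>"
    then show "\<exists>r>0. qball \<rho> x r \<subseteq> \<Union>\<K>"
      by (meson UnionE Union_upper order_trans)
  qed
  then show ?thesis
    by (simp add: qtopology_def topology_inverse')
qed

definition borel_of_qm :: "('a \<Rightarrow> 'a \<Rightarrow> real) \<Rightarrow> 'a set set" where
  "borel_of_qm \<rho> = sigma_sets UNIV {U. openin (qtopology \<rho>) U}"

text \<open>For a set \<open>A\<close> outside the \<open>\<sigma>\<close>-algebra, the measure of \<open>A\<close> is the outer measure
  induced by \<open>M\<close>.\<close>

definition borel_regular :: "('a \<Rightarrow> 'a \<Rightarrow> real) \<Rightarrow> 'a measure \<Rightarrow> bool" where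
  "borel_regular \<rho> M \<longleftrightarrow>
     space M = UNIV \<and>
     (\<forall>U. openin (qtopology \<rho>) U \<longrightarrow> U \<in> sets M) \<and>
     (\<forall>A. \<exists>E \<in> borel_of_qm \<rho>. A \<subseteq> E \<and> outer_measure_of M A = emeasure M E)"

definition doubling :: "('a \<Rightarrow> 'a \<Rightarrow> real) \<Rightarrow> 'a measure \<Rightarrow> bool" where
  "doubling \<rho> M \<longleftrightarrow>
     space M = UNIV \<and>
     (\<forall>x. \<forall>r>0. qball \<rho> x r \<in> sets M) \<and>
     (\<exists>C::real. \<forall>x. \<forall>r>0. emeasure M (qball \<rho> x (2 * r)) \<le> ennreal C * emeasure M (qball \<rho> x r))"

definition standing_assms :: "('a \<Rightarrow> 'a \<Rightarrow> real) \<Rightarrow> 'a measure \<Rightarrow> bool" where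
  "standing_assms \<rho> M \<longleftrightarrow>
     (\<forall>x. \<forall>r>0. openin (qtopology \<rho>) (qball \<rho> x r)) \<and>
     borel_regular \<rho> M \<and>
     (\<forall>x. \<forall>r>0. 0 < emeasure M (qball \<rho> x r) \<and> emeasure M (qball \<rho> x r) < \<infinity>) \<and>
     qdiam \<rho> UNIV = \<infinity> \<and>
     (\<forall>x. emeasure M {x} = 0)"

definition monotone_geodesic :: "('a \<Rightarrow> 'a \<Rightarrow> real) \<Rightarrow> bool" where
  "monotone_geodesic \<rho> \<longleftrightarrow>
     (\<exists>Kt>0. \<forall>s>0. \<forall>x y. \<rho> x y \<ge> s \<longrightarrow>
        (\<exists>(m::nat) xs. xs 0 = x \<and> xs m = y \<and>
           (\<forall>i<m. \<rho> (xs i) (xs (Suc i)) \<le> Kt * s \<and>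
                  \<rho> (xs (Suc i)) (xs m) \<le> \<rho> (xs i) (xs m) - s)))"


section \<open>The parabolic product space\<close>

definition par_dist :: "('a \<Rightarrow> 'a \<Rightarrow> real) \<Rightarrow> real \<Rightarrow> 'a \<times> real \<Rightarrow> 'a \<times> real \<Rightarrow> real" where
  "par_dist \<rho> p z w = max (\<rho> (fst z) (fst w)) (\<bar>snd z - snd w\<bar> powr (1 / p))"

text \<open>Completion makes measurability of functions on the product invariant under
  modification on null sets; integrals are unaffected.\<close>

definition par_measure :: "'a measure \<Rightarrow> ('a \<times> real) measure" where
  "par_measure M = completion (M \<Otimes>\<^sub>M lborel)"

definition cyl :: "('a \<Rightarrow> 'a \<Rightarrow> real) \<Rightarrow> real \<Rightarrow> 'a \<Rightarrow> real \<Rightarrow> real \<Rightarrow> ('a \<times> real) set" where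
  "cyl \<rho> p x t l = qball \<rho> x l \<times> {t - l powr p <..< t + l powr p}"

definition cyl_minus ::
  "('a \<Rightarrow> 'a \<Rightarrow> real) \<Rightarrow> real \<Rightarrow> real \<Rightarrow> 'a \<Rightarrow> real \<Rightarrow> real \<Rightarrow> ('a \<times> real) set" where
  "cyl_minus \<rho> p \<gamma> x t l = qball \<rho> x l \<times> {t - l powr p <..< t - \<gamma> * l powr p}"

definition cyl_plus ::
  "('a \<Rightarrow> 'a \<Rightarrow> real) \<Rightarrow> real \<Rightarrow> real \<Rightarrow> 'a \<Rightarrow> real \<Rightarrow> real \<Rightarrow> ('a \<times> real) set" where
  "cyl_plus \<rho> p \<gamma> x t l = qball \<rho> x l \<times> {t + \<gamma> * l powr p <..< t + l powr p}"

definition L1_loc ::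
  "('a \<Rightarrow> 'a \<Rightarrow> real) \<Rightarrow> real \<Rightarrow> 'a measure \<Rightarrow> ('a \<times> real \<Rightarrow> real) set" where
  "L1_loc \<rho> p M =
     {u \<in> borel_measurable (par_measure M).
        \<forall>x t. \<exists>r>0. set_integrable (par_measure M) (cyl \<rho> p x t r) u}"

definition L_infty :: "'a measure \<Rightarrow> ('a \<times> real \<Rightarrow> real) set" where
  "L_infty M =
     {b \<in> borel_measurable (par_measure M). \<exists>C. AE z in par_measure M. \<bar>b z\<bar> \<le> C}"

text \<open>The function \<open>a\<close> assigns the constant \<open>a\<^sub>R\<close> to the cylinder \<open>R\<close> as a set. The averages
  of the nonnegative functions are taken in \<^typ>\<open>ennreal\<close>, so that finiteness of the
  supremum includes finiteness of each integral.\<close>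

definition PBMO_plus ::
  "('a \<Rightarrow> 'a \<Rightarrow> real) \<Rightarrow> real \<Rightarrow> 'a measure \<Rightarrow> ('a \<times> real \<Rightarrow> real) set" where
  "PBMO_plus \<rho> p M =
     {u \<in> L1_loc \<rho> p M. \<exists>\<gamma>. 0 < \<gamma> \<and> \<gamma> < 1 \<and> (\<exists>a :: ('a \<times> real) set \<Rightarrow> real.
        (SUP (x, t, l) \<in> UNIV \<times> UNIV \<times> {0<..}.
           (\<integral>\<^sup>+ z \<in> cyl_plus \<rho> p \<gamma> x t l. ennreal (max 0 (u z - a (cyl \<rho> p x t l))) \<partial>par_measure M)
             / emeasure (par_measure M) (cyl_plus \<rho> p \<gamma> x t l)
         + (\<integral>\<^sup>+ z \<in> cyl_minus \<rho> p \<gamma> x t l. ennreal (max 0 (a (cyl \<rho> p x t l) - u z)) \<partial>par_measure M)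
             / emeasure (par_measure M) (cyl_minus \<rho> p \<gamma> x t l)) < \<infinity>)}"

definition locally_finite_measure ::
  "('a \<Rightarrow> 'a \<Rightarrow> real) \<Rightarrow> real \<Rightarrow> ('a \<times> real) measure \<Rightarrow> bool" where
  "locally_finite_measure \<rho> p \<nu> \<longleftrightarrow> (\<forall>x t. \<exists>r>0. emeasure \<nu> (cyl \<rho> p x t r) < \<infinity>)"


section \<open>Adjacent dyadic systems and maximal functions\<close>

text \<open>The number of systems is \<open>N\<close>; \<open>I k \<tau>\<close> is the index set of generation \<open>k\<close> in the system
  \<open>\<tau> \<in> {1..N}\<close>. The cubes constructed by Hytonen and Kairema are Borel sets. The remaining
  properties do not imply this (points on the boundary of cubes can be distributed
  arbitrarily), and it is required for the measure of a parabolic rectangle to be defined.\<close>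

definition adjacent_dyadic ::
  "('a \<Rightarrow> 'a \<Rightarrow> real) \<Rightarrow> real \<Rightarrow> real \<Rightarrow> real \<Rightarrow> real \<Rightarrow> nat \<Rightarrow> (int \<Rightarrow> nat \<Rightarrow> 'i set) \<Rightarrow>
   (int \<Rightarrow> nat \<Rightarrow> 'i \<Rightarrow> 'a) \<Rightarrow> (int \<Rightarrow> nat \<Rightarrow> 'i \<Rightarrow> 'a set) \<Rightarrow> bool" where
  "adjacent_dyadic \<rho> K0 \<delta> c0 C0 N I z Q \<longleftrightarrow>
     (let c1 = c0 / (3 * K0 ^ 2); C1 = 2 * K0 * C0 in
       (\<forall>\<tau>\<in>{1..N}. \<forall>k.
          (\<forall>\<alpha>\<in>I k \<tau>. \<forall>\<beta>\<in>I k \<tau>. \<alpha> \<noteq> \<beta> \<longrightarrow> c0 * \<delta> powi k \<le> \<rho> (z k \<tau> \<alpha>) (z k \<tau> \<beta>)) \<and>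
          (\<forall>x. \<exists>\<alpha>\<in>I k \<tau>. \<rho> x (z k \<tau> \<alpha>) < C0 * \<delta> powi k) \<and>
          (\<Union>\<alpha>\<in>I k \<tau>. Q k \<tau> \<alpha>) = UNIV \<and>
          disjoint_family_on (Q k \<tau>) (I k \<tau>) \<and>
          (\<forall>\<alpha>\<in>I k \<tau>. Q k \<tau> \<alpha> \<in> borel_of_qm \<rho> \<and>
             qball \<rho> (z k \<tau> \<alpha>) (c1 * \<delta> powi k) \<subseteq> Q k \<tau> \<alpha> \<and>
             Q k \<tau> \<alpha> \<subseteq> qball \<rho> (z k \<tau> \<alpha>) (C1 * \<delta> powi k)) \<and>
          (\<forall>l\<ge>k. \<forall>\<alpha>\<in>I k \<tau>. \<forall>\<beta>\<in>I l \<tau>.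
             (Q l \<tau> \<beta> \<subseteq> Q k \<tau> \<alpha> \<or> Q l \<tau> \<beta> \<inter> Q k \<tau> \<alpha> = {}) \<and>
             (Q l \<tau> \<beta> \<subseteq> Q k \<tau> \<alpha> \<longrightarrow>
                qball \<rho> (z l \<tau> \<beta>) (C1 * \<delta> powi l) \<subseteq> qball \<rho> (z k \<tau> \<alpha>) (C1 * \<delta> powi k)))) \<and>
       (\<exists>Cs>0. \<forall>x. \<forall>r>0. \<exists>\<tau>\<in>{1..N}. \<exists>k. \<exists>\<alpha>\<in>I k \<tau>.
          qball \<rho> x r \<subseteq> Q k \<tau> \<alpha> \<and> qdiam \<rho> (Q k \<tau> \<alpha>) \<le> ennreal (Cs * r)))"

definition rect_minus :: "real \<Rightarrow> real \<Rightarrow> real \<Rightarrow> 'a set \<Rightarrow> int \<Rightarrow> real \<Rightarrow> ('a \<times> real) set" where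
  "rect_minus p \<delta> \<gamma> S k t = S \<times> {t - \<delta> powr (k * p) <..< t - \<gamma> * \<delta> powr (k * p)}"

definition rect_plus :: "real \<Rightarrow> real \<Rightarrow> real \<Rightarrow> 'a set \<Rightarrow> int \<Rightarrow> real \<Rightarrow> ('a \<times> real) set" where
  "rect_plus p \<delta> \<gamma> S k t = S \<times> {t + \<gamma> * \<delta> powr (k * p) <..< t + \<delta> powr (k * p)}"

definition max_minus ::
  "real \<Rightarrow> 'a measure \<Rightarrow> real \<Rightarrow> nat \<Rightarrow> (int \<Rightarrow> nat \<Rightarrow> 'i set) \<Rightarrow> (int \<Rightarrow> nat \<Rightarrow> 'i \<Rightarrow> 'a set) \<Rightarrow>
   real \<Rightarrow> ('a \<times> real) measure \<Rightarrow> 'a \<times> real \<Rightarrow> ennreal" where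
  "max_minus p M \<delta> N I Q \<gamma> \<nu> = (\<lambda>(x, t).
     SUP (\<tau>, k, \<alpha>) \<in> {(\<tau>, k, \<alpha>). \<tau> \<in> {1..N} \<and> \<alpha> \<in> I k \<tau> \<and> x \<in> Q k \<tau> \<alpha>}.
       emeasure \<nu> (rect_minus p \<delta> \<gamma> (Q k \<tau> \<alpha>) k t)
         / emeasure (par_measure M) (rect_minus p \<delta> \<gamma> (Q k \<tau> \<alpha>) k t))"

definition max_plus ::
  "real \<Rightarrow> 'a measure \<Rightarrow> real \<Rightarrow> nat \<Rightarrow> (int \<Rightarrow> nat \<Rightarrow> 'i set) \<Rightarrow> (int \<Rightarrow> nat \<Rightarrow> 'i \<Rightarrow> 'a set) \<Rightarrow>
   real \<Rightarrow> ('a \<times> real) measure \<Rightarrow> 'a \<times> real \<Rightarrow> ennreal" where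
  "max_plus p M \<delta> N I Q \<gamma> \<nu> = (\<lambda>(x, t).
     SUP (\<tau>, k, \<alpha>) \<in> {(\<tau>, k, \<alpha>). \<tau> \<in> {1..N} \<and> \<alpha> \<in> I k \<tau> \<and> x \<in> Q k \<tau> \<alpha>}.
       emeasure \<nu> (rect_plus p \<delta> \<gamma> (Q k \<tau> \<alpha>) k t)
         / emeasure (par_measure M) (rect_plus p \<delta> \<gamma> (Q k \<tau> \<alpha>) k t))"

definition elog :: "ennreal \<Rightarrow> ereal" where
  "elog y = (if y = 0 then - \<infinity> else if y = \<infinity> then \<infinity> else ereal (ln (enn2real y)))"

text \<open>Almost everywhere equality of the real-valued \<open>f\<close> with the extended-real-valued
  \<open>- \<alpha> log m\<^sub>1 + \<beta> log m\<^sub>2 + b\<close>. A sum in \<^typ>\<open>ereal\<close> is finite only if every summand is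
  (\<open>\<infinity> + (- \<infinity>) = \<infinity>\<close>), so the equality entails that both logarithms are finite almost
  everywhere.\<close>

definition log_repr ::
  "'a measure \<Rightarrow> ('a \<times> real \<Rightarrow> real) \<Rightarrow> real \<Rightarrow> ('a \<times> real \<Rightarrow> ennreal) \<Rightarrow>
   real \<Rightarrow> ('a \<times> real \<Rightarrow> ennreal) \<Rightarrow> ('a \<times> real \<Rightarrow> real) \<Rightarrow> bool" where
  "log_repr M f \<alpha> m1 \<beta> m2 b \<longleftrightarrow>
     (AE z in par_measure M.
        ereal (f z) = - (ereal \<alpha> * elog (m1 z)) + ereal \<beta> * elog (m2 z) + ereal (b z))"

end

theory Submission
  imports Defs
begin

text \<open>Part (i). A John--Nirenberg inequality along chains of cylinders makes
  \<open>exp (\<kappa> f)\<close> satisfy a parabolic Muckenhoupt condition with a time lag for small \<open>\<kappa>\<close>. On a grid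
  of boxes (dyadic cubes times dyadic time intervals) this yields strong-type bounds, with weights
  \<open>exp (\<plusminus> \<kappa> f)\<close>, for the maximal operators that average over a box shifted in time. Iterating a
  sublinear operator built from both weighted maximal operators (Rubio de Francia) gives \<open>\<Phi>\<close> such
  that \<open>exp (- \<kappa> f) \<Phi>\<close> and \<open>exp (\<kappa> f) \<Phi>\<close> dominate their backward and forward maximal
  functions; the densities of the two measures are these products, and their quotient is
  \<open>exp (2 \<kappa> f)\<close>.

  Part (ii). The infimum \<open>Y\<close> of the maximal function over the cylinder opposite in time
  controls all averages at large scales, while the small scales see only the restriction of the
  measure to a neighbourhood of the cylinder; the weak-type bound for that restriction makes the
  average of the positive part of \<open>log (M \<nu> / Y)\<close> bounded.\<close>

text \<open>The obstacle is the time lag. \<open>PBMO_plus\<close> bounds \<open>f\<close> from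
  above after the centre of a cylinder and from below before it, so two constants are comparable
  only if the later part of one cylinder overlaps the earlier part of the other, and only in one
  direction. The estimates therefore relate a box to its \<open>i\<close>-th shift, and each
  covering argument pays a factor \<open>2 * \<bar>i\<bar> + 1\<close>. The lagged condition on the
  weight \<open>w = exp (8 \<kappa> f)\<close> is of type A_3, as
  \<open>exp (- 4 \<kappa> f)\<close> is \<open>w\<close> to the power -1/2. Cauchy-Schwarz then
  turns the weighted weak type bound at exponent 4 into an unweighted L^2 bound, and a level-set
  argument raises 4 to 8, the exponent in which the iteration runs. The lag in the representation is
  always 1/2, whatever the lag of \<open>f\<close>: the slabs between \<open>dur k / 2\<close> and
  \<open>dur k\<close> are cut into boxes so short that only shifts by at least 2 occur, and these
  are far enough apart for a chain of cylinders, whatever the lag of \<open>f\<close>. A sign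
  \<open>s\<close> runs through the proof, because replacing \<open>f\<close> by \<open>- f\<close>
  reverses time.\<close>

section \<open>From truncated weak type bounds to strong type bounds\<close>

lemma ennreal_divide_mult_cancel:
  fixes b c :: ennreal
  assumes "0 < b" "b < \<infinity>"
  shows "c / b * b = c"
  using assms by (metis ennreal_divide_times ennreal_divide_self ennreal_times_divide infinity_ennreal_def mult.commute mult.right_neutral not_gr_zero top.not_eq_extremum)

lemma ennreal_less_divide_imp:
  fixes h b c :: ennreal
  assumes "h < c / b" "0 < b" "b < \<infinity>"
  shows "h * b \<le> c"
  using assms by (metis ennreal_divide_mult_cancel less_imp_le mult_right_mono zero_le)

text \<open>Keeping only \<open>[r/2, r)\<close>, an interval of length r/2 on which the integrand
  is at least r/2, gives r^2/4; this is the factor 4. For \<open>x = \<infinity>\<close> the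
  integral diverges. As an inequality in \<open>ennreal\<close> it serves as a layer-cake formula
  for functions that may be infinite.\<close>

lemma nn_integral_truncated_identity_ge:
  "x * x \<le> 4 * (\<integral>\<^sup>+y. ennreal y * indicator {0<..} y * indicator {y. ennreal y < x} y \<partial>lborel)"
proof (cases x)
  case (real r)
  show ?thesis
  proof (cases "r = 0")
    case True
    then show ?thesis using real by simp
  next
    case False
    with real have r: "r > 0" by simp
    have "ennreal (r / 2) * emeasure lborel {r/2..<r}
        = (\<integral>\<^sup>+y. ennreal (r/2) * indicator {r/2..<r} y \<partial>lborel)"
      by (rule nn_integral_cmult_indicator[symmetric]) simp
    also have "\<dots> \<le> (\<integral>\<^sup>+y. ennreal y * indicator {0<..} y * indicator {y. ennreal y < x} y \<partial>lborel)"
      using r real by (intro nn_integral_mono) (auto split: split_indicator intro!: ennreal_leI simp: ennreal_less_iff)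
    finally have "4 * (ennreal (r / 2) * emeasure lborel {r/2..<r}) \<le> 4 * (\<integral>\<^sup>+y. ennreal y * indicator {0<..} y * indicator {y. ennreal y < x} y \<partial>lborel)"
      by (intro mult_left_mono) auto
    moreover have "4 * (ennreal (r / 2) * emeasure lborel {r/2..<r}) = x * x"
    proof -
      have "4 * (ennreal (r / 2) * emeasure lborel {r/2..<r}) = ennreal 4 * (ennreal (r/2) * ennreal (r/2))"
        using r by (simp add: field_simps)
      also have "\<dots> = ennreal (4 * ((r/2) * (r/2)))" using r by (simp add: ennreal_mult[symmetric] del: ennreal_numeral)
      also have "\<dots> = x * x" using r real by (simp add: ennreal_mult)
      finally show ?thesis .
    qed
    ultimately show ?thesis by simp
  qed
next
  case top
  have "emeasure lborel {1::real..} = \<infinity>"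
  proof (rule ccontr)
    assume "emeasure lborel {1::real..} \<noteq> \<infinity>"
    then obtain c where c: "emeasure lborel {1::real..} = ennreal c" "c \<ge> 0"
      by (cases "emeasure lborel {1::real..}") auto
    have "emeasure lborel {1..c + 2} \<le> emeasure lborel {1::real..}"
      by (intro emeasure_mono) auto
    then show False using c by (simp add: ennreal_le_iff)
  qed
  then have "(\<infinity>::ennreal) = (\<integral>\<^sup>+y. indicator {1::real..} y \<partial>lborel)"
    by simp
  also have "\<dots> \<le> (\<integral>\<^sup>+y. ennreal y * indicator {0<..} y * indicator {y. ennreal y < x} y \<partial>lborel)"
  proof (rule nn_integral_mono)
    fix y :: real
    show "indicator {1..} y \<le> ennreal y * indicator {0<..} y * indicator {y. ennreal y < x} y"
      using top ennreal_leI[of 1 y] by (cases "1 \<le> y") auto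
  qed
  finally show ?thesis by (simp add: top_unique ennreal_mult_top)
qed

text \<open>Fubini turns the layer-cake formula for \<open>G\<^sup>2\<close> into an integral of the weak type bound.\<close>

lemma weak_type_imp_L2:
  fixes G g :: "'s \<Rightarrow> ennreal"
  assumes sf: "sigma_finite_measure m" and [measurable]: "G \<in> borel_measurable m" "g \<in> borel_measurable m"
    and weak: "\<And>y::real. 0 < y \<Longrightarrow>
      ennreal y * emeasure m {z \<in> space m. ennreal y < G z} \<le> C * (\<integral>\<^sup>+z. g z * indicator {z. ennreal y < g z} z \<partial>m)"
  shows "(\<integral>\<^sup>+z. G z * G z \<partial>m) \<le> 4 * C * (\<integral>\<^sup>+z. g z * g z \<partial>m)"
proof -
  interpret m: sigma_finite_measure m by fact
  interpret P: pair_sigma_finite lborel m ..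
  have *: "(\<integral>\<^sup>+z. G z * G z \<partial>m) \<le> (\<integral>\<^sup>+z. 4 * (\<integral>\<^sup>+y. ennreal y * indicator {0<..} y * indicator {y. ennreal y < G z} y \<partial>lborel) \<partial>m)"
    by (intro nn_integral_mono nn_integral_truncated_identity_ge)
  also have "\<dots> = 4 * (\<integral>\<^sup>+z. (\<integral>\<^sup>+y. ennreal y * indicator {0<..} y * indicator {y. ennreal y < G z} y \<partial>lborel) \<partial>m)"
    by (intro nn_integral_cmult) measurable
  also have "(\<integral>\<^sup>+z. (\<integral>\<^sup>+y. ennreal y * indicator {0<..} y * indicator {y. ennreal y < G z} y \<partial>lborel) \<partial>m)
     = (\<integral>\<^sup>+y. (\<integral>\<^sup>+z. ennreal y * indicator {0<..} y * indicator {y. ennreal y < G z} y \<partial>m) \<partial>lborel)"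
    by (intro P.Fubini') measurable
  also have "\<dots> \<le> (\<integral>\<^sup>+y. (\<integral>\<^sup>+z. C * (g z * (indicator {0<..} y * indicator {z. ennreal y < g z} z)) \<partial>m) \<partial>lborel)"
  proof (rule nn_integral_mono)
    fix y :: real
    show "(\<integral>\<^sup>+z. ennreal y * indicator {0<..} y * indicator {y. ennreal y < G z} y \<partial>m)
      \<le> (\<integral>\<^sup>+z. C * (g z * (indicator {0<..} y * indicator {z. ennreal y < g z} z)) \<partial>m)"
    proof (cases "0 < y")
      case True
      have "(\<integral>\<^sup>+z. ennreal y * indicator {0<..} y * indicator {y. ennreal y < G z} y \<partial>m)
        = (\<integral>\<^sup>+z. ennreal y * indicator {z \<in> space m. ennreal y < G z} z \<partial>m)"
        using True by (intro nn_integral_cong) (auto split: split_indicator)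
      also have "\<dots> = ennreal y * emeasure m {z \<in> space m. ennreal y < G z}"
        by (subst nn_integral_cmult_indicator) auto
      also note weak[OF True]
      also have "C * (\<integral>\<^sup>+z. g z * indicator {z. ennreal y < g z} z \<partial>m) =
        (\<integral>\<^sup>+z. C * (g z * (indicator {0<..} y * indicator {z. ennreal y < g z} z)) \<partial>m)"
        using True by (subst nn_integral_cmult[symmetric]) auto
      finally show ?thesis .
    qed auto
  qed
  also have "\<dots> = (\<integral>\<^sup>+y. C * (\<integral>\<^sup>+z. (g z * (indicator {0<..} y * indicator {z. ennreal y < g z} z)) \<partial>m) \<partial>lborel)"
    by (intro nn_integral_cong nn_integral_cmult) measurable
  also have "\<dots> = C * (\<integral>\<^sup>+y. (\<integral>\<^sup>+z. (g z * (indicator {0<..} y * indicator {z. ennreal y < g z} z)) \<partial>m) \<partial>lborel)"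
    by (intro nn_integral_cmult) measurable
  also have "(\<integral>\<^sup>+y. (\<integral>\<^sup>+z. (g z * (indicator {0<..} y * indicator {z. ennreal y < g z} z)) \<partial>m) \<partial>lborel)
     = (\<integral>\<^sup>+z. (\<integral>\<^sup>+y. (g z * (indicator {0<..} y * indicator {z. ennreal y < g z} z)) \<partial>lborel) \<partial>m)"
    by (intro P.Fubini'[symmetric]) measurable
  also have "\<dots> \<le> (\<integral>\<^sup>+z. g z * g z \<partial>m)"
  proof (rule nn_integral_mono)
    fix z
    have "(\<integral>\<^sup>+y. (g z * (indicator {0<..} y * indicator {z. ennreal y < g z} z)) \<partial>lborel)
      = g z * (\<integral>\<^sup>+y. indicator {y. 0 < y \<and> ennreal y < g z} y \<partial>lborel)"
      by (subst nn_integral_cmult[symmetric]) (auto intro!: nn_integral_cong split: split_indicator)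
    also have "(\<integral>\<^sup>+y. indicator {y. 0 < y \<and> ennreal y < g z} y \<partial>lborel) \<le> g z"
    proof (cases "g z")
      case (real r)
      have "(\<integral>\<^sup>+y. indicator {y. 0 < y \<and> ennreal y < g z} y \<partial>lborel) \<le> (\<integral>\<^sup>+y. indicator {0..r} y \<partial>lborel)"
        using real by (intro nn_integral_mono) (auto split: split_indicator simp: ennreal_less_iff)
      also have "\<dots> = g z" using real by simp
      finally show ?thesis .
    qed simp
    finally show "(\<integral>\<^sup>+y. (g z * (indicator {0<..} y * indicator {z. ennreal y < g z} z)) \<partial>lborel) \<le> g z * g z"
      by (simp add: mult_left_mono)
  qed
  finally show ?thesis by (simp add: mult_left_mono mult.assoc)
qed

text \<open>The L^2 statement is applied to \<open>(G / 2) ^ n\<close> and \<open>g ^ n\<close>. The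
  truncation of \<open>g\<close> at the level \<open>h\<close>, while \<open>G\<close> is tested at
  \<open>2 h\<close>, is what raises the exponent from \<open>n\<close> to \<open>2 n\<close>;
  undoing the halving of \<open>G\<close> costs \<open>2 ^ (2 * n)\<close>.\<close>

lemma weak_type_imp_strong_type:
  fixes G g :: "'s \<Rightarrow> ennreal"
  assumes sf: "sigma_finite_measure m" and [measurable]: "G \<in> borel_measurable m" "g \<in> borel_measurable m"
    and n: "0 < n"
    and weak: "\<And>h::real. 0 < h \<Longrightarrow>
      ennreal h ^ n * emeasure m {z \<in> space m. 2 * ennreal h < G z} \<le> C * (\<integral>\<^sup>+z. g z ^ n * indicator {z. ennreal h < g z} z \<partial>m)"
  shows "(\<integral>\<^sup>+z. G z ^ (2*n) \<partial>m) \<le> 2 ^ (2*n) * (4 * C) * (\<integral>\<^sup>+z. g z ^ (2*n) \<partial>m)"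
proof -
  have pow: "x < y \<longleftrightarrow> x ^ n < y ^ n" for x y :: ennreal
  proof -
    have "x ^ n < y ^ n" if "x < y"
    proof -
      obtain r where r: "x = ennreal r" "0 \<le> r" using \<open>x < y\<close> by (cases x) auto
      show ?thesis
      proof (cases y)
        case (real s)
        then show ?thesis using r that n by (auto simp: ennreal_power ennreal_less_iff intro!: power_strict_mono)
      next
        case top
        then show ?thesis using r n by (simp add: ennreal_power power_eq_top_ennreal less_top[symmetric])
      qed
    qed
    moreover have "y ^ n \<le> x ^ n" if "y \<le> x" using that by (simp add: power_mono)
    ultimately show ?thesis by (meson not_less)
  qed
  have two: "ennreal (1/2) * x * 2 = x" for x :: ennreal
  proof -
    have "ennreal (1/2) * ennreal 2 = 1" by (subst ennreal_mult[symmetric]) auto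
    then have "ennreal (1/2) * 2 = 1" by simp
    then show ?thesis by (metis mult.assoc mult.commute mult_1)
  qed
  let ?G = "\<lambda>z. (ennreal (1/2) * G z) ^ n" and ?g = "\<lambda>z. g z ^ n"
  have "(\<integral>\<^sup>+z. ?G z * ?G z \<partial>m) \<le> 4 * C * (\<integral>\<^sup>+z. ?g z * ?g z \<partial>m)"
  proof (intro weak_type_imp_L2 sf)
    fix y :: real assume y: "0 < y"
    define h where "h = root n y"
    have h: "h > 0" "h ^ n = y" using y n by (auto simp: h_def)
    then have hn: "ennreal y = ennreal h ^ n" by (simp add: ennreal_power)
    have "{z \<in> space m. ennreal y < ?G z} = {z \<in> space m. 2 * ennreal h < G z}"
    proof -
      have "ennreal y < ?G z \<longleftrightarrow> 2 * ennreal h < G z" for z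
      proof -
        have "ennreal y < ?G z \<longleftrightarrow> ennreal h < ennreal (1/2) * G z" unfolding hn using pow by metis
        also have "\<dots> \<longleftrightarrow> \<not> (ennreal (1/2) * G z \<le> ennreal h)" by auto
        also have "ennreal (1/2) * G z \<le> ennreal h \<longleftrightarrow> G z \<le> 2 * ennreal h"
        proof
          assume "ennreal (1/2) * G z \<le> ennreal h"
          then have "ennreal (1/2) * G z * 2 \<le> ennreal h * 2" by (rule mult_right_mono) simp
          then show "G z \<le> 2 * ennreal h" unfolding two by (simp add: mult.commute)
        next
          assume "G z \<le> 2 * ennreal h"
          then have "ennreal (1/2) * G z \<le> ennreal (1/2) * (2 * ennreal h)" by (rule mult_left_mono) simp
          also have "\<dots> = ennreal h" using two[of "ennreal h"] by (metis mult.assoc mult.commute)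
          finally show "ennreal (1/2) * G z \<le> ennreal h" .
        qed
        finally show ?thesis by auto
      qed
      then show ?thesis by simp
    qed
    moreover have "{z. ennreal y < ?g z} = {z. ennreal h < g z}"
      unfolding hn using pow by metis
    ultimately show "ennreal y * emeasure m {z \<in> space m. ennreal y < ?G z} \<le> C * (\<integral>\<^sup>+z. ?g z * indicator {z. ennreal y < ?g z} z \<partial>m)"
      using weak[OF h(1)] by (simp add: hn)
  qed measurable
  then have *: "(\<integral>\<^sup>+z. ?G z * ?G z \<partial>m) \<le> 4 * C * (\<integral>\<^sup>+z. g z ^ (2*n) \<partial>m)"
    by (simp add: mult_2 power_add)
  have "G z ^ (2*n) = 2 ^ (2*n) * (?G z * ?G z)" for z
  proof -
    have "G z ^ (2*n) = ((ennreal (1/2) * G z) * 2) ^ (2*n)" by (simp only: two)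
    also have "\<dots> = (ennreal (1/2) * G z) ^ (2*n) * 2 ^ (2*n)" by (rule power_mult_distrib)
    also have "\<dots> = 2 ^ (2*n) * (ennreal (1/2) * G z) ^ (n + n)" unfolding mult_2 by (rule mult.commute)
    finally show ?thesis by (simp only: power_add)
  qed
  then have "(\<integral>\<^sup>+z. G z ^ (2*n) \<partial>m) = 2 ^ (2*n) * (\<integral>\<^sup>+z. ?G z * ?G z \<partial>m)"
    by (subst nn_integral_cmult[symmetric]) auto
  also have "\<dots> \<le> 2 ^ (2*n) * (4 * C * (\<integral>\<^sup>+z. g z ^ (2*n) \<partial>m))"
    by (intro mult_left_mono *) auto
  finally show ?thesis by (simp add: mult.assoc)
qed

section \<open>Shifted grids: maximal boxes and the covering estimate\<close>

lemma emeasure_UN_le_count_space: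
  assumes I: "countable I" and X: "\<And>i. i \<in> I \<Longrightarrow> X i \<in> sets M"
  shows "emeasure M (\<Union>i\<in>I. X i) \<le> (\<integral>\<^sup>+i. emeasure M (X i) \<partial>count_space I)"
proof -
  have "emeasure M (\<Union>i\<in>I. X i) = (\<integral>\<^sup>+z. indicator (\<Union>i\<in>I. X i) z \<partial>M)"
    using I X by (intro nn_integral_indicator[symmetric] sets.countable_UN') auto
  also have "\<dots> \<le> (\<integral>\<^sup>+z. (\<integral>\<^sup>+i. indicator (X i) z \<partial>count_space I) \<partial>M)"
  proof (rule nn_integral_mono)
    fix z
    show "indicator (\<Union>i\<in>I. X i) z \<le> (\<integral>\<^sup>+i. indicator (X i) z \<partial>count_space I)"
    proof (cases "z \<in> (\<Union>i\<in>I. X i)")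
      case True
      then obtain i where i: "i \<in> I" "z \<in> X i" by auto
      from nn_integral_ge_point[OF i(1), of "\<lambda>i. indicator (X i) z"] i True show ?thesis by auto
    qed auto
  qed
  also have "\<dots> = (\<integral>\<^sup>+i. (\<integral>\<^sup>+z. indicator (X i) z \<partial>M) \<partial>count_space I)"
    using I X by (intro nn_integral_count_space_nn_integral) auto
  also have "\<dots> = (\<integral>\<^sup>+i. emeasure M (X i) \<partial>count_space I)"
    using X by (intro nn_integral_cong) auto
  finally show ?thesis .
qed

text \<open>An abstract system of nested boxes with a shift along one direction. In the application the
  boxes are products of a dyadic cube and a time interval, and \<open>sh i\<close> translates a box by \<open>i\<close> times
  its own length in time.\<close>

locale shift_grid =
  fixes L :: "'s measure" and B :: "'b set" and gen :: "'b \<Rightarrow> int"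
    and sh :: "int \<Rightarrow> 'b \<Rightarrow> 'b" and bx :: "'b \<Rightarrow> 's set"
  assumes space_L: "space L = UNIV"
    and countable_B: "countable B"
    and sh_in: "P \<in> B \<Longrightarrow> sh i P \<in> B"
    and gen_sh: "gen (sh i P) = gen P"
    and sh_sh: "sh i (sh j P) = sh (i + j) P"
    and sh_0: "sh 0 P = P"
    and sets_bx [measurable]: "P \<in> B \<Longrightarrow> bx P \<in> sets L"
    and pos_bx: "P \<in> B \<Longrightarrow> 0 < emeasure L (bx P)"
    and fin_bx: "P \<in> B \<Longrightarrow> emeasure L (bx P) < \<infinity>"
    and emeasure_sh: "P \<in> B \<Longrightarrow> emeasure L (bx (sh i P)) = emeasure L (bx P)"
    and cover: "\<exists>P\<in>B. gen P = k \<and> x \<in> bx P"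
    and nested: "P \<in> B \<Longrightarrow> P' \<in> B \<Longrightarrow> gen P < gen P' \<Longrightarrow> bx P' \<subseteq> bx P \<or> bx P \<inter> bx P' = {}"
    and disjoint_gen: "P \<in> B \<Longrightarrow> P' \<in> B \<Longrightarrow> gen P = gen P' \<Longrightarrow> P \<noteq> P' \<Longrightarrow> bx P \<inter> bx P' = {}"
    and shift_sub: "P \<in> B \<Longrightarrow> P' \<in> B \<Longrightarrow> gen P \<le> gen P' \<Longrightarrow> bx P' \<subseteq> bx P \<Longrightarrow>
       \<exists>i'. \<bar>i'\<bar> \<le> \<bar>i\<bar> \<and> bx (sh i P') \<subseteq> bx (sh i' P)"
    and generate: "D \<in> sets L \<Longrightarrow> emeasure L D < \<infinity> \<Longrightarrow> 0 < m \<Longrightarrow>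
       \<exists>E\<in>sigma_sets UNIV (bx ` {P \<in> B. \<exists>n::nat. gen P = k + int m * int n}).
         emeasure L (D - E \<union> (E - D)) = 0"
begin

lemma countable_sub: "F \<subseteq> B \<Longrightarrow> countable F"
  using countable_B countable_subset by blast

lemma sets_UN_bx: "F \<subseteq> B \<Longrightarrow> (\<Union>P\<in>F. bx P) \<in> sets L"
  by (intro sets.countable_UN' countable_sub) auto

lemma bx_nonempty: "P \<in> B \<Longrightarrow> bx P \<noteq> {}"
  using pos_bx[of P] by auto

lemma sigma_finite_L: "sigma_finite_measure L"
proof
  show "\<exists>A. countable A \<and> A \<subseteq> sets L \<and> \<Union>A = space L \<and> (\<forall>a\<in>A. emeasure L a \<noteq> \<infinity>)"
    using countable_B cover[where k=0] fin_bx sets_bx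
    by (intro exI[of _ "bx ` B"]) (auto simp: space_L less_top[symmetric])
qed

lemma nested_le:
  assumes "P \<in> B" "P' \<in> B" "gen P \<le> gen P'" "x \<in> bx P" "x \<in> bx P'"
  shows "bx P' \<subseteq> bx P"
proof (cases "gen P = gen P'")
  case True
  then show ?thesis using disjoint_gen[of P P'] assms by blast
next
  case False
  then show ?thesis using nested[of P P'] assms by force
qed

text \<open>The lower bound on the generations makes the ascent to ever coarser boxes of the family
  stop, which is the induction; nesting makes maximal boxes disjoint. The last clause is kept for
  the John-Nirenberg argument, which has to know that an ancestor of a stopping box is not itself in
  the family.\<close>

lemma maximal_subfamily:
  assumes F: "F \<subseteq> B" and k0: "\<And>P. P \<in> F \<Longrightarrow> k0 \<le> gen P"
  obtains G where "G \<subseteq> F" "disjoint_family_on bx G"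
    "\<And>P. P \<in> F \<Longrightarrow> \<exists>P'\<in>G. gen P' \<le> gen P \<and> bx P \<subseteq> bx P'"
    "\<And>P P'. P \<in> G \<Longrightarrow> P' \<in> F \<Longrightarrow> gen P' < gen P \<Longrightarrow> \<not> bx P \<subseteq> bx P'"
proof
  let ?G = "{P \<in> F. \<forall>P'\<in>F. gen P' < gen P \<longrightarrow> \<not> bx P \<subseteq> bx P'}"
  show "?G \<subseteq> F" by auto
  show "disjoint_family_on bx ?G"
    unfolding disjoint_family_on_def
  proof (intro ballI impI)
    fix P P' assume PP: "P \<in> ?G" "P' \<in> ?G" "P \<noteq> P'"
    then consider "gen P = gen P'" | "gen P < gen P'" | "gen P' < gen P" by linarith
    then show "bx P \<inter> bx P' = {}"
      using PP F nested[of P P'] nested[of P' P] disjoint_gen[of P P'] by cases blast+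
  qed
  show "\<exists>P'\<in>?G. gen P' \<le> gen P \<and> bx P \<subseteq> bx P'" if "P \<in> F" for P
    using that
  proof (induction "nat (gen P - k0)" arbitrary: P rule: less_induct)
    case less
    show ?case
    proof (cases "P \<in> ?G")
      case False
      with less.prems obtain P' where P': "P' \<in> F" "gen P' < gen P" "bx P \<subseteq> bx P'" by auto
      then have "nat (gen P' - k0) < nat (gen P - k0)" using k0[of P'] by auto
      from less.hyps[OF this P'(1)] P' show ?thesis by (meson order_trans less_imp_le)
    qed auto
  qed
  show "\<not> bx P \<subseteq> bx P'" if "P \<in> ?G" "P' \<in> F" "gen P' < gen P" for P P'
    using that by blast
qed

lemma emeasure_UN_disjoint:
  assumes "G \<subseteq> B" "disjoint_family_on bx G" "\<And>P. P \<in> B \<Longrightarrow> bx P \<in> sets m"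
  shows "emeasure m (\<Union>P\<in>G. bx P) = (\<integral>\<^sup>+P. emeasure m (bx P) \<partial>count_space G)"
  using assms by (intro emeasure_UN_countable countable_sub) auto

text \<open>Boxes that are shifted into a maximal one are covered by boundedly many shifts of the latter.\<close>

lemma weak_type_bounded_below:
  assumes F: "F \<subseteq> B" and k0: "\<And>P. P \<in> F \<Longrightarrow> kmin \<le> gen P"
    and m: "\<And>P. P \<in> B \<Longrightarrow> bx P \<in> sets m" and W: "W \<in> sets m"
    and h: "\<And>P. P \<in> F \<Longrightarrow> h * emeasure L (bx P) \<le> emeasure m (bx (sh i P) \<inter> W)"
  shows "h * emeasure L (\<Union>P\<in>F. bx P) \<le> ennreal (2 * \<bar>i\<bar> + 1) * emeasure m W"
proof -
  have F': "sh i ` F \<subseteq> B" using F sh_in by auto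
  have k0': "kmin \<le> gen P" if "P \<in> sh i ` F" for P using that k0 by (auto simp: gen_sh)
  \<comment> \<open>Maximal boxes are selected among the shifted ones, where \<open>h\<close> bounds
    the mass of \<open>m\<close> from below; disjointness can then be used on the side of
    \<open>m\<close>.\<close>
  obtain G where G: "G \<subseteq> sh i ` F" "disjoint_family_on bx G"
    "\<And>P. P \<in> sh i ` F \<Longrightarrow> \<exists>P'\<in>G. gen P' \<le> gen P \<and> bx P \<subseteq> bx P'"
    using maximal_subfamily[OF F' k0'] by metis
  have GB: "G \<subseteq> B" using G(1) F' by auto
  have cG: "countable G" using GB by (rule countable_sub)
  let ?I = "{-\<bar>i\<bar>..\<bar>i\<bar>}"
  have "(\<Union>P\<in>F. bx P) \<subseteq> (\<Union>P\<in>G. \<Union>j\<in>?I. bx (sh j P))"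
  proof (rule UN_least)
    fix P assume P: "P \<in> F"
    then obtain P' where P': "P' \<in> G" "gen P' \<le> gen (sh i P)" "bx (sh i P) \<subseteq> bx P'"
      using G(3)[of "sh i P"] by auto
    have "sh i P \<in> B" "P' \<in> B" using P F' P' GB by auto
    from shift_sub[OF this(2,1) P'(2,3), of "-i"] obtain i' where
      "\<bar>i'\<bar> \<le> \<bar>-i\<bar>" "bx (sh (-i) (sh i P)) \<subseteq> bx (sh i' P')" by blast
    then have "bx P \<subseteq> bx (sh i' P')" "i' \<in> ?I" by (auto simp: sh_sh sh_0)
    then show "bx P \<subseteq> (\<Union>P\<in>G. \<Union>j\<in>?I. bx (sh j P))" using P' by blast
  qed
  then have "emeasure L (\<Union>P\<in>F. bx P) \<le> emeasure L (\<Union>P\<in>G. \<Union>j\<in>?I. bx (sh j P))"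
    using GB sh_in cG by (intro emeasure_mono sets.countable_UN') auto
  also have "\<dots> \<le> (\<integral>\<^sup>+P. emeasure L (\<Union>j\<in>?I. bx (sh j P)) \<partial>count_space G)"
    using GB sh_in cG by (intro emeasure_UN_le_count_space) auto
  also have "\<dots> \<le> (\<integral>\<^sup>+P. ennreal (2 * \<bar>i\<bar> + 1) * emeasure L (bx P) \<partial>count_space G)"
  proof (rule nn_integral_mono)
    fix P assume "P \<in> space (count_space G)"
    then have P: "P \<in> B" using GB by auto
    have "emeasure L (\<Union>j\<in>?I. bx (sh j P)) \<le> (\<Sum>j\<in>?I. emeasure L (bx (sh j P)))"
      using P sh_in by (intro emeasure_subadditive_finite) auto
    also have "\<dots> = of_nat (card ?I) * emeasure L (bx P)"
      using P by (simp add: emeasure_sh)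
    also have "(of_nat (card ?I) :: ennreal) = ennreal (2 * \<bar>i\<bar> + 1)"
      by (simp add: ennreal_of_nat_eq_real_of_nat)
    finally show "emeasure L (\<Union>j\<in>?I. bx (sh j P)) \<le> ennreal (2 * \<bar>i\<bar> + 1) * emeasure L (bx P)" .
  qed
  finally have "h * emeasure L (\<Union>P\<in>F. bx P) \<le> h * (\<integral>\<^sup>+P. ennreal (2 * \<bar>i\<bar> + 1) * emeasure L (bx P) \<partial>count_space G)"
    by (rule mult_left_mono) simp
  also have "\<dots> = ennreal (2 * \<bar>i\<bar> + 1) * (\<integral>\<^sup>+P. h * emeasure L (bx P) \<partial>count_space G)"
    by (simp add: nn_integral_cmult mult.left_commute)
  also have "(\<integral>\<^sup>+P. h * emeasure L (bx P) \<partial>count_space G) \<le> (\<integral>\<^sup>+P. emeasure m (bx P \<inter> W) \<partial>count_space G)"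
  proof (rule nn_integral_mono)
    fix P assume "P \<in> space (count_space G)"
    then obtain P' where "P' \<in> F" "P = sh i P'" using G(1) by auto
    then show "h * emeasure L (bx P) \<le> emeasure m (bx P \<inter> W)"
      using h[of P'] F by (auto simp: emeasure_sh)
  qed
  also have "\<dots> = emeasure m (\<Union>P\<in>G. bx P \<inter> W)"
    using G(2) GB m W cG
    by (intro emeasure_UN_countable[symmetric]) (auto simp: disjoint_family_on_def)
  also have "\<dots> \<le> emeasure m W" using W by (intro emeasure_mono) auto
  finally show ?thesis by (simp add: mult_left_mono)
qed

text \<open>The bound for generations at least \<open>- n\<close> has a constant independent of
  \<open>n\<close>, and the truncated unions increase to the full one.\<close>

lemma weak_type:
  assumes F: "F \<subseteq> B"
    and m: "\<And>P. P \<in> B \<Longrightarrow> bx P \<in> sets m" and W: "W \<in> sets m"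
    and h: "\<And>P. P \<in> F \<Longrightarrow> h * emeasure L (bx P) \<le> emeasure m (bx (sh i P) \<inter> W)"
  shows "h * emeasure L (\<Union>P\<in>F. bx P) \<le> ennreal (2 * \<bar>i\<bar> + 1) * emeasure m W"
proof -
  define U where "U n = (\<Union>P\<in>{P \<in> F. - int n \<le> gen P}. bx P)" for n :: nat
  have "(\<Union>P\<in>F. bx P) = (\<Union>n. U n)"
  proof -
    have "\<exists>n::nat. - int n \<le> gen P" for P by (rule exI[of _ "nat (- gen P)"]) auto
    then show ?thesis by (auto simp: U_def) blast
  qed
  moreover have "(SUP n. emeasure L (U n)) = emeasure L (\<Union>n. U n)"
  proof (rule SUP_emeasure_incseq)
    show "range U \<subseteq> sets L" using F by (auto simp: U_def intro!: sets_UN_bx)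
    show "incseq U" unfolding U_def by (rule monoI) force
  qed
  ultimately have "h * emeasure L (\<Union>P\<in>F. bx P) = (SUP n. h * emeasure L (U n))"
    by (simp add: SUP_mult_left_ennreal[symmetric])
  also have "\<dots> \<le> ennreal (2 * \<bar>i\<bar> + 1) * emeasure m W"
    unfolding U_def
  proof (rule SUP_least)
    fix n :: nat
    show "h * emeasure L (\<Union>P\<in>{P \<in> F. - int n \<le> gen P}. bx P) \<le> ennreal (2 * \<bar>i\<bar> + 1) * emeasure m W"
      using F m W h by (intro weak_type_bounded_below[where kmin="- int n"]) auto
  qed
  finally show ?thesis .
qed

end

section \<open>Density in boxes and the shifted maximal operator\<close>

lemma ennreal_mult_right_le_cancel:
  fixes a b c :: ennreal
  assumes "a * c \<le> b * c" "0 < c" "c < \<infinity>"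
  shows "a \<le> b"
  using assms by (metis ennreal_mult_strict_right_mono infinity_ennreal_def leD leI)

lemma ennreal_power_pos: "0 < (x::ennreal) \<Longrightarrow> 0 < x ^ n"
  by (metis not_gr_zero power_not_zero)

lemma ennreal_power_finite: "(x::ennreal) < \<infinity> \<Longrightarrow> x ^ n < \<infinity>"
  by (cases x) (auto simp: ennreal_power)

context shift_grid
begin

lemma sigma_sets_boxes: "sigma_sets UNIV (bx ` {P \<in> B. Q P}) \<subseteq> sets L"
proof -
  have "bx ` {P \<in> B. Q P} \<subseteq> sets L" by auto
  from sets.sigma_sets_subset[OF this] show ?thesis by (simp add: space_L)
qed

text \<open>The sets that can be approximated inside \<open>P0\<close> by unions of boxes of a
  single generation are closed under the operations of a \<sigma>-algebra: the boxes of one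
  generation partition the space, so a complement is again a union of that generation, and finitely
  many generations are merged by subdividing to the finest. Working inside \<open>P0\<close> keeps
  the measures finite, as the truncation of a countable union requires.\<close>

lemma approx_by_generation:
  assumes P0: "P0 \<in> B" and m: "0 < m"
    and A: "A \<in> sigma_sets UNIV (bx ` {P \<in> B. \<exists>n::nat. gen P = k + int m * int n})"
    and e: "0 < (e::real)"
  shows "\<exists>n::nat. \<exists>F\<subseteq>{P \<in> B. gen P = k + int m * int n}.
     emeasure L (bx P0 \<inter> (A - (\<Union>P\<in>F. bx P) \<union> ((\<Union>P\<in>F. bx P) - A))) \<le> ennreal e"
  using A e
proof (induction arbitrary: e rule: sigma_sets.induct)
  case (Basic a)
  then obtain P n where "P \<in> B" "gen P = k + int m * int n" "a = bx P" by auto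
  then show ?case by (intro exI[of _ n] exI[of _ "{P}"]) auto
next
  case Empty
  then show ?case by (intro exI[of _ 0] exI[of _ "{}"]) auto
next
  case (Compl a)
  from Compl.IH[OF Compl.prems] obtain n F where F: "F \<subseteq> {P \<in> B. gen P = k + int m * int n}"
     "emeasure L (bx P0 \<inter> (a - (\<Union>P\<in>F. bx P) \<union> ((\<Union>P\<in>F. bx P) - a))) \<le> ennreal e" by blast
  let ?F = "{P \<in> B. gen P = k + int m * int n} - F"
  have "(\<Union>P\<in>?F. bx P) = UNIV - (\<Union>P\<in>F. bx P)"
  proof (intro equalityI subsetI)
    fix x assume "x \<in> (\<Union>P\<in>?F. bx P)"
    then obtain P where P: "P \<in> ?F" "x \<in> bx P" by auto
    have "x \<notin> bx P'" if "P' \<in> F" for P'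
    proof -
      have "P' \<in> B" "gen P = gen P'" "P \<noteq> P'" "P \<in> B" using P that F(1) by auto
      then show ?thesis using disjoint_gen[of P P'] P(2) by blast
    qed
    then show "x \<in> UNIV - (\<Union>P\<in>F. bx P)" by auto
  next
    fix x assume x: "x \<in> UNIV - (\<Union>P\<in>F. bx P)"
    obtain P where "P \<in> B" "gen P = k + int m * int n" "x \<in> bx P" using cover by blast
    then show "x \<in> (\<Union>P\<in>?F. bx P)" using x by auto
  qed
  then have "(UNIV - a) - (\<Union>P\<in>?F. bx P) \<union> ((\<Union>P\<in>?F. bx P) - (UNIV - a))
     = a - (\<Union>P\<in>F. bx P) \<union> ((\<Union>P\<in>F. bx P) - a)" by auto
  then show ?case using F by (intro exI[of _ n] exI[of _ ?F]) auto
next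
  case (Union a)
  let ?S = "\<lambda>n. {P \<in> B. gen P = k + int m * int n}"
  have sub: "sigma_sets UNIV (bx ` {P \<in> B. \<exists>n::nat. gen P = k + int m * int n}) \<subseteq> sets L"
    by (rule sigma_sets_boxes)
  have a: "a i \<in> sets L" for i using Union.hyps sub by auto
  define D where "D n = bx P0 \<inter> ((\<Union>i. a i) - (\<Union>i<n. a i))" for n :: nat
  have "(\<lambda>n. emeasure L (D n)) \<longlonglongrightarrow> emeasure L (\<Inter>n. D n)"
  proof (rule Lim_emeasure_decseq)
    show "range D \<subseteq> sets L" using a P0 by (auto simp: D_def)
    show "decseq D" by (rule antimonoI) (force simp: D_def)
    show "emeasure L (D n) \<noteq> \<infinity>" for n
      using emeasure_mono[of "D n" "bx P0" L] fin_bx[OF P0] P0 by (auto simp: D_def top_unique)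
  qed
  moreover have "(\<Inter>n. D n) = {}" unfolding D_def by blast
  ultimately have "(\<lambda>n. emeasure L (D n)) \<longlonglongrightarrow> 0" by simp
  then have "\<forall>\<^sub>F n in sequentially. emeasure L (D n) < ennreal (e/2)"
    using Union.prems by (intro order_tendstoD) auto
  then obtain n where n: "emeasure L (D n) < ennreal (e/2)"
    by (auto simp: eventually_sequentially)
  \<comment> \<open>Half of \<open>e\<close> pays for the tail of the union, and the first
    \<open>n\<close> sets share the other half; \<open>n + 1\<close> covers
    \<open>n = 0\<close>.\<close>
  define d where "d = e / (2 * (real n + 1))"
  have d: "d > 0" using Union.prems by (simp add: d_def)
  define ok where "ok i j F \<longleftrightarrow> F \<subseteq> ?S j \<and>
      emeasure L (bx P0 \<inter> (a i - (\<Union>P\<in>F. bx P) \<union> ((\<Union>P\<in>F. bx P) - a i))) \<le> ennreal d" for i j F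
  have "\<exists>j F. ok i j F" for i using Union.IH[OF d, of i] unfolding ok_def .
  then obtain j F where ok: "\<And>i. ok i (j i) (F i)" by metis
  have F: "\<And>i. F i \<subseteq> ?S (j i)"
    "\<And>i. emeasure L (bx P0 \<inter> (a i - (\<Union>P\<in>F i. bx P) \<union> ((\<Union>P\<in>F i. bx P) - a i))) \<le> ennreal d"
    using ok unfolding ok_def by auto
  define J where "J = Max (j ` {..n})"
  have J: "j i \<le> J" if "i < n" for i using that by (auto simp: J_def intro!: Max_ge)
  \<comment> \<open>Each selected box is the union of the boxes of generation \<open>J\<close>
    inside it, so one generation suffices for all \<open>n\<close> sets.\<close>
  define G where "G = {P' \<in> ?S J. \<exists>i<n. \<exists>P\<in>F i. bx P' \<subseteq> bx P}"
  have G: "(\<Union>P\<in>G. bx P) = (\<Union>i<n. \<Union>P\<in>F i. bx P)"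
  proof (intro equalityI subsetI)
    fix x assume "x \<in> (\<Union>P\<in>G. bx P)"
    then show "x \<in> (\<Union>i<n. \<Union>P\<in>F i. bx P)" by (fastforce simp: G_def)
  next
    fix x assume "x \<in> (\<Union>i<n. \<Union>P\<in>F i. bx P)"
    then obtain i P where iP: "i < n" "P \<in> F i" "x \<in> bx P" by auto
    obtain P' where P': "P' \<in> B" "gen P' = k + int m * int J" "x \<in> bx P'" using cover by blast
    have P: "P \<in> B" "gen P \<le> gen P'"
    proof -
      have "int m * int (j i) \<le> int m * int J" using J[OF iP(1)] by (intro mult_left_mono) auto
      moreover have "P \<in> ?S (j i)" using F(1)[of i] iP by blast
      ultimately show "P \<in> B" "gen P \<le> gen P'" using P' by auto
    qed
    have "bx P' \<subseteq> bx P" using nested_le[OF P(1) P'(1) P(2)] iP P' by blast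
    then show "x \<in> (\<Union>P\<in>G. bx P)" using P' iP by (auto simp: G_def)
  qed
  have GS: "G \<subseteq> ?S J" by (auto simp: G_def)
  let ?D = "\<lambda>i. bx P0 \<inter> (a i - (\<Union>P\<in>F i. bx P) \<union> ((\<Union>P\<in>F i. bx P) - a i))"
  have Fs: "(\<Union>P\<in>F i. bx P) \<in> sets L" for i
    using F(1)[of i] by (intro sets_UN_bx) auto
  have "emeasure L (bx P0 \<inter> ((\<Union>i. a i) - (\<Union>P\<in>G. bx P) \<union> ((\<Union>P\<in>G. bx P) - (\<Union>i. a i))))
     \<le> emeasure L (D n \<union> (\<Union>i<n. ?D i))"
  proof (rule emeasure_mono)
    show "bx P0 \<inter> ((\<Union>i. a i) - (\<Union>P\<in>G. bx P) \<union> ((\<Union>P\<in>G. bx P) - (\<Union>i. a i))) \<subseteq> D n \<union> (\<Union>i<n. ?D i)"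
    proof
      fix x assume x: "x \<in> bx P0 \<inter> ((\<Union>i. a i) - (\<Union>P\<in>G. bx P) \<union> ((\<Union>P\<in>G. bx P) - (\<Union>i. a i)))"
      show "x \<in> D n \<union> (\<Union>i<n. ?D i)"
      proof (cases "x \<in> (\<Union>i. a i)")
        case True
        with x have "\<forall>i<n. x \<notin> (\<Union>P\<in>F i. bx P)" unfolding G by blast
        with True x show ?thesis unfolding D_def by blast
      next
        case False
        with x obtain i where "i < n" "x \<in> (\<Union>P\<in>F i. bx P)" unfolding G by blast
        with False x show ?thesis by blast
      qed
    qed
    show "D n \<union> (\<Union>i<n. ?D i) \<in> sets L"
    proof -
      have "?D i \<in> sets L" for i using a[of i] Fs[of i] P0 by (intro sets.Int sets.Un sets.Diff) auto
      then have "(\<Union>i<n. ?D i) \<in> sets L" by blast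
      then show ?thesis using a P0 by (auto simp: D_def)
    qed
  qed
  also have "\<dots> \<le> emeasure L (D n) + emeasure L (\<Union>i<n. ?D i)"
    using a Fs P0 by (intro emeasure_subadditive) (auto simp: D_def)
  also have "\<dots> \<le> ennreal (e/2) + (\<Sum>i<n. emeasure L (?D i))"
    using a Fs P0 n by (intro add_mono emeasure_subadditive_finite) (auto simp: less_imp_le)
  also have "(\<Sum>i<n. emeasure L (?D i)) \<le> (\<Sum>i<n. ennreal d)"
    by (intro sum_mono F(2))
  also have "(\<Sum>i<n. ennreal d) = ennreal (n * d)"
    using d by (simp add: ennreal_of_nat_eq_real_of_nat ennreal_mult)
  also have "n * d \<le> e / 2" using Union.prems by (simp add: d_def field_simps)
  finally have "emeasure L (bx P0 \<inter> ((\<Union>i. a i) - (\<Union>P\<in>G. bx P) \<union> ((\<Union>P\<in>G. bx P) - (\<Union>i. a i)))) \<le> ennreal (e/2) + ennreal (e/2)"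
    by (simp add: ennreal_leI)
  also have "\<dots> = ennreal e" using Union.prems by (simp add: ennreal_plus[symmetric] del: ennreal_plus)
  finally show ?case using GS by blast
qed

lemma density_box:
  assumes D: "D \<in> sets L" "0 < emeasure L D" and m: "0 < m" and \<kappa>: "0 \<le> \<kappa>" "\<kappa> < 1"
  shows "\<exists>P\<in>B. (\<exists>n::nat. gen P = k + int m * int n) \<and>
           ennreal \<kappa> * emeasure L (bx P) < emeasure L (D \<inter> bx P)"
proof -
  have "\<exists>P0\<in>B. gen P0 = k \<and> 0 < emeasure L (D \<inter> bx P0)"
  proof (rule ccontr)
    assume "\<not> ?thesis"
    then have "emeasure L (D \<inter> bx P) = 0" if "P \<in> B" "gen P = k" for P
      using that by (metis not_gr_zero)
    then have "(\<Union>P\<in>{P\<in>B. gen P = k}. D \<inter> bx P) \<in> null_sets L"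
      using D by (intro null_sets_UN' countable_sub) (auto intro!: null_setsI)
    moreover have "(\<Union>P\<in>{P\<in>B. gen P = k}. D \<inter> bx P) = D" using cover[of k] by blast
    ultimately show False using D by auto
  qed
  then obtain P0 where P0: "P0 \<in> B" "gen P0 = k" "0 < emeasure L (D \<inter> bx P0)" by blast
  define D0 where "D0 = D \<inter> bx P0"
  have D0: "D0 \<in> sets L" using D P0 by (auto simp: D0_def)
  have fin: "emeasure L D0 < \<infinity>"
    using emeasure_mono[of D0 "bx P0" L] fin_bx[OF P0(1)] P0 by (auto simp: D0_def)
  obtain E where E: "E \<in> sigma_sets UNIV (bx ` {P \<in> B. \<exists>n::nat. gen P = k + int m * int n})"
     "emeasure L (D0 - E \<union> (E - D0)) = 0"
    using generate[OF D0 fin m] by blast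
  obtain d where d: "emeasure L D0 = ennreal d" "0 < d"
    using fin P0(3) by (cases "emeasure L D0") (auto simp: D0_def)
  \<comment> \<open>The error that contradicts density at most \<open>\<kappa>\<close>: with x the
    mass of \<open>D0\<close> in the union, d \<le> x + e and (1 - \<kappa>) x \<le> \<kappa> e,
    whereas (1 - \<kappa>) (d - e) \<ge> 3 e.\<close>
  define e where "e = (1 - \<kappa>) * d / 4"
  have e: "e > 0" using \<kappa> d by (simp add: e_def)
  obtain n F where F: "F \<subseteq> {P \<in> B. gen P = k + int m * int n}"
     "emeasure L (bx P0 \<inter> (E - (\<Union>P\<in>F. bx P) \<union> ((\<Union>P\<in>F. bx P) - E))) \<le> ennreal e"
    using approx_by_generation[OF P0(1) m E(1) e] by blast
  define F0 where "F0 = {P \<in> F. bx P \<subseteq> bx P0}"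
  have F0B: "F0 \<subseteq> B" using F by (auto simp: F0_def)
  define U where "U = (\<Union>P\<in>F0. bx P)"
  have Us: "U \<in> sets L" unfolding U_def by (rule sets_UN_bx[OF F0B])
  have UP: "bx P0 \<inter> (\<Union>P\<in>F. bx P) = U"
  proof -
    have "bx P \<subseteq> bx P0" if "P \<in> F" "bx P0 \<inter> bx P \<noteq> {}" for P
    proof -
      obtain x where x: "x \<in> bx P0" "x \<in> bx P" using \<open>bx P0 \<inter> bx P \<noteq> {}\<close> by auto
      have "P \<in> B" "gen P0 \<le> gen P" using F that P0 by auto
      then show ?thesis using nested_le[of P0 P x] x P0 by simp
    qed
    then show ?thesis by (auto simp: U_def F0_def)
  qed
  have Es: "E \<in> sets L"
    by (rule subsetD[OF sigma_sets_boxes E(1)])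
  have Fs: "(\<Union>P\<in>F. bx P) \<in> sets L" using F(1) by (intro sets_UN_bx) auto
  have sym: "emeasure L (D0 - U) \<le> ennreal e" "emeasure L (U - D0) \<le> ennreal e"
  proof -
    let ?R = "bx P0 \<inter> (E - (\<Union>P\<in>F. bx P) \<union> ((\<Union>P\<in>F. bx P) - E)) \<union> (D0 - E \<union> (E - D0))"
    have "emeasure L ?R \<le> ennreal e"
      using emeasure_subadditive[of "bx P0 \<inter> (E - (\<Union>P\<in>F. bx P) \<union> ((\<Union>P\<in>F. bx P) - E))" L "D0 - E \<union> (E - D0)"]
        F(2) E(2) Es Fs D0 P0(1) by auto
    moreover have "D0 - U \<subseteq> ?R" "U - D0 \<subseteq> ?R" using UP by (auto simp: D0_def)
    moreover have "?R \<in> sets L" using Es Fs D0 P0(1) by auto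
    ultimately show "emeasure L (D0 - U) \<le> ennreal e" "emeasure L (U - D0) \<le> ennreal e"
      by (meson emeasure_mono order_trans)+
  qed
  have "\<exists>P\<in>F0. ennreal \<kappa> * emeasure L (bx P) < emeasure L (D \<inter> bx P)"
  proof (rule ccontr)
    assume neg: "\<not> ?thesis"
    have le: "emeasure L (D0 \<inter> bx P) \<le> ennreal \<kappa> * emeasure L (bx P)" if "P \<in> F0" for P
    proof -
      have "D0 \<inter> bx P = D \<inter> bx P" using that by (auto simp: F0_def D0_def)
      with neg that show ?thesis by (auto simp: not_less)
    qed
    have disj: "disjoint_family_on bx F0"
      unfolding disjoint_family_on_def
    proof (intro ballI impI)
      fix P P' assume "P \<in> F0" "P' \<in> F0" "P \<noteq> P'"
      moreover from this have "P \<in> {P \<in> B. gen P = k + int m * int n}" "P' \<in> {P \<in> B. gen P = k + int m * int n}"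
        using F(1) unfolding F0_def by blast+
      ultimately show "bx P \<inter> bx P' = {}" using disjoint_gen[of P P'] by simp
    qed
    have "emeasure L (D0 \<inter> U) = emeasure L (\<Union>P\<in>F0. D0 \<inter> bx P)"
      by (auto simp: U_def intro!: arg_cong[where f="emeasure L"])
    also have "\<dots> = (\<integral>\<^sup>+P. emeasure L (D0 \<inter> bx P) \<partial>count_space F0)"
      using D0 F0B disj by (intro emeasure_UN_countable countable_sub) (auto simp: disjoint_family_on_def)
    also have "\<dots> \<le> (\<integral>\<^sup>+P. ennreal \<kappa> * emeasure L (bx P) \<partial>count_space F0)"
      by (intro nn_integral_mono) (auto intro: le)
    also have "\<dots> = ennreal \<kappa> * emeasure L U"
      unfolding U_def using F0B disj by (subst nn_integral_cmult) (auto simp: emeasure_UN_disjoint)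
    also have "emeasure L U = emeasure L (D0 \<inter> U) + emeasure L (U - D0)"
      using D0 Us by (subst plus_emeasure) (auto intro!: arg_cong[where f="emeasure L"])
    finally have 1: "emeasure L (D0 \<inter> U) \<le> ennreal \<kappa> * (emeasure L (D0 \<inter> U) + ennreal e)"
      using sym(2) by (meson add_left_mono mult_left_mono order_trans zero_le)
    have "emeasure L D0 = emeasure L (D0 \<inter> U) + emeasure L (D0 - U)"
      using D0 Us by (subst plus_emeasure) (auto intro!: arg_cong[where f="emeasure L"])
    then have 2: "ennreal d \<le> emeasure L (D0 \<inter> U) + ennreal e"
      using sym(1) d by (metis add_left_mono)
    have "emeasure L (D0 \<inter> U) < \<infinity>"
      using emeasure_mono[of "D0 \<inter> U" D0 L] fin D0 by auto
    then obtain x where x: "emeasure L (D0 \<inter> U) = ennreal x" "0 \<le> x"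
      by (cases "emeasure L (D0 \<inter> U)") auto
    have "d \<le> x + e" using 2 x e by (simp add: ennreal_plus[symmetric] del: ennreal_plus)
    moreover have "x \<le> \<kappa> * (x + e)"
      using 1 x e \<kappa> by (simp add: ennreal_plus[symmetric] ennreal_mult[symmetric] del: ennreal_plus)
    then have "(1 - \<kappa>) * x \<le> \<kappa> * e" by (simp add: algebra_simps)
    moreover have "\<kappa> * e \<le> 1 * e" using \<kappa> e by (intro mult_right_mono) auto
    moreover have "(1 - \<kappa>) * (d - e) \<le> (1 - \<kappa>) * x" using \<kappa> \<open>d \<le> x + e\<close> by (intro mult_left_mono) auto
    moreover have "d - e \<ge> 3/4 * d"
    proof -
      have "0 \<le> \<kappa> * d" using \<kappa> d by simp
      moreover have "e = d / 4 - (\<kappa> * d) / 4" by (simp add: e_def algebra_simps diff_divide_distrib)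
      ultimately show ?thesis by linarith
    qed
    then have "(1 - \<kappa>) * (d - e) \<ge> (1 - \<kappa>) * (3/4 * d)" using \<kappa> by (intro mult_left_mono) auto
    moreover have "(1 - \<kappa>) * (3/4 * d) = 3 * e" by (simp add: e_def)
    ultimately show False using e by linarith
  qed
  then show ?thesis using F by (auto simp: F0_def)
qed

text \<open>The supremum of the averages of \<open>g\<close> over the \<open>i\<close>-th shifts of the boxes that contain a point.\<close>

definition mop :: "int \<Rightarrow> ('s \<Rightarrow> ennreal) \<Rightarrow> 's \<Rightarrow> ennreal" where
  "mop i g z = (SUP P\<in>B. (\<integral>\<^sup>+w\<in>bx (sh i P). g w \<partial>L) / emeasure L (bx P) * indicator (bx P) z)"

lemma borel_measurable_mop [measurable]: "mop i g \<in> borel_measurable L"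
  unfolding mop_def by (intro borel_measurable_SUP countable_B) auto

lemma mop_ge: "P \<in> B \<Longrightarrow> z \<in> bx P \<Longrightarrow> (\<integral>\<^sup>+w\<in>bx (sh i P). g w \<partial>L) / emeasure L (bx P) \<le> mop i g z"
  unfolding mop_def by (rule SUP_upper2[of P]) auto

text \<open>The part of \<open>g\<close> below \<open>h\<close> contributes at most \<open>h\<close>
  to an average, so an average above \<open>2 h\<close> keeps at least \<open>h\<close> after
  truncation.\<close>

lemma mop_gt_truncate:
  assumes z: "2 * ennreal h < mop i g z" and [measurable]: "g \<in> borel_measurable L"
  shows "\<exists>P\<in>B. z \<in> bx P \<and>
    ennreal h * emeasure L (bx P) \<le> (\<integral>\<^sup>+w\<in>bx (sh i P). g w * indicator {w. ennreal h < g w} w \<partial>L)"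
proof -
  from z obtain P where P: "P \<in> B"
    "2 * ennreal h < (\<integral>\<^sup>+w\<in>bx (sh i P). g w \<partial>L) / emeasure L (bx P) * indicator (bx P) z"
    unfolding mop_def less_SUP_iff by blast
  then have zP: "z \<in> bx P" and
    *: "2 * ennreal h < (\<integral>\<^sup>+w\<in>bx (sh i P). g w \<partial>L) / emeasure L (bx P)"
    by (auto split: split_indicator_asm)
  have shP: "bx (sh i P) \<in> sets L" using P sh_in by auto
  have "2 * ennreal h * emeasure L (bx P) \<le> (\<integral>\<^sup>+w\<in>bx (sh i P). g w \<partial>L)"
    using ennreal_less_divide_imp[OF * pos_bx fin_bx] P by auto
  also have "\<dots> \<le> (\<integral>\<^sup>+w. g w * indicator {w. ennreal h < g w} w * indicator (bx (sh i P)) w + ennreal h * indicator (bx (sh i P)) w \<partial>L)"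
    by (intro nn_integral_mono) (auto split: split_indicator simp: not_less)
  also have "\<dots> = (\<integral>\<^sup>+w\<in>bx (sh i P). g w * indicator {w. ennreal h < g w} w \<partial>L) + ennreal h * emeasure L (bx P)"
    using P shP by (subst nn_integral_add) (auto simp: emeasure_sh nn_integral_cmult_indicator)
  finally have "ennreal h * emeasure L (bx P) + ennreal h * emeasure L (bx P)
     \<le> ennreal h * emeasure L (bx P) + (\<integral>\<^sup>+w\<in>bx (sh i P). g w * indicator {w. ennreal h < g w} w \<partial>L)"
    by (simp add: mult_2 distrib_right add.commute)
  moreover have "ennreal h * emeasure L (bx P) \<noteq> top"
    using fin_bx[of P] P by (auto simp: ennreal_mult_eq_top_iff)
  ultimately have "ennreal h * emeasure L (bx P) \<le> (\<integral>\<^sup>+w\<in>bx (sh i P). g w * indicator {w. ennreal h < g w} w \<partial>L)"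
    by (metis ennreal_add_left_cancel_le infinity_ennreal_def)
  with P zP show ?thesis by blast
qed

text \<open>\<open>weak_type\<close> is used with the truncated \<open>g\<close> as the density of
  the second measure and with \<open>W\<close> the whole space.\<close>

lemma mop_L2:
  assumes [measurable]: "g \<in> borel_measurable L"
  shows "(\<integral>\<^sup>+z. mop i g z ^ 2 \<partial>L) \<le> 2 ^ 2 * (4 * ennreal (2 * \<bar>i\<bar> + 1)) * (\<integral>\<^sup>+z. g z ^ 2 \<partial>L)"
proof -
  have "(\<integral>\<^sup>+z. mop i g z ^ (2*1) \<partial>L) \<le> 2 ^ (2*1) * (4 * ennreal (2 * \<bar>i\<bar> + 1)) * (\<integral>\<^sup>+z. g z ^ (2*1) \<partial>L)"
  proof (rule weak_type_imp_strong_type[OF sigma_finite_L])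
    fix h :: real assume h: "0 < h"
    let ?g = "\<lambda>z. g z * indicator {z. ennreal h < g z} z"
    define F where "F = {P\<in>B. ennreal h * emeasure L (bx P) \<le> (\<integral>\<^sup>+w\<in>bx (sh i P). ?g w \<partial>L)}"
    have FB: "F \<subseteq> B" by (auto simp: F_def)
    have "{z \<in> space L. 2 * ennreal h < mop i g z} \<subseteq> (\<Union>P\<in>F. bx P)"
      using mop_gt_truncate by (fastforce simp: F_def)
    then have "ennreal h * emeasure L {z \<in> space L. 2 * ennreal h < mop i g z} \<le> ennreal h * emeasure L (\<Union>P\<in>F. bx P)"
      using sets_UN_bx[OF FB] by (intro mult_left_mono emeasure_mono) auto
    also have "\<dots> \<le> ennreal (2 * \<bar>i\<bar> + 1) * emeasure (density L ?g) UNIV"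
      using FB sh_in
      by (intro weak_type) (auto simp: F_def emeasure_density sets.top[of L, unfolded space_L])
    also have "emeasure (density L ?g) UNIV = (\<integral>\<^sup>+z. ?g z \<partial>L)"
      using sets.top[of L] by (subst emeasure_density) (auto simp: space_L)
    finally show "ennreal h ^ 1 * emeasure L {z \<in> space L. 2 * ennreal h < mop i g z}
      \<le> ennreal (2 * \<bar>i\<bar> + 1) * (\<integral>\<^sup>+z. g z ^ 1 * indicator {z. ennreal h < g z} z \<partial>L)" by simp
  qed auto
  then show ?thesis by simp
qed

text \<open>\<open>cond\<close> is a lagged A_3 condition for the weight \<open>E ^ 8\<close>, of
  which \<open>E' ^ 4\<close> is the power -1/2. By Cauchy-Schwarz the squared average of
  \<open>g\<close> over the shifted box is at most the product of the averages of
  \<open>V = g^2 E^4\<close> and \<open>E' ^ 4\<close>. Squaring once more and multiplying by the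
  weight of \<open>P\<close> gives h^4 w(P) \<le> K times the integral of \<open>(mop i V)^2\<close>
  over \<open>P\<close>. Summation over disjoint maximal boxes leaves the unweighted L^2 bound for
  \<open>V\<close>, and V^2 = g^4 E^8.\<close>

lemma mop_weighted:
  fixes E E' :: "'s \<Rightarrow> ennreal"
  assumes [measurable]: "E \<in> borel_measurable L" "E' \<in> borel_measurable L" "g \<in> borel_measurable L"
    and E: "\<And>z. E z * E' z = 1" "\<And>z. E z < \<infinity>"
    and cond: "\<And>P. P \<in> B \<Longrightarrow>
      (\<integral>\<^sup>+w\<in>bx P. E w ^ 8 \<partial>L) * (\<integral>\<^sup>+w\<in>bx (sh i P). E' w ^ 4 \<partial>L) ^ 2 \<le> K * emeasure L (bx P) ^ 3"
  shows "(\<integral>\<^sup>+z. (E z * mop i g z) ^ 8 \<partial>L) \<le>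
    2 ^ 8 * (4 * (K * (2 ^ 2 * (4 * ennreal (2 * \<bar>i\<bar> + 1))))) * (\<integral>\<^sup>+z. (E z * g z) ^ 8 \<partial>L)"
proof -
  interpret sigma_finite_measure L by (rule sigma_finite_L)
  let ?w = "density L (\<lambda>z. E z ^ 8)"
  let ?C = "K * (2 ^ 2 * (4 * ennreal (2 * \<bar>i\<bar> + 1)))"
  have "sigma_finite_measure ?w"
    using E(2) by (subst sigma_finite_iff_density_finite) (auto simp: power_eq_top_ennreal less_top)
  then have "(\<integral>\<^sup>+z. mop i g z ^ (2*4) \<partial>?w) \<le> 2 ^ (2*4) * (4 * ?C) * (\<integral>\<^sup>+z. g z ^ (2*4) \<partial>?w)"
  proof (rule weak_type_imp_strong_type)
    fix h :: real assume h: "0 < h"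
    let ?g = "\<lambda>z. g z * indicator {z. ennreal h < g z} z"
    define F where "F = {P\<in>B. ennreal h * emeasure L (bx P) \<le> (\<integral>\<^sup>+w\<in>bx (sh i P). ?g w \<partial>L)}"
    have FB: "F \<subseteq> B" by (auto simp: F_def)
    define V where "V = (\<lambda>z. ?g z ^ 2 * E z ^ 4)"
    have [measurable]: "V \<in> borel_measurable L" by (simp add: V_def)
    define Uk where "Uk n = (\<Union>P\<in>{P \<in> F. - int n \<le> gen P}. bx P)" for n :: nat
    have Uks: "Uk n \<in> sets L" for n unfolding Uk_def using FB by (intro sets_UN_bx) auto
    have single: "ennreal h ^ 4 * emeasure ?w (bx P) \<le> K * emeasure (density L (\<lambda>z. mop i V z ^ 2)) (bx P)"
      if P: "P \<in> F" for P
    proof -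
      have PB: "P \<in> B" "sh i P \<in> B" using P FB sh_in by auto
      let ?p = "emeasure L (bx P)" and ?Y = "\<integral>\<^sup>+w\<in>bx (sh i P). V w \<partial>L"
      have p: "0 < ?p" "?p < \<infinity>" using pos_bx fin_bx PB by auto
      have "(\<integral>\<^sup>+w\<in>bx (sh i P). ?g w \<partial>L) ^ 2 =
        (\<integral>\<^sup>+w. (?g w * E w ^ 2 * indicator (bx (sh i P)) w) * (E' w ^ 2 * indicator (bx (sh i P)) w) \<partial>L) ^ 2"
      proof -
        have EE: "E w ^ 2 * E' w ^ 2 = 1" for w using E(1)[of w] by (simp add: power_mult_distrib[symmetric])
        have "?g w * indicator (bx (sh i P)) w = (?g w * E w ^ 2 * indicator (bx (sh i P)) w) * (E' w ^ 2 * indicator (bx (sh i P)) w)" for w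
          using EE[of w] by (auto split: split_indicator simp: mult.assoc)
        then show ?thesis by simp
      qed
      also have "\<dots> \<le> (\<integral>\<^sup>+w. (?g w * E w ^ 2 * indicator (bx (sh i P)) w) ^ 2 \<partial>L) * (\<integral>\<^sup>+w. (E' w ^ 2 * indicator (bx (sh i P)) w) ^ 2 \<partial>L)"
        using PB by (intro Cauchy_Schwarz_nn_integral) auto
      also have "(\<integral>\<^sup>+w. (?g w * E w ^ 2 * indicator (bx (sh i P)) w) ^ 2 \<partial>L) = ?Y"
        by (intro nn_integral_cong) (auto split: split_indicator simp: V_def power_mult_distrib power_mult[symmetric])
      also have "(\<integral>\<^sup>+w. (E' w ^ 2 * indicator (bx (sh i P)) w) ^ 2 \<partial>L) = (\<integral>\<^sup>+w\<in>bx (sh i P). E' w ^ 4 \<partial>L)"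
        by (intro nn_integral_cong) (auto split: split_indicator simp: power_mult[symmetric])
      finally have CS: "(\<integral>\<^sup>+w\<in>bx (sh i P). ?g w \<partial>L) ^ 2 \<le> ?Y * (\<integral>\<^sup>+w\<in>bx (sh i P). E' w ^ 4 \<partial>L)" .
      \<comment> \<open>The average of \<open>V\<close> over the shifted box; \<open>mop i V\<close>
        is at least \<open>q\<close> at every point of \<open>bx P\<close>.\<close>
      define q where "q = ?Y / ?p"
      have q: "?Y = q * ?p" using ennreal_divide_mult_cancel[OF p] by (simp add: q_def)
      have w: "emeasure ?w (bx P) = (\<integral>\<^sup>+w\<in>bx P. E w ^ 8 \<partial>L)" using PB by (subst emeasure_density) auto
      have "ennreal h * ?p \<le> (\<integral>\<^sup>+w\<in>bx (sh i P). ?g w \<partial>L)" using P by (simp add: F_def)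
      then have "(ennreal h * ?p) ^ 4 \<le> (\<integral>\<^sup>+w\<in>bx (sh i P). ?g w \<partial>L) ^ 4" by (intro power_mono) auto
      also have "\<dots> = ((\<integral>\<^sup>+w\<in>bx (sh i P). ?g w \<partial>L) ^ 2) ^ 2" by (simp add: power_mult[symmetric])
      also have "\<dots> \<le> (?Y * (\<integral>\<^sup>+w\<in>bx (sh i P). E' w ^ 4 \<partial>L)) ^ 2" using CS by (intro power_mono) auto
      finally have "emeasure ?w (bx P) * (ennreal h * ?p) ^ 4 \<le> emeasure ?w (bx P) * (?Y * (\<integral>\<^sup>+w\<in>bx (sh i P). E' w ^ 4 \<partial>L)) ^ 2"
        by (rule mult_left_mono) simp
      also have "\<dots> = ?Y ^ 2 * ((\<integral>\<^sup>+w\<in>bx P. E w ^ 8 \<partial>L) * (\<integral>\<^sup>+w\<in>bx (sh i P). E' w ^ 4 \<partial>L) ^ 2)"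
        unfolding w by (simp add: power_mult_distrib ac_simps)
      also have "\<dots> \<le> ?Y ^ 2 * (K * ?p ^ 3)" using cond[OF PB(1)] by (rule mult_left_mono) simp
      also have "\<dots> = (K * (q ^ 2 * ?p)) * ?p ^ 4"
        unfolding q by (simp add: power_mult_distrib ac_simps power2_eq_square power3_eq_cube power4_eq_xxxx)
      finally have le4: "(ennreal h ^ 4 * emeasure ?w (bx P)) * ?p ^ 4 \<le> (K * (q ^ 2 * ?p)) * ?p ^ 4"
        by (simp add: power_mult_distrib ac_simps)
      then have "ennreal h ^ 4 * emeasure ?w (bx P) \<le> K * (q ^ 2 * ?p)"
        using p by (intro ennreal_mult_right_le_cancel[OF le4] ennreal_power_pos ennreal_power_finite)
      also have "q ^ 2 * ?p = (\<integral>\<^sup>+z. q ^ 2 * indicator (bx P) z \<partial>L)"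
        using PB by (simp add: nn_integral_cmult_indicator)
      also have "\<dots> \<le> (\<integral>\<^sup>+z. mop i V z ^ 2 * indicator (bx P) z \<partial>L)"
        using mop_ge[OF PB(1), where i=i and g=V]
        by (intro nn_integral_mono) (auto split: split_indicator simp: q_def intro!: power_mono)
      also have "\<dots> = emeasure (density L (\<lambda>z. mop i V z ^ 2)) (bx P)" using PB by (subst emeasure_density) auto
      finally show ?thesis by (simp add: mult_left_mono)
    qed
    have Ukle: "ennreal h ^ 4 * emeasure ?w (Uk n) \<le> K * (\<integral>\<^sup>+z. mop i V z ^ 2 \<partial>L)" for n
    proof -
      let ?F = "{P \<in> F. - int n \<le> gen P}"
      have FB': "?F \<subseteq> B" using FB by auto
      have kmin: "- int n \<le> gen P" if "P \<in> ?F" for P using that by simp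
      obtain G where G: "G \<subseteq> ?F" "disjoint_family_on bx G"
        "\<And>P. P \<in> ?F \<Longrightarrow> \<exists>P'\<in>G. gen P' \<le> gen P \<and> bx P \<subseteq> bx P'"
        using maximal_subfamily[OF FB' kmin] by metis
      have GB: "G \<subseteq> B" using G(1) FB by auto
      have "Uk n \<subseteq> (\<Union>P\<in>G. bx P)" using G(3) unfolding Uk_def by blast
      then have "ennreal h ^ 4 * emeasure ?w (Uk n) \<le> ennreal h ^ 4 * emeasure ?w (\<Union>P\<in>G. bx P)"
        using sets_UN_bx[OF GB] by (intro mult_left_mono emeasure_mono) auto
      also have "\<dots> = (\<integral>\<^sup>+P. ennreal h ^ 4 * emeasure ?w (bx P) \<partial>count_space G)"
        using GB G(2) by (subst emeasure_UN_disjoint) (auto simp: nn_integral_cmult)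
      also have "\<dots> \<le> (\<integral>\<^sup>+P. K * emeasure (density L (\<lambda>z. mop i V z ^ 2)) (bx P) \<partial>count_space G)"
        using G(1) by (intro nn_integral_mono single) auto
      also have "\<dots> = K * emeasure (density L (\<lambda>z. mop i V z ^ 2)) (\<Union>P\<in>G. bx P)"
        using GB G(2) by (subst emeasure_UN_disjoint) (auto simp: nn_integral_cmult)
      also have "\<dots> \<le> K * emeasure (density L (\<lambda>z. mop i V z ^ 2)) (space L)"
        using sets.top[of L] by (intro mult_left_mono emeasure_mono) (auto simp: space_L)
      also have "emeasure (density L (\<lambda>z. mop i V z ^ 2)) (space L) = (\<integral>\<^sup>+z. mop i V z ^ 2 \<partial>L)"
        by (subst emeasure_density) (auto intro!: nn_integral_cong)
      finally show ?thesis .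
    qed
    have "{z \<in> space ?w. 2 * ennreal h < mop i g z} \<subseteq> (\<Union>n. Uk n)"
    proof
      fix z assume "z \<in> {z \<in> space ?w. 2 * ennreal h < mop i g z}"
      then obtain P where P: "P \<in> F" "z \<in> bx P" using mop_gt_truncate[of h i g z] by (auto simp: F_def)
      then have "z \<in> Uk (nat (- gen P))" by (auto simp: Uk_def)
      then show "z \<in> (\<Union>n. Uk n)" by blast
    qed
    then have "ennreal h ^ 4 * emeasure ?w {z \<in> space ?w. 2 * ennreal h < mop i g z} \<le> ennreal h ^ 4 * emeasure ?w (\<Union>n. Uk n)"
      using Uks by (intro mult_left_mono emeasure_mono) auto
    also have "emeasure ?w (\<Union>n. Uk n) = (SUP n. emeasure ?w (Uk n))"
    proof (rule SUP_emeasure_incseq[symmetric])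
      show "range Uk \<subseteq> sets ?w" using Uks by auto
      show "incseq Uk" unfolding Uk_def by (rule monoI) force
    qed
    also have "ennreal h ^ 4 * (SUP n. emeasure ?w (Uk n)) = (SUP n. ennreal h ^ 4 * emeasure ?w (Uk n))"
      by (simp add: SUP_mult_left_ennreal)
    also have "\<dots> \<le> K * (\<integral>\<^sup>+z. mop i V z ^ 2 \<partial>L)" by (intro SUP_least Ukle)
    also have "\<dots> \<le> K * (2 ^ 2 * (4 * ennreal (2 * \<bar>i\<bar> + 1)) * (\<integral>\<^sup>+z. V z ^ 2 \<partial>L))"
      by (intro mult_left_mono mop_L2) auto
    also have "(\<integral>\<^sup>+z. V z ^ 2 \<partial>L) = (\<integral>\<^sup>+z. E z ^ 8 * (g z ^ 4 * indicator {z. ennreal h < g z} z) \<partial>L)"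
      by (intro nn_integral_cong) (auto simp: V_def power_mult_distrib power_mult[symmetric] ac_simps split: split_indicator)
    also have "\<dots> = (\<integral>\<^sup>+z. g z ^ 4 * indicator {z. ennreal h < g z} z \<partial>?w)"
      by (subst nn_integral_density) auto
    finally show "ennreal h ^ 4 * emeasure ?w {z \<in> space ?w. 2 * ennreal h < mop i g z} \<le> ?C * (\<integral>\<^sup>+z. g z ^ 4 * indicator {z. ennreal h < g z} z \<partial>?w)"
      by (simp add: mult.assoc)
  qed auto
  then show ?thesis
    by (simp add: nn_integral_density power_mult_distrib)
qed

end

section \<open>The John-Nirenberg inequality on a shifted grid\<close>

text \<open>For x in (n E, (n + 1) E] the exponential is at most (3/2)^(n+1), and layer n is present
  in the sum. The base 3/2 is smaller than 2 so that the layers can be summed against level sets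
  that halve at every step.\<close>

lemma ennreal_exp_le_layers:
  assumes E: "0 < (E::real)"
  shows "ennreal (exp (ln (3/2) / E * x)) \<le> 1 + (\<Sum>n. ennreal ((3/2) ^ Suc n) * indicator {y. real n * E < y} x)"
proof (cases "x \<le> 0")
  case True
  then have "ln (3/2) / E * x \<le> 0" using E by (intro mult_nonneg_nonpos) auto
  then have "exp (ln (3/2) / E * x) \<le> 1" by simp
  then have "ennreal (exp (ln (3/2) / E * x)) \<le> 1" by (simp add: ennreal_leI flip: ennreal_1)
  then show ?thesis by (rule order_trans) simp
next
  case False
  define n where "n = nat (\<lceil>x / E\<rceil> - 1)"
  have c: "\<lceil>x / E\<rceil> \<ge> 1" using False E by simp
  then have n: "real n = of_int \<lceil>x / E\<rceil> - 1" by (simp add: n_def)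
  then have "real n < x / E" "x / E \<le> real n + 1" by linarith+
  then have nx: "real n * E < x" "x \<le> (real n + 1) * E" using E by (auto simp: field_simps)
  have "ln (3/2) / E * x \<le> ln (3/2) / E * ((real n + 1) * E)" using nx E by (intro mult_left_mono) auto
  also have "\<dots> = real (Suc n) * ln (3/2)" using E by simp
  finally have "exp (ln (3/2) / E * x) \<le> exp (real (Suc n) * ln (3/2))" by simp
  also have "\<dots> = (3/2) ^ Suc n" by (subst exp_of_nat_mult) simp
  finally have "ennreal (exp (ln (3/2) / E * x)) \<le> ennreal ((3/2) ^ Suc n) * indicator {y. real n * E < y} x"
    using nx by (simp add: ennreal_leI)
  also have "\<dots> \<le> (\<Sum>n. ennreal ((3/2) ^ Suc n) * indicator {y. real n * E < y} x)"
  proof -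
    define h where "h n = ennreal ((3/2) ^ Suc n) * indicator {y. real n * E < y} x" for n
    have "h n \<le> (\<Sum>k. h k)" using sum_le_suminf[of h "{n}"] by simp
    then show ?thesis unfolding h_def .
  qed
  finally show ?thesis by (rule order_trans) simp
qed

context shift_grid
begin

text \<open>The stopping boxes are the maximal ones with \<open>a P' > a P + \<Lambda>\<close>; their \<open>i\<close>-th shifts lie in \<open>W\<close> and
  carry much of the mass of \<open>(f - a P)\<^sub>+\<close>.\<close>

lemma john_nirenberg_distribution:
  fixes f :: "'s \<Rightarrow> real" and a :: "'b \<Rightarrow> real"
  assumes [measurable]: "f \<in> borel_measurable L" and m: "0 < m" and C: "0 < C"
    and child: "\<And>P P'. P \<in> B \<Longrightarrow> P' \<in> B \<Longrightarrow> gen P' = gen P + int m \<Longrightarrow> bx P' \<subseteq> bx P \<Longrightarrow> a P' \<le> a P + C"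
    and upper: "\<And>P. P \<in> B \<Longrightarrow> \<exists>W\<in>sets L. bx P \<subseteq> W \<and>
       (\<forall>P'\<in>B. gen P + int m \<le> gen P' \<longrightarrow> bx P' \<subseteq> bx P \<longrightarrow> bx (sh i P') \<subseteq> W) \<and>
       (\<integral>\<^sup>+z\<in>W. ennreal (max 0 (f z - a P)) \<partial>L) \<le> ennreal C * emeasure L (bx P)"
    and lower: "\<And>P. P \<in> B \<Longrightarrow>
       (\<integral>\<^sup>+z\<in>bx (sh i P). ennreal (max 0 (a P - f z)) \<partial>L) \<le> ennreal C * emeasure L (bx P)"
    and E: "E = (2 * (2 * \<bar>i\<bar> + 1) + 3) * C" and P: "P \<in> B"
  shows "emeasure L {z \<in> bx P. a P + real n * E < f z} \<le> ennreal ((1/2) ^ n) * emeasure L (bx P)"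
  using P
proof (induction n arbitrary: P)
  case 0
  then show ?case by (auto intro!: emeasure_mono)
next
  case (Suc n)
  define c :: real where "c = 2 * \<bar>i\<bar> + 1"
  have c: "c \<ge> 1" by (simp add: c_def)
  \<comment> \<open>\<open>weak_type\<close> costs the factor \<open>c\<close>; a jump of \<Lambda>
    leaves mass \<Lambda> - C = 2 c C per unit of measure on the shifted stopping boxes, so they
    fill at most half of \<open>P\<close>.\<close>
  define \<Lambda> where "\<Lambda> = C + 2 * c * C"
  have \<Lambda>: "\<Lambda> > C" "E = \<Lambda> + 2 * C"
  proof -
    show "\<Lambda> > C" using C c by (simp add: \<Lambda>_def)
    show "E = \<Lambda> + 2 * C" by (simp add: \<Lambda>_def E c_def algebra_simps)
  qed
  obtain W where W: "W \<in> sets L" "bx P \<subseteq> W"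
    "\<And>P'. P' \<in> B \<Longrightarrow> gen P + int m \<le> gen P' \<Longrightarrow> bx P' \<subseteq> bx P \<Longrightarrow> bx (sh i P') \<subseteq> W"
    "(\<integral>\<^sup>+z\<in>W. ennreal (max 0 (f z - a P)) \<partial>L) \<le> ennreal C * emeasure L (bx P)"
    using upper[OF Suc.prems] by blast
  \<comment> \<open>\<open>Suc l\<close> excludes \<open>P\<close> itself: stopping boxes are at
    least \<open>m\<close> generations finer, as \<open>upper\<close> requires before it places
    their shifts inside \<open>W\<close>.\<close>
  define F where "F = {P' \<in> B. (\<exists>l::nat. gen P' = gen P + int m * int (Suc l)) \<and> bx P' \<subseteq> bx P \<and> a P + \<Lambda> < a P'}"
  have FB: "F \<subseteq> B" by (auto simp: F_def)
  have Fgen: "gen P \<le> gen P'" if "P' \<in> F" for P' using that m by (auto simp: F_def)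
  obtain G where G: "G \<subseteq> F" "disjoint_family_on bx G"
      "\<And>P. P \<in> F \<Longrightarrow> \<exists>P'\<in>G. gen P' \<le> gen P \<and> bx P \<subseteq> bx P'"
      "\<And>P P'. P \<in> G \<Longrightarrow> P' \<in> F \<Longrightarrow> gen P' < gen P \<Longrightarrow> \<not> bx P \<subseteq> bx P'"
    using maximal_subfamily[OF FB Fgen] by metis
  have GB: "G \<subseteq> B" using G FB by blast
  have GF: "(\<Union>P\<in>G. bx P) = (\<Union>P\<in>F. bx P)" using G(1,3) by blast
  \<comment> \<open>Since \<open>a P' - a P > \<Lambda>\<close>, the functions
    \<open>(f - a P)\<^sub>+\<close> and \<open>(a P' - f)\<^sub>+\<close> add up to at least
    \<Lambda> everywhere; \<open>lower\<close> bounds the second one on the shifted box.\<close>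
  have mass: "ennreal (\<Lambda> - C) * emeasure L (bx P') \<le> emeasure (density L (\<lambda>z. ennreal (max 0 (f z - a P)))) (bx (sh i P') \<inter> W)"
    if P': "P' \<in> F" for P'
  proof -
    let ?p = "emeasure L (bx P')"
    have P'B: "P' \<in> B" "sh i P' \<in> B" using P' FB sh_in by auto
    obtain l where l: "gen P' = gen P + int m * int (Suc l)" using P' by (auto simp: F_def)
    have "int m * 1 \<le> int m * int (Suc l)" by (intro mult_left_mono) auto
    then have "gen P + int m \<le> gen P'" using l by simp
    then have sub: "bx (sh i P') \<subseteq> W" using W(3)[OF P'B(1)] P' by (simp add: F_def)
    have "ennreal (\<Lambda> - C) * ?p + ennreal C * ?p = ennreal \<Lambda> * emeasure L (bx (sh i P'))"
      using \<Lambda> C P'B by (simp add: emeasure_sh distrib_right[symmetric] ennreal_plus[symmetric] del: ennreal_plus)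
    also have "\<dots> = (\<integral>\<^sup>+z. ennreal \<Lambda> * indicator (bx (sh i P')) z \<partial>L)"
      using P'B by (simp add: nn_integral_cmult_indicator)
    also have "\<dots> \<le> (\<integral>\<^sup>+z. ennreal (max 0 (f z - a P)) * indicator (bx (sh i P')) z + ennreal (max 0 (a P' - f z)) * indicator (bx (sh i P')) z \<partial>L)"
    proof (rule nn_integral_mono)
      fix z
      have "\<Lambda> \<le> max 0 (f z - a P) + max 0 (a P' - f z)" using P' by (auto simp: F_def)
      then have "ennreal \<Lambda> \<le> ennreal (max 0 (f z - a P)) + ennreal (max 0 (a P' - f z))"
        by (simp add: ennreal_plus[symmetric] ennreal_leI del: ennreal_plus)
      then show "ennreal \<Lambda> * indicator (bx (sh i P')) z \<le> ennreal (max 0 (f z - a P)) * indicator (bx (sh i P')) z + ennreal (max 0 (a P' - f z)) * indicator (bx (sh i P')) z"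
        by (auto split: split_indicator)
    qed
    also have "\<dots> = (\<integral>\<^sup>+z. ennreal (max 0 (f z - a P)) * indicator (bx (sh i P')) z \<partial>L) + (\<integral>\<^sup>+z\<in>bx (sh i P'). ennreal (max 0 (a P' - f z)) \<partial>L)"
      using P'B by (subst nn_integral_add) auto
    also have "\<dots> \<le> (\<integral>\<^sup>+z. ennreal (max 0 (f z - a P)) * indicator (bx (sh i P')) z \<partial>L) + ennreal C * ?p"
      by (intro add_left_mono lower P'B)
    finally have "ennreal C * ?p + ennreal (\<Lambda> - C) * ?p \<le> ennreal C * ?p + (\<integral>\<^sup>+z. ennreal (max 0 (f z - a P)) * indicator (bx (sh i P')) z \<partial>L)"
      by (simp add: add.commute)
    moreover have "ennreal C * ?p \<noteq> \<infinity>" using fin_bx[OF P'B(1)] by (auto simp: ennreal_mult_eq_top_iff)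
    ultimately have "ennreal (\<Lambda> - C) * ?p \<le> (\<integral>\<^sup>+z. ennreal (max 0 (f z - a P)) * indicator (bx (sh i P')) z \<partial>L)"
      by (metis ennreal_add_left_cancel_le)
    also have "\<dots> = emeasure (density L (\<lambda>z. ennreal (max 0 (f z - a P)))) (bx (sh i P') \<inter> W)"
    proof -
      have "bx (sh i P') \<inter> W = bx (sh i P')" using sub by blast
      then show ?thesis using P'B by (subst emeasure_density) auto
    qed
    finally show ?thesis .
  qed
  have half: "emeasure L (\<Union>P\<in>G. bx P) \<le> ennreal (1/2) * emeasure L (bx P)"
  proof -
    have "ennreal (\<Lambda> - C) * emeasure L (\<Union>P\<in>F. bx P) \<le>
      ennreal (2 * \<bar>i\<bar> + 1) * emeasure (density L (\<lambda>z. ennreal (max 0 (f z - a P)))) W"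
      using FB W(1) mass by (intro weak_type) auto
    also have "emeasure (density L (\<lambda>z. ennreal (max 0 (f z - a P)))) W = (\<integral>\<^sup>+z\<in>W. ennreal (max 0 (f z - a P)) \<partial>L)"
      using W(1) by (subst emeasure_density) auto
    also have "\<dots> \<le> ennreal C * emeasure L (bx P)" by (rule W(4))
    also have "ennreal (2 * \<bar>i\<bar> + 1) * (ennreal C * emeasure L (bx P)) = ennreal (c * C) * emeasure L (bx P)"
      using C c by (simp add: c_def ennreal_mult mult.assoc)
    also have "c * C = (\<Lambda> - C) * (1/2)" by (simp add: \<Lambda>_def)
    also have "ennreal ((\<Lambda> - C) * (1/2)) * emeasure L (bx P) = (ennreal (1/2) * emeasure L (bx P)) * ennreal (\<Lambda> - C)"
      using \<Lambda> by (subst ennreal_mult) (auto simp: ac_simps)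
    finally have "emeasure L (\<Union>P\<in>F. bx P) * ennreal (\<Lambda> - C) \<le> (ennreal (1/2) * emeasure L (bx P)) * ennreal (\<Lambda> - C)"
      by (simp add: mult_left_mono mult_right_mono mult.commute)
    then show ?thesis unfolding GF by (rule ennreal_mult_right_le_cancel) (use \<Lambda> in auto)
  qed
  define D where "D = {z \<in> bx P - (\<Union>P\<in>F. bx P). a P + E < f z}"
  have Ds: "D \<in> sets L"
  proof -
    have "D = {z \<in> space L. a P + E < f z} \<inter> (bx P - (\<Union>P\<in>F. bx P))" by (auto simp: D_def space_L)
    then show ?thesis using sets_UN_bx[OF FB] Suc.prems by simp
  qed
  \<comment> \<open>A box filled to three quarters by \<open>D\<close> cannot be a stopping box,
    hence \<open>f - a P' > 2 C\<close> on its part in \<open>D\<close>; then 3/4 times 2 C exceeds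
    the bound C from \<open>upper\<close>.\<close>
  have D0: "emeasure L D = 0"
  proof (rule ccontr)
    assume "emeasure L D \<noteq> 0"
    then have "0 < emeasure L D" by (simp add: zero_less_iff_neq_zero)
    from density_box[OF Ds this m, of "3/4" "gen P"] obtain P' l where P': "P' \<in> B"
      "gen P' = gen P + int m * int l" "ennreal (3/4) * emeasure L (bx P') < emeasure L (D \<inter> bx P')" by auto
    have "D \<inter> bx P' \<noteq> {}" using P'(3) by auto
    then obtain x where x: "x \<in> D" "x \<in> bx P'" by blast
    have sub: "bx P' \<subseteq> bx P"
      using nested_le[OF Suc.prems P'(1), of x] x P'(2) by (auto simp: D_def)
    have "P' \<notin> F" using x by (auto simp: D_def)
    have "a P' \<le> a P + \<Lambda>"
    proof (cases l)
      case 0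
      then have "gen P' = gen P" using P' by simp
      then have "P' = P" using disjoint_gen[OF P'(1) Suc.prems] x by (auto simp: D_def)
      then show ?thesis using \<Lambda> C by simp
    next
      case (Suc l')
      then show ?thesis using \<open>P' \<notin> F\<close> P' sub by (auto simp: F_def)
    qed
    then have gt: "f z - a P' > 2 * C" if "z \<in> D" for z using that \<Lambda> by (auto simp: D_def)
    obtain W' where W': "W' \<in> sets L" "bx P' \<subseteq> W'"
      "(\<integral>\<^sup>+z\<in>W'. ennreal (max 0 (f z - a P')) \<partial>L) \<le> ennreal C * emeasure L (bx P')"
      using upper[OF P'(1)] by blast
    have "ennreal (2 * C) * emeasure L (D \<inter> bx P') = (\<integral>\<^sup>+z. ennreal (2 * C) * indicator (D \<inter> bx P') z \<partial>L)"
      using Ds P' by (simp add: nn_integral_cmult_indicator)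
    also have "\<dots> \<le> (\<integral>\<^sup>+z\<in>W'. ennreal (max 0 (f z - a P')) \<partial>L)"
    proof (rule nn_integral_mono)
      fix z
      show "ennreal (2 * C) * indicator (D \<inter> bx P') z \<le> ennreal (max 0 (f z - a P')) * indicator W' z"
        using gt[of z] W'(2) C by (auto split: split_indicator intro!: ennreal_leI)
    qed
    also note W'(3)
    finally have le: "ennreal (2 * C) * emeasure L (D \<inter> bx P') \<le> ennreal C * emeasure L (bx P')" .
    obtain p where p: "emeasure L (bx P') = ennreal p" "0 < p"
      using pos_bx[OF P'(1)] fin_bx[OF P'(1)] by (cases "emeasure L (bx P')") auto
    have "emeasure L (D \<inter> bx P') \<le> emeasure L (bx P')" using P' by (intro emeasure_mono) auto
    then obtain d where d: "emeasure L (D \<inter> bx P') = ennreal d" "0 \<le> d"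
      using p by (cases "emeasure L (D \<inter> bx P')") (auto simp: top_unique)
    have "3/4 * p < d" using P'(3) p d by (simp add: ennreal_mult[symmetric] ennreal_less_iff del: ennreal_half ennreal_divide_numeral)
    moreover have "2 * C * d \<le> C * p" using le p d C by (simp add: ennreal_mult[symmetric])
    then have "2 * d \<le> p" using C by (simp add: mult.left_commute[of 2 C] mult.assoc)
    ultimately show False using p by linarith
  qed
  have sub: "{z \<in> bx P. a P + real (Suc n) * E < f z} \<subseteq> D \<union> (\<Union>P'\<in>G. {z \<in> bx P'. a P' + real n * E < f z})"
  proof
    fix z assume z: "z \<in> {z \<in> bx P. a P + real (Suc n) * E < f z}"
    show "z \<in> D \<union> (\<Union>P'\<in>G. {z \<in> bx P'. a P' + real n * E < f z})"
    proof (cases "z \<in> (\<Union>P\<in>F. bx P)")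
      case False
      have "a P + E \<le> a P + real (Suc n) * E" using \<Lambda> C by (simp add: algebra_simps)
      with False z show ?thesis by (auto simp: D_def)
    next
      case True
      then obtain P' where P': "P' \<in> G" "z \<in> bx P'" using GF by blast
      then have "P' \<in> F" using G by blast
      then obtain l where l: "gen P' = gen P + int m * int (Suc l)" and PF: "P' \<in> B" "bx P' \<subseteq> bx P" by (auto simp: F_def)
      \<comment> \<open>The ancestor one step of \<open>m\<close> generations above a stopping box:
        by maximality it does not stop, so the constant has risen by at most \<Lambda> up to there
        and by at most C in the last step. E = \<Lambda> + 2 C leaves room.\<close>
      obtain P'' where P'': "P'' \<in> B" "gen P'' = gen P + int m * int l" "z \<in> bx P''" using cover by blast
      have g: "gen P' = gen P'' + int m" using l P'' by (simp add: algebra_simps)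
      have s1: "bx P' \<subseteq> bx P''" using nested_le[OF P''(1) PF(1) _ P''(3) P'(2)] g by simp
      have s2: "bx P'' \<subseteq> bx P"
        using nested_le[OF Suc.prems P''(1), of z] P'' PF P' by auto
      have "a P'' \<le> a P + \<Lambda>"
      proof (cases l)
        case 0
        then have "gen P'' = gen P" using P'' by simp
        then have "P'' = P" using disjoint_gen[OF P''(1) Suc.prems] P'' PF P' by blast
        then show ?thesis using \<Lambda> C by simp
      next
        case (Suc l')
        have "P'' \<notin> F" using G(4)[OF P'(1), of P''] g m s1 by auto
        then show ?thesis using Suc P'' s2 by (auto simp: F_def)
      qed
      then have "a P' \<le> a P + \<Lambda> + C" using child[OF P''(1) PF(1) g s1] by simp
      then have "a P' + real n * E \<le> a P + real (Suc n) * E" using \<Lambda> C by (simp add: algebra_simps)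
      then show ?thesis using z P' by auto
    qed
  qed
  have lev: "{z \<in> bx P'. a P' + real n * E < f z} \<in> sets L" if "P' \<in> B" for P'
  proof -
    have "{z \<in> bx P'. a P' + real n * E < f z} = {z \<in> space L. a P' + real n * E < f z} \<inter> bx P'" by (auto simp: space_L)
    then show ?thesis using that by simp
  qed
  have Us: "(\<Union>P'\<in>G. {z \<in> bx P'. a P' + real n * E < f z}) \<in> sets L"
    using GB by (intro sets.countable_UN' countable_sub lev) auto
  have "emeasure L {z \<in> bx P. a P + real (Suc n) * E < f z} \<le> emeasure L (D \<union> (\<Union>P'\<in>G. {z \<in> bx P'. a P' + real n * E < f z}))"
    using Ds Us by (intro emeasure_mono sub) auto
  also have "\<dots> \<le> emeasure L D + emeasure L (\<Union>P'\<in>G. {z \<in> bx P'. a P' + real n * E < f z})"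
    using Ds Us by (rule emeasure_subadditive)
  also have "\<dots> \<le> (\<integral>\<^sup>+P'. emeasure L {z \<in> bx P'. a P' + real n * E < f z} \<partial>count_space G)"
    unfolding D0 using GB lev by (auto intro!: emeasure_UN_le_count_space countable_sub)
  also have "\<dots> \<le> (\<integral>\<^sup>+P'. ennreal ((1/2) ^ n) * emeasure L (bx P') \<partial>count_space G)"
    using GB by (intro nn_integral_mono Suc.IH) auto
  also have "\<dots> = ennreal ((1/2) ^ n) * emeasure L (\<Union>P\<in>G. bx P)"
    using GB G(2) by (subst emeasure_UN_disjoint) (auto simp: nn_integral_cmult)
  also have "\<dots> \<le> ennreal ((1/2) ^ n) * (ennreal (1/2) * emeasure L (bx P))"
    by (intro mult_left_mono half) auto
  also have "\<dots> = ennreal ((1/2) ^ Suc n) * emeasure L (bx P)"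
    by (simp only: mult.assoc[symmetric]) (subst ennreal_mult[symmetric], auto simp: mult.commute)
  finally show ?case .
qed

text \<open>The layers contribute (3/2)^(n+1) (1/2)^n = 3/2 (3/4)^n, with sum 6; the constant 1 in
  \<open>ennreal_exp_le_layers\<close> makes it 7.\<close>

lemma john_nirenberg:
  fixes f :: "'s \<Rightarrow> real" and a :: "'b \<Rightarrow> real"
  assumes f [measurable]: "f \<in> borel_measurable L" and m: "0 < m" and C: "0 < C"
    and child: "\<And>P P'. P \<in> B \<Longrightarrow> P' \<in> B \<Longrightarrow> gen P' = gen P + int m \<Longrightarrow> bx P' \<subseteq> bx P \<Longrightarrow> a P' \<le> a P + C"
    and upper: "\<And>P. P \<in> B \<Longrightarrow> \<exists>W\<in>sets L. bx P \<subseteq> W \<and>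
       (\<forall>P'\<in>B. gen P + int m \<le> gen P' \<longrightarrow> bx P' \<subseteq> bx P \<longrightarrow> bx (sh i P') \<subseteq> W) \<and>
       (\<integral>\<^sup>+z\<in>W. ennreal (max 0 (f z - a P)) \<partial>L) \<le> ennreal C * emeasure L (bx P)"
    and lower: "\<And>P. P \<in> B \<Longrightarrow>
       (\<integral>\<^sup>+z\<in>bx (sh i P). ennreal (max 0 (a P - f z)) \<partial>L) \<le> ennreal C * emeasure L (bx P)"
    and E: "E = (2 * (2 * \<bar>i\<bar> + 1) + 3) * C" and P: "P \<in> B"
  shows "(\<integral>\<^sup>+z\<in>bx P. ennreal (exp (ln (3/2) / E * (f z - a P))) \<partial>L) \<le> 7 * emeasure L (bx P)"
proof -
  have E0: "E > 0" using C by (auto simp: E intro!: mult_pos_pos)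
  have sets: "{z \<in> bx P. a P + real n * E < f z} \<in> sets L" for n
  proof -
    have "{z \<in> bx P. a P + real n * E < f z} = {z \<in> space L. a P + real n * E < f z} \<inter> bx P" by (auto simp: space_L)
    then show ?thesis using P by simp
  qed
  have "(\<integral>\<^sup>+z\<in>bx P. ennreal (exp (ln (3/2) / E * (f z - a P))) \<partial>L)
    \<le> (\<integral>\<^sup>+z. indicator (bx P) z + (\<Sum>n. ennreal ((3/2) ^ Suc n) * indicator {z \<in> bx P. a P + real n * E < f z} z) \<partial>L)"
  proof (rule nn_integral_mono)
    fix z
    show "ennreal (exp (ln (3/2) / E * (f z - a P))) * indicator (bx P) z \<le>
       indicator (bx P) z + (\<Sum>n. ennreal ((3/2) ^ Suc n) * indicator {z \<in> bx P. a P + real n * E < f z} z)"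
    proof (cases "z \<in> bx P")
      case True
      have "indicator {y. real n * E < y} (f z - a P) = (indicator {z \<in> bx P. a P + real n * E < f z} z :: ennreal)" for n
        using True by (auto split: split_indicator)
      then show ?thesis using ennreal_exp_le_layers[OF E0, of "f z - a P"] True by simp
    qed auto
  qed
  also have "\<dots> = emeasure L (bx P) + (\<Sum>n. ennreal ((3/2) ^ Suc n) * emeasure L {z \<in> bx P. a P + real n * E < f z})"
    using P sets by (subst nn_integral_add) (auto simp: nn_integral_suminf nn_integral_cmult_indicator)
  also have "(\<Sum>n. ennreal ((3/2) ^ Suc n) * emeasure L {z \<in> bx P. a P + real n * E < f z})
     \<le> (\<Sum>n. ennreal (3/2 * (3/4) ^ n) * emeasure L (bx P))"
  proof (rule suminf_le)
    fix n
    have "ennreal ((3/2) ^ Suc n) * emeasure L {z \<in> bx P. a P + real n * E < f z}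
      \<le> ennreal ((3/2) ^ Suc n) * (ennreal ((1/2) ^ n) * emeasure L (bx P))"
      using john_nirenberg_distribution[where f=f and a=a and m=m and C=C and i=i and E=E and P=P and n=n, OF f m C child upper lower E P]
      by (rule mult_left_mono) auto
    also have "\<dots> = ennreal (3/2 * (3/4) ^ n) * emeasure L (bx P)"
    proof -
      have "((3/2) ^ Suc n :: real) * (1/2) ^ n = 3/2 * (3/4) ^ n"
        by (simp add: power_mult_distrib[symmetric])
      then have "ennreal ((3/2) ^ Suc n) * ennreal ((1/2) ^ n) = ennreal (3/2 * (3/4) ^ n)"
        by (subst ennreal_mult[symmetric]) (simp_all del: power_Suc)
      then show ?thesis by (simp only: mult.assoc[symmetric])
    qed
    finally show "ennreal ((3/2) ^ Suc n) * emeasure L {z \<in> bx P. a P + real n * E < f z}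
       \<le> ennreal (3/2 * (3/4) ^ n) * emeasure L (bx P)" .
  qed auto
  also have "\<dots> = 6 * emeasure L (bx P)"
  proof -
    have "(\<lambda>n. 3/2 * (3/4) ^ n :: real) sums (3/2 * (1 / (1 - 3/4)))"
      by (intro sums_mult geometric_sums) simp
    then have "(\<Sum>n. ennreal (3/2 * (3/4) ^ n)) = ennreal 6"
      by (intro suminf_ennreal_eq) auto
    then show ?thesis by simp
  qed
  also have "emeasure L (bx P) + 6 * emeasure L (bx P) = (1 + 6) * emeasure L (bx P)"
    by (simp only: distrib_right mult_1)
  also have "(1 + 6 :: ennreal) = 7" by simp
  finally show ?thesis by (simp add: add_left_mono)
qed

end

section \<open>Volumes of balls and dyadic cubes\<close>

locale homogeneous_dyadic =
  fixes \<rho> :: "'a \<Rightarrow> 'a \<Rightarrow> real" and M :: "'a measure" and K0 p \<delta> c0 C0 :: real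
    and N :: nat and I :: "int \<Rightarrow> nat \<Rightarrow> 'i set"
    and ctr :: "int \<Rightarrow> nat \<Rightarrow> 'i \<Rightarrow> 'a" and Q :: "int \<Rightarrow> nat \<Rightarrow> 'i \<Rightarrow> 'a set"
  assumes qm: "quasi_metric \<rho> K0" and doubling: "doubling \<rho> M"
    and standing: "standing_assms \<rho> M" and monotone_geodesic: "monotone_geodesic \<rho>"
    and p: "1 < p" and standing_par: "standing_assms (par_dist \<rho> p) (par_measure M)"
    and \<delta>: "0 < \<delta>" "\<delta> < 1"
    and c0: "0 < c0" "c0 \<le> C0"
    and adjacent: "adjacent_dyadic \<rho> K0 \<delta> c0 C0 N I ctr Q"
begin

abbreviation "PM \<equiv> par_measure M"
abbreviation "qb \<equiv> qball \<rho>"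

definition c1 where "c1 = c0 / (3 * K0 ^ 2)"
definition C1 where "C1 = 2 * K0 * C0"
definition rad :: "int \<Rightarrow> real" where "rad k = \<delta> powi k"
definition dur :: "int \<Rightarrow> real" where "dur k = \<delta> powr (k * p)"

lemma K0: "1 \<le> K0" and dist_nonneg: "0 \<le> \<rho> x y" and dist_eq_0: "\<rho> x y = 0 \<longleftrightarrow> x = y"
  and dist_sym: "\<rho> x y = \<rho> y x" and dist_tri: "\<rho> x y \<le> K0 * (\<rho> x w + \<rho> w y)"
  using qm unfolding quasi_metric_def by blast+

lemma c1: "0 < c1" and C1: "0 < C1"
  using c0 K0 by (auto simp: c1_def C1_def)

lemma C0: "0 < C0" using c0 by simp

lemma rad_pos: "0 < rad k" and dur_pos: "0 < dur k"
  using \<delta> by (auto simp: rad_def dur_def zero_less_power_int)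

lemma dur_rad: "dur k = rad k powr p"
  using \<delta> unfolding dur_def rad_def by (simp add: powr_powr[symmetric] powr_real_of_int')

lemma rad_mono: "k \<le> l \<Longrightarrow> rad l \<le> rad k"
  using \<delta> unfolding rad_def by (intro power_int_decreasing) auto

lemma dur_mono: "k \<le> l \<Longrightarrow> dur l \<le> dur k"
  unfolding dur_rad using rad_mono[of k l] rad_pos[of l] p by (intro powr_mono2) auto

lemma rad_add: "rad (k + l) = rad k * rad l"
  using \<delta> unfolding rad_def by (simp add: power_int_add)

lemma rad_nat: "rad (int n) = \<delta> ^ n"
  by (simp add: rad_def)

lemma ball_mono: "r \<le> s \<Longrightarrow> qb x r \<subseteq> qb x s"
  by (auto simp: qball_def)

lemma ball_trans: "\<rho> x y \<le> s \<Longrightarrow> qb x r \<subseteq> qb y (K0 * (s + r))"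
proof
  fix w assume "\<rho> x y \<le> s" "w \<in> qb x r"
  then have "\<rho> y x + \<rho> x w < s + r" by (auto simp: qball_def dist_sym[of y x])
  then have "K0 * (\<rho> y x + \<rho> x w) < K0 * (s + r)" using K0 by (intro mult_strict_left_mono) auto
  then show "w \<in> qb y (K0 * (s + r))" using dist_tri[of y w x] by (simp add: qball_def)
qed

lemma space_M: "space M = UNIV"
  using standing by (simp add: standing_assms_def borel_regular_def)

lemma open_ball: "0 < r \<Longrightarrow> openin (qtopology \<rho>) (qb x r)"
  using standing by (simp add: standing_assms_def)

lemma sets_open: "openin (qtopology \<rho>) U \<Longrightarrow> U \<in> sets M"
  using standing by (simp add: standing_assms_def borel_regular_def)

lemma sets_borel: "A \<in> borel_of_qm \<rho> \<Longrightarrow> A \<in> sets M"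
proof -
  have "sigma_sets (space M) {U. openin (qtopology \<rho>) U} \<subseteq> sets M"
    using sets_open by (intro sets.sigma_sets_subset) auto
  then show "A \<in> borel_of_qm \<rho> \<Longrightarrow> A \<in> sets M" by (auto simp: borel_of_qm_def space_M)
qed

lemma sets_ball: "0 < r \<Longrightarrow> qb x r \<in> sets M"
  by (intro sets_open open_ball)

definition vol :: "'a \<Rightarrow> real \<Rightarrow> real" where "vol x r = measure M (qb x r)"

lemma emeasure_ball: "0 < r \<Longrightarrow> emeasure M (qb x r) = ennreal (vol x r)"
  and vol_pos: "0 < r \<Longrightarrow> 0 < vol x r"
proof -
  assume r: "0 < r"
  have *: "0 < emeasure M (qb x r)" "emeasure M (qb x r) < \<infinity>"
    using standing r unfolding standing_assms_def by blast+
  then show 1: "emeasure M (qb x r) = ennreal (vol x r)"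
    unfolding vol_def by (intro emeasure_eq_ennreal_measure) auto
  show "0 < vol x r" using *(1) unfolding 1 by (simp add: ennreal_less_zero_iff)
qed

lemma vol_mono: "0 < r \<Longrightarrow> qb x r \<subseteq> qb y s \<Longrightarrow> 0 < s \<Longrightarrow> vol x r \<le> vol y s"
  using emeasure_mono[of "qb x r" "qb y s" M] sets_ball[of s y] vol_pos[of s y]
  by (auto simp: emeasure_ball ennreal_le_iff2)

lemma vol_scale: "\<exists>D\<ge>1. \<forall>x. \<forall>r>0. vol x (c * r) \<le> D * vol x r"
proof -
  obtain C :: real where C: "\<And>x r. 0 < r \<Longrightarrow> emeasure M (qb x (2 * r)) \<le> ennreal C * emeasure M (qb x r)"
    using doubling unfolding doubling_def by blast
  define D where "D = max C 1"
  have D: "D \<ge> 1" by (simp add: D_def)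
  have step: "vol x (2 * r) \<le> D * vol x r" if r: "0 < r" for x r
  proof -
    have "ennreal C * emeasure M (qb x r) \<le> ennreal D * emeasure M (qb x r)"
      by (intro mult_right_mono ennreal_leI) (auto simp: D_def)
    then have "ennreal (vol x (2 * r)) \<le> ennreal (D * vol x r)"
      using order_trans[OF C[OF r, of x]] r D vol_pos[OF r, of x] by (simp add: emeasure_ball ennreal_mult)
    then show ?thesis using D vol_pos[OF r, of x] by (simp add: ennreal_le_iff)
  qed
  have iter: "vol x (2 ^ n * r) \<le> D ^ n * vol x r" if r: "0 < r" for x r and n :: nat
  proof (induction n)
    case (Suc n)
    have "vol x (2 ^ Suc n * r) \<le> D * vol x (2 ^ n * r)"
      using step[of "2 ^ n * r" x] r by (simp add: mult.assoc)
    also have "\<dots> \<le> D * (D ^ n * vol x r)" using Suc D by (intro mult_left_mono) auto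
    finally show ?case by (simp add: mult.assoc)
  qed simp
  obtain n :: nat where n: "c < 2 ^ n" using real_arch_pow[of 2 c] by auto
  have "vol x (c * r) \<le> D ^ n * vol x r" if r: "0 < r" for x r
  proof (cases "0 < c")
    case True
    have "vol x (c * r) \<le> vol x (2 ^ n * r)"
      using n r True by (intro vol_mono ball_mono) auto
    also note iter[OF r]
    finally show ?thesis .
  next
    case False
    then have "qb x (c * r) = {}"
      using r dist_nonneg mult_nonpos_nonneg[of c r] by (auto simp: qball_def not_less) (meson not_less order_trans less_le_trans)
    then have "vol x (c * r) = 0" by (simp add: vol_def)
    then show ?thesis using D vol_pos[OF r, of x] by simp
  qed
  then show ?thesis using D one_le_power[OF D] by blast
qed

text \<open>The ball about x lies in one about y whose radius is larger by the factor
  \<open>2 * K0\<close>, so \<open>vol_scale\<close> applies at y.\<close>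

lemma vol_compare: "\<exists>D\<ge>1. \<forall>x y r. 0 < r \<longrightarrow> \<rho> x y \<le> c * r \<longrightarrow> vol x (c * r) \<le> D * vol y r"
proof -
  obtain D where D: "D \<ge> 1" "\<And>x r. 0 < r \<Longrightarrow> vol x (K0 * (c + c) * r) \<le> D * vol x r"
    using vol_scale[of "K0 * (c + c)"] by auto
  have "vol x (c * r) \<le> D * vol y r" if r: "0 < r" "\<rho> x y \<le> c * r" for x y r
  proof (cases "0 < c")
    case True
    have "vol x (c * r) \<le> vol y (K0 * (c * r + c * r))"
      using ball_trans[OF r(2), of "c * r"] r True K0 by (intro vol_mono) (auto intro!: mult_pos_pos)
    also have "K0 * (c * r + c * r) = K0 * (c + c) * r" by (simp add: algebra_simps)
    also note D(2)[OF r(1)]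
    finally show ?thesis .
  next
    case False
    then have "c * r \<le> 0" using r by (simp add: mult_nonpos_nonneg)
    then have "qb x (c * r) = {}"
      using dist_nonneg by (auto simp: qball_def not_less intro: order_trans)
    then have "vol x (c * r) = 0" by (simp add: vol_def)
    then show ?thesis using D vol_pos[OF r(1), of y] by simp
  qed
  then show ?thesis using D by blast
qed

lemma dyadic:
  assumes "\<tau> \<in> {1..N}"
  shows center_near: "\<exists>\<alpha>\<in>I k \<tau>. \<rho> x (ctr k \<tau> \<alpha>) < C0 * rad k"
    and cubes_cover: "(\<Union>\<alpha>\<in>I k \<tau>. Q k \<tau> \<alpha>) = UNIV"
    and cubes_disjoint: "disjoint_family_on (Q k \<tau>) (I k \<tau>)"
    and cube_borel: "\<alpha> \<in> I k \<tau> \<Longrightarrow> Q k \<tau> \<alpha> \<in> borel_of_qm \<rho>"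
    and cube_inner: "\<alpha> \<in> I k \<tau> \<Longrightarrow> qb (ctr k \<tau> \<alpha>) (c1 * rad k) \<subseteq> Q k \<tau> \<alpha>"
    and cube_outer: "\<alpha> \<in> I k \<tau> \<Longrightarrow> Q k \<tau> \<alpha> \<subseteq> qb (ctr k \<tau> \<alpha>) (C1 * rad k)"
    and cubes_nested: "k \<le> l \<Longrightarrow> \<alpha> \<in> I k \<tau> \<Longrightarrow> \<beta> \<in> I l \<tau> \<Longrightarrow> Q l \<tau> \<beta> \<subseteq> Q k \<tau> \<alpha> \<or> Q l \<tau> \<beta> \<inter> Q k \<tau> \<alpha> = {}"
    and balls_nested: "k \<le> l \<Longrightarrow> \<alpha> \<in> I k \<tau> \<Longrightarrow> \<beta> \<in> I l \<tau> \<Longrightarrow> Q l \<tau> \<beta> \<subseteq> Q k \<tau> \<alpha> \<Longrightarrow>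
       qb (ctr l \<tau> \<beta>) (C1 * rad l) \<subseteq> qb (ctr k \<tau> \<alpha>) (C1 * rad k)"
proof -
  note all = adjacent[unfolded adjacent_dyadic_def Let_def c1_def[symmetric] C1_def[symmetric] rad_def[symmetric],
      THEN conjunct1, rule_format, OF assms]
  note d = all[THEN conjunct2]
  show "\<exists>\<alpha>\<in>I k \<tau>. \<rho> x (ctr k \<tau> \<alpha>) < C0 * rad k" using d[THEN conjunct1] by blast
  note d = d[THEN conjunct2]
  show "(\<Union>\<alpha>\<in>I k \<tau>. Q k \<tau> \<alpha>) = UNIV" by (rule d[THEN conjunct1])
  note d = d[THEN conjunct2]
  show "disjoint_family_on (Q k \<tau>) (I k \<tau>)" by (rule d[THEN conjunct1])
  note d = d[THEN conjunct2]
  show "Q k \<tau> \<alpha> \<in> borel_of_qm \<rho>" "qb (ctr k \<tau> \<alpha>) (c1 * rad k) \<subseteq> Q k \<tau> \<alpha>"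
    "Q k \<tau> \<alpha> \<subseteq> qb (ctr k \<tau> \<alpha>) (C1 * rad k)" if "\<alpha> \<in> I k \<tau>"
    using d[THEN conjunct1, THEN bspec, OF that] by auto
  note d = d[THEN conjunct2]
  show "Q l \<tau> \<beta> \<subseteq> Q k \<tau> \<alpha> \<or> Q l \<tau> \<beta> \<inter> Q k \<tau> \<alpha> = {}"
    if "k \<le> l" "\<alpha> \<in> I k \<tau>" "\<beta> \<in> I l \<tau>"
    using d[rule_format, OF that] by (rule conjunct1)
  show "qb (ctr l \<tau> \<beta>) (C1 * rad l) \<subseteq> qb (ctr k \<tau> \<alpha>) (C1 * rad k)"
    if "k \<le> l" "\<alpha> \<in> I k \<tau>" "\<beta> \<in> I l \<tau>" "Q l \<tau> \<beta> \<subseteq> Q k \<tau> \<alpha>"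
    using d[rule_format, OF that(1-3)] that(4) by (rule conjunct2[THEN mp])
qed

lemma adjacent_cube: "\<exists>Cs>0. \<forall>x. \<forall>r>0. \<exists>\<tau>\<in>{1..N}. \<exists>k. \<exists>\<alpha>\<in>I k \<tau>.
   qb x r \<subseteq> Q k \<tau> \<alpha> \<and> qdiam \<rho> (Q k \<tau> \<alpha>) \<le> ennreal (Cs * r)"
  by (rule adjacent[unfolded adjacent_dyadic_def Let_def, THEN conjunct2])

lemma cube_sets: "\<tau> \<in> {1..N} \<Longrightarrow> \<alpha> \<in> I k \<tau> \<Longrightarrow> Q k \<tau> \<alpha> \<in> sets M"
  using cube_borel sets_borel by blast

lemma center_in_cube: "\<tau> \<in> {1..N} \<Longrightarrow> \<alpha> \<in> I k \<tau> \<Longrightarrow> ctr k \<tau> \<alpha> \<in> Q k \<tau> \<alpha>"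
  using cube_inner[of \<tau> \<alpha> k] c1 rad_pos[of k] dist_eq_0[of "ctr k \<tau> \<alpha>" "ctr k \<tau> \<alpha>"] by (auto simp: qball_def)

lemma cube_in_ball: "\<tau> \<in> {1..N} \<Longrightarrow> \<alpha> \<in> I k \<tau> \<Longrightarrow> x \<in> Q k \<tau> \<alpha> \<Longrightarrow> y \<in> Q k \<tau> \<alpha> \<Longrightarrow> \<rho> x y < 2 * K0 * C1 * rad k"
proof -
  assume a: "\<tau> \<in> {1..N}" "\<alpha> \<in> I k \<tau>" "x \<in> Q k \<tau> \<alpha>" "y \<in> Q k \<tau> \<alpha>"
  let ?z = "ctr k \<tau> \<alpha>"
  have "\<rho> x ?z + \<rho> ?z y < C1 * rad k + C1 * rad k"
    using cube_outer[OF a(1,2)] a(3,4) by (intro add_strict_mono) (auto simp: qball_def dist_sym[of x])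
  then have "K0 * (\<rho> x ?z + \<rho> ?z y) < K0 * (C1 * rad k + C1 * rad k)"
    using K0 by (intro mult_strict_left_mono) auto
  then show ?thesis using dist_tri[of x y ?z] by (simp add: algebra_simps)
qed

definition cvol :: "int \<Rightarrow> nat \<Rightarrow> 'i \<Rightarrow> real" where "cvol k \<tau> \<alpha> = measure M (Q k \<tau> \<alpha>)"

lemma cvol:
  assumes "\<tau> \<in> {1..N}" "\<alpha> \<in> I k \<tau>"
  shows emeasure_cube: "emeasure M (Q k \<tau> \<alpha>) = ennreal (cvol k \<tau> \<alpha>)"
    and cvol_pos: "0 < cvol k \<tau> \<alpha>"
    and cvol_ge: "vol (ctr k \<tau> \<alpha>) (c1 * rad k) \<le> cvol k \<tau> \<alpha>"
    and cvol_le: "cvol k \<tau> \<alpha> \<le> vol (ctr k \<tau> \<alpha>) (C1 * rad k)"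
proof -
  have r: "0 < c1 * rad k" "0 < C1 * rad k" using c1 C1 rad_pos by auto
  have 1: "ennreal (vol (ctr k \<tau> \<alpha>) (c1 * rad k)) \<le> emeasure M (Q k \<tau> \<alpha>)"
    using emeasure_mono[OF cube_inner[OF assms] cube_sets[OF assms]] by (simp add: emeasure_ball[OF r(1)])
  have 2: "emeasure M (Q k \<tau> \<alpha>) \<le> ennreal (vol (ctr k \<tau> \<alpha>) (C1 * rad k))"
    using emeasure_mono[OF cube_outer[OF assms] sets_ball[OF r(2)]] by (simp add: emeasure_ball[OF r(2)])
  then have "emeasure M (Q k \<tau> \<alpha>) \<noteq> \<infinity>" by (auto simp: top_unique)
  then show 3: "emeasure M (Q k \<tau> \<alpha>) = ennreal (cvol k \<tau> \<alpha>)"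
    unfolding cvol_def by (simp add: emeasure_eq_ennreal_measure)
  show "vol (ctr k \<tau> \<alpha>) (c1 * rad k) \<le> cvol k \<tau> \<alpha>"
    using 1 3 vol_pos[OF r(1), of "ctr k \<tau> \<alpha>"] by (auto simp add: ennreal_le_iff2 cvol_def)
  then show "0 < cvol k \<tau> \<alpha>" using vol_pos[OF r(1)] by (meson less_le_trans)
  show "cvol k \<tau> \<alpha> \<le> vol (ctr k \<tau> \<alpha>) (C1 * rad k)"
    using 2 3 vol_pos[OF r(2)] by (simp add: ennreal_le_iff less_imp_le)
qed

text \<open>The cubes are disjoint and a ball has finite volume, so only finitely many meet a given
  ball in measure above 1/(n + 1); each does so for some n, because its measure is positive and the
  balls exhaust the space.\<close>

lemma countable_cubes:
  assumes \<tau>: "\<tau> \<in> {1..N}"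
  shows "countable (I k \<tau>)"
proof -
  obtain x0 :: 'a where True by blast
  define S where "S n = {\<alpha> \<in> I k \<tau>. 1 / real (Suc n) < measure M (qb x0 (real (Suc n)) \<inter> Q k \<tau> \<alpha>)}" for n
  have fin: "finite (S n)" for n
  proof (rule ccontr)
    assume inf: "infinite (S n)"
    let ?V = "vol x0 (real (Suc n))"
    obtain m :: nat where m: "?V * real (Suc n) < real m" using reals_Archimedean2 by blast
    obtain T where T: "T \<subseteq> S n" "finite T" "card T = m"
      using infinite_arbitrarily_large[OF inf] by metis
    let ?X = "\<lambda>\<alpha>. qb x0 (real (Suc n)) \<inter> Q k \<tau> \<alpha>"
    have TI: "T \<subseteq> I k \<tau>" using T by (auto simp: S_def)
    have Xs: "?X \<alpha> \<in> sets M" if "\<alpha> \<in> T" for \<alpha>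
      using that TI sets_ball cube_sets[OF \<tau>] by (intro sets.Int) auto
    have le: "emeasure M (\<Union>\<alpha>\<in>T. ?X \<alpha>) \<le> ennreal ?V"
      using emeasure_mono[of "\<Union>\<alpha>\<in>T. ?X \<alpha>" "qb x0 (real (Suc n))" M] sets_ball[of "real (Suc n)" x0]
      by (simp add: emeasure_ball)
    have "disjoint_family_on ?X T"
      using cubes_disjoint[OF \<tau>, of k] TI unfolding disjoint_family_on_def by blast
    then have "(\<Sum>\<alpha>\<in>T. emeasure M (?X \<alpha>)) = emeasure M (\<Union>\<alpha>\<in>T. ?X \<alpha>)"
      using T Xs by (intro sum_emeasure) auto
    moreover have "(\<Sum>\<alpha>\<in>T. ennreal (1 / real (Suc n))) \<le> (\<Sum>\<alpha>\<in>T. emeasure M (?X \<alpha>))"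
    proof (intro sum_mono)
      fix \<alpha> assume a: "\<alpha> \<in> T"
      have "emeasure M (?X \<alpha>) \<le> ennreal ?V"
        using emeasure_mono[of "?X \<alpha>" "qb x0 (real (Suc n))" M] sets_ball[of "real (Suc n)" x0]
        by (simp add: emeasure_ball)
      then have "emeasure M (?X \<alpha>) = ennreal (measure M (?X \<alpha>))"
        by (intro emeasure_eq_ennreal_measure) (auto simp: top_unique)
      moreover have "1 / real (Suc n) < measure M (?X \<alpha>)" using a T(1) by (auto simp: S_def)
      ultimately show "ennreal (1 / real (Suc n)) \<le> emeasure M (?X \<alpha>)" by (simp add: ennreal_leI)
    qed
    ultimately have "ennreal (real m * (1 / real (Suc n))) \<le> ennreal ?V"
    proof -
      have "ennreal (real m * (1 / real (Suc n))) = (\<Sum>\<alpha>\<in>T. ennreal (1 / real (Suc n)))"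
        using T(3) by (subst ennreal_mult) (simp_all add: ennreal_of_nat_eq_real_of_nat)
      then show ?thesis
        using le \<open>(\<Sum>\<alpha>\<in>T. emeasure M (?X \<alpha>)) = _\<close> \<open>(\<Sum>\<alpha>\<in>T. ennreal (1 / real (Suc n))) \<le> _\<close> by simp
    qed
    then have "real m * (1 / real (Suc n)) \<le> ?V" using vol_pos[of "real (Suc n)" x0] by (simp add: ennreal_le_iff)
    then have "real m \<le> ?V * real (Suc n)" by (simp add: field_simps)
    then show False using m by simp
  qed
  have "I k \<tau> \<subseteq> (\<Union>n. S n)"
  proof
    fix \<alpha> assume \<alpha>: "\<alpha> \<in> I k \<tau>"
    let ?A = "\<lambda>n. qb x0 (real (Suc n)) \<inter> Q k \<tau> \<alpha>"
    have U: "(\<Union>n. ?A n) = Q k \<tau> \<alpha>"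
    proof -
      have "\<exists>n::nat. \<rho> x0 y < real (Suc n)" for y using reals_Archimedean2[of "\<rho> x0 y"] by (metis less_Suc_eq less_trans of_nat_less_iff lessI)
      then show ?thesis by (auto simp: qball_def)
    qed
    have "(\<lambda>n. emeasure M (?A n)) \<longlonglongrightarrow> emeasure M (\<Union>n. ?A n)"
    proof (rule Lim_emeasure_incseq)
      show "range ?A \<subseteq> sets M" using sets_ball cube_sets[OF \<tau> \<alpha>] by auto
      show "incseq ?A" by (rule monoI) (auto simp: qball_def)
    qed
    then have "(\<lambda>n. emeasure M (?A n)) \<longlonglongrightarrow> ennreal (cvol k \<tau> \<alpha>)" by (simp only: U emeasure_cube[OF \<tau> \<alpha>])
    then have "(\<lambda>n. measure M (?A n)) \<longlonglongrightarrow> cvol k \<tau> \<alpha>"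
      unfolding measure_def using cvol_pos[OF \<tau> \<alpha>] by (intro tendsto_enn2real) auto
    then have "\<forall>\<^sub>F n in sequentially. cvol k \<tau> \<alpha> / 2 < measure M (?A n)"
      using cvol_pos[OF \<tau> \<alpha>] by (intro order_tendstoD) auto
    moreover have "\<forall>\<^sub>F n in sequentially. 1 / real (Suc n) < cvol k \<tau> \<alpha> / 2"
      using cvol_pos[OF \<tau> \<alpha>] LIMSEQ_inverse_real_of_nat by (intro order_tendstoD(2)[where y=0]) (auto simp: inverse_eq_divide)
    ultimately have "\<forall>\<^sub>F n in sequentially. 1 / real (Suc n) < measure M (?A n)"
      by eventually_elim simp
    then obtain n where "1 / real (Suc n) < measure M (?A n)" by (auto simp: eventually_sequentially)
    then show "\<alpha> \<in> (\<Union>n. S n)" using \<alpha> by (auto simp: S_def)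
  qed
  then show ?thesis using fin by (meson countable_UN countable_finite countable_subset countableI_type)
qed

lemma space_par: "space PM = UNIV"
  using standing_par by (simp add: standing_assms_def borel_regular_def)

lemma sets_borel_par: "A \<in> borel_of_qm (par_dist \<rho> p) \<Longrightarrow> A \<in> sets PM"
proof -
  have "sigma_sets (space PM) {U. openin (qtopology (par_dist \<rho> p)) U} \<subseteq> sets PM"
    using standing_par by (intro sets.sigma_sets_subset) (auto simp: standing_assms_def borel_regular_def)
  then show "A \<in> borel_of_qm (par_dist \<rho> p) \<Longrightarrow> A \<in> sets PM" by (auto simp: borel_of_qm_def space_par)
qed

lemma Times_sets: "A \<in> sets M \<Longrightarrow> T \<in> sets borel \<Longrightarrow> A \<times> T \<in> sets PM"
  unfolding par_measure_def by (intro sets_completionI_sets pair_measureI) auto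

lemma emeasure_Times: "A \<in> sets M \<Longrightarrow> T \<in> sets borel \<Longrightarrow> emeasure PM (A \<times> T) = emeasure M A * emeasure lborel T"
  unfolding par_measure_def by (subst emeasure_completion) (auto simp: lborel.emeasure_pair_measure_Times)

lemma par_ballI:
  assumes "\<rho> x y < r" "\<bar>t - s\<bar> < r powr p"
  shows "(y, s) \<in> qball (par_dist \<rho> p) (x, t) r"
proof -
  have r: "0 < r" using assms(1) dist_nonneg[of x y] by simp
  have "\<bar>t - s\<bar> powr (1/p) < (r powr p) powr (1/p)"
    using assms(2) p by (intro powr_less_mono2) auto
  also have "\<dots> = r" using r p by (simp add: powr_powr)
  finally show ?thesis using assms(1) by (simp add: qball_def par_dist_def)
qed

end

section \<open>Parabolic boxes form a shifted grid\<close>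

lemma int_div_bounds:
  fixes a g :: int
  assumes "0 < g"
  shows "a div g * g \<le> a" "a + 1 \<le> (a div g + 1) * g"
proof -
  have "a div g * g + a mod g = a" "0 \<le> a mod g" "a mod g < g" using assms by auto
  moreover have "(a div g + 1) * g = a div g * g + g" by (simp add: distrib_right)
  ultimately show "a div g * g \<le> a" "a + 1 \<le> (a div g + 1) * g" by linarith+
qed

context homogeneous_dyadic
begin

text \<open>Rounding \<open>\<sigma> dur k\<close> down to a power of two makes the time grids of all generations nested.\<close>

definition tl :: "real \<Rightarrow> int \<Rightarrow> real" where
  "tl \<sigma> k = 2 powi \<lfloor>log 2 (\<sigma> * dur k)\<rfloor>"

definition boxes :: "nat \<Rightarrow> (int \<times> 'i \<times> int) set" where
  "boxes \<tau> = {(k, \<alpha>, j). \<alpha> \<in> I k \<tau>}"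

fun shf :: "int \<Rightarrow> int \<times> 'i \<times> int \<Rightarrow> int \<times> 'i \<times> int" where
  "shf i (k, \<alpha>, j) = (k, \<alpha>, j + i)"

fun box :: "real \<Rightarrow> nat \<Rightarrow> int \<times> 'i \<times> int \<Rightarrow> ('a \<times> real) set" where
  "box \<sigma> \<tau> (k, \<alpha>, j) = Q k \<tau> \<alpha> \<times> {j * tl \<sigma> k ..< (real_of_int j + 1) * tl \<sigma> k}"

lemma tl_pos: "0 < tl \<sigma> k"
  by (simp add: tl_def zero_less_power_int)

lemma tl_bounds:
  assumes "0 < \<sigma>"
  shows "tl \<sigma> k \<le> \<sigma> * dur k" "\<sigma> * dur k < 2 * tl \<sigma> k"
proof -
  have s: "0 < \<sigma> * dur k" using assms dur_pos by simp
  have "tl \<sigma> k = 2 powr of_int \<lfloor>log 2 (\<sigma> * dur k)\<rfloor>" by (simp add: tl_def powr_real_of_int')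
  moreover have "2 powr of_int \<lfloor>log 2 (\<sigma> * dur k)\<rfloor> \<le> 2 powr (log 2 (\<sigma> * dur k))" by simp
  moreover have "2 powr (log 2 (\<sigma> * dur k)) < 2 powr (of_int \<lfloor>log 2 (\<sigma> * dur k)\<rfloor> + 1)"
    by (intro powr_less_mono) linarith+
  ultimately show "tl \<sigma> k \<le> \<sigma> * dur k" "\<sigma> * dur k < 2 * tl \<sigma> k"
    using s by (auto simp: powr_add)
qed

lemma tl_refine:
  assumes "0 < \<sigma>" "k \<le> l"
  shows "\<exists>n::nat. tl \<sigma> k = 2 ^ n * tl \<sigma> l"
proof -
  let ?e = "\<lambda>k. \<lfloor>log 2 (\<sigma> * dur k)\<rfloor>"
  have "log 2 (\<sigma> * dur l) \<le> log 2 (\<sigma> * dur k)"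
    using assms dur_mono[of k l] dur_pos by simp
  then have le: "?e l \<le> ?e k" by (rule floor_mono)
  have "tl \<sigma> k = 2 powi (int (nat (?e k - ?e l)) + ?e l)" using le by (simp add: tl_def)
  also have "\<dots> = 2 powi (int (nat (?e k - ?e l))) * tl \<sigma> l" by (simp add: tl_def power_int_add)
  also have "\<dots> = 2 ^ (nat (?e k - ?e l)) * tl \<sigma> l" by (simp only: power_int_of_nat)
  finally show ?thesis by blast
qed

text \<open>In units of \<open>tl \<sigma> l\<close> both intervals have integer end points. A
  common point gives strict inequalities between integers, which sharpen to the inclusion.\<close>

lemma time_nested:
  fixes j j' :: int
  assumes \<sigma>: "0 < \<sigma>" "k \<le> l" and s: "s \<in> {j * tl \<sigma> k ..< (real_of_int j + 1) * tl \<sigma> k}" "s \<in> {j' * tl \<sigma> l ..< (real_of_int j' + 1) * tl \<sigma> l}"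
  shows "\<exists>n::nat. tl \<sigma> k = 2 ^ n * tl \<sigma> l \<and> j * 2 ^ n \<le> j' \<and> j' + 1 \<le> (j + 1) * 2 ^ n"
proof -
  obtain n :: nat where n: "tl \<sigma> k = 2 ^ n * tl \<sigma> l" using tl_refine[OF \<sigma>] by blast
  have t: "0 < tl \<sigma> l" by (rule tl_pos)
  have "(real_of_int j * 2 ^ n) * tl \<sigma> l < (real_of_int j' + 1) * tl \<sigma> l"
    using s n by (auto simp: mult.assoc)
  then have "real_of_int (j * 2 ^ n) < real_of_int (j' + 1)" using t by simp
  then have 1: "j * 2 ^ n < j' + 1" by (simp only: of_int_less_iff)
  have "real_of_int j' * tl \<sigma> l < ((real_of_int j + 1) * 2 ^ n) * tl \<sigma> l"
    using s n by (auto simp: mult.assoc)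
  then have "real_of_int j' < real_of_int ((j + 1) * 2 ^ n)" using t by simp
  then have 2: "j' < (j + 1) * 2 ^ n" by (simp only: of_int_less_iff)
  show ?thesis using n 1 2 by (intro exI[of _ n]) auto
qed

lemma time_sub:
  fixes j j' :: int
  assumes "tl \<sigma> k = 2 ^ n * tl \<sigma> l" "j * 2 ^ n \<le> j'" "j' + 1 \<le> (j + 1) * 2 ^ n"
  shows "{j' * tl \<sigma> l ..< (real_of_int j' + 1) * tl \<sigma> l} \<subseteq> {j * tl \<sigma> k ..< (real_of_int j + 1) * tl \<sigma> k}"
proof -
  have "real_of_int (j * 2 ^ n) * tl \<sigma> l \<le> real_of_int j' * tl \<sigma> l"
    using assms(2) tl_pos[of \<sigma> l] by (intro mult_right_mono) (simp_all only: of_int_le_iff less_imp_le)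
  moreover have "real_of_int (j' + 1) * tl \<sigma> l \<le> real_of_int ((j + 1) * 2 ^ n) * tl \<sigma> l"
    using assms(3) tl_pos[of \<sigma> l] by (intro mult_right_mono) (simp_all only: of_int_le_iff less_imp_le)
  ultimately show ?thesis using assms(1) by (auto simp: mult.assoc)
qed

lemma emeasure_box:
  assumes "\<tau> \<in> {1..N}" "\<alpha> \<in> I k \<tau>"
  shows "emeasure PM (box \<sigma> \<tau> (k, \<alpha>, j)) = ennreal (cvol k \<tau> \<alpha> * tl \<sigma> k)"
proof -
  have "emeasure lborel {j * tl \<sigma> k ..< (real_of_int j + 1) * tl \<sigma> k} = ennreal (tl \<sigma> k)"
    using tl_pos[of \<sigma> k] by (subst emeasure_lborel_Ico) (auto simp: algebra_simps)
  then show ?thesis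
    using assms cvol_pos[OF assms] tl_pos[of \<sigma> k]
    by (simp add: emeasure_Times cube_sets emeasure_cube ennreal_mult)
qed

lemma sets_box: "\<tau> \<in> {1..N} \<Longrightarrow> P \<in> boxes \<tau> \<Longrightarrow> box \<sigma> \<tau> P \<in> sets PM"
  by (cases P) (auto simp: boxes_def intro!: Times_sets cube_sets)

lemma countable_boxes: "\<tau> \<in> {1..N} \<Longrightarrow> countable (boxes \<tau>)"
proof -
  assume "\<tau> \<in> {1..N}"
  then have "countable (SIGMA k:UNIV. I k \<tau> \<times> (UNIV::int set))"
    by (intro countable_SIGMA countable_cubes) auto
  moreover have "boxes \<tau> = (SIGMA k:UNIV. I k \<tau> \<times> (UNIV::int set))" by (auto simp: boxes_def)
  ultimately show ?thesis by simp
qed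

lemma cover_box:
  assumes "\<tau> \<in> {1..N}"
  shows "\<exists>\<alpha>\<in>I k \<tau>. \<exists>j. w \<in> box \<sigma> \<tau> (k, \<alpha>, j)"
proof -
  obtain x t where w: "w = (x, t)" by (cases w)
  obtain \<alpha> where \<alpha>: "\<alpha> \<in> I k \<tau>" "x \<in> Q k \<tau> \<alpha>" using cubes_cover[OF assms, of k] by blast
  have "w \<in> box \<sigma> \<tau> (k, \<alpha>, \<lfloor>t / tl \<sigma> k\<rfloor>)"
    using \<alpha> floor_divide_lower[OF tl_pos[of \<sigma> k], of t] floor_divide_upper[OF tl_pos[of \<sigma> k], of t] by (simp add: w)
  then show ?thesis using \<alpha> by blast
qed

lemma cube_meet_sub:
  assumes "\<tau> \<in> {1..N}" "\<alpha> \<in> I k \<tau>" "\<beta> \<in> I l \<tau>" "k \<le> l" "x \<in> Q k \<tau> \<alpha>" "x \<in> Q l \<tau> \<beta>"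
  shows "Q l \<tau> \<beta> \<subseteq> Q k \<tau> \<alpha>"
  using cubes_nested[OF assms(1,4,2,3)] assms by blast

lemma box_sub_cube_sub:
  assumes "box \<sigma> \<tau> (l, \<beta>, j') \<subseteq> box \<sigma> \<tau> (k, \<alpha>, j)" "\<tau> \<in> {1..N}" "\<beta> \<in> I l \<tau>"
  shows "Q l \<tau> \<beta> \<subseteq> Q k \<tau> \<alpha>" "{j' * tl \<sigma> l ..< (real_of_int j' + 1) * tl \<sigma> l} \<subseteq> {j * tl \<sigma> k ..< (real_of_int j + 1) * tl \<sigma> k}"
proof -
  have "j' * tl \<sigma> l \<in> {j' * tl \<sigma> l ..< (real_of_int j' + 1) * tl \<sigma> l}" using tl_pos[of \<sigma> l] by (simp add: algebra_simps)
  moreover have "ctr l \<tau> \<beta> \<in> Q l \<tau> \<beta>" using assms by (intro center_in_cube)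
  ultimately show "Q l \<tau> \<beta> \<subseteq> Q k \<tau> \<alpha>" "{j' * tl \<sigma> l ..< (real_of_int j' + 1) * tl \<sigma> l} \<subseteq> {j * tl \<sigma> k ..< (real_of_int j + 1) * tl \<sigma> k}"
    using assms(1) unfolding box.simps by blast+
qed

text \<open>Diameters of cubes, and time lengths to the power 1/p, both decay like the powers of
  \<delta>. So each point of \<open>U\<close> lies in a box of the progression contained in
  \<open>U\<close>, and there are countably many boxes.\<close>

lemma open_par_boxes:
  assumes \<tau>: "\<tau> \<in> {1..N}" and \<sigma>: "0 < \<sigma>" and m: "0 < m"
    and U: "openin (qtopology (par_dist \<rho> p)) U"
  shows "U \<in> sigma_sets UNIV (box \<sigma> \<tau> ` {P \<in> boxes \<tau>. \<exists>n::nat. fst P = k + int m * int n})"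
proof -
  let ?S = "{P \<in> boxes \<tau>. \<exists>n::nat. fst P = k + int m * int n}"
  have "U \<subseteq> (\<Union>P\<in>{P\<in>?S. box \<sigma> \<tau> P \<subseteq> U}. box \<sigma> \<tau> P)"
  proof
    fix w assume w: "w \<in> U"
    obtain x t where xt: "w = (x, t)" by (cases w)
    obtain r where r: "0 < r" "qball (par_dist \<rho> p) (x, t) r \<subseteq> U"
      using U w xt unfolding openin_qtopology by blast
    have lim: "(\<lambda>n. c * \<delta> ^ n) \<longlonglongrightarrow> 0" for c :: real
      using \<delta> by (auto intro!: tendsto_eq_intros LIMSEQ_power_zero)
    have rr: "0 < r powr p" using r by simp
    have ev: "\<forall>\<^sub>F n in sequentially. 2 * K0 * C1 * rad k * \<delta> ^ n < r \<and> \<sigma> powr (1/p) * rad k * \<delta> ^ n < r"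
      using r by (intro eventually_conj order_tendstoD(2)[OF lim]) auto
    then obtain n0 where n0: "\<And>n. n \<ge> n0 \<Longrightarrow> 2 * K0 * C1 * rad k * \<delta> ^ n < r \<and> \<sigma> powr (1/p) * rad k * \<delta> ^ n < r"
      by (auto simp: eventually_sequentially)
    have n1: "m * n0 \<ge> n0" using m by simp
    let ?l = "k + int m * int n0"
    have radl: "rad ?l = rad k * \<delta> ^ (m * n0)" by (simp add: rad_add rad_nat flip: of_nat_mult)
    obtain \<alpha> j where P: "\<alpha> \<in> I ?l \<tau>" "w \<in> box \<sigma> \<tau> (?l, \<alpha>, j)" using cover_box[OF \<tau>] by blast
    have "box \<sigma> \<tau> (?l, \<alpha>, j) \<subseteq> qball (par_dist \<rho> p) (x, t) r"
    proof
      fix v assume v: "v \<in> box \<sigma> \<tau> (?l, \<alpha>, j)"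
      obtain y s where ys: "v = (y, s)" by (cases v)
      have "\<rho> x y < 2 * K0 * C1 * rad ?l"
        using P v by (intro cube_in_ball[OF \<tau> P(1)]) (auto simp: xt ys)
      also have "\<dots> < r" using n0[OF n1] by (simp add: radl mult.assoc)
      finally have 1: "\<rho> x y < r" .
      have tr: "\<bar>t - s\<bar> < tl \<sigma> ?l" using P v by (auto simp: xt ys algebra_simps)
      have "tl \<sigma> ?l \<le> \<sigma> * dur ?l" using tl_bounds[OF \<sigma>] by simp
      also have "\<dots> = (\<sigma> powr (1/p) * rad ?l) powr p"
        using \<sigma> p rad_pos[of ?l] by (simp add: powr_mult powr_powr dur_rad)
      also have "\<dots> < r powr p"
        using n0[OF n1] p \<sigma> rad_pos[of ?l] by (intro powr_less_mono2) (auto simp: radl mult.assoc)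
      finally have "\<bar>t - s\<bar> < r powr p" using tr by simp
      with 1 show "v \<in> qball (par_dist \<rho> p) (x, t) r" unfolding ys by (rule par_ballI)
    qed
    then have "(?l, \<alpha>, j) \<in> {P\<in>?S. box \<sigma> \<tau> P \<subseteq> U}" using r P(1) by (auto simp: boxes_def)
    then show "w \<in> (\<Union>P\<in>{P\<in>?S. box \<sigma> \<tau> P \<subseteq> U}. box \<sigma> \<tau> P)" using P(2) by blast
  qed
  then have eq: "U = (\<Union>P\<in>{P\<in>?S. box \<sigma> \<tau> P \<subseteq> U}. box \<sigma> \<tau> P)" by blast
  have c: "countable {P\<in>?S. box \<sigma> \<tau> P \<subseteq> U}"
    by (rule countable_subset[OF _ countable_boxes[OF \<tau>]]) auto
  interpret sigma_algebra UNIV "sigma_sets UNIV (box \<sigma> \<tau> ` ?S)"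
    by (rule sigma_algebra_sigma_sets) auto
  have "(\<Union>P\<in>{P\<in>?S. box \<sigma> \<tau> P \<subseteq> U}. box \<sigma> \<tau> P) \<in> sigma_sets UNIV (box \<sigma> \<tau> ` ?S)"
    by (intro countable_UN' c) auto
  then show ?thesis using eq by simp
qed

lemma shift_grid_boxes:
  assumes \<tau>: "\<tau> \<in> {1..N}" and \<sigma>: "0 < \<sigma>"
  shows "shift_grid PM (boxes \<tau>) fst shf (box \<sigma> \<tau>)"
proof
  show "space PM = UNIV" by (rule space_par)
  show "countable (boxes \<tau>)" by (rule countable_boxes[OF \<tau>])
  fix P P' assume P: "P \<in> boxes \<tau>"
  obtain k \<alpha> j where P_eq: "P = (k, \<alpha>, j)" and \<alpha>: "\<alpha> \<in> I k \<tau>" using P by (auto simp: boxes_def)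
  show "shf i P \<in> boxes \<tau>" for i using P by (cases P) (auto simp: boxes_def)
  show "box \<sigma> \<tau> P \<in> sets PM" by (rule sets_box[OF \<tau> P])
  show "0 < emeasure PM (box \<sigma> \<tau> P)" "emeasure PM (box \<sigma> \<tau> P) < \<infinity>"
    using cvol_pos[OF \<tau> \<alpha>] tl_pos[of \<sigma> k] unfolding P_eq emeasure_box[OF \<tau> \<alpha>] by (auto simp: ennreal_less_zero_iff)
  show "emeasure PM (box \<sigma> \<tau> (shf i P)) = emeasure PM (box \<sigma> \<tau> P)" for i
    unfolding P_eq shf.simps emeasure_box[OF \<tau> \<alpha>] ..
  assume P': "P' \<in> boxes \<tau>"
  obtain l \<beta> j' where P'_eq: "P' = (l, \<beta>, j')" and \<beta>: "\<beta> \<in> I l \<tau>" using P' by (auto simp: boxes_def)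
  show "box \<sigma> \<tau> P' \<subseteq> box \<sigma> \<tau> P \<or> box \<sigma> \<tau> P \<inter> box \<sigma> \<tau> P' = {}" if "fst P < fst P'"
  proof (rule ccontr)
    assume neg: "\<not> ?thesis"
    then obtain x t where w: "(x, t) \<in> box \<sigma> \<tau> P" "(x, t) \<in> box \<sigma> \<tau> P'" by auto
    have kl: "k \<le> l" using that P_eq P'_eq by simp
    have "Q l \<tau> \<beta> \<subseteq> Q k \<tau> \<alpha>"
      using cube_meet_sub[OF \<tau> \<alpha> \<beta> kl, of x] w by (auto simp: P_eq P'_eq)
    moreover obtain n where "tl \<sigma> k = 2 ^ n * tl \<sigma> l" "j * 2 ^ n \<le> j'" "j' + 1 \<le> (j + 1) * 2 ^ n"
      using time_nested[OF \<sigma> kl, of t j j'] w by (auto simp: P_eq P'_eq)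
    then have "{j' * tl \<sigma> l ..< (real_of_int j' + 1) * tl \<sigma> l} \<subseteq> {j * tl \<sigma> k ..< (real_of_int j + 1) * tl \<sigma> k}" by (rule time_sub)
    ultimately have "box \<sigma> \<tau> P' \<subseteq> box \<sigma> \<tau> P" by (auto simp only: P_eq P'_eq box.simps)
    then show False using neg by blast
  qed
  show "box \<sigma> \<tau> P \<inter> box \<sigma> \<tau> P' = {}" if "fst P = fst P'" "P \<noteq> P'"
  proof (rule ccontr)
    assume "\<not> ?thesis"
    then obtain x t where w: "(x, t) \<in> box \<sigma> \<tau> P" "(x, t) \<in> box \<sigma> \<tau> P'" by auto
    have kl: "l = k" using that P_eq P'_eq by simp
    have "\<beta> = \<alpha>"
      using cubes_disjoint[OF \<tau>, of k] w \<alpha> \<beta> unfolding disjoint_family_on_def P_eq P'_eq kl by auto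
    moreover have "j' = j"
    proof -
      have 1: "t \<in> {j * tl \<sigma> k ..< (real_of_int j + 1) * tl \<sigma> k}" "t \<in> {j' * tl \<sigma> k ..< (real_of_int j' + 1) * tl \<sigma> k}"
        using w by (auto simp: P_eq P'_eq kl)
      have n0: "n = 0" if "tl \<sigma> k = 2 ^ n * tl \<sigma> k" for n
      proof (rule ccontr)
        assume "n \<noteq> 0"
        then have "(1::real) < 2 ^ n" by simp
        then show False using that tl_pos[of \<sigma> k] by simp
      qed
      obtain n where "tl \<sigma> k = 2 ^ n * tl \<sigma> k" "j * 2 ^ n \<le> j'" "j' + 1 \<le> (j + 1) * 2 ^ n"
        using time_nested[OF \<sigma> order_refl 1] by blast
      with n0[of n] show ?thesis by simp
    qed
    ultimately show False using that P_eq P'_eq kl by simp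
  qed
  show "\<exists>i'. \<bar>i'\<bar> \<le> \<bar>i\<bar> \<and> box \<sigma> \<tau> (shf i P') \<subseteq> box \<sigma> \<tau> (shf i' P)"
    if "fst P \<le> fst P'" "box \<sigma> \<tau> P' \<subseteq> box \<sigma> \<tau> P" for i
  proof -
    have kl: "k \<le> l" using that P_eq P'_eq by simp
    have QQ: "Q l \<tau> \<beta> \<subseteq> Q k \<tau> \<alpha>" and tt: "{j' * tl \<sigma> l ..< (real_of_int j' + 1) * tl \<sigma> l} \<subseteq> {j * tl \<sigma> k ..< (real_of_int j + 1) * tl \<sigma> k}"
      using box_sub_cube_sub[OF that(2)[unfolded P_eq P'_eq] \<tau> \<beta>] .
    have "j' * tl \<sigma> l \<in> {j' * tl \<sigma> l ..< (real_of_int j' + 1) * tl \<sigma> l}" using tl_pos[of \<sigma> l] by (simp add: algebra_simps)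
    with tt time_nested[OF \<sigma> kl] obtain n where n: "tl \<sigma> k = 2 ^ n * tl \<sigma> l" "j * 2 ^ n \<le> j'" "j' + 1 \<le> (j + 1) * 2 ^ n"
      by blast
    \<comment> \<open>Index, relative to \<open>P\<close>, of the coarse time interval that contains
      the fine one moved by \<open>i\<close>. Since 2^n fine intervals make one coarse interval, the
      quotient changes by at most \<open>\<bar>i\<bar>\<close>.\<close>
    define i' where "i' = (j' + i) div 2 ^ n - j"
    have A: "(j + i') * 2 ^ n \<le> j' + i" "j' + i + 1 \<le> (j + i' + 1) * 2 ^ n"
      using int_div_bounds[of "2 ^ n" "j' + i"] by (simp_all add: i'_def)
    have "\<bar>i'\<bar> \<le> \<bar>i\<bar>"
    proof -
      have g: "(2::int) ^ n \<ge> 1" by simp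
      have u: "i' * 2 ^ n < 2 ^ n + i" using A(1) n(3) by (simp add: algebra_simps)
      have v: "i - 2 ^ n < i' * 2 ^ n" using A(2) n(2) by (simp add: algebra_simps)
      have "i' \<le> \<bar>i\<bar>"
      proof (rule ccontr)
        assume "\<not> ?thesis"
        then have "(\<bar>i\<bar> + 1) * 2 ^ n \<le> i' * 2 ^ n" using g by (intro mult_right_mono) auto
        moreover have "\<bar>i\<bar> * 1 \<le> \<bar>i\<bar> * 2 ^ n" using g by (intro mult_left_mono) auto
        ultimately have "\<bar>i\<bar> + 2 ^ n \<le> i' * 2 ^ n" by (simp add: algebra_simps)
        with u show False by simp
      qed
      moreover have "- i' \<le> \<bar>i\<bar>"
      proof (rule ccontr)
        assume "\<not> ?thesis"
        then have "(\<bar>i\<bar> + 1) * 2 ^ n \<le> (- i') * 2 ^ n" using g by (intro mult_right_mono) auto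
        moreover have "\<bar>i\<bar> * 1 \<le> \<bar>i\<bar> * 2 ^ n" using g by (intro mult_left_mono) auto
        ultimately have "\<bar>i\<bar> + 2 ^ n \<le> - (i' * 2 ^ n)" by (simp add: algebra_simps)
        with v show False by simp
      qed
      ultimately show ?thesis by simp
    qed
    moreover have "box \<sigma> \<tau> (shf i P') \<subseteq> box \<sigma> \<tau> (shf i' P)"
      using time_sub[OF n(1) A] QQ by (auto simp only: P_eq P'_eq box.simps shf.simps)
    ultimately show ?thesis by blast
  qed
next
  show "fst (shf i P) = fst P" for i P by (cases P) auto
  show "shf i (shf j P) = shf (i + j) P" for i j P by (cases P) auto
  show "shf 0 P = P" for P by (cases P) auto
  show "\<exists>P\<in>boxes \<tau>. fst P = k \<and> x \<in> box \<sigma> \<tau> P" for k x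
    using cover_box[OF \<tau>, of k x \<sigma>] by (fastforce simp: boxes_def)
  show "\<exists>E\<in>sigma_sets UNIV (box \<sigma> \<tau> ` {P \<in> boxes \<tau>. \<exists>n::nat. fst P = k + int m * int n}). emeasure PM (D - E \<union> (E - D)) = 0"
    if D: "D \<in> sets PM" "emeasure PM D < \<infinity>" and m: "0 < m" for D m k
  proof -
    \<comment> \<open>A Borel hull from Borel regularity; it differs from \<open>D\<close> by a null
      set as \<open>D\<close> is measurable with finite measure.\<close>
    obtain E where E: "E \<in> borel_of_qm (par_dist \<rho> p)" "D \<subseteq> E" "outer_measure_of PM D = emeasure PM E"
      using standing_par[unfolded standing_assms_def borel_regular_def, THEN conjunct2, THEN conjunct1,
          THEN conjunct2, THEN conjunct2, THEN spec, of D] by (elim bexE conjE)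
    have "emeasure PM (E - D) = emeasure PM E - emeasure PM D"
      using E D sets_borel_par[OF E(1)] by (intro emeasure_Diff) auto
    also have "\<dots> = 0" using E(3) D by simp
    finally have "emeasure PM (D - E \<union> (E - D)) = 0" using E(2) by (simp add: Diff_eq_empty_iff[THEN iffD2])
    moreover have "borel_of_qm (par_dist \<rho> p) \<subseteq> sigma_sets UNIV (box \<sigma> \<tau> ` {P \<in> boxes \<tau>. \<exists>n::nat. fst P = k + int m * int n})"
      unfolding borel_of_qm_def
      by (intro sigma_sets_mono) (auto intro!: open_par_boxes[OF \<tau> \<sigma> m])
    ultimately show ?thesis using E(1) by blast
  qed
qed

end

section \<open>Comparing the constants along chains of cylinders\<close>

lemma nn_set_integral_mono_set:
  "S \<subseteq> W \<Longrightarrow> (\<integral>\<^sup>+z\<in>S. g z \<partial>m) \<le> (\<integral>\<^sup>+z\<in>W. g z \<partial>m)"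
  by (rule nn_integral_mono) (auto split: split_indicator)

text \<open>For \<open>s = 1\<close> the slab lies after \<open>t\<close>, for \<open>s = -1\<close> before it.\<close>

definition tslab :: "real \<Rightarrow> real \<Rightarrow> real \<Rightarrow> real \<Rightarrow> real set" where
  "tslab s t lo hi = {r. lo < s * (r - t) \<and> s * (r - t) < hi}"

lemma tslab_plus: "tslab 1 t lo hi = {t + lo <..< t + hi}"
  and tslab_minus: "tslab (-1) t lo hi = {t - hi <..< t - lo}"
  by (auto simp: tslab_def)

lemma sets_tslab [measurable]: "tslab s t lo hi \<in> sets borel"
  unfolding tslab_def by measurable

lemma emeasure_tslab: "s = 1 \<or> s = -1 \<Longrightarrow> lo \<le> hi \<Longrightarrow> emeasure lborel (tslab s t lo hi) = ennreal (hi - lo)"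
  by (auto simp: tslab_plus tslab_minus)

context homogeneous_dyadic
begin

text \<open>The working form of \<open>PBMO_plus\<close>: no denominators, constants indexed by
  centre, time and radius instead of by the cylinder as a set, and a sign \<open>s\<close> that
  makes the passage from \<open>f\<close> to \<open>- f\<close> a symmetry, see
  \<open>PB_reflect\<close>.\<close>

definition PB :: "real \<Rightarrow> real \<Rightarrow> real \<Rightarrow> ('a \<Rightarrow> real \<Rightarrow> real \<Rightarrow> real) \<Rightarrow> ('a \<times> real \<Rightarrow> real) \<Rightarrow> bool" where
  "PB s \<gamma> A a f \<longleftrightarrow> f \<in> borel_measurable PM \<and> (\<forall>x t l. 0 < l \<longrightarrow>
     (\<integral>\<^sup>+z\<in>qb x l \<times> tslab s t (\<gamma> * l powr p) (l powr p). ennreal (max 0 (f z - a x t l)) \<partial>PM) \<le> ennreal (A * vol x l * l powr p) \<and>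
     (\<integral>\<^sup>+z\<in>qb x l \<times> tslab (-s) t (\<gamma> * l powr p) (l powr p). ennreal (max 0 (a x t l - f z)) \<partial>PM) \<le> ennreal (A * vol x l * l powr p))"

lemma PB_measurable: "PB s \<gamma> A a f \<Longrightarrow> f \<in> borel_measurable PM"
  by (simp add: PB_def)

lemma PB_upper: "PB s \<gamma> A a f \<Longrightarrow> 0 < l \<Longrightarrow>
  (\<integral>\<^sup>+z\<in>qb x l \<times> tslab s t (\<gamma> * l powr p) (l powr p). ennreal (max 0 (f z - a x t l)) \<partial>PM) \<le> ennreal (A * vol x l * l powr p)"
  and PB_lower: "PB s \<gamma> A a f \<Longrightarrow> 0 < l \<Longrightarrow>
  (\<integral>\<^sup>+z\<in>qb x l \<times> tslab (-s) t (\<gamma> * l powr p) (l powr p). ennreal (max 0 (a x t l - f z)) \<partial>PM) \<le> ennreal (A * vol x l * l powr p)"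
  by (auto simp: PB_def)

lemma PB_reflect: "PB s \<gamma> A a f \<Longrightarrow> PB (-s) \<gamma> A (\<lambda>x t l. - a x t l) (\<lambda>z. - f z)"
  by (auto simp: PB_def)

lemma sets_qb_tslab: "0 < r \<Longrightarrow> qb y r \<times> tslab s t lo hi \<in> sets PM"
  by (intro Times_sets sets_ball sets_tslab)

lemma overlap:
  assumes PB: "PB s \<gamma> A a f" and s: "s = 1 \<or> s = -1" and A: "0 \<le> A" and \<kappa>: "0 < \<kappa>"
    and l: "0 < l" "0 < l'" "0 < r" "lo < hi"
    and balls: "qb y r \<subseteq> qb x l" "qb y r \<subseteq> qb x' l'"
    and times: "tslab s w lo hi \<subseteq> tslab s t (\<gamma> * l powr p) (l powr p)"
      "tslab s w lo hi \<subseteq> tslab (-s) t' (\<gamma> * l' powr p) (l' powr p)"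
    and size: "\<kappa> * (vol x l * l powr p) \<le> vol y r * (hi - lo)" "\<kappa> * (vol x' l' * l' powr p) \<le> vol y r * (hi - lo)"
  shows "a x' t' l' \<le> a x t l + 2 * A / \<kappa>"
proof (cases "a x' t' l' \<le> a x t l")
  case True
  then show ?thesis using A \<kappa> by (simp add: add_increasing2)
next
  case False
  note [measurable] = PB_measurable[OF PB]
  let ?S = "qb y r \<times> tslab s w lo hi" and ?d = "a x' t' l' - a x t l"
  have Ss: "?S \<in> sets PM" using l by (intro sets_qb_tslab) auto
  define m where "m = vol y r * (hi - lo)"
  have m: "0 < m" using vol_pos[OF l(3)] l by (simp add: m_def)
  have mS: "emeasure PM ?S = ennreal m"
    using l s vol_pos[OF l(3), of y] by (simp add: emeasure_Times sets_ball emeasure_ball emeasure_tslab m_def ennreal_mult)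
  have "ennreal ?d * emeasure PM ?S = (\<integral>\<^sup>+z. ennreal ?d * indicator ?S z \<partial>PM)"
    using Ss by (simp add: nn_integral_cmult_indicator)
  also have "\<dots> \<le> (\<integral>\<^sup>+z. ennreal (max 0 (a x' t' l' - f z)) * indicator ?S z + ennreal (max 0 (f z - a x t l)) * indicator ?S z \<partial>PM)"
  proof (rule nn_integral_mono)
    fix z
    have "ennreal ?d \<le> ennreal (max 0 (a x' t' l' - f z) + max 0 (f z - a x t l))" by (rule ennreal_leI) auto
    then show "ennreal ?d * indicator ?S z \<le> ennreal (max 0 (a x' t' l' - f z)) * indicator ?S z + ennreal (max 0 (f z - a x t l)) * indicator ?S z"
      by (auto split: split_indicator)
  qed
  also have "\<dots> = (\<integral>\<^sup>+z\<in>?S. ennreal (max 0 (a x' t' l' - f z)) \<partial>PM) + (\<integral>\<^sup>+z\<in>?S. ennreal (max 0 (f z - a x t l)) \<partial>PM)"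
    using Ss by (subst nn_integral_add) auto
  also have "\<dots> \<le> ennreal (A * vol x' l' * l' powr p) + ennreal (A * vol x l * l powr p)"
  proof (rule add_mono)
    have "?S \<subseteq> qb x' l' \<times> tslab (-s) t' (\<gamma> * l' powr p) (l' powr p)" using balls times by blast
    from nn_set_integral_mono_set[OF this] PB_lower[OF PB l(2), of x' t']
    show "(\<integral>\<^sup>+z\<in>?S. ennreal (max 0 (a x' t' l' - f z)) \<partial>PM) \<le> ennreal (A * vol x' l' * l' powr p)" by (rule order_trans)
    have "?S \<subseteq> qb x l \<times> tslab s t (\<gamma> * l powr p) (l powr p)" using balls times by blast
    from nn_set_integral_mono_set[OF this] PB_upper[OF PB l(1), of x t]
    show "(\<integral>\<^sup>+z\<in>?S. ennreal (max 0 (f z - a x t l)) \<partial>PM) \<le> ennreal (A * vol x l * l powr p)" by (rule order_trans)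
  qed
  also have "\<dots> \<le> ennreal (A * (m / \<kappa>)) + ennreal (A * (m / \<kappa>))"
  proof -
    have "vol x' l' * l' powr p \<le> m / \<kappa>" "vol x l * l powr p \<le> m / \<kappa>"
      using size[folded m_def] \<kappa> by (simp_all add: pos_le_divide_eq mult.commute)
    then show ?thesis using A unfolding mult.assoc by (intro add_mono ennreal_leI mult_left_mono) auto
  qed
  also have "\<dots> = ennreal (2 * A * m / \<kappa>)"
    using A \<kappa> m by (subst ennreal_plus[symmetric]) auto
  finally have "ennreal (?d * m) \<le> ennreal (2 * A * m / \<kappa>)"
    using False m unfolding mS by (subst ennreal_mult) auto
  then have "?d * m \<le> 2 * A * m / \<kappa>" using A \<kappa> m by (simp add: ennreal_le_iff)
  then have "?d * m \<le> (2 * A / \<kappa>) * m" by simp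
  then have "?d \<le> 2 * A / \<kappa>" using m by (rule mult_right_le_imp_le)
  then show ?thesis by simp
qed

lemma chain_step:
  assumes \<gamma>: "0 < \<gamma>" "\<gamma> < 1" and s: "s = 1 \<or> s = -1" and A: "0 \<le> A"
  obtains D where "0 \<le> D" "\<And>a f x x' t t' l. PB s \<gamma> A a f \<Longrightarrow> 0 < l \<Longrightarrow> \<rho> x x' \<le> l / (2 * K0) \<Longrightarrow>
     (1 + 3 * \<gamma>) / 2 * l powr p \<le> s * (t' - t) \<Longrightarrow> s * (t' - t) \<le> (3 + \<gamma>) / 2 * l powr p \<Longrightarrow>
     a x' t' l \<le> a x t l + D"
proof -
  obtain V where V: "V \<ge> 1" "\<And>x y r. 0 < r \<Longrightarrow> \<rho> x y \<le> 2 * K0 * r \<Longrightarrow> vol x (2 * K0 * r) \<le> V * vol y r"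
    using vol_compare[of "2 * K0"] by blast
  define \<kappa> where "\<kappa> = (1 - \<gamma>) / (2 * V)"
  have \<kappa>: "0 < \<kappa>" using V \<gamma> by (simp add: \<kappa>_def)
  have "a x' t' l \<le> a x t l + 2 * A / \<kappa>"
    if PB: "PB s \<gamma> A a f" and l: "0 < l" and x: "\<rho> x x' \<le> l / (2 * K0)"
      and t: "(1 + 3 * \<gamma>) / 2 * l powr p \<le> s * (t' - t)" "s * (t' - t) \<le> (3 + \<gamma>) / 2 * l powr p"
    for a f x x' t t' l
  proof -
    define L where "L = l powr p"
    have L: "0 < L" using l by (simp add: L_def)
    define \<theta> where "\<theta> = s * (t' - t)"
    \<comment> \<open>The common part of the two slabs, measured from \<open>t\<close> in direction
      \<open>s\<close>.\<close>
    define lo hi where "lo = max (\<gamma> * L) (\<theta> - L)" and "hi = min L (\<theta> - \<gamma> * L)"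
    have \<gamma>L: "\<gamma> * L < L" using \<gamma> L by simp
    have \<theta>: "L / 2 + 3 / 2 * (\<gamma> * L) \<le> \<theta>" "\<theta> \<le> 3 / 2 * L + (\<gamma> * L) / 2"
    proof -
      have "(1 + 3 * \<gamma>) / 2 * L = L / 2 + 3 / 2 * (\<gamma> * L)" "(3 + \<gamma>) / 2 * L = 3 / 2 * L + (\<gamma> * L) / 2"
        by (simp_all add: field_simps)
      then show "L / 2 + 3 / 2 * (\<gamma> * L) \<le> \<theta>" "\<theta> \<le> 3 / 2 * L + (\<gamma> * L) / 2"
        using t by (simp_all only: \<theta>_def L_def)
    qed
    have len: "(L - \<gamma> * L) / 2 \<le> hi - lo" 
    proof -
      have "lo = \<gamma> * L \<or> lo = \<theta> - L" "hi = L \<or> hi = \<theta> - \<gamma> * L"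
        by (auto simp: lo_def hi_def max_def min_def)
      then show ?thesis using \<theta> \<gamma>L by (elim disjE) (simp_all add: mult.commute[of \<gamma> L])
    qed
    let ?r = "l / (2 * K0)"
    have r: "0 < ?r" "2 * K0 * ?r = l" using l K0 by auto
    have K0l: "K0 * (?r + ?r) = l" using K0 by (simp add: field_simps)
    have "qb x' ?r \<subseteq> qb x l" using ball_trans[of x' x ?r ?r] x K0l by (simp add: dist_sym)
    moreover have "?r \<le> l" using r K0 l by (simp add: field_simps)
    then have "qb x' ?r \<subseteq> qb x' l" by (rule ball_mono)
    moreover have "tslab s t lo hi \<subseteq> tslab s t (\<gamma> * L) L"
      by (auto simp: tslab_def lo_def hi_def)
    moreover have "tslab s t lo hi \<subseteq> tslab (-s) t' (\<gamma> * L) L"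
    proof
      fix q assume q: "q \<in> tslab s t lo hi"
      have "- s * (q - t') = \<theta> - s * (q - t)" by (simp add: \<theta>_def algebra_simps)
      then show "q \<in> tslab (-s) t' (\<gamma> * L) L" using q by (auto simp: tslab_def lo_def hi_def)
    qed
    moreover have sz: "\<kappa> * (v * L) \<le> vol x' ?r * (hi - lo)" if "v \<le> V * vol x' ?r" for v
    proof -
      have "\<kappa> * (v * L) \<le> \<kappa> * ((V * vol x' ?r) * L)"
        using that \<kappa> L by (intro mult_left_mono mult_right_mono) auto
      also have "\<dots> = vol x' ?r * ((L - \<gamma> * L) / 2)"
        using V by (simp add: \<kappa>_def field_simps)
      also have "\<dots> \<le> vol x' ?r * (hi - lo)" using len vol_pos[OF r(1)] by (intro mult_left_mono) (auto intro: less_imp_le)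
      finally show ?thesis .
    qed
    moreover have "vol x l \<le> V * vol x' ?r" using V(2)[OF r(1), of x x'] x r \<open>?r \<le> l\<close> by simp
    moreover have "vol x' l \<le> V * vol x' ?r" using V(2)[OF r(1), of x' x'] r l dist_eq_0[of x' x'] by simp
    ultimately show ?thesis
      using overlap[OF PB s A \<kappa> l l r(1), where x=x and x'=x' and y=x' and lo=lo and hi=hi and w=t and t=t and t'=t', folded L_def] len \<gamma>L
      by simp
  qed
  then show thesis using that[of "2 * A / \<kappa>"] A \<kappa> by auto
qed

text \<open>A monotone geodesic with parameter \<open>s = l / Kc\<close> shortens the remaining
  distance by at least \<open>s\<close> at every step, so it has at most
  \<open>\<rho> x y / s\<close> steps; repeating its end point extends it to any larger length.
  Points closer than \<open>s\<close> are joined by one step, hence the summand 1. The length has to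
  be prescribed because the available time dictates the number of steps.\<close>

lemma chain_path:
  obtains Kc where "0 < Kc" "\<And>x y l n. 0 < l \<Longrightarrow> Kc * \<rho> x y / l + 1 \<le> real n \<Longrightarrow>
     \<exists>xs. xs 0 = x \<and> xs n = y \<and> (\<forall>i<n. \<rho> (xs i) (xs (Suc i)) \<le> l / (2 * K0))"
proof -
  obtain Kt where Kt: "Kt > 0" "\<forall>s>0. \<forall>x y. s \<le> \<rho> x y \<longrightarrow>
        (\<exists>(m::nat) xs. xs 0 = x \<and> xs m = y \<and>
           (\<forall>i<m. \<rho> (xs i) (xs (Suc i)) \<le> Kt * s \<and> \<rho> (xs (Suc i)) (xs m) \<le> \<rho> (xs i) (xs m) - s))"
    using monotone_geodesic unfolding monotone_geodesic_def by (elim exE conjE)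
  define Kc where "Kc = 2 * K0 * max 1 Kt"
  have Kc: "0 < Kc" using K0 by (simp add: Kc_def)
  have "\<exists>xs. xs 0 = x \<and> xs n = y \<and> (\<forall>i<n. \<rho> (xs i) (xs (Suc i)) \<le> l / (2 * K0))"
    if l: "0 < l" and n: "Kc * \<rho> x y / l + 1 \<le> real n" for x y l n
  proof -
    define s where "s = l / Kc"
    have s: "0 < s" using l Kc by (simp add: s_def)
    have "max 1 Kt * s = l / (2 * K0)" using K0 by (simp add: s_def Kc_def)
    moreover have "Kt * s \<le> max 1 Kt * s" "1 * s \<le> max 1 Kt * s" using s by (intro mult_right_mono; simp)+
    ultimately have sl: "Kt * s \<le> l / (2 * K0)" "s \<le> l / (2 * K0)" by auto
    have ns: "\<rho> x y / s + 1 \<le> real n" using n by (simp add: s_def mult.commute)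
    show ?thesis
    proof (cases "s \<le> \<rho> x y")
      case True
      obtain m xs where xs: "xs 0 = x" "xs m = y"
        "\<And>i. i < m \<Longrightarrow> \<rho> (xs i) (xs (Suc i)) \<le> Kt * s" "\<And>i. i < m \<Longrightarrow> \<rho> (xs (Suc i)) (xs m) \<le> \<rho> (xs i) (xs m) - s"
        using Kt(2)[rule_format, OF s True] by metis
      have dec: "i \<le> m \<Longrightarrow> \<rho> (xs i) (xs m) \<le> \<rho> x y - real i * s" for i
      proof (induction i)
        case (Suc i)
        then show ?case using xs(4)[of i] by (simp add: algebra_simps)
      qed (simp add: xs)
      have "real m * s \<le> \<rho> x y" using dec[of m] dist_nonneg[of "xs m" "xs m"] by simp
      then have "real m \<le> \<rho> x y / s" using s by (simp add: field_simps)
      then have mn: "m \<le> n" using ns by simp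
      define ys where "ys i = (if i \<le> m then xs i else y)" for i
      have "\<rho> (ys i) (ys (Suc i)) \<le> l / (2 * K0)" for i
      proof (cases "i < m")
        case True
        then show ?thesis using xs(3)[of i] sl by (simp add: ys_def)
      next
        case False
        then have "ys i = y" "ys (Suc i) = y" using xs(2) by (auto simp: ys_def)
        then show ?thesis using dist_eq_0[of y y] sl s by simp
      qed
      moreover have "ys 0 = x" "ys n = y" using xs mn by (auto simp: ys_def)
      ultimately show ?thesis by blast
    next
      case False
      have "0 \<le> \<rho> x y / s" using dist_nonneg s by simp
      then have "1 \<le> n" using ns by linarith
      define ys where "ys i = (if i = 0 then x else y)" for i :: nat
      have "\<rho> (ys i) (ys (Suc i)) \<le> l / (2 * K0)" for i
        using False sl s dist_eq_0[of y y] by (auto simp: ys_def)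
      moreover have "ys 0 = x" "ys n = y" using \<open>1 \<le> n\<close> by (auto simp: ys_def)
      ultimately show ?thesis by blast
    qed
  qed
  then show thesis using that[OF Kc] by blast
qed

text \<open>The time is split into \<open>n\<close> equal steps. The excess over \<open>n\<close>
  ideal steps is at most one ideal step; divided by \<open>n\<close>, it stays within the tolerance
  (1 - \<gamma>)/2 l^p of \<open>chain_step\<close> as soon as n \<ge> 2 (1 + \<gamma>)/(1 -
  \<gamma>), which is \<open>n0\<close>.\<close>

lemma chain:
  assumes \<gamma>: "0 < \<gamma>" "\<gamma> < 1" and s: "s = 1 \<or> s = -1" and A: "0 \<le> A"
  obtains D Kc n0 where "0 \<le> D" "0 < Kc" "\<And>a f x y t t' l n. PB s \<gamma> A a f \<Longrightarrow> 0 < l \<Longrightarrow>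
     n0 \<le> real n \<Longrightarrow> Kc * \<rho> x y / l + 1 \<le> real n \<Longrightarrow>
     real n * ((1 + \<gamma>) * l powr p) \<le> s * (t' - t) \<Longrightarrow> s * (t' - t) \<le> (real n + 1) * ((1 + \<gamma>) * l powr p) \<Longrightarrow>
     a y t' l \<le> a x t l + real n * D"
proof -
  obtain D where D: "0 \<le> D" "\<And>a f x x' t t' l. PB s \<gamma> A a f \<Longrightarrow> 0 < l \<Longrightarrow> \<rho> x x' \<le> l / (2 * K0) \<Longrightarrow>
     (1 + 3 * \<gamma>) / 2 * l powr p \<le> s * (t' - t) \<Longrightarrow> s * (t' - t) \<le> (3 + \<gamma>) / 2 * l powr p \<Longrightarrow>
     a x' t' l \<le> a x t l + D"
    using chain_step[OF \<gamma> s A] by blast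
  obtain Kc where Kc: "0 < Kc" "\<And>x y l n. 0 < l \<Longrightarrow> Kc * \<rho> x y / l + 1 \<le> real n \<Longrightarrow>
     \<exists>xs. xs 0 = x \<and> xs n = y \<and> (\<forall>i<n. \<rho> (xs i) (xs (Suc i)) \<le> l / (2 * K0))"
    using chain_path by blast
  define n0 where "n0 = 2 * (1 + \<gamma>) / (1 - \<gamma>)"
  have "a y t' l \<le> a x t l + real n * D"
    if PB: "PB s \<gamma> A a f" and l: "0 < l" and n: "n0 \<le> real n" "Kc * \<rho> x y / l + 1 \<le> real n"
     and t: "real n * ((1 + \<gamma>) * l powr p) \<le> s * (t' - t)" "s * (t' - t) \<le> (real n + 1) * ((1 + \<gamma>) * l powr p)"
     for a f x y t t' l n
  proof -
    obtain xs where xs: "xs 0 = x" "xs n = y" "\<And>i. i < n \<Longrightarrow> \<rho> (xs i) (xs (Suc i)) \<le> l / (2 * K0)"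
      using Kc(2)[OF l n(2)] by blast
    define L where "L = l powr p"
    have L: "0 < L" using l by (simp add: L_def)
    have "0 \<le> Kc * \<rho> x y / l" using Kc(1) dist_nonneg l by simp
    then have npos: "0 < real n" using n by linarith
    define \<theta> where "\<theta> = s * (t' - t) / real n"
    have a1: "(1 + \<gamma>) * L \<le> \<theta>" using t(1) npos by (simp add: \<theta>_def L_def field_simps)
    have a2: "\<gamma> * L \<le> 1 * L" using \<gamma> L by (intro mult_right_mono) auto
    have a3: "\<theta> \<le> (1 + \<gamma>) * L + (1 + \<gamma>) * L / real n"
    proof -
      have "\<theta> \<le> (real n + 1) * ((1 + \<gamma>) * L) / real n"
        using t(2) npos unfolding \<theta>_def L_def by (intro divide_right_mono) auto
      also have "\<dots> = (1 + \<gamma>) * L + (1 + \<gamma>) * L / real n"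
        using npos by (simp add: distrib_right add_divide_distrib)
      finally show ?thesis .
    qed
    have a4: "(1 + \<gamma>) * L / real n \<le> (1 - \<gamma>) / 2 * L"
    proof -
      have "2 * (1 + \<gamma>) \<le> (1 - \<gamma>) * real n" using n(1) \<gamma> by (simp add: n0_def field_simps)
      then have "2 * (1 + \<gamma>) * L \<le> (1 - \<gamma>) * real n * L" using L by (intro mult_right_mono) auto
      then show ?thesis using npos by (simp add: field_simps)
    qed
    have \<theta>: "(1 + 3 * \<gamma>) / 2 * L \<le> \<theta>" "\<theta> \<le> (3 + \<gamma>) / 2 * L"
    proof -
      have "(1 + 3 * \<gamma>) / 2 * L \<le> (1 + \<gamma>) * L" using a2 by (simp add: field_simps)
      then show "(1 + 3 * \<gamma>) / 2 * L \<le> \<theta>" using a1 by (rule order_trans)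
      have "\<theta> \<le> (1 + \<gamma>) * L + (1 - \<gamma>) / 2 * L" using a3 a4 by linarith
      also have "\<dots> = (3 + \<gamma>) / 2 * L" by (simp add: field_simps)
      finally show "\<theta> \<le> (3 + \<gamma>) / 2 * L" .
    qed
    have ss: "s * s = 1" using s by auto
    have "i \<le> n \<Longrightarrow> a (xs i) (t + s * (real i * \<theta>)) l \<le> a x t l + real i * D" for i
    proof (induction i)
      case (Suc i)
      have "s * ((t + s * (real (Suc i) * \<theta>)) - (t + s * (real i * \<theta>))) = (s * s) * \<theta>" by (simp add: algebra_simps)
      then have "s * ((t + s * (real (Suc i) * \<theta>)) - (t + s * (real i * \<theta>))) = \<theta>" using ss by simp
      then have "a (xs (Suc i)) (t + s * (real (Suc i) * \<theta>)) l \<le> a (xs i) (t + s * (real i * \<theta>)) l + D"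
        using D(2)[OF PB l xs(3)[of i]] Suc.prems \<theta> by (simp only: L_def Suc_le_eq)
      then show ?case using Suc by (simp add: algebra_simps)
    qed (simp add: xs)
    from this[of n] have "a y (t + s * (real n * \<theta>)) l \<le> a x t l + real n * D" by (simp add: xs)
    moreover have "t + s * (real n * \<theta>) = t'"
    proof -
      have "s * (real n * \<theta>) = (s * s) * (t' - t)" using npos by (simp add: \<theta>_def)
      then show ?thesis using ss by simp
    qed
    ultimately show ?thesis by simp
  qed
  then show thesis using that[OF D(1) Kc(1), of n0] by blast
qed

end

section \<open>Exponential integrability on parabolic boxes\<close>

lemma (in shift_grid) integral_le_refine:
  assumes P: "P \<in> B" and n: "gen P \<le> n" and [measurable]: "g \<in> borel_measurable L"
    and le: "\<And>P'. P' \<in> B \<Longrightarrow> gen P' = n \<Longrightarrow> bx P' \<subseteq> bx P \<Longrightarrow> (\<integral>\<^sup>+z\<in>bx P'. g z \<partial>L) \<le> c * emeasure L (bx P')"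
  shows "(\<integral>\<^sup>+z\<in>bx P. g z \<partial>L) \<le> c * emeasure L (bx P)"
proof -
  define G where "G = {P' \<in> B. gen P' = n \<and> bx P' \<subseteq> bx P}"
  have GB: "G \<subseteq> B" by (auto simp: G_def)
  have disj: "disjoint_family_on bx G"
    unfolding disjoint_family_on_def
  proof (intro ballI impI)
    fix P1 P2 assume "P1 \<in> G" "P2 \<in> G" "P1 \<noteq> P2"
    then show "bx P1 \<inter> bx P2 = {}" using disjoint_gen[of P1 P2] by (simp add: G_def)
  qed
  have U: "(\<Union>P\<in>G. bx P) = bx P"
  proof (intro equalityI subsetI)
    fix x assume "x \<in> (\<Union>P\<in>G. bx P)"
    then show "x \<in> bx P" by (auto simp: G_def)
  next
    fix x assume x: "x \<in> bx P"
    obtain P' where P': "P' \<in> B" "gen P' = n" "x \<in> bx P'" using cover by blast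
    have "bx P' \<subseteq> bx P" using nested_le[OF P P'(1) _ x P'(3)] n P'(2) by simp
    then show "x \<in> (\<Union>P\<in>G. bx P)" using P' by (auto simp: G_def)
  qed
  have "(\<integral>\<^sup>+z\<in>bx P. g z \<partial>L) = emeasure (density L g) (\<Union>P\<in>G. bx P)"
    unfolding U using P by (subst emeasure_density) auto
  also have "\<dots> = (\<integral>\<^sup>+P'. emeasure (density L g) (bx P') \<partial>count_space G)"
    using GB disj by (intro emeasure_UN_disjoint) auto
  also have "\<dots> \<le> (\<integral>\<^sup>+P'. c * emeasure L (bx P') \<partial>count_space G)"
  proof (rule nn_integral_mono)
    fix P' assume "P' \<in> space (count_space G)"
    then have P': "P' \<in> B" "gen P' = n" "bx P' \<subseteq> bx P" by (auto simp: G_def)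
    then show "emeasure (density L g) (bx P') \<le> c * emeasure L (bx P')"
      using le[OF P'] by (subst emeasure_density) auto
  qed
  also have "\<dots> = c * emeasure L (\<Union>P\<in>G. bx P)"
    using GB disj by (subst emeasure_UN_disjoint) (auto simp: nn_integral_cmult)
  finally show ?thesis unfolding U .
qed

locale pbmo_grid = homogeneous_dyadic +
  fixes \<gamma> :: real
  assumes \<gamma>: "0 < \<gamma>" "\<gamma> < 1"
begin

text \<open>A box of generation \<open>k\<close> is attached to a cylinder of radius \<open>ll k\<close> with
  \<open>(ll k) powr p = Lr * tl \<sigma> k\<close>, so that in units of \<open>tl \<sigma> k\<close> the geometry is the same for all \<open>k\<close>.\<close>

definition Lr where "Lr = max (8 / (1 - \<gamma>)) (20 * C1 powr p)"
definition \<sigma> where "\<sigma> = 2 * C1 powr p / Lr"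
text \<open>An integer near the middle of (\<gamma> Lr, Lr), the later slab of a cylinder in units
  of \<open>tl \<sigma> k\<close>; lemma \<open>u\<close> records the margins on both sides.\<close>

definition u :: nat where "u = nat \<lceil>(1 + \<gamma>) * Lr / 2\<rceil>"
definition ll where "ll k = (Lr * tl \<sigma> k) powr (1 / p)"
definition mid where "mid k j = (real_of_int j + 1/2) * tl \<sigma> k"
text \<open>The middle of the box lies u + 1/2 units after this time in direction \<open>s\<close>,
  and the box moved back by 2 u + 1 units lies as far before it. Thus the box is in the later part
  of the cylinder and that shift is in the earlier part; the 1/2 makes their distance a whole number
  of boxes.\<close>

definition tc where "tc s k j = mid k j - s * (real u + 1/2) * tl \<sigma> k"
definition aP where "aP s a \<tau> P = (case P of (k, \<alpha>, j) \<Rightarrow> a (ctr k \<tau> \<alpha>) (tc s k j) (ll k))"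

text \<open>The first entry of the maximum makes the slab at least 8 time units long, enough for a
  box and its margins. The second forces \<open>\<sigma> \<le> 1 / 10\<close>, on which
  \<open>lag_ge\<close> relies.\<close>

lemma Lr: "8 \<le> Lr" "8 \<le> (1 - \<gamma>) * Lr" "20 * C1 powr p \<le> Lr"
proof -
  have "8 / (1 - \<gamma>) \<le> Lr" by (simp add: Lr_def)
  then show 1: "8 \<le> (1 - \<gamma>) * Lr" using \<gamma> by (simp add: pos_divide_le_eq mult.commute)
  have "0 < Lr" using \<open>8 / (1 - \<gamma>) \<le> Lr\<close> \<gamma> by (meson divide_pos_pos less_le_trans zero_less_numeral diff_gt_0_iff_gt)
  then have "(1 - \<gamma>) * Lr \<le> 1 * Lr" using \<gamma> by (intro mult_right_mono) auto
  then show "8 \<le> Lr" using 1 by simp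
  show "20 * C1 powr p \<le> Lr" by (simp add: Lr_def)
qed

lemma u: "\<gamma> * Lr + 4 \<le> real u" "real u + 2 \<le> Lr - 1"
proof -
  have "0 \<le> (1 + \<gamma>) * Lr / 2" using \<gamma> Lr by simp
  then have ul: "(1 + \<gamma>) * Lr / 2 \<le> real u" "real u < (1 + \<gamma>) * Lr / 2 + 1"
    unfolding u_def by linarith+
  define g h where "g = \<gamma> * Lr" and "h = (1 - \<gamma>) * Lr"
  have e: "(1 + \<gamma>) * Lr / 2 = g + h / 2" and e': "g + h = Lr" by (simp_all add: g_def h_def field_simps)
  have "g + h / 2 \<le> real u" "real u < g + h / 2 + 1"
    using ul unfolding e by auto
  moreover have "8 \<le> h" using Lr(2) by (simp only: h_def)
  ultimately show "\<gamma> * Lr + 4 \<le> real u" "real u + 2 \<le> Lr - 1" unfolding g_def[symmetric] using e' by linarith+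
qed

lemma \<sigma>: "0 < \<sigma>" "\<sigma> \<le> 1 / 10"
  using C1 Lr by (auto simp: \<sigma>_def field_simps)

text \<open>\<open>\<sigma>\<close> is chosen so that Lr \<sigma> dur k = 2 (C1 rad k)^p. Rounding
  in \<open>tl\<close> loses at most a factor 2, so \<open>ll k powr p\<close> lies between one and
  two times (C1 rad k)^p: the ball contains the cube and is not much larger.\<close>

lemma ll: "0 < ll k" "ll k powr p = Lr * tl \<sigma> k" "C1 * rad k \<le> ll k" "ll k \<le> 2 * C1 * rad k"
proof -
  have Lt: "0 < Lr * tl \<sigma> k" using Lr(1) tl_pos by simp
  show "0 < ll k" using Lr(1) tl_pos[of \<sigma> k] by (simp add: ll_def)
  show 1: "ll k powr p = Lr * tl \<sigma> k" using Lt p by (simp add: ll_def powr_powr)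
  have C: "0 < C1 * rad k" using C1 rad_pos by simp
  have eq: "Lr * (\<sigma> * dur k) = 2 * (C1 * rad k) powr p"
    using C1 rad_pos[of k] Lr(1) by (simp add: \<sigma>_def dur_rad powr_mult)
  have "Lr * (\<sigma> * dur k) \<le> Lr * (2 * tl \<sigma> k)"
    using tl_bounds[OF \<sigma>(1), of k] Lr(1) by (intro mult_left_mono) auto
  then have "(C1 * rad k) powr p \<le> ll k powr p" unfolding 1 eq by simp
  then show "C1 * rad k \<le> ll k"
    using powr_less_mono2[of p "ll k" "C1 * rad k"] p \<open>0 < ll k\<close> by fastforce
  have "Lr * tl \<sigma> k \<le> Lr * (\<sigma> * dur k)"
    using tl_bounds[OF \<sigma>(1), of k] Lr(1) by (intro mult_left_mono) auto
  also have "\<dots> \<le> (2 * (C1 * rad k)) powr p"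
  proof -
    have "(2::real) powr 1 \<le> 2 powr p" using p by (intro powr_mono) auto
    then show ?thesis unfolding eq using C by (simp add: powr_mult mult_right_mono)
  qed
  finally have "ll k powr p \<le> (2 * (C1 * rad k)) powr p" unfolding 1 .
  then have "ll k \<le> 2 * (C1 * rad k)"
    using powr_less_mono2[of p "2 * (C1 * rad k)" "ll k"] p C by fastforce
  then show "ll k \<le> 2 * C1 * rad k" by simp
qed

lemma dur_add: "dur (k + int m) = \<delta> powr (m * p) * dur k"
  using \<delta> by (simp add: dur_def powr_add[symmetric] algebra_simps)

lemma tl_ratio:
  "tl \<sigma> (k + int m) \<le> 2 * \<delta> powr (m * p) * tl \<sigma> k" "\<delta> powr (m * p) * tl \<sigma> k \<le> 2 * tl \<sigma> (k + int m)"
proof -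
  have d: "0 < \<delta> powr (m * p)" using \<delta> by simp
  have "tl \<sigma> (k + int m) \<le> \<delta> powr (m * p) * (\<sigma> * dur k)"
    using tl_bounds(1)[OF \<sigma>(1), of "k + int m"] by (simp add: dur_add ac_simps)
  also have "\<dots> \<le> \<delta> powr (m * p) * (2 * tl \<sigma> k)"
    using tl_bounds(2)[OF \<sigma>(1), of k] d by (intro mult_left_mono) auto
  finally show "tl \<sigma> (k + int m) \<le> 2 * \<delta> powr (m * p) * tl \<sigma> k" by simp
  have "\<delta> powr (m * p) * tl \<sigma> k \<le> \<delta> powr (m * p) * (\<sigma> * dur k)"
    using tl_bounds(1)[OF \<sigma>(1), of k] d by (intro mult_left_mono) auto
  also have "\<dots> \<le> 2 * tl \<sigma> (k + int m)"
    using tl_bounds(2)[OF \<sigma>(1), of "k + int m"] by (simp add: dur_add ac_simps)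
  finally show "\<delta> powr (m * p) * tl \<sigma> k \<le> 2 * tl \<sigma> (k + int m)" .
qed

lemma time_interval_mid:
  "r \<in> {real_of_int j * tl \<sigma> k ..< (real_of_int j + 1) * tl \<sigma> k} \<Longrightarrow> \<bar>r - mid k j\<bar> \<le> tl \<sigma> k / 2"
  by (auto simp: mid_def field_simps abs_le_iff)

lemma mid_sub:
  assumes "{real_of_int j' * tl \<sigma> l ..< (real_of_int j' + 1) * tl \<sigma> l} \<subseteq> {real_of_int j * tl \<sigma> k ..< (real_of_int j + 1) * tl \<sigma> k}"
  shows "\<bar>mid l j' - mid k j\<bar> \<le> tl \<sigma> k / 2 - tl \<sigma> l / 2"
proof -
  have "(real_of_int j' * tl \<sigma> l < (real_of_int j' + 1) * tl \<sigma> l)" using tl_pos[of \<sigma> l] by (simp add: algebra_simps)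
  with assms have "real_of_int j * tl \<sigma> k \<le> real_of_int j' * tl \<sigma> l" "(real_of_int j' + 1) * tl \<sigma> l \<le> (real_of_int j + 1) * tl \<sigma> k"
    by (simp_all add: atLeastLessThan_subset_iff)
  then show ?thesis by (auto simp: mid_def field_simps abs_le_iff)
qed

lemma cyl_vol:
  obtains V where "1 \<le> V" "\<And>k \<tau> \<alpha>. \<tau> \<in> {1..N} \<Longrightarrow> \<alpha> \<in> I k \<tau> \<Longrightarrow> vol (ctr k \<tau> \<alpha>) (ll k) \<le> V * cvol k \<tau> \<alpha>"
proof -
  obtain V where V: "V \<ge> 1" "\<And>x r. 0 < r \<Longrightarrow> vol x ((2 * C1 / c1) * r) \<le> V * vol x r"
    using vol_scale[of "2 * C1 / c1"] by blast
  have "vol (ctr k \<tau> \<alpha>) (ll k) \<le> V * cvol k \<tau> \<alpha>" if "\<tau> \<in> {1..N}" "\<alpha> \<in> I k \<tau>" for k \<tau> \<alpha>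
  proof -
    have c: "0 < c1 * rad k" using c1 rad_pos by simp
    have "vol (ctr k \<tau> \<alpha>) (ll k) \<le> vol (ctr k \<tau> \<alpha>) (2 * C1 * rad k)"
      using ll[of k] C1 rad_pos[of k] by (intro vol_mono ball_mono) auto
    also have "2 * C1 * rad k = (2 * C1 / c1) * (c1 * rad k)" using c1 by simp
    also have "vol (ctr k \<tau> \<alpha>) \<dots> \<le> V * vol (ctr k \<tau> \<alpha>) (c1 * rad k)" by (rule V(2)[OF c])
    also have "\<dots> \<le> V * cvol k \<tau> \<alpha>" using V(1) cvol_ge[OF that] by (intro mult_left_mono) auto
    finally show ?thesis .
  qed
  then show thesis using that V(1) by blast
qed

lemma jn_boxes:
  assumes PB: "PB (of_int si) \<gamma> A a f" and si: "si = 1 \<or> si = -1" and A: "0 \<le> A"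
  shows "\<exists>\<epsilon>>0. \<forall>\<tau>\<in>{1..N}. \<forall>P\<in>boxes \<tau>.
    (\<integral>\<^sup>+z\<in>box \<sigma> \<tau> P. ennreal (exp (\<epsilon> * (f z - aP (of_int si) a \<tau> P))) \<partial>PM) \<le> 7 * emeasure PM (box \<sigma> \<tau> P)"
proof -
  define s where "s = real_of_int si"
  have s: "s = 1 \<or> s = -1" using si by (auto simp: s_def)
  have ss: "s * s = 1" using s by auto
  have ss': "s * (s * y) = y" for y using s by auto
  have sabs: "\<bar>s * y\<bar> = \<bar>y\<bar>" for y using s by (auto simp: abs_mult)
  note [measurable] = PB_measurable[OF PB]
  \<comment> \<open>After \<open>m\<close> generations the time unit has shrunk by the factor 2 Lr.
    Since 2 u + 1 \<le> 2 Lr, moving a descendant by 2 u + 1 of its own lengths displaces it by at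
    most one length of the original box.\<close>
  obtain m where m: "0 < m" "\<And>k. 2 * Lr * tl \<sigma> (k + int m) \<le> tl \<sigma> k"
  proof -
    have d1: "\<delta> powr p < 1" using \<delta> p using powr_less_mono2[of p \<delta> 1] by simp
    obtain m where m: "(\<delta> powr p) ^ m < 1 / (4 * Lr)"
      using real_arch_pow_inv[OF _ d1, of "1 / (4 * Lr)"] Lr(1) by auto
    have "m \<noteq> 0"
    proof
      assume "m = 0"
      then show False using m Lr(1) by simp
    qed
    moreover have "2 * Lr * tl \<sigma> (k + int m) \<le> tl \<sigma> k" for k
    proof -
      have e: "(\<delta> powr p) ^ m = \<delta> powr (m * p)" using \<delta> by (simp add: powr_powr[symmetric] powr_realpow[symmetric] mult.commute)
      have "2 * Lr * tl \<sigma> (k + int m) \<le> 2 * Lr * (2 * \<delta> powr (m * p) * tl \<sigma> k)"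
        using tl_ratio(1)[of k m] Lr(1) by (intro mult_left_mono) auto
      also have "\<dots> = (4 * Lr * \<delta> powr (m * p)) * tl \<sigma> k" by simp
      also have "\<dots> \<le> 1 * tl \<sigma> k"
        using m Lr(1) tl_pos[of \<sigma> k] unfolding e by (intro mult_right_mono) (auto simp: field_simps)
      finally show ?thesis by simp
    qed
    ultimately show thesis using that[of m] by auto
  qed
  have tlm: "2 * Lr * tl \<sigma> l \<le> tl \<sigma> k" if kl: "k + int m \<le> l" for k l
  proof -
    obtain n where "tl \<sigma> (k + int m) = 2 ^ n * tl \<sigma> l" using tl_refine[OF \<sigma>(1) kl] by blast
    moreover have "1 * tl \<sigma> l \<le> 2 ^ n * tl \<sigma> l" using tl_pos[of \<sigma> l] by (intro mult_right_mono) auto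
    ultimately have "2 * Lr * tl \<sigma> l \<le> 2 * Lr * tl \<sigma> (k + int m)" using Lr(1) by simp
    then show ?thesis using m(2)[of k] by simp
  qed
  obtain V where V: "1 \<le> V" "\<And>k \<tau> \<alpha>. \<tau> \<in> {1..N} \<Longrightarrow> \<alpha> \<in> I k \<tau> \<Longrightarrow> vol (ctr k \<tau> \<alpha>) (ll k) \<le> V * cvol k \<tau> \<alpha>"
    using cyl_vol by blast
  obtain V' where V': "1 \<le> V'" "\<And>x y r. 0 < r \<Longrightarrow> \<rho> x y \<le> (2 / \<delta> ^ m) * r \<Longrightarrow> vol x ((2 / \<delta> ^ m) * r) \<le> V' * vol y r"
    using vol_compare[of "2 / \<delta> ^ m"] by blast
  \<comment> \<open>\<open>V'\<close> compares the volumes and \<open>\<delta> powr (m * p)\<close>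
    the durations of the two generations; 1 - \<gamma> is the share of the slab, and the 2 pays for
    the rounding in \<open>tl\<close>.\<close>
  define \<kappa> where "\<kappa> = (1 - \<gamma>) * \<delta> powr (m * p) / (2 * V')"
  have \<kappa>: "0 < \<kappa>" using \<gamma> \<delta> V' by (simp add: \<kappa>_def)
  define C where "C = max (2 * A / \<kappa>) (A * V * Lr) + 1"
  have C: "0 < C" "2 * A / \<kappa> \<le> C" "A * V * Lr \<le> C" 
  proof -
    have "0 \<le> 2 * A / \<kappa>" using A \<kappa> by simp
    then show "0 < C" by (simp add: C_def max_def)
    show "2 * A / \<kappa> \<le> C" "A * V * Lr \<le> C" unfolding C_def by linarith+
  qed
  \<comment> \<open>The shift, against \<open>s\<close>, that takes a box from the later to the
    earlier part of its cylinder.\<close>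
  let ?i = "- si * (2 * int u + 1)"
  define E where "E = (2 * (2 * \<bar>?i\<bar> + 1) + 3) * C"
  have E: "0 < E" using C by (auto simp: E_def intro!: mult_pos_pos)
  \<comment> \<open>\<open>e\<close> stands for the displacement of a descendant: even one full unit
    backwards the later slab is not left.\<close>
  have inslab: "r \<in> tslab s (tc s k j) (\<gamma> * ll k powr p) (ll k powr p)"
    if r: "\<bar>s * (r - mid k j) - e\<bar> \<le> tl \<sigma> k / 2" and e: "- tl \<sigma> k \<le> e" "e \<le> 0" for r k j e
  proof -
    let ?t = "tl \<sigma> k"
    have t: "0 < ?t" by (rule tl_pos)
    have eq: "s * (r - tc s k j) = s * (r - mid k j) + (real u + 1/2) * ?t"
      by (simp add: tc_def algebra_simps ss')
    have "(\<gamma> * Lr + 4) * ?t \<le> real u * ?t" "(real u + 2) * ?t \<le> (Lr - 1) * ?t"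
      using u t by (auto intro!: mult_right_mono)
    then have "\<gamma> * (Lr * ?t) + 4 * ?t \<le> real u * ?t" "real u * ?t + 2 * ?t \<le> Lr * ?t - ?t"
      by (auto simp: algebra_simps)
    moreover have "s * (r - tc s k j) = s * (r - mid k j) + real u * ?t + ?t / 2" using eq by (simp add: algebra_simps)
    moreover have "- (?t / 2) \<le> s * (r - mid k j) - e" "s * (r - mid k j) - e \<le> ?t / 2" using r by linarith+
    ultimately show ?thesis using e t unfolding tslab_def ll(2) mem_Collect_eq by (intro conjI) linarith+
  qed
  have JN: "(\<integral>\<^sup>+z\<in>box \<sigma> \<tau> P. ennreal (exp (ln (3/2) / E * (f z - aP s a \<tau> P))) \<partial>PM) \<le> 7 * emeasure PM (box \<sigma> \<tau> P)"
    if \<tau>: "\<tau> \<in> {1..N}" and P: "P \<in> boxes \<tau>" for \<tau> P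
  proof -
    interpret G: shift_grid PM "boxes \<tau>" fst shf "box \<sigma> \<tau>" by (rule shift_grid_boxes[OF \<tau> \<sigma>(1)])
    have bound: "ennreal (A * vol (ctr k \<tau> \<alpha>) (ll k) * ll k powr p) \<le> ennreal C * emeasure PM (box \<sigma> \<tau> (k, \<alpha>, j))"
      if \<alpha>: "\<alpha> \<in> I k \<tau>" for k \<alpha> j
    proof -
      have "A * vol (ctr k \<tau> \<alpha>) (ll k) * ll k powr p \<le> A * (V * cvol k \<tau> \<alpha>) * (Lr * tl \<sigma> k)"
        using A V(2)[OF \<tau> \<alpha>] Lr(1) tl_pos[of \<sigma> k] unfolding ll(2) by (intro mult_right_mono mult_left_mono) auto
      also have "\<dots> = (A * V * Lr) * (cvol k \<tau> \<alpha> * tl \<sigma> k)" by simp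
      also have "\<dots> \<le> C * (cvol k \<tau> \<alpha> * tl \<sigma> k)"
        using C(3) cvol_pos[OF \<tau> \<alpha>] tl_pos[of \<sigma> k] by (intro mult_right_mono) (auto intro: less_imp_le)
      finally show ?thesis
        unfolding emeasure_box[OF \<tau> \<alpha>] using C(1) cvol_pos[OF \<tau> \<alpha>] tl_pos[of \<sigma> k]
        by (subst ennreal_mult[symmetric]) (auto intro: ennreal_leI)
    qed
    show ?thesis
    proof (rule G.john_nirenberg[where m=m and C=C and i="?i"])
      show "f \<in> borel_measurable PM" by measurable
      show "0 < m" "0 < C" "P \<in> boxes \<tau>" by (fact m(1) C(1) P)+
      show "E = (2 * (2 * \<bar>?i\<bar> + 1) + 3) * C" by (simp add: E_def)
    next
      fix P P' assume P: "P \<in> boxes \<tau>" "P' \<in> boxes \<tau>" "fst P' = fst P + int m" "box \<sigma> \<tau> P' \<subseteq> box \<sigma> \<tau> P"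
      obtain k \<alpha> j where P_eq: "P = (k, \<alpha>, j)" "\<alpha> \<in> I k \<tau>" using P(1) by (auto simp: boxes_def)
      obtain \<beta> j' where P'_eq: "P' = (k + int m, \<beta>, j')" "\<beta> \<in> I (k + int m) \<tau>" using P(2,3) by (auto simp: boxes_def P_eq)
      let ?l = "k + int m"
      note sub = box_sub_cube_sub[OF P(4)[unfolded P_eq P'_eq] \<tau> P'_eq(2)]
      let ?L = "ll ?l powr p"
      have r: "0 < C1 * rad ?l" using C1 rad_pos by simp
      have radl: "rad ?l = rad k * \<delta> ^ m" by (simp add: rad_add rad_nat)
      have rr: "(2 / \<delta> ^ m) * (C1 * rad ?l) = 2 * C1 * rad k" using \<delta> by (simp add: radl)
      have cc: "\<rho> (ctr k \<tau> \<alpha>) (ctr ?l \<tau> \<beta>) \<le> 2 * C1 * rad k"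
      proof -
        have "ctr ?l \<tau> \<beta> \<in> qb (ctr k \<tau> \<alpha>) (C1 * rad k)"
          using center_in_cube[OF \<tau> P'_eq(2)] sub(1) cube_outer[OF \<tau> P_eq(2)] by blast
        then show ?thesis using mult_pos_pos[OF C1 rad_pos[of k]] by (simp add: qball_def)
      qed
      have v1: "vol (ctr k \<tau> \<alpha>) (ll k) \<le> V' * vol (ctr ?l \<tau> \<beta>) (C1 * rad ?l)"
      proof -
        have "vol (ctr k \<tau> \<alpha>) (ll k) \<le> vol (ctr k \<tau> \<alpha>) (2 * C1 * rad k)"
          using ll[of k] C1 rad_pos[of k] by (intro vol_mono ball_mono) auto
        also have "\<dots> \<le> V' * vol (ctr ?l \<tau> \<beta>) (C1 * rad ?l)"
          using V'(2)[OF r, of "ctr k \<tau> \<alpha>" "ctr ?l \<tau> \<beta>"] cc unfolding rr by simp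
        finally show ?thesis .
      qed
      have v2: "vol (ctr ?l \<tau> \<beta>) (ll ?l) \<le> V' * vol (ctr ?l \<tau> \<beta>) (C1 * rad ?l)"
      proof -
        have "ll ?l \<le> 2 * C1 * rad k"
          using ll(4)[of ?l] rad_mono[of k ?l] C1 by (smt (verit) mult_left_mono of_nat_0_le_iff)
        then have "vol (ctr ?l \<tau> \<beta>) (ll ?l) \<le> vol (ctr ?l \<tau> \<beta>) (2 * C1 * rad k)"
          using ll[of ?l] C1 rad_pos[of k] by (intro vol_mono ball_mono) auto
        also have "\<dots> \<le> V' * vol (ctr ?l \<tau> \<beta>) (C1 * rad ?l)"
          using V'(2)[OF r, of "ctr ?l \<tau> \<beta>" "ctr ?l \<tau> \<beta>"] dist_eq_0[of "ctr ?l \<tau> \<beta>" "ctr ?l \<tau> \<beta>"] C1 rad_pos[of k]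
          unfolding rr by simp
        finally show ?thesis .
      qed
      have sz: "\<kappa> * (v * t) \<le> vol (ctr ?l \<tau> \<beta>) (C1 * rad ?l) * (- (\<gamma> * ?L) - (- ?L))"
        if v: "v \<le> V' * vol (ctr ?l \<tau> \<beta>) (C1 * rad ?l)" "0 \<le> t" "\<delta> powr (m * p) * t \<le> 2 * ?L" for v t
      proof -
        let ?v = "vol (ctr ?l \<tau> \<beta>) (C1 * rad ?l)"
        have "\<kappa> * (v * t) \<le> \<kappa> * (V' * ?v * t)" using v \<kappa> by (intro mult_left_mono mult_right_mono) auto
        also have "\<dots> = (1 - \<gamma>) * ?v / 2 * (\<delta> powr (m * p) * t)" using V'(1) by (simp add: \<kappa>_def)
        also have "\<dots> \<le> (1 - \<gamma>) * ?v / 2 * (2 * ?L)"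
          using v \<gamma> vol_pos[OF r, of "ctr ?l \<tau> \<beta>"] by (intro mult_left_mono) auto
        also have "\<dots> = ?v * (- (\<gamma> * ?L) - (- ?L))" by (simp add: field_simps)
        finally show ?thesis .
      qed
      \<comment> \<open>The earlier slab of the finer cylinder, at times between - L and - \<gamma>
        L from its centre in direction \<open>s\<close>, is so short and so near to the parent box
        that the later slab of the coarser cylinder contains it.\<close>
      have "a (ctr ?l \<tau> \<beta>) (tc s ?l j') (ll ?l) \<le> a (ctr k \<tau> \<alpha>) (tc s k j) (ll k) + 2 * A / \<kappa>"
      proof (rule overlap[OF PB[folded s_def] s A \<kappa> ll(1) ll(1) r, where w="tc s ?l j'" and lo="- ?L" and hi="- (\<gamma> * ?L)" and y="ctr ?l \<tau> \<beta>"])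
        show "- ?L < - (\<gamma> * ?L)" using \<gamma> ll(1)[of ?l] by simp
        have "qb (ctr ?l \<tau> \<beta>) (C1 * rad ?l) \<subseteq> qb (ctr k \<tau> \<alpha>) (C1 * rad k)"
          by (rule balls_nested[OF \<tau> _ P_eq(2) P'_eq(2) sub(1)]) simp
        also have "\<dots> \<subseteq> qb (ctr k \<tau> \<alpha>) (ll k)" by (intro ball_mono ll)
        finally show "qb (ctr ?l \<tau> \<beta>) (C1 * rad ?l) \<subseteq> qb (ctr k \<tau> \<alpha>) (ll k)" .
        show "qb (ctr ?l \<tau> \<beta>) (C1 * rad ?l) \<subseteq> qb (ctr ?l \<tau> \<beta>) (ll ?l)" by (intro ball_mono ll)
        show "tslab s (tc s ?l j') (- ?L) (- (\<gamma> * ?L)) \<subseteq> tslab (- s) (tc s ?l j') (\<gamma> * ?L) ?L"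
          by (auto simp: tslab_def)
        show "tslab s (tc s ?l j') (- ?L) (- (\<gamma> * ?L)) \<subseteq> tslab s (tc s k j) (\<gamma> * ll k powr p) (ll k powr p)"
        proof
          fix q assume "q \<in> tslab s (tc s ?l j') (- ?L) (- (\<gamma> * ?L))"
          then have q: "- ?L < s * (q - tc s ?l j')" "s * (q - tc s ?l j') < - (\<gamma> * ?L)" by (auto simp: tslab_def)
          let ?b = "tl \<sigma> ?l"
          have b: "0 < ?b" by (rule tl_pos)
          have "0 \<le> \<gamma> * ?L" using \<gamma> by simp
          have eq: "s * (q - mid k j) = s * (q - tc s ?l j') + s * (mid ?l j' - mid k j) - (real u + 1/2) * ?b"
            by (simp add: tc_def algebra_simps ss')
          have "\<bar>s * (mid ?l j' - mid k j)\<bar> \<le> tl \<sigma> k / 2" using mid_sub[OF sub(2)] b by (simp add: sabs)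
          moreover have "(real u + 1/2) * ?b \<le> Lr * ?b" using u b by (intro mult_right_mono) auto
          moreover have "0 \<le> (real u + 1/2) * ?b" using b by simp
          moreover have "2 * (Lr * ?b) \<le> tl \<sigma> k" using tlm[of k ?l] by simp
          ultimately show "q \<in> tslab s (tc s k j) (\<gamma> * ll k powr p) (ll k powr p)"
            using q \<open>0 \<le> \<gamma> * ?L\<close> eq unfolding ll(2)
            by (intro inslab[of q k j "s * (q - tc s ?l j') - (real u + 1/2) * ?b", unfolded ll(2)]) linarith+
        qed
        show "\<kappa> * (vol (ctr k \<tau> \<alpha>) (ll k) * ll k powr p) \<le> vol (ctr ?l \<tau> \<beta>) (C1 * rad ?l) * (- (\<gamma> * ?L) - (- ?L))"
        proof (rule sz[OF v1])
          have "Lr * (\<delta> powr (m * p) * tl \<sigma> k) \<le> Lr * (2 * tl \<sigma> ?l)"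
            using tl_ratio(2)[of m k] Lr(1) by (intro mult_left_mono) auto
          then show "\<delta> powr (m * p) * ll k powr p \<le> 2 * ?L" by (simp add: ll(2) ac_simps)
        qed simp
        show "\<kappa> * (vol (ctr ?l \<tau> \<beta>) (ll ?l) * ?L) \<le> vol (ctr ?l \<tau> \<beta>) (C1 * rad ?l) * (- (\<gamma> * ?L) - (- ?L))"
        proof (rule sz[OF v2])
          have "\<delta> powr (m * p) \<le> 1" using \<delta> p by (intro powr_le1) auto
          then have "\<delta> powr (m * p) * ?L \<le> 1 * ?L" by (intro mult_right_mono) auto
          also have "\<dots> \<le> 2 * ?L" by simp
          finally show "\<delta> powr (m * p) * ?L \<le> 2 * ?L" .
        qed simp
      qed
      then show "aP s a \<tau> P' \<le> aP s a \<tau> P + C" using C(2) by (simp add: aP_def P_eq P'_eq)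
    next
      fix P assume P: "P \<in> boxes \<tau>"
      obtain k \<alpha> j where P_eq: "P = (k, \<alpha>, j)" "\<alpha> \<in> I k \<tau>" using P(1) by (auto simp: boxes_def)
      have Qb: "Q k \<tau> \<alpha> \<subseteq> qb (ctr k \<tau> \<alpha>) (ll k)"
        using cube_outer[OF \<tau> P_eq(2)] ball_mono[OF ll(3)] by blast
      let ?W = "qb (ctr k \<tau> \<alpha>) (ll k) \<times> tslab s (tc s k j) (\<gamma> * ll k powr p) (ll k powr p)"
      have W: "?W \<in> sets PM" by (intro sets_qb_tslab ll)
      moreover have "box \<sigma> \<tau> P \<subseteq> ?W"
      proof
        fix z assume z: "z \<in> box \<sigma> \<tau> P"
        obtain x r where xr: "z = (x, r)" by (cases z)
        have "\<bar>s * (r - mid k j) - 0\<bar> \<le> tl \<sigma> k / 2"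
          using time_interval_mid[of r j k] z by (simp add: xr P_eq sabs)
        from inslab[OF this] have "r \<in> tslab s (tc s k j) (\<gamma> * ll k powr p) (ll k powr p)"
          using tl_pos[of \<sigma> k] by simp
        then show "z \<in> ?W" using Qb z by (auto simp: xr P_eq)
      qed
      moreover have "box \<sigma> \<tau> (shf ?i P') \<subseteq> ?W"
        if P': "P' \<in> boxes \<tau>" "fst P + int m \<le> fst P'" "box \<sigma> \<tau> P' \<subseteq> box \<sigma> \<tau> P" for P'
      proof
        obtain l \<beta> j' where P'_eq: "P' = (l, \<beta>, j')" "\<beta> \<in> I l \<tau>" using P'(1) by (auto simp: boxes_def)
        note sub = box_sub_cube_sub[OF P'(3)[unfolded P_eq P'_eq] \<tau> P'_eq(2)]
        have kl: "k + int m \<le> l" using P'(2) by (simp add: P_eq P'_eq)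
        let ?b = "tl \<sigma> l"
        have b: "0 < ?b" by (rule tl_pos)
        fix z assume z: "z \<in> box \<sigma> \<tau> (shf ?i P')"
        obtain x r where xr: "z = (x, r)" by (cases z)
        have "\<bar>r - mid l (j' + ?i)\<bar> \<le> ?b / 2" using time_interval_mid[of r "j' + ?i" l] z by (simp add: xr P'_eq)
        moreover have "mid l (j' + ?i) = mid l j' - s * ((2 * real u + 1) * ?b)"
          by (simp add: mid_def s_def algebra_simps)
        ultimately have 1: "\<bar>s * (r - mid l j' + s * ((2 * real u + 1) * ?b))\<bar> \<le> ?b / 2" unfolding sabs by linarith
        have "s * (r - mid l j' + s * ((2 * real u + 1) * ?b)) = s * (r - mid l j') + (s * s) * ((2 * real u + 1) * ?b)"
          by (simp add: algebra_simps)
        then have 1: "\<bar>s * (r - mid l j') + (2 * real u + 1) * ?b\<bar> \<le> ?b / 2" using 1 ss by simp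
        have 2: "\<bar>s * (mid l j' - mid k j)\<bar> \<le> tl \<sigma> k / 2 - ?b / 2" using mid_sub[OF sub(2)] by (simp add: sabs)
        have 3: "s * (r - mid k j) = s * (r - mid l j') + s * (mid l j' - mid k j)" by (simp add: algebra_simps)
        have 4: "(2 * real u + 1) * ?b \<le> 2 * Lr * ?b" using u b by (intro mult_right_mono) auto
        have 5: "0 \<le> (2 * real u + 1) * ?b" using b by simp
        have "\<bar>s * (r - mid k j) - (- ((2 * real u + 1) * ?b))\<bar> \<le> tl \<sigma> k / 2" using 1 2 3 by linarith
        from inslab[OF this] have "r \<in> tslab s (tc s k j) (\<gamma> * ll k powr p) (ll k powr p)"
          using 4 5 tlm[OF kl] by simp
        moreover have "x \<in> Q k \<tau> \<alpha>" using z sub(1) by (auto simp: xr P'_eq)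
        ultimately show "z \<in> ?W" using Qb by (auto simp: xr)
      qed
      moreover have "(\<integral>\<^sup>+z\<in>?W. ennreal (max 0 (f z - aP s a \<tau> P)) \<partial>PM) \<le> ennreal C * emeasure PM (box \<sigma> \<tau> P)"
        using order_trans[OF PB_upper[OF PB[folded s_def] ll(1)] bound[OF P_eq(2)]] by (simp add: aP_def P_eq)
      ultimately show "\<exists>W\<in>sets PM. box \<sigma> \<tau> P \<subseteq> W \<and>
         (\<forall>P'\<in>boxes \<tau>. fst P + int m \<le> fst P' \<longrightarrow> box \<sigma> \<tau> P' \<subseteq> box \<sigma> \<tau> P \<longrightarrow> box \<sigma> \<tau> (shf ?i P') \<subseteq> W) \<and>
         (\<integral>\<^sup>+z\<in>W. ennreal (max 0 (f z - aP s a \<tau> P)) \<partial>PM) \<le> ennreal C * emeasure PM (box \<sigma> \<tau> P)" by blast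
      have "box \<sigma> \<tau> (shf ?i P) \<subseteq> qb (ctr k \<tau> \<alpha>) (ll k) \<times> tslab (-s) (tc s k j) (\<gamma> * ll k powr p) (ll k powr p)"
      proof
        let ?b = "tl \<sigma> k"
        have b: "0 < ?b" by (rule tl_pos)
        fix z assume z: "z \<in> box \<sigma> \<tau> (shf ?i P)"
        obtain x r where xr: "z = (x, r)" by (cases z)
        have "\<bar>r - mid k (j + ?i)\<bar> \<le> ?b / 2" using time_interval_mid[of r "j + ?i" k] z by (simp add: xr P_eq)
        moreover have "mid k (j + ?i) = mid k j - s * ((2 * real u + 1) * ?b)"
          by (simp add: mid_def s_def algebra_simps)
        ultimately have 1: "\<bar>s * (r - mid k j + s * ((2 * real u + 1) * ?b))\<bar> \<le> ?b / 2" unfolding sabs by linarith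
        have "s * (r - mid k j + s * ((2 * real u + 1) * ?b)) = s * (r - mid k j) + (s * s) * ((2 * real u + 1) * ?b)"
          by (simp add: algebra_simps)
        then have 1: "\<bar>s * (r - mid k j) + (2 * real u + 1) * ?b\<bar> \<le> ?b / 2" using 1 ss by simp
        have eq: "s * (r - tc s k j) = s * (r - mid k j) + (real u + 1/2) * ?b"
          by (simp add: tc_def algebra_simps ss')
        have "(\<gamma> * Lr + 4) * ?b \<le> real u * ?b" "(real u + 2) * ?b \<le> (Lr - 1) * ?b"
          using u b by (auto intro!: mult_right_mono)
        then have "\<gamma> * (Lr * ?b) + 4 * ?b \<le> real u * ?b" "real u * ?b + 2 * ?b \<le> Lr * ?b - ?b"
          by (auto simp: algebra_simps)
        moreover have "\<bar>s * (r - mid k j) + 2 * (real u * ?b) + ?b\<bar> \<le> ?b / 2"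
          using 1 by (simp add: algebra_simps)
        moreover have "s * (r - tc s k j) = s * (r - mid k j) + real u * ?b + ?b / 2" using eq by (simp add: algebra_simps)
        ultimately have "\<gamma> * (Lr * ?b) < - (s * (r - tc s k j)) \<and> - (s * (r - tc s k j)) < Lr * ?b"
          using b by (intro conjI) linarith+
        then have "r \<in> tslab (-s) (tc s k j) (\<gamma> * ll k powr p) (ll k powr p)"
          by (simp add: tslab_def ll(2))
        then show "z \<in> qb (ctr k \<tau> \<alpha>) (ll k) \<times> tslab (-s) (tc s k j) (\<gamma> * ll k powr p) (ll k powr p)"
          using Qb z by (auto simp: xr P_eq)
      qed
      from nn_set_integral_mono_set[OF this] PB_lower[OF PB[folded s_def] ll(1)]
      have "(\<integral>\<^sup>+z\<in>box \<sigma> \<tau> (shf ?i P). ennreal (max 0 (aP s a \<tau> P - f z)) \<partial>PM) \<le> ennreal (A * vol (ctr k \<tau> \<alpha>) (ll k) * ll k powr p)"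
        unfolding aP_def P_eq prod.case by (rule order_trans)
      also note bound[OF P_eq(2), of j, folded P_eq(1)]
      finally show "(\<integral>\<^sup>+z\<in>box \<sigma> \<tau> (shf ?i P). ennreal (max 0 (aP s a \<tau> P - f z)) \<partial>PM) \<le> ennreal C * emeasure PM (box \<sigma> \<tau> P)" .
    qed
  qed
  moreover have "0 < ln (3/2) / E" using E by simp
  ultimately show ?thesis unfolding s_def by blast
qed

end

section \<open>Slab averages and shifted box averages\<close>

context homogeneous_dyadic
begin

text \<open>Both maximal functions at once, with the sign \<open>s\<close> selecting the side in
  time, so that an estimate is proved only once.\<close>

definition Mx :: "real \<Rightarrow> real \<Rightarrow> ('a \<times> real) measure \<Rightarrow> 'a \<times> real \<Rightarrow> ennreal" where
  "Mx s \<eta> m w = (SUP (\<tau>, k, \<alpha>) \<in> {(\<tau>, k, \<alpha>). \<tau> \<in> {1..N} \<and> \<alpha> \<in> I k \<tau> \<and> fst w \<in> Q k \<tau> \<alpha>}.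
     emeasure m (Q k \<tau> \<alpha> \<times> tslab s (snd w) (\<eta> * dur k) (dur k)) / emeasure PM (Q k \<tau> \<alpha> \<times> tslab s (snd w) (\<eta> * dur k) (dur k)))"

lemma max_plus_eq_Mx: "max_plus p M \<delta> N I Q \<eta> m = Mx 1 \<eta> m"
  and max_minus_eq_Mx: "max_minus p M \<delta> N I Q \<eta> m = Mx (-1) \<eta> m"
  by (auto simp: fun_eq_iff max_plus_def max_minus_def Mx_def rect_plus_def rect_minus_def tslab_plus tslab_minus dur_def)

lemma emeasure_slab:
  assumes "\<tau> \<in> {1..N}" "\<alpha> \<in> I k \<tau>" and s: "s = 1 \<or> s = -1" and \<eta>: "\<eta> \<le> 1"
  shows "emeasure PM (Q k \<tau> \<alpha> \<times> tslab s t (\<eta> * dur k) (dur k)) = ennreal (cvol k \<tau> \<alpha> * ((1 - \<eta>) * dur k))"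
proof -
  have "\<eta> * dur k \<le> 1 * dur k" using \<eta> dur_pos[of k] by (intro mult_right_mono) auto
  moreover have "(1 - \<eta>) * dur k = dur k - \<eta> * dur k" by (simp add: algebra_simps)
  ultimately show ?thesis
    using assms(1,2) cvol_pos[OF assms(1,2)]
    by (simp add: emeasure_Times cube_sets emeasure_cube emeasure_tslab[OF s] ennreal_mult)
qed

text \<open>The numbers of boxes by which one may have to move from the box of a point at time t to
  meet the slab from \<eta> dur k to dur k after t. Here \<open>tl \<sigma> k\<close> lies between
  \<sigma> dur k / 2 and \<sigma> dur k, and the positions inside the two boxes account for the one
  unit at either end.\<close>

definition lag :: "real \<Rightarrow> real \<Rightarrow> int set" where
  "lag \<eta> \<sigma> = {i. \<eta> / \<sigma> - 1 < i \<and> i < 2 / \<sigma> + 1}"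

lemma finite_lag: "finite (lag \<eta> \<sigma>)"
proof (rule finite_subset)
  show "lag \<eta> \<sigma> \<subseteq> {\<lfloor>\<eta> / \<sigma> - 1\<rfloor>..\<lceil>2 / \<sigma> + 1\<rceil>}" by (auto simp: lag_def) linarith+
qed auto

lemma slab_subset:
  assumes \<sigma>: "0 < \<sigma>" and si: "si = 1 \<or> si = -1" and \<eta>: "0 \<le> \<eta>"
    and t: "t \<in> {real_of_int j * tl \<sigma> k ..< (real_of_int j + 1) * tl \<sigma> k}"
  shows "S \<times> tslab (of_int si) t (\<eta> * dur k) (dur k) \<subseteq>
    (\<Union>i\<in>lag \<eta> \<sigma>. S \<times> {real_of_int (j + si * i) * tl \<sigma> k ..< (real_of_int (j + si * i) + 1) * tl \<sigma> k})"
proof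
  fix z assume z: "z \<in> S \<times> tslab (of_int si) t (\<eta> * dur k) (dur k)"
  obtain x r where xr: "z = (x, r)" by (cases z)
  let ?b = "tl \<sigma> k"
  have b: "0 < ?b" by (rule tl_pos)
  define i where "i = si * (\<lfloor>r / ?b\<rfloor> - j)"
  have j: "j + si * i = \<lfloor>r / ?b\<rfloor>" using si by (auto simp: i_def)
  have r: "real_of_int \<lfloor>r / ?b\<rfloor> * ?b \<le> r" "r < (real_of_int \<lfloor>r / ?b\<rfloor> + 1) * ?b"
    using floor_divide_lower[OF b] floor_divide_upper[OF b] by auto
  have q: "\<eta> * dur k < of_int si * (r - t)" "of_int si * (r - t) < dur k" using z by (auto simp: xr tslab_def)
  have diff: "\<bar>of_int si * (r - t) - real_of_int i * ?b\<bar> < ?b"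
  proof -
    have "of_int si * (r - t) - real_of_int i * ?b = of_int si * ((r - real_of_int \<lfloor>r / ?b\<rfloor> * ?b) - (t - real_of_int j * ?b))"
      by (simp add: i_def algebra_simps)
    moreover have "\<bar>(r - real_of_int \<lfloor>r / ?b\<rfloor> * ?b) - (t - real_of_int j * ?b)\<bar> < ?b"
      using r t by (auto simp: algebra_simps abs_less_iff)
    ultimately show ?thesis using si by (auto simp: abs_mult)
  qed
  have "\<sigma> * dur k < 2 * ?b" "?b \<le> \<sigma> * dur k" using tl_bounds[OF \<sigma>] by auto
  then have d: "dur k < 2 / \<sigma> * ?b" "?b / \<sigma> \<le> dur k" using \<sigma> by (auto simp: field_simps)
  have "\<eta> * (?b / \<sigma>) \<le> \<eta> * dur k" using d \<eta> by (intro mult_left_mono) auto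
  then have "(\<eta> / \<sigma> - 1) * ?b < real_of_int i * ?b" "real_of_int i * ?b < (2 / \<sigma> + 1) * ?b"
    using q diff d by (auto simp: algebra_simps abs_less_iff)
  then have "i \<in> lag \<eta> \<sigma>" using b by (simp add: lag_def)
  moreover have "z \<in> S \<times> {real_of_int (j + si * i) * tl \<sigma> k ..< (real_of_int (j + si * i) + 1) * tl \<sigma> k}"
    using z r unfolding j xr by auto
  ultimately show "z \<in> (\<Union>i\<in>lag \<eta> \<sigma>. S \<times> {real_of_int (j + si * i) * tl \<sigma> k ..< (real_of_int (j + si * i) + 1) * tl \<sigma> k})" by blast
qed

text \<open>Cover the slab by the boxes from \<open>slab_subset\<close> and normalise by one box
  instead of the slab: 1 / dur k \<le> \<sigma> / tl \<sigma> k.\<close>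

lemma slab_le:
  assumes \<sigma>: "0 < \<sigma>" and si: "si = 1 \<or> si = -1" and \<eta>: "0 \<le> \<eta>" "\<eta> < 1"
    and \<tau>: "\<tau> \<in> {1..N}" "\<alpha> \<in> I k \<tau>"
    and t: "t \<in> {real_of_int j * tl \<sigma> k ..< (real_of_int j + 1) * tl \<sigma> k}"
    and m: "\<And>P. P \<in> boxes \<tau> \<Longrightarrow> box \<sigma> \<tau> P \<in> sets m"
  shows "emeasure m (Q k \<tau> \<alpha> \<times> tslab (of_int si) t (\<eta> * dur k) (dur k))
      / emeasure PM (Q k \<tau> \<alpha> \<times> tslab (of_int si) t (\<eta> * dur k) (dur k))
    \<le> ennreal (\<sigma> / (1 - \<eta>)) * (\<Sum>i\<in>lag \<eta> \<sigma>. emeasure m (box \<sigma> \<tau> (shf (si * i) (k, \<alpha>, j))) / emeasure PM (box \<sigma> \<tau> (k, \<alpha>, j)))"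
proof -
  let ?S = "Q k \<tau> \<alpha> \<times> tslab (of_int si) t (\<eta> * dur k) (dur k)"
  let ?v = "cvol k \<tau> \<alpha>"
  have sets: "box \<sigma> \<tau> (shf (si * i) (k, \<alpha>, j)) \<in> sets m" for i
    using \<tau>(2) by (intro m) (simp add: boxes_def)
  have "emeasure m ?S \<le> emeasure m (\<Union>i\<in>lag \<eta> \<sigma>. box \<sigma> \<tau> (shf (si * i) (k, \<alpha>, j)))"
    using slab_subset[OF \<sigma> si \<eta>(1) t, of "Q k \<tau> \<alpha>"] sets finite_lag by (intro emeasure_mono) auto
  also have "\<dots> \<le> (\<Sum>i\<in>lag \<eta> \<sigma>. emeasure m (box \<sigma> \<tau> (shf (si * i) (k, \<alpha>, j))))"
    using sets finite_lag by (intro emeasure_subadditive_finite) auto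
  finally have 1: "emeasure m ?S \<le> (\<Sum>i\<in>lag \<eta> \<sigma>. emeasure m (box \<sigma> \<tau> (shf (si * i) (k, \<alpha>, j))))" .
  have s: "real_of_int si = 1 \<or> real_of_int si = -1" using si by auto
  have v: "0 < ?v" by (rule cvol_pos[OF \<tau>])
  have b: "0 < tl \<sigma> k" by (rule tl_pos)
  have d: "0 < (1 - \<eta>) * dur k" using \<eta> dur_pos by simp
  have le: "1 / (?v * ((1 - \<eta>) * dur k)) \<le> (\<sigma> / (1 - \<eta>)) * (1 / (?v * tl \<sigma> k))"
  proof -
    have "1 / dur k \<le> \<sigma> / tl \<sigma> k" using b dur_pos[of k] tl_bounds(1)[OF \<sigma>, of k] by (simp add: field_simps)
    then have "(1 / (?v * (1 - \<eta>))) * (1 / dur k) \<le> (1 / (?v * (1 - \<eta>))) * (\<sigma> / tl \<sigma> k)"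
      using v \<eta> by (intro mult_left_mono) auto
    then show ?thesis by (simp add: mult.assoc mult.commute mult.left_commute)
  qed
  have inv: "x / ennreal c = x * ennreal (1 / c)" if "0 < c" for x c
    using that by (simp add: divide_ennreal_def inverse_ennreal inverse_eq_divide)
  have "emeasure m ?S / emeasure PM ?S = emeasure m ?S * ennreal (1 / (?v * ((1 - \<eta>) * dur k)))"
    unfolding emeasure_slab[OF \<tau> s less_imp_le[OF \<eta>(2)]] using v d by (intro inv) simp
  also have "\<dots> \<le> (\<Sum>i\<in>lag \<eta> \<sigma>. emeasure m (box \<sigma> \<tau> (shf (si * i) (k, \<alpha>, j)))) * ennreal ((\<sigma> / (1 - \<eta>)) * (1 / (?v * tl \<sigma> k)))"
    using 1 le by (intro mult_mono ennreal_leI) auto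
  also have "\<dots> = ennreal (\<sigma> / (1 - \<eta>)) * (\<Sum>i\<in>lag \<eta> \<sigma>. emeasure m (box \<sigma> \<tau> (shf (si * i) (k, \<alpha>, j))) * ennreal (1 / (?v * tl \<sigma> k)))"
  proof -
    have "ennreal ((\<sigma> / (1 - \<eta>)) * (1 / (?v * tl \<sigma> k))) = ennreal (\<sigma> / (1 - \<eta>)) * ennreal (1 / (?v * tl \<sigma> k))"
      using \<eta> \<sigma> v b by (intro ennreal_mult) auto
    then show ?thesis by (simp only: mult.left_commute[of _ "ennreal (\<sigma> / (1 - \<eta>))"] sum_distrib_right)
  qed
  also have "(\<Sum>i\<in>lag \<eta> \<sigma>. emeasure m (box \<sigma> \<tau> (shf (si * i) (k, \<alpha>, j))) * ennreal (1 / (?v * tl \<sigma> k)))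
      = (\<Sum>i\<in>lag \<eta> \<sigma>. emeasure m (box \<sigma> \<tau> (shf (si * i) (k, \<alpha>, j))) / emeasure PM (box \<sigma> \<tau> (k, \<alpha>, j)))"
    unfolding emeasure_box[OF \<tau>] using v b by (intro sum.cong refl inv[symmetric]) simp
  finally show ?thesis .
qed

end

section \<open>The lagged Muckenhoupt condition and weighted bounds\<close>

context pbmo_grid
begin

text \<open>Both boxes are cut \<open>m\<close> generations finer, and a chain of cylinders joins
  every piece of the shifted box to every piece of \<open>P\<close>. Hence the supremum
  \<open>H\<close> of the constants over the pieces of \<open>P\<close> exceeds the constant of any
  piece of the shift by at most \<open>D'\<close>. The two integrals are bounded by exp (8 \<kappa>
  H) and exp (4 \<kappa> (D' - H)); in the product with the square of the second, \<open>H\<close>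
  cancels.\<close>

lemma weighted_condition:
  assumes PB: "PB (of_int si) \<gamma> A a f" and si: "si = 1 \<or> si = -1" and A: "0 \<le> A" and \<kappa>: "0 < \<kappa>"
    and up: "\<And>\<tau> P. \<tau> \<in> {1..N} \<Longrightarrow> P \<in> boxes \<tau> \<Longrightarrow>
      (\<integral>\<^sup>+z\<in>box \<sigma> \<tau> P. ennreal (exp (8 * \<kappa> * (f z - aP (of_int si) a \<tau> P))) \<partial>PM) \<le> 8 * emeasure PM (box \<sigma> \<tau> P)"
    and lo: "\<And>\<tau> P. \<tau> \<in> {1..N} \<Longrightarrow> P \<in> boxes \<tau> \<Longrightarrow>
      (\<integral>\<^sup>+z\<in>box \<sigma> \<tau> P. ennreal (exp (4 * \<kappa> * (aP (of_int (- si)) a \<tau> P - f z))) \<partial>PM) \<le> 8 * emeasure PM (box \<sigma> \<tau> P)"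
    and i: "2 \<le> i"
  shows "\<exists>K\<ge>0. \<forall>\<tau>\<in>{1..N}. \<forall>P\<in>boxes \<tau>.
      (\<integral>\<^sup>+z\<in>box \<sigma> \<tau> P. ennreal (exp (\<kappa> * f z)) ^ 8 \<partial>PM) * (\<integral>\<^sup>+z\<in>box \<sigma> \<tau> (shf (- si * i) P). ennreal (exp (- (\<kappa> * f z))) ^ 4 \<partial>PM) ^ 2
      \<le> ennreal K * emeasure PM (box \<sigma> \<tau> P) ^ 3"
proof -
  define s where "s = real_of_int si"
  have s: "s = 1 \<or> s = -1" using si by (auto simp: s_def)
  have ss': "s * (s * y) = y" for y using s by auto
  have sabs: "\<bar>s * y\<bar> = \<bar>y\<bar>" for y using s by (auto simp: abs_mult)
  note [measurable] = PB_measurable[OF PB]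
  obtain D Kc n0 where D: "0 \<le> D" "0 < Kc" "\<And>a f x y t t' l n. PB s \<gamma> A a f \<Longrightarrow> 0 < l \<Longrightarrow>
     n0 \<le> real n \<Longrightarrow> Kc * \<rho> x y / l + 1 \<le> real n \<Longrightarrow>
     real n * ((1 + \<gamma>) * l powr p) \<le> s * (t' - t) \<Longrightarrow> s * (t' - t) \<le> (real n + 1) * ((1 + \<gamma>) * l powr p) \<Longrightarrow>
     a y t' l \<le> a x t l + real n * D"
    using chain[OF \<gamma> s A] by metis
  \<comment> \<open>The centres of two pieces are at most 2 K0 y radii apart, with y the ratio of
    the radii, so a chain needs about R y steps. \<open>X\<close> also absorbs \<open>n0\<close> and
    the loss from rounding the number of steps down.\<close>
  define R where "R = Kc * (2 * K0 * (real_of_int i + 1) )"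
  define X where "X = R + \<bar>n0\<bar> + 2"
  have R: "0 \<le> R" using D(2) K0 i by (simp add: R_def)
  have X: "1 \<le> X" "R \<le> X" "n0 + 2 \<le> X" using R by (auto simp: X_def)
  text \<open>Since \<open>p > 1\<close>, on fine scales the time between the two boxes allows for enough steps to cover
    their spatial distance.\<close>
  obtain m where m: "16 * Lr * X < ((1 / \<delta>) powr (p - 1)) ^ m"
  proof -
    have "1 < (1 / \<delta>) powr (p - 1)" using \<delta> p by (intro gr_one_powr) auto
    then show thesis using real_arch_pow that by blast
  qed
  define y where "y = (1 / \<delta>) ^ m"
  have y: "1 \<le> y" using \<delta> by (simp add: y_def)
  have yp: "y powr p = 1 / \<delta> powr (m * p)"
    using \<delta> by (simp add: y_def powr_realpow[symmetric] powr_powr powr_divide)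
  have ypow: "8 * Lr * (X * y + X) \<le> y powr p"
  proof -
    have "y powr p = y powr (p - 1) * y" using y by (simp add: powr_diff)
    moreover have "y powr (p - 1) = ((1 / \<delta>) powr (p - 1)) ^ m"
    proof -
      have "((1 / \<delta>) powr real m) powr (p - 1) = ((1 / \<delta>) powr (p - 1)) powr real m"
        by (simp only: powr_powr mult.commute)
      then show ?thesis using \<delta> by (simp add: y_def powr_realpow)
    qed
    ultimately have "16 * Lr * X * y \<le> y powr p" using m y by (auto intro!: mult_right_mono)
    moreover have "8 * Lr * X * 1 \<le> 8 * Lr * X * y" using Lr(1) X y by (intro mult_left_mono) auto
    ultimately show ?thesis by (simp add: algebra_simps)
  qed
  define D' where "D' = (real_of_int i + 1) * (2 * y powr p) / Lr * D"
  have compare: "aP s a \<tau> P' \<le> aP (-s) a \<tau> P'' + D'"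
    if \<tau>: "\<tau> \<in> {1..N}" and P: "P \<in> boxes \<tau>" and P': "P' \<in> boxes \<tau>" "fst P' = fst P + int m" "box \<sigma> \<tau> P' \<subseteq> box \<sigma> \<tau> P"
      and P'': "P'' \<in> boxes \<tau>" "fst P'' = fst P + int m" "box \<sigma> \<tau> P'' \<subseteq> box \<sigma> \<tau> (shf (- si * i) P)"
    for \<tau> P P' P''
  proof -
    obtain k \<alpha> j where P_eq: "P = (k, \<alpha>, j)" "\<alpha> \<in> I k \<tau>" using P(1) by (auto simp: boxes_def)
    obtain \<beta> j' where P'_eq: "P' = (k + int m, \<beta>, j')" "\<beta> \<in> I (k + int m) \<tau>" using P' by (auto simp: boxes_def P_eq)
    obtain \<beta>' j'' where P''_eq: "P'' = (k + int m, \<beta>', j'')" "\<beta>' \<in> I (k + int m) \<tau>" using P'' by (auto simp: boxes_def P_eq)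
    let ?l = "k + int m"
    let ?b = "tl \<sigma> k" and ?b' = "tl \<sigma> ?l"
    have b: "0 < ?b" "0 < ?b'" by (rule tl_pos)+
    note sub' = box_sub_cube_sub[OF P'(3)[unfolded P_eq P'_eq] \<tau> P'_eq(2)]
    note sub'' = box_sub_cube_sub[OF P''(3)[unfolded P_eq P''_eq shf.simps] \<tau> P''_eq(2)]
    have ratio: "y powr p * ?b' \<le> 2 * ?b" "?b \<le> 2 * y powr p * ?b'"
      using tl_ratio(1)[of k m] tl_ratio(2)[of m k] \<delta> unfolding yp by (auto simp: field_simps)
    have ratio': "y powr p * ?b' \<le> 2 * ?b" by (rule ratio)
    \<comment> \<open>The time available to the chain. The two boxes are at least i - 1 \<ge> 1
      units apart, and the placement of the two cylinders, on facing sides of their boxes, uses up 2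
      u + 1 of the finer units.\<close>
    define T where "T = s * (tc s ?l j' - tc (-s) ?l j'')"
    have T: "T = s * (mid ?l j' - mid ?l j'') - (2 * real u + 1) * ?b'"
      by (simp add: T_def tc_def algebra_simps ss')
    have "\<bar>s * (mid ?l j' - mid k j)\<bar> \<le> ?b / 2" "\<bar>s * (mid ?l j'' - mid k (j + - si * i))\<bar> \<le> ?b / 2"
      using mid_sub[OF sub'(2)] mid_sub[OF sub''(2)] b by (auto simp: sabs)
    moreover have "s * mid k (j + - si * i) = s * mid k j - real_of_int i * ?b"
      by (simp add: mid_def algebra_simps s_def[symmetric] ss')
    then have "s * (mid ?l j' - mid ?l j'') = s * (mid ?l j' - mid k j) - s * (mid ?l j'' - mid k (j + - si * i)) + real_of_int i * ?b"
      by (simp add: algebra_simps)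
    ultimately have mm: "real_of_int i * ?b - ?b \<le> s * (mid ?l j' - mid ?l j'')" "s * (mid ?l j' - mid ?l j'') \<le> real_of_int i * ?b + ?b"
      by linarith+
    have "2 * ?b \<le> real_of_int i * ?b" using i b by (intro mult_right_mono) auto
    moreover have "(2 * real u + 1) * ?b' \<le> 2 * Lr * ?b'" using u b by (intro mult_right_mono) auto
    moreover have "0 \<le> (2 * real u + 1) * ?b'" using b by simp
    moreover have Lb: "8 * (Lr * ?b') \<le> 2 * ?b"
    proof -
      have "8 * Lr * 1 \<le> 8 * Lr * (X * y + X)" using X y Lr(1) by (intro mult_left_mono) (auto intro!: add_increasing)
      then have "8 * Lr \<le> y powr p" using ypow by simp
      then have "8 * Lr * ?b' \<le> y powr p * ?b'" using b by (intro mult_right_mono) auto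
      then show ?thesis using ratio by simp
    qed
    ultimately have Tb: "?b / 2 \<le> T" "T \<le> (real_of_int i + 1) * ?b"
      using mm unfolding T by (auto simp: algebra_simps)
    \<comment> \<open>The ideal duration of one step of the chain; \<open>n\<close> below is the
      number of such steps that fit into \<open>T\<close>.\<close>
    define w where "w = (1 + \<gamma>) * ll ?l powr p"
    have w: "w = (1 + \<gamma>) * (Lr * ?b')" by (simp add: w_def ll(2))
    have LB: "0 < Lr * ?b'" using Lr(1) b by simp
    have wb: "Lr * ?b' \<le> w" "w \<le> 2 * (Lr * ?b')" "0 < w"
    proof -
      have g: "v \<le> (1 + \<gamma>) * v" "(1 + \<gamma>) * v \<le> 2 * v" if "0 < v" for v
        using mult_right_mono[of 1 "1 + \<gamma>" v] mult_right_mono[of "1 + \<gamma>" 2 v] \<gamma> that by simp_all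
      show "Lr * ?b' \<le> w" "w \<le> 2 * (Lr * ?b')" unfolding w by (rule g[OF LB])+
      then show "0 < w" using LB by (rule_tac less_le_trans)
    qed
    define n where "n = nat \<lfloor>T / w\<rfloor>"
    have T0: "0 \<le> T / w" using Tb wb b by simp
    then have n: "real n \<le> T / w" "T / w < real n + 1" unfolding n_def by linarith+
    have nT: "real n * w \<le> T" "T \<le> (real n + 1) * w" using n wb by (auto simp: field_simps)
    have nX: "X * y + X - 1 \<le> real n"
    proof -
      have "8 * Lr * (X * y + X) * ?b' \<le> y powr p * ?b'" using ypow b by (intro mult_right_mono) auto
      then have "8 * Lr * (X * y + X) * ?b' \<le> 2 * ?b" using ratio by (linarith | blast intro: order_trans | simp add: algebra_simps)
      moreover have "(X * y + X) * w \<le> (X * y + X) * (2 * (Lr * ?b'))" using wb X y by (intro mult_left_mono) auto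
      ultimately have "(X * y + X) * w \<le> ?b / 2" by (simp add: algebra_simps)
      then have "(X * y + X) * w \<le> T" using Tb by simp
      then have "X * y + X \<le> T / w" using wb by (simp add: field_simps)
      then show ?thesis using n by simp
    qed
    have Xy: "1 \<le> X * y" "R * y \<le> X * y" using X y mult_mono[of 1 X 1 y] by (auto intro!: mult_right_mono)
    have "aP s a \<tau> P' \<le> aP (-s) a \<tau> P'' + real n * D"
      unfolding aP_def P'_eq P''_eq prod.case
    proof (rule D(3)[OF PB[folded s_def] ll(1)])
      show "n0 \<le> real n" using nX X Xy by linarith
      show "real n * ((1 + \<gamma>) * ll ?l powr p) \<le> s * (tc s ?l j' - tc (-s) ?l j'')"
        "s * (tc s ?l j' - tc (-s) ?l j'') \<le> (real n + 1) * ((1 + \<gamma>) * ll ?l powr p)"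
        using nT by (simp_all add: w_def T_def)
      have "ctr ?l \<tau> \<beta>' \<in> Q k \<tau> \<alpha>" "ctr ?l \<tau> \<beta> \<in> Q k \<tau> \<alpha>"
        using center_in_cube[OF \<tau>] P'_eq P''_eq sub'(1) sub''(1) by blast+
      then have "\<rho> (ctr ?l \<tau> \<beta>') (ctr ?l \<tau> \<beta>) \<le> 2 * K0 * C1 * rad k"
        using cube_in_ball[OF \<tau> P_eq(2)] less_imp_le by blast
      also have "2 * K0 * C1 * rad k \<le> 2 * K0 * (ll ?l * y)"
      proof -
        have "C1 * rad k = C1 * rad ?l * y" using \<delta> by (simp add: y_def rad_add rad_nat power_one_over)
        also have "\<dots> \<le> ll ?l * y" using ll(3) y by (intro mult_right_mono) auto
        finally show ?thesis using K0 by (simp add: mult.assoc mult_left_mono)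
      qed
      finally have "Kc * \<rho> (ctr ?l \<tau> \<beta>') (ctr ?l \<tau> \<beta>) / ll ?l \<le> Kc * (2 * K0 * (ll ?l * y)) / ll ?l"
        using D(2) ll(1)[of ?l] by (intro divide_right_mono mult_left_mono) auto
      also have "\<dots> = Kc * (2 * K0 * 1) * y" using ll(1)[of ?l] by simp
      also have "\<dots> \<le> R * y" unfolding R_def using D(2) K0 i y by (intro mult_right_mono mult_left_mono) auto
      finally show "Kc * \<rho> (ctr ?l \<tau> \<beta>') (ctr ?l \<tau> \<beta>) / ll ?l + 1 \<le> real n" using nX X Xy R by (simp add: X_def)
    qed
    also have "real n * D \<le> D'"
    proof -
      have "real n * (Lr * ?b') \<le> real n * w" using wb by (intro mult_left_mono) auto
      also have "\<dots> \<le> (real_of_int i + 1) * ?b" using nT Tb by simp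
      also have "\<dots> \<le> (real_of_int i + 1) * (2 * y powr p * ?b')" using ratio i by (intro mult_left_mono) auto
      finally have "(real n * Lr) * ?b' \<le> ((real_of_int i + 1) * (2 * y powr p)) * ?b'" by (simp add: ac_simps)
      then have "real n * Lr \<le> (real_of_int i + 1) * (2 * y powr p)" using b by (rule_tac mult_right_le_imp_le) auto
      then have "real n \<le> (real_of_int i + 1) * (2 * y powr p) / Lr" using Lr(1) by (simp add: field_simps)
      then show ?thesis unfolding D'_def using D(1) by (rule mult_right_mono)
    qed
    finally show ?thesis by simp
  qed
  define K where "K = 8 ^ 3 * exp (8 * \<kappa> * D')"
  have "(\<integral>\<^sup>+z\<in>box \<sigma> \<tau> P. ennreal (exp (\<kappa> * f z)) ^ 8 \<partial>PM) * (\<integral>\<^sup>+z\<in>box \<sigma> \<tau> (shf (- si * i) P). ennreal (exp (- (\<kappa> * f z))) ^ 4 \<partial>PM) ^ 2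
      \<le> ennreal K * emeasure PM (box \<sigma> \<tau> P) ^ 3" if \<tau>: "\<tau> \<in> {1..N}" and P: "P \<in> boxes \<tau>" for \<tau> P
  proof -
    interpret G: shift_grid PM "boxes \<tau>" fst shf "box \<sigma> \<tau>" by (rule shift_grid_boxes[OF \<tau> \<sigma>(1)])
    let ?n = "fst P + int m"
    have shP: "shf (- si * i) P \<in> boxes \<tau>" by (rule G.sh_in[OF P])
    \<comment> \<open>Bounded above, since all its elements are compared with one and the same piece
      of the shifted box; so the supremum exists although the number of pieces is not
      controlled.\<close>
    define S where "S = aP s a \<tau> ` {P' \<in> boxes \<tau>. fst P' = ?n \<and> box \<sigma> \<tau> P' \<subseteq> box \<sigma> \<tau> P}"
    have sub_ex: "\<exists>P'\<in>boxes \<tau>. fst P' = ?n \<and> box \<sigma> \<tau> P' \<subseteq> box \<sigma> \<tau> R" if R: "R \<in> boxes \<tau>" "fst R = fst P" for R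
    proof -
      obtain z where z: "z \<in> box \<sigma> \<tau> R" using G.bx_nonempty[OF R(1)] by blast
      obtain P' where P': "P' \<in> boxes \<tau>" "fst P' = ?n" "z \<in> box \<sigma> \<tau> P'" using G.cover by blast
      have "box \<sigma> \<tau> P' \<subseteq> box \<sigma> \<tau> R" using G.nested_le[OF R(1) P'(1) _ z P'(3)] P'(2) R(2) by simp
      then show ?thesis using P' by blast
    qed
    have S0: "S \<noteq> {}" using sub_ex[OF P refl] unfolding S_def by blast
    have Sle: "v \<le> aP (-s) a \<tau> P'' + D'"
      if "v \<in> S" "P'' \<in> boxes \<tau>" "fst P'' = ?n" "box \<sigma> \<tau> P'' \<subseteq> box \<sigma> \<tau> (shf (- si * i) P)" for v P''
    proof -
      from that(1) obtain P' where "P' \<in> boxes \<tau>" "fst P' = ?n" "box \<sigma> \<tau> P' \<subseteq> box \<sigma> \<tau> P" "v = aP s a \<tau> P'"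
        by (auto simp: S_def)
      with compare[OF \<tau> P this(1-3) that(2-4)] show ?thesis by simp
    qed
    have bdd: "bdd_above S"
    proof -
      obtain P'' where P'': "P'' \<in> boxes \<tau>" "fst P'' = ?n" "box \<sigma> \<tau> P'' \<subseteq> box \<sigma> \<tau> (shf (- si * i) P)"
        using sub_ex[OF shP G.gen_sh] by blast
      show ?thesis by (rule bdd_aboveI[of _ "aP (-s) a \<tau> P'' + D'"]) (rule Sle[OF _ P''])
    qed
    define H where "H = Sup S"
    have 1: "(\<integral>\<^sup>+z\<in>box \<sigma> \<tau> P. ennreal (exp (\<kappa> * f z)) ^ 8 \<partial>PM) \<le> ennreal (8 * exp (8 * \<kappa> * H)) * emeasure PM (box \<sigma> \<tau> P)"
    proof (rule G.integral_le_refine[OF P, of ?n])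
      fix P' assume P': "P' \<in> boxes \<tau>" "fst P' = ?n" "box \<sigma> \<tau> P' \<subseteq> box \<sigma> \<tau> P"
      then have "aP s a \<tau> P' \<le> H" unfolding H_def by (intro cSup_upper bdd) (auto simp: S_def)
      have [measurable]: "box \<sigma> \<tau> P' \<in> sets PM" by (rule G.sets_bx[OF P'(1)])
      have "(\<integral>\<^sup>+z\<in>box \<sigma> \<tau> P'. ennreal (exp (\<kappa> * f z)) ^ 8 \<partial>PM) \<le>
        (\<integral>\<^sup>+z. ennreal (exp (8 * \<kappa> * H)) * (ennreal (exp (8 * \<kappa> * (f z - aP s a \<tau> P'))) * indicator (box \<sigma> \<tau> P') z) \<partial>PM)"
      proof (rule nn_integral_mono)
        fix z
        have "exp (\<kappa> * f z) ^ 8 = exp (8 * \<kappa> * f z)" by (simp add: exp_of_nat_mult[symmetric])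
        also have "\<dots> \<le> exp (8 * \<kappa> * H + 8 * \<kappa> * (f z - aP s a \<tau> P'))"
          using \<open>aP s a \<tau> P' \<le> H\<close> \<kappa> by (simp add: algebra_simps)
        finally have "ennreal (exp (\<kappa> * f z)) ^ 8 \<le> ennreal (exp (8 * \<kappa> * H)) * ennreal (exp (8 * \<kappa> * (f z - aP s a \<tau> P')))"
          by (simp add: ennreal_power ennreal_mult[symmetric] exp_add[symmetric] ennreal_leI)
        then show "ennreal (exp (\<kappa> * f z)) ^ 8 * indicator (box \<sigma> \<tau> P') z \<le> ennreal (exp (8 * \<kappa> * H)) * (ennreal (exp (8 * \<kappa> * (f z - aP s a \<tau> P'))) * indicator (box \<sigma> \<tau> P') z)"
          by (auto split: split_indicator)
      qed
      also have "\<dots> = ennreal (exp (8 * \<kappa> * H)) * (\<integral>\<^sup>+z\<in>box \<sigma> \<tau> P'. ennreal (exp (8 * \<kappa> * (f z - aP s a \<tau> P'))) \<partial>PM)"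
        by (rule nn_integral_cmult) measurable
      also have "\<dots> \<le> ennreal (exp (8 * \<kappa> * H)) * (8 * emeasure PM (box \<sigma> \<tau> P'))"
        using up[OF \<tau> P'(1), folded s_def] by (rule mult_left_mono) simp
      finally show "(\<integral>\<^sup>+z\<in>box \<sigma> \<tau> P'. ennreal (exp (\<kappa> * f z)) ^ 8 \<partial>PM) \<le> ennreal (8 * exp (8 * \<kappa> * H)) * emeasure PM (box \<sigma> \<tau> P')"
        by (simp add: ennreal_mult ac_simps)
    qed auto
    have 2: "(\<integral>\<^sup>+z\<in>box \<sigma> \<tau> (shf (- si * i) P). ennreal (exp (- (\<kappa> * f z))) ^ 4 \<partial>PM) \<le> ennreal (8 * exp (4 * \<kappa> * (D' - H))) * emeasure PM (box \<sigma> \<tau> (shf (- si * i) P))"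
    proof (rule G.integral_le_refine[OF shP, of ?n])
      fix P' assume P': "P' \<in> boxes \<tau>" "fst P' = ?n" "box \<sigma> \<tau> P' \<subseteq> box \<sigma> \<tau> (shf (- si * i) P)"
      have "H \<le> aP (-s) a \<tau> P' + D'" unfolding H_def using Sle[OF _ P'] by (intro cSup_least S0) auto
      have [measurable]: "box \<sigma> \<tau> P' \<in> sets PM" by (rule G.sets_bx[OF P'(1)])
      have "(\<integral>\<^sup>+z\<in>box \<sigma> \<tau> P'. ennreal (exp (- (\<kappa> * f z))) ^ 4 \<partial>PM) \<le>
        (\<integral>\<^sup>+z. ennreal (exp (4 * \<kappa> * (D' - H))) * (ennreal (exp (4 * \<kappa> * (aP (-s) a \<tau> P' - f z))) * indicator (box \<sigma> \<tau> P') z) \<partial>PM)"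
      proof (rule nn_integral_mono)
        fix z
        have "exp (- (\<kappa> * f z)) ^ 4 = exp (- (4 * \<kappa> * f z))" by (simp add: exp_of_nat_mult[symmetric])
        also have "\<dots> \<le> exp (4 * \<kappa> * (D' - H) + 4 * \<kappa> * (aP (-s) a \<tau> P' - f z))"
        proof -
          have "0 \<le> 4 * \<kappa> * (aP (-s) a \<tau> P' + D' - H)" using \<open>H \<le> aP (-s) a \<tau> P' + D'\<close> \<kappa> by simp
          then show ?thesis by (simp add: algebra_simps)
        qed
        finally have "ennreal (exp (- (\<kappa> * f z))) ^ 4 \<le> ennreal (exp (4 * \<kappa> * (D' - H))) * ennreal (exp (4 * \<kappa> * (aP (-s) a \<tau> P' - f z)))"
          by (simp add: ennreal_power ennreal_mult[symmetric] exp_add[symmetric] ennreal_leI)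
        then show "ennreal (exp (- (\<kappa> * f z))) ^ 4 * indicator (box \<sigma> \<tau> P') z \<le> ennreal (exp (4 * \<kappa> * (D' - H))) * (ennreal (exp (4 * \<kappa> * (aP (-s) a \<tau> P' - f z))) * indicator (box \<sigma> \<tau> P') z)"
          by (auto split: split_indicator)
      qed
      also have "\<dots> = ennreal (exp (4 * \<kappa> * (D' - H))) * (\<integral>\<^sup>+z\<in>box \<sigma> \<tau> P'. ennreal (exp (4 * \<kappa> * (aP (-s) a \<tau> P' - f z))) \<partial>PM)"
        by (rule nn_integral_cmult) measurable
      also have "\<dots> \<le> ennreal (exp (4 * \<kappa> * (D' - H))) * (8 * emeasure PM (box \<sigma> \<tau> P'))"
        using lo[OF \<tau> P'(1)] by (intro mult_left_mono) (simp_all add: s_def)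
      finally show "(\<integral>\<^sup>+z\<in>box \<sigma> \<tau> P'. ennreal (exp (- (\<kappa> * f z))) ^ 4 \<partial>PM) \<le> ennreal (8 * exp (4 * \<kappa> * (D' - H))) * emeasure PM (box \<sigma> \<tau> P')"
        by (simp add: ennreal_mult ac_simps)
    qed (auto simp: G.gen_sh)
    let ?p = "emeasure PM (box \<sigma> \<tau> P)"
    have "(\<integral>\<^sup>+z\<in>box \<sigma> \<tau> P. ennreal (exp (\<kappa> * f z)) ^ 8 \<partial>PM) * (\<integral>\<^sup>+z\<in>box \<sigma> \<tau> (shf (- si * i) P). ennreal (exp (- (\<kappa> * f z))) ^ 4 \<partial>PM) ^ 2
      \<le> (ennreal (8 * exp (8 * \<kappa> * H)) * ?p) * (ennreal (8 * exp (4 * \<kappa> * (D' - H))) * ?p) ^ 2"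
      using 1 2[unfolded G.emeasure_sh[OF P]] by (intro mult_mono power_mono) simp_all
    also have "\<dots> = (ennreal (8 * exp (8 * \<kappa> * H)) * ennreal (8 * exp (4 * \<kappa> * (D' - H))) ^ 2) * ?p ^ 3"
      by (simp only: power_mult_distrib power2_eq_square power3_eq_cube ac_simps)
    also have "ennreal (8 * exp (8 * \<kappa> * H)) * ennreal (8 * exp (4 * \<kappa> * (D' - H))) ^ 2 = ennreal ((8 * exp (8 * \<kappa> * H)) * (8 * exp (4 * \<kappa> * (D' - H))) ^ 2)"
      by (simp add: ennreal_power ennreal_mult[symmetric])
    also have "(8 * exp (8 * \<kappa> * H)) * (8 * exp (4 * \<kappa> * (D' - H))) ^ 2 = K"
    proof -
      have "exp (8 * \<kappa> * H) * exp (4 * \<kappa> * (D' - H)) ^ 2 = exp (8 * \<kappa> * D')"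
        by (simp add: power2_eq_square exp_add[symmetric] algebra_simps)
      then show ?thesis unfolding K_def by (simp add: power_mult_distrib)
    qed
    finally show ?thesis .
  qed
  moreover have "0 \<le> K" by (simp add: K_def)
  ultimately show ?thesis by blast
qed

definition mp where "mp \<tau> i g = shift_grid.mop PM (boxes \<tau>) shf (box \<sigma> \<tau>) i g"

text \<open>\<open>weighted_condition\<close> is used for \<open>f\<close> in direction
  \<open>si\<close> and for \<open>- f\<close> in direction \<open>- si\<close>. Division by 8 in
  the choice of \<open>\<kappa>\<close> makes both exponents, 8 \<kappa> and 4 \<kappa>, admissible
  in the two John-Nirenberg inequalities.\<close>

lemma strong_bound_mp:
  assumes PB: "PB (of_int si) \<gamma> A a f" and si: "si = 1 \<or> si = -1" and A: "0 \<le> A"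
  shows "\<exists>\<kappa>>0. \<forall>i\<ge>2. \<exists>C::real. 0 \<le> C \<and> (\<forall>\<tau>\<in>{1..N}. \<forall>g\<in>borel_measurable PM.
     (\<integral>\<^sup>+z. (ennreal (exp (\<kappa> * f z)) * mp \<tau> (- si * i) g z) ^ 8 \<partial>PM) \<le> ennreal C * (\<integral>\<^sup>+z. (ennreal (exp (\<kappa> * f z)) * g z) ^ 8 \<partial>PM) \<and>
     (\<integral>\<^sup>+z. (ennreal (exp (- (\<kappa> * f z))) * mp \<tau> (si * i) g z) ^ 8 \<partial>PM) \<le> ennreal C * (\<integral>\<^sup>+z. (ennreal (exp (- (\<kappa> * f z))) * g z) ^ 8 \<partial>PM))"
proof -
  note [measurable] = PB_measurable[OF PB]
  have si': "- si = 1 \<or> - si = -1" using si by auto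
  let ?a = "\<lambda>x t l. - a x t l" and ?f = "\<lambda>z. - f z"
  have PB': "PB (of_int (- si)) \<gamma> A ?a ?f" using PB_reflect[OF PB] by simp
  obtain \<epsilon> where \<epsilon>: "0 < \<epsilon>" "\<forall>\<tau>\<in>{1..N}. \<forall>P\<in>boxes \<tau>.
    (\<integral>\<^sup>+z\<in>box \<sigma> \<tau> P. ennreal (exp (\<epsilon> * (f z - aP (of_int si) a \<tau> P))) \<partial>PM) \<le> 7 * emeasure PM (box \<sigma> \<tau> P)"
    using jn_boxes[OF PB si A] by (elim exE conjE)
  obtain \<epsilon>' where \<epsilon>': "0 < \<epsilon>'" "\<forall>\<tau>\<in>{1..N}. \<forall>P\<in>boxes \<tau>.
    (\<integral>\<^sup>+z\<in>box \<sigma> \<tau> P. ennreal (exp (\<epsilon>' * (?f z - aP (of_int (-si)) ?a \<tau> P))) \<partial>PM) \<le> 7 * emeasure PM (box \<sigma> \<tau> P)"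
    using jn_boxes[OF PB' si' A] by (elim exE conjE)
  \<comment> \<open>A smaller exponent increases the exponential only where it is at most 1; this
    costs one more measure of the box, and 7 becomes 8.\<close>
  have shrink: "(\<integral>\<^sup>+z\<in>box \<sigma> \<tau> P. ennreal (exp (c * h z)) \<partial>PM) \<le> 8 * emeasure PM (box \<sigma> \<tau> P)"
    if P: "\<tau> \<in> {1..N}" "P \<in> boxes \<tau>" and c: "0 \<le> c" "c \<le> e" and [measurable]: "h \<in> borel_measurable PM"
     and le: "(\<integral>\<^sup>+z\<in>box \<sigma> \<tau> P. ennreal (exp (e * h z)) \<partial>PM) \<le> 7 * emeasure PM (box \<sigma> \<tau> P)" for \<tau> P c e h
  proof -
    have [measurable]: "box \<sigma> \<tau> P \<in> sets PM" by (rule sets_box[OF P])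
    have "(\<integral>\<^sup>+z\<in>box \<sigma> \<tau> P. ennreal (exp (c * h z)) \<partial>PM) \<le> (\<integral>\<^sup>+z. indicator (box \<sigma> \<tau> P) z + ennreal (exp (e * h z)) * indicator (box \<sigma> \<tau> P) z \<partial>PM)"
    proof (rule nn_integral_mono)
      fix z
      have "exp (c * h z) \<le> 1 + exp (e * h z)"
      proof (cases "0 \<le> h z")
        case True
        then have "c * h z \<le> e * h z" using c by (intro mult_right_mono) auto
        then show ?thesis by (simp add: add_increasing)
      next
        case False
        then have "c * h z \<le> 0" using c by (simp add: mult_nonneg_nonpos)
        then have "exp (c * h z) \<le> 1" by simp
        then show ?thesis by (simp add: add_increasing2)
      qed
      then have "ennreal (exp (c * h z)) \<le> ennreal (1 + exp (e * h z))" by (rule ennreal_leI)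
      then show "ennreal (exp (c * h z)) * indicator (box \<sigma> \<tau> P) z \<le> indicator (box \<sigma> \<tau> P) z + ennreal (exp (e * h z)) * indicator (box \<sigma> \<tau> P) z"
        by (auto split: split_indicator)
    qed
    also have "\<dots> = emeasure PM (box \<sigma> \<tau> P) + (\<integral>\<^sup>+z\<in>box \<sigma> \<tau> P. ennreal (exp (e * h z)) \<partial>PM)"
      by (subst nn_integral_add) auto
    also have "\<dots> \<le> emeasure PM (box \<sigma> \<tau> P) + 7 * emeasure PM (box \<sigma> \<tau> P)" using le by (rule add_left_mono)
    also have "\<dots> = (1 + 7) * emeasure PM (box \<sigma> \<tau> P)" by (simp only: distrib_right mult_1)
    also have "(1 + 7 :: ennreal) = 8" by simp
    finally show ?thesis .
  qed
  define \<kappa> where "\<kappa> = min \<epsilon> \<epsilon>' / 8"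
  have \<kappa>: "0 < \<kappa>" "8 * \<kappa> \<le> \<epsilon>" "8 * \<kappa> \<le> \<epsilon>'" "4 * \<kappa> \<le> \<epsilon>" "4 * \<kappa> \<le> \<epsilon>'" using \<epsilon>(1) \<epsilon>'(1) by (auto simp: \<kappa>_def)
  have aPn: "aP s ?a \<tau> P = - aP s a \<tau> P" for s \<tau> P by (cases P) (simp add: aP_def)
  have up: "(\<integral>\<^sup>+z\<in>box \<sigma> \<tau> P. ennreal (exp (c * (f z - aP (of_int si) a \<tau> P))) \<partial>PM) \<le> 8 * emeasure PM (box \<sigma> \<tau> P)"
    if "\<tau> \<in> {1..N}" "P \<in> boxes \<tau>" "0 \<le> c" "c \<le> \<epsilon>" for \<tau> P c
    using shrink[OF that, of "\<lambda>z. f z - aP (of_int si) a \<tau> P"] \<epsilon>(2)[rule_format, OF that(1,2)] by simp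
  have lo: "(\<integral>\<^sup>+z\<in>box \<sigma> \<tau> P. ennreal (exp (c * (aP (of_int (- si)) a \<tau> P - f z))) \<partial>PM) \<le> 8 * emeasure PM (box \<sigma> \<tau> P)"
    if "\<tau> \<in> {1..N}" "P \<in> boxes \<tau>" "0 \<le> c" "c \<le> \<epsilon>'" for \<tau> P c
    using shrink[OF that, of "\<lambda>z. aP (of_int (-si)) a \<tau> P - f z"] \<epsilon>'(2)[rule_format, OF that(1,2), unfolded aPn] by (simp add: add.commute)
  have EE: "ennreal (exp (\<kappa> * f z)) * ennreal (exp (- (\<kappa> * f z))) = 1" for z
    by (simp add: ennreal_mult[symmetric] exp_add[symmetric])
  have EE': "ennreal (exp (- (\<kappa> * f z))) * ennreal (exp (\<kappa> * f z)) = 1" for z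
    by (simp add: ennreal_mult[symmetric] exp_add[symmetric])
  have bound: "\<exists>C::real. 0 \<le> C \<and> (\<forall>\<tau>\<in>{1..N}. \<forall>g\<in>borel_measurable PM.
     (\<integral>\<^sup>+z. (ennreal (exp (\<kappa> * f z)) * mp \<tau> (- si * i) g z) ^ 8 \<partial>PM) \<le> ennreal C * (\<integral>\<^sup>+z. (ennreal (exp (\<kappa> * f z)) * g z) ^ 8 \<partial>PM) \<and>
     (\<integral>\<^sup>+z. (ennreal (exp (- (\<kappa> * f z))) * mp \<tau> (si * i) g z) ^ 8 \<partial>PM) \<le> ennreal C * (\<integral>\<^sup>+z. (ennreal (exp (- (\<kappa> * f z))) * g z) ^ 8 \<partial>PM))"
    if i: "2 \<le> i" for i
  proof -
    have "\<exists>K1\<ge>0. \<forall>\<tau>\<in>{1..N}. \<forall>P\<in>boxes \<tau>.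
      (\<integral>\<^sup>+z\<in>box \<sigma> \<tau> P. ennreal (exp (\<kappa> * f z)) ^ 8 \<partial>PM) * (\<integral>\<^sup>+z\<in>box \<sigma> \<tau> (shf (- si * i) P). ennreal (exp (- (\<kappa> * f z))) ^ 4 \<partial>PM) ^ 2
      \<le> ennreal K1 * emeasure PM (box \<sigma> \<tau> P) ^ 3"
    proof (rule weighted_condition[OF PB si A \<kappa>(1) _ _ i])
      show "(\<integral>\<^sup>+z\<in>box \<sigma> \<tau> P. ennreal (exp (8 * \<kappa> * (f z - aP (of_int si) a \<tau> P))) \<partial>PM) \<le> 8 * emeasure PM (box \<sigma> \<tau> P)"
        "(\<integral>\<^sup>+z\<in>box \<sigma> \<tau> P. ennreal (exp (4 * \<kappa> * (aP (of_int (- si)) a \<tau> P - f z))) \<partial>PM) \<le> 8 * emeasure PM (box \<sigma> \<tau> P)"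
        if "\<tau> \<in> {1..N}" "P \<in> boxes \<tau>" for \<tau> P
        using up[OF that] lo[OF that] \<kappa> by auto
    qed
    then obtain K1 where K1: "0 \<le> K1" "\<forall>\<tau>\<in>{1..N}. \<forall>P\<in>boxes \<tau>. (\<integral>\<^sup>+z\<in>box \<sigma> \<tau> P. ennreal (exp (\<kappa> * f z)) ^ 8 \<partial>PM) * (\<integral>\<^sup>+z\<in>box \<sigma> \<tau> (shf (- si * i) P). ennreal (exp (- (\<kappa> * f z))) ^ 4 \<partial>PM) ^ 2
      \<le> ennreal K1 * emeasure PM (box \<sigma> \<tau> P) ^ 3" by (elim exE conjE)
    have "\<exists>K2\<ge>0. \<forall>\<tau>\<in>{1..N}. \<forall>P\<in>boxes \<tau>.
      (\<integral>\<^sup>+z\<in>box \<sigma> \<tau> P. ennreal (exp (\<kappa> * ?f z)) ^ 8 \<partial>PM) * (\<integral>\<^sup>+z\<in>box \<sigma> \<tau> (shf (- (- si) * i) P). ennreal (exp (- (\<kappa> * ?f z))) ^ 4 \<partial>PM) ^ 2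
      \<le> ennreal K2 * emeasure PM (box \<sigma> \<tau> P) ^ 3"
    proof (rule weighted_condition[OF PB' si' A \<kappa>(1) _ _ i])
      show "(\<integral>\<^sup>+z\<in>box \<sigma> \<tau> P. ennreal (exp (8 * \<kappa> * (?f z - aP (of_int (- si)) ?a \<tau> P))) \<partial>PM) \<le> 8 * emeasure PM (box \<sigma> \<tau> P)"
        "(\<integral>\<^sup>+z\<in>box \<sigma> \<tau> P. ennreal (exp (4 * \<kappa> * (aP (of_int (- (- si))) ?a \<tau> P - ?f z))) \<partial>PM) \<le> 8 * emeasure PM (box \<sigma> \<tau> P)"
        if "\<tau> \<in> {1..N}" "P \<in> boxes \<tau>" for \<tau> P
        using lo[OF that, of "8 * \<kappa>"] up[OF that, of "4 * \<kappa>"] \<kappa> unfolding aPn by (simp_all add: add.commute)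
    qed
    then obtain K2 where K2: "0 \<le> K2" "\<forall>\<tau>\<in>{1..N}. \<forall>P\<in>boxes \<tau>. (\<integral>\<^sup>+z\<in>box \<sigma> \<tau> P. ennreal (exp (\<kappa> * ?f z)) ^ 8 \<partial>PM) * (\<integral>\<^sup>+z\<in>box \<sigma> \<tau> (shf (- (- si) * i) P). ennreal (exp (- (\<kappa> * ?f z))) ^ 4 \<partial>PM) ^ 2
      \<le> ennreal K2 * emeasure PM (box \<sigma> \<tau> P) ^ 3" by (elim exE conjE)
    \<comment> \<open>16384 collects the numerical factors of \<open>mop_weighted\<close>: 2^8 times
      4 times 2^2 times 4.\<close>
    define C where "C i = 16384 * (max K1 K2 * (2 * real_of_int \<bar>i\<bar> + 1))" for i :: int
    have Ceq: "2 ^ 8 * (4 * (ennreal (max K1 K2) * (2 ^ 2 * (4 * ennreal (2 * \<bar>j\<bar> + 1))))) = ennreal (C j)" for j :: int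
      using K1(1) by (simp add: C_def ennreal_mult max.coboundedI1 mult.left_commute[of "ennreal (max K1 K2)"] del: ennreal_plus)
    have C0: "0 \<le> C i" using K1(1) by (simp add: C_def max.coboundedI1)
    have Cs: "C (- si * i) = C i" "C (si * i) = C i" using si by (auto simp: C_def)
    have "(\<integral>\<^sup>+z. (ennreal (exp (\<kappa> * f z)) * mp \<tau> (- si * i) g z) ^ 8 \<partial>PM) \<le> ennreal (C i) * (\<integral>\<^sup>+z. (ennreal (exp (\<kappa> * f z)) * g z) ^ 8 \<partial>PM) \<and>
     (\<integral>\<^sup>+z. (ennreal (exp (- (\<kappa> * f z))) * mp \<tau> (si * i) g z) ^ 8 \<partial>PM) \<le> ennreal (C i) * (\<integral>\<^sup>+z. (ennreal (exp (- (\<kappa> * f z))) * g z) ^ 8 \<partial>PM)"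
      if \<tau>: "\<tau> \<in> {1..N}" and [measurable]: "g \<in> borel_measurable PM" for \<tau> g
    proof -
      interpret G: shift_grid PM "boxes \<tau>" fst shf "box \<sigma> \<tau>" by (rule shift_grid_boxes[OF \<tau> \<sigma>(1)])
      show ?thesis
        unfolding mp_def
      proof (rule conjI)
        show "(\<integral>\<^sup>+z. (ennreal (exp (\<kappa> * f z)) * G.mop (- si * i) g z) ^ 8 \<partial>PM) \<le> ennreal (C i) * (\<integral>\<^sup>+z. (ennreal (exp (\<kappa> * f z)) * g z) ^ 8 \<partial>PM)"
          unfolding Cs(1)[symmetric] Ceq[symmetric]
        proof (rule G.mop_weighted[where E'="\<lambda>z. ennreal (exp (- (\<kappa> * f z)))"])
          fix P assume "P \<in> boxes \<tau>"
          from K1(2)[rule_format, OF \<tau> this] show "(\<integral>\<^sup>+w\<in>box \<sigma> \<tau> P. ennreal (exp (\<kappa> * f w)) ^ 8 \<partial>PM) * (\<integral>\<^sup>+w\<in>box \<sigma> \<tau> (shf (- si * i) P). ennreal (exp (- (\<kappa> * f w))) ^ 4 \<partial>PM) ^ 2 \<le> ennreal (max K1 K2) * emeasure PM (box \<sigma> \<tau> P) ^ 3"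
            by (rule order_trans) (intro mult_right_mono ennreal_leI; simp)
        qed (auto simp: EE)
        show "(\<integral>\<^sup>+z. (ennreal (exp (- (\<kappa> * f z))) * G.mop (si * i) g z) ^ 8 \<partial>PM) \<le> ennreal (C i) * (\<integral>\<^sup>+z. (ennreal (exp (- (\<kappa> * f z))) * g z) ^ 8 \<partial>PM)"
          unfolding Cs(2)[symmetric] Ceq[symmetric]
        proof (rule G.mop_weighted[where E'="\<lambda>z. ennreal (exp (\<kappa> * f z))"])
          fix P assume "P \<in> boxes \<tau>"
          from K2(2)[rule_format, OF \<tau> this] have "(\<integral>\<^sup>+w\<in>box \<sigma> \<tau> P. ennreal (exp (- (\<kappa> * f w))) ^ 8 \<partial>PM) * (\<integral>\<^sup>+w\<in>box \<sigma> \<tau> (shf (si * i) P). ennreal (exp (\<kappa> * f w)) ^ 4 \<partial>PM) ^ 2 \<le> ennreal K2 * emeasure PM (box \<sigma> \<tau> P) ^ 3" by simp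
          then show "(\<integral>\<^sup>+w\<in>box \<sigma> \<tau> P. ennreal (exp (- (\<kappa> * f w))) ^ 8 \<partial>PM) * (\<integral>\<^sup>+w\<in>box \<sigma> \<tau> (shf (si * i) P). ennreal (exp (\<kappa> * f w)) ^ 4 \<partial>PM) ^ 2 \<le> ennreal (max K1 K2) * emeasure PM (box \<sigma> \<tau> P) ^ 3"
            by (rule order_trans) (intro mult_right_mono ennreal_leI; simp)
        qed (auto simp: EE')
      qed
    qed
    then show ?thesis using C0 by (intro exI[of _ "C i"] conjI ballI) simp_all
  qed
  show ?thesis by (intro exI[of _ \<kappa>] conjI allI impI \<kappa>(1) bound)
qed

end

section \<open>Sublinearity, measurability and a differentiation estimate\<close>

lemma ennreal_sum_power_le:
  fixes x :: "'b \<Rightarrow> ennreal"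
  assumes F: "finite F" and n: "0 < n"
  shows "(\<Sum>j\<in>F. x j) ^ n \<le> of_nat (card F) ^ n * (\<Sum>j\<in>F. x j ^ n)"
proof (cases "F = {}")
  case True
  then show ?thesis using n by simp
next
  case False
  obtain m where m: "m \<in> F" "\<And>j. j \<in> F \<Longrightarrow> x j \<le> x m"
  proof -
    have "Max (x ` F) \<in> x ` F" using F False by (intro Max_in) auto
    then obtain m where "m \<in> F" "Max (x ` F) = x m" by auto
    moreover have "x j \<le> Max (x ` F)" if "j \<in> F" for j using F that by (intro Max_ge) auto
    ultimately show thesis using that by metis
  qed
  have "(\<Sum>j\<in>F. x j) \<le> (\<Sum>j\<in>F. x m)" using m by (intro sum_mono) auto
  also have "\<dots> = of_nat (card F) * x m" by simp
  finally have "(\<Sum>j\<in>F. x j) ^ n \<le> (of_nat (card F) * x m) ^ n" by (rule power_mono) simp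
  also have "\<dots> = of_nat (card F) ^ n * x m ^ n" by (rule power_mult_distrib)
  also have "\<dots> \<le> of_nat (card F) ^ n * (\<Sum>j\<in>F. x j ^ n)"
    using F m by (intro mult_left_mono member_le_sum) auto
  finally show ?thesis .
qed

lemma ennreal_le_1_plus_power:
  fixes y :: ennreal
  assumes "0 < n"
  shows "y \<le> 1 + y ^ n"
proof (cases "1 \<le> y")
  case True
  have "y ^ 1 \<le> y ^ n" using assms True by (intro power_increasing) auto
  then show ?thesis by (simp add: add_increasing)
qed (simp add: add_increasing2)

context shift_grid
begin

text \<open>Averages commute with series, and each average is at most the supremum of its own term.
  The infinite sum is needed because the fixed function of the iteration is a series.\<close>

lemma mop_suminf:
  assumes [measurable]: "\<And>n::nat. h n \<in> borel_measurable L"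
  shows "mop i (\<lambda>w. \<Sum>n. h n w) z \<le> (\<Sum>n. mop i (h n) z)"
  unfolding mop_def[of i "\<lambda>w. \<Sum>n. h n w"]
proof (rule SUP_least)
  fix P assume P: "P \<in> B"
  have [measurable]: "bx (sh i P) \<in> sets L" using P sh_in by auto
  show "(\<integral>\<^sup>+w\<in>bx (sh i P). (\<Sum>n. h n w) \<partial>L) / emeasure L (bx P) * indicator (bx P) z \<le> (\<Sum>n. mop i (h n) z)"
  proof (cases "z \<in> bx P")
    case True
    have "(\<integral>\<^sup>+w\<in>bx (sh i P). (\<Sum>n. h n w) \<partial>L) = (\<integral>\<^sup>+w. (\<Sum>n. h n w * indicator (bx (sh i P)) w) \<partial>L)"
      by (simp add: ennreal_suminf_multc)
    also have "\<dots> = (\<Sum>n. \<integral>\<^sup>+w. h n w * indicator (bx (sh i P)) w \<partial>L)"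
      by (rule nn_integral_suminf) measurable
    finally have "(\<integral>\<^sup>+w\<in>bx (sh i P). (\<Sum>n. h n w) \<partial>L) / emeasure L (bx P) = (\<Sum>n. (\<integral>\<^sup>+w\<in>bx (sh i P). h n w \<partial>L) / emeasure L (bx P))"
      by (simp add: divide_ennreal_def ennreal_suminf_multc)
    also have "\<dots> \<le> (\<Sum>n. mop i (h n) z)" by (intro suminf_le mop_ge P True) auto
    finally show ?thesis using True by simp
  qed simp
qed

lemma mop_cmult:
  assumes [measurable]: "h \<in> borel_measurable L"
  shows "mop i (\<lambda>w. c * h w) z \<le> c * mop i h z"
  unfolding mop_def[of i "\<lambda>w. c * h w"]
proof (rule SUP_least)
  fix P assume P: "P \<in> B"
  have [measurable]: "bx (sh i P) \<in> sets L" using P sh_in by auto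
  show "(\<integral>\<^sup>+w\<in>bx (sh i P). c * h w \<partial>L) / emeasure L (bx P) * indicator (bx P) z \<le> c * mop i h z"
  proof (cases "z \<in> bx P")
    case True
    have "(\<integral>\<^sup>+w\<in>bx (sh i P). c * h w \<partial>L) = c * (\<integral>\<^sup>+w\<in>bx (sh i P). h w \<partial>L)"
      by (simp add: mult.assoc nn_integral_cmult)
    then have "(\<integral>\<^sup>+w\<in>bx (sh i P). c * h w \<partial>L) / emeasure L (bx P) = c * ((\<integral>\<^sup>+w\<in>bx (sh i P). h w \<partial>L) / emeasure L (bx P))"
      by (simp add: divide_ennreal_def mult.assoc)
    also have "\<dots> \<le> c * mop i h z" by (intro mult_left_mono mop_ge P True) auto
    finally show ?thesis using True by simp
  qed simp
qed

end

context homogeneous_dyadic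
begin

text \<open>For open \<open>A\<close> the product is open, because a parabolic ball is contained in
  a product of small sets. The general case is an induction with \<open>J\<close> fixed, complements
  being taken inside \<open>UNIV \<times> J\<close>.\<close>

lemma borel_Times:
  assumes A: "A \<in> borel_of_qm \<rho>" and J: "open J"
  shows "A \<times> J \<in> borel_of_qm (par_dist \<rho> p)"
proof -
  interpret sigma_algebra UNIV "borel_of_qm (par_dist \<rho> p)"
    unfolding borel_of_qm_def by (rule sigma_algebra_sigma_sets) auto
  have opn: "U \<times> J \<in> borel_of_qm (par_dist \<rho> p)" if U: "openin (qtopology \<rho>) U" for U
  proof -
    have "openin (qtopology (par_dist \<rho> p)) (U \<times> J)"
      unfolding openin_qtopology
    proof
      fix w assume w: "w \<in> U \<times> J"
      obtain x t where xt: "w = (x, t)" by (cases w)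
      obtain r where r: "0 < r" "qb x r \<subseteq> U" using U w unfolding openin_qtopology xt by blast
      obtain e where e: "0 < e" "\<And>s. \<bar>s - t\<bar> < e \<Longrightarrow> s \<in> J"
        using J w unfolding xt open_dist dist_real_def by (metis mem_Sigma_iff)
      define r' where "r' = min r (e powr (1/p))"
      have r': "0 < r'" using r e by (simp add: r'_def)
      have "qball (par_dist \<rho> p) w r' \<subseteq> U \<times> J"
      proof
        fix v assume v: "v \<in> qball (par_dist \<rho> p) w r'"
        obtain y s where ys: "v = (y, s)" by (cases v)
        have 1: "\<rho> x y < r" "\<bar>t - s\<bar> powr (1/p) < e powr (1/p)"
          using v by (auto simp: qball_def par_dist_def xt ys r'_def)
        have "\<bar>t - s\<bar> < e"
        proof (rule ccontr)
          assume "\<not> ?thesis"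
          then have "e powr (1/p) \<le> \<bar>t - s\<bar> powr (1/p)" using e p by (intro powr_mono2) auto
          then show False using 1 by simp
        qed
        then show "v \<in> U \<times> J" using 1 r e(2)[of s] by (auto simp: ys qball_def abs_minus_commute)
      qed
      then show "\<exists>r>0. qball (par_dist \<rho> p) w r \<subseteq> U \<times> J" using r' by blast
    qed
    then show ?thesis unfolding borel_of_qm_def by auto
  qed
  have U: "openin (qtopology \<rho>) UNIV" unfolding openin_qtopology by (auto intro: exI[of _ 1])
  show ?thesis
    using A unfolding borel_of_qm_def[of \<rho>]
  proof induction
    case (Basic a)
    then show ?case using opn by simp
  next
    case (Compl a)
    have "(UNIV - a) \<times> J = UNIV \<times> J - a \<times> J" by auto
    then show ?case using Compl.IH opn[OF U] by auto
  next
    case (Union a)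
    have "\<Union>(range a) \<times> J = (\<Union>i. a i \<times> J)" by auto
    then show ?case using Union.IH by auto
  qed auto
qed

lemma open_tslab: "open (tslab s t lo hi)"
proof -
  have "tslab s t lo hi = {r. lo < s * (r - t)} \<inter> {r. s * (r - t) < hi}" by (auto simp: tslab_def)
  then show ?thesis by (auto intro!: open_Int open_Collect_less continuous_intros)
qed

text \<open>The function is lower semicontinuous: by continuity from below the slab cut by 1/(n + 1)
  at both ends still has measure above \<open>y\<close> for some n, and it lies in the slab of every
  time nearer to t than 1/(n + 1).\<close>

lemma measurable_slab:
  assumes m: "\<And>lo hi t. S \<times> tslab s t lo hi \<in> sets m" and s: "s = 1 \<or> s = -1"
  shows "(\<lambda>t. emeasure m (S \<times> tslab s t lo hi)) \<in> borel_measurable borel"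
proof (rule borel_measurableI_greater)
  fix y
  have "open {t. y < emeasure m (S \<times> tslab s t lo hi)}"
    unfolding open_dist
  proof (intro ballI)
    fix t assume t: "t \<in> {t. y < emeasure m (S \<times> tslab s t lo hi)}"
    define X where "X n = S \<times> tslab s t (lo + 1 / real (Suc n)) (hi - 1 / real (Suc n))" for n
    have "(SUP n. emeasure m (X n)) = emeasure m (\<Union>n. X n)"
    proof (rule SUP_emeasure_incseq)
      show "range X \<subseteq> sets m" using m by (auto simp: X_def)
      show "incseq X"
      proof (rule incseq_SucI)
        fix n
        have "1 / real (Suc (Suc n)) \<le> 1 / real (Suc n)" by (simp add: field_simps)
        then show "X n \<le> X (Suc n)" by (auto simp: X_def tslab_def)
      qed
    qed
    also have "(\<Union>n. X n) = S \<times> tslab s t lo hi"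
    proof (intro equalityI subsetI)
      fix z assume "z \<in> (\<Union>n. X n)"
      then obtain n where n: "z \<in> X n" by blast
      have e: "0 < 1 / real (Suc n)" by simp
      show "z \<in> S \<times> tslab s t lo hi" using n by (auto simp: X_def tslab_def simp del: of_nat_Suc) (use e in linarith)+
    next
      fix z assume z: "z \<in> S \<times> tslab s t lo hi"
      obtain x r where xr: "z = (x, r)" by (cases z)
      let ?e = "min (s * (r - t) - lo) (hi - s * (r - t))"
      have "0 < ?e" using z by (auto simp: xr tslab_def)
      then obtain n where "inverse (real (Suc n)) < ?e" using reals_Archimedean by blast
      then have "z \<in> X n" using z by (auto simp: xr X_def tslab_def inverse_eq_divide)
      then show "z \<in> (\<Union>n. X n)" by blast
    qed
    finally have "y < (SUP n. emeasure m (X n))" using t by simp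
    then obtain n where n: "y < emeasure m (X n)" by (auto simp: less_SUP_iff)
    have "t' \<in> {t. y < emeasure m (S \<times> tslab s t lo hi)}" if "dist t' t < 1 / real (Suc n)" for t'
    proof -
      have d: "\<bar>s * (t' - t)\<bar> < 1 / real (Suc n)" using that s by (auto simp: dist_real_def abs_mult)
      have "X n \<subseteq> S \<times> tslab s t' lo hi"
      proof
        fix z assume z: "z \<in> X n"
        obtain x r where xr: "z = (x, r)" by (cases z)
        have "lo + 1 / real (Suc n) < s * (r - t)" "s * (r - t) < hi - 1 / real (Suc n)" "x \<in> S"
          using z by (auto simp: X_def tslab_def xr)
        moreover have "s * (r - t) = s * (r - t') + s * (t' - t)" by (simp add: algebra_simps)
        ultimately have "lo < s * (r - t')" "s * (r - t') < hi" "x \<in> S" using d by linarith+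
        then show "z \<in> S \<times> tslab s t' lo hi" by (simp add: xr tslab_def)
      qed
      then have "emeasure m (X n) \<le> emeasure m (S \<times> tslab s t' lo hi)" by (intro emeasure_mono m)
      then show ?thesis using n by simp
    qed
    then show "\<exists>e>0. \<forall>t'. dist t' t < e \<longrightarrow> t' \<in> {t. y < emeasure m (S \<times> tslab s t lo hi)}"
      by (intro exI[of _ "1 / real (Suc n)"]) auto
  qed
  then show "{t \<in> space borel. y < emeasure m (S \<times> tslab s t lo hi)} \<in> sets borel" by simp
qed

text \<open>Writing the condition that the point is in the cube as an indicator makes the index set
  of the supremum countable and the same for all points.\<close>

lemma borel_measurable_Mx:
  assumes m: "\<And>\<tau> k \<alpha> lo hi t. \<tau> \<in> {1..N} \<Longrightarrow> \<alpha> \<in> I k \<tau> \<Longrightarrow> Q k \<tau> \<alpha> \<times> tslab s t lo hi \<in> sets m"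
    and s: "s = 1 \<or> s = -1" and \<eta>: "\<eta> \<le> 1"
  shows "Mx s \<eta> m \<in> borel_measurable PM"
proof -
  define J where "J = (SIGMA \<tau>:{1..N}. SIGMA k:(UNIV::int set). I k \<tau>)"
  have J: "countable J" unfolding J_def by (intro countable_SIGMA countable_cubes) auto
  let ?h = "\<lambda>(\<tau>, k, \<alpha>) w. emeasure m (Q k \<tau> \<alpha> \<times> tslab s (snd w) (\<eta> * dur k) (dur k)) / ennreal (cvol k \<tau> \<alpha> * ((1 - \<eta>) * dur k))
      * indicator (Q k \<tau> \<alpha> \<times> UNIV) w"
  have "Mx s \<eta> m w = (SUP c\<in>J. ?h c w)" for w
  proof (rule antisym)
    show "Mx s \<eta> m w \<le> (SUP c\<in>J. ?h c w)"
      unfolding Mx_def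
    proof (rule SUP_least, clarify)
      fix \<tau> k \<alpha> assume a: "\<tau> \<in> {1..N}" "\<alpha> \<in> I k \<tau>" "fst w \<in> Q k \<tau> \<alpha>"
      have "emeasure m (Q k \<tau> \<alpha> \<times> tslab s (snd w) (\<eta> * dur k) (dur k)) / emeasure PM (Q k \<tau> \<alpha> \<times> tslab s (snd w) (\<eta> * dur k) (dur k)) = ?h (\<tau>, k, \<alpha>) w"
        using a by (cases w) (auto simp: emeasure_slab[OF a(1,2) s \<eta>])
      also have "\<dots> \<le> (SUP c\<in>J. ?h c w)" using a by (intro SUP_upper) (auto simp: J_def)
      finally show "emeasure m (Q k \<tau> \<alpha> \<times> tslab s (snd w) (\<eta> * dur k) (dur k)) / emeasure PM (Q k \<tau> \<alpha> \<times> tslab s (snd w) (\<eta> * dur k) (dur k)) \<le> (SUP c\<in>J. ?h c w)" .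
    qed
    show "(SUP c\<in>J. ?h c w) \<le> Mx s \<eta> m w"
    proof (rule SUP_least)
      fix c assume c: "c \<in> J"
      obtain \<tau> k \<alpha> where c_eq: "c = (\<tau>, k, \<alpha>)" by (cases c)
      have a: "\<tau> \<in> {1..N}" "\<alpha> \<in> I k \<tau>" using c by (auto simp: J_def c_eq)
      show "?h c w \<le> Mx s \<eta> m w"
      proof (cases "fst w \<in> Q k \<tau> \<alpha>")
        case True
        then have "?h c w = emeasure m (Q k \<tau> \<alpha> \<times> tslab s (snd w) (\<eta> * dur k) (dur k)) / emeasure PM (Q k \<tau> \<alpha> \<times> tslab s (snd w) (\<eta> * dur k) (dur k))"
          by (cases w) (auto simp: emeasure_slab[OF a s \<eta>] c_eq)
        also have "\<dots> \<le> Mx s \<eta> m w"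
          unfolding Mx_def by (rule SUP_upper2[of "(\<tau>, k, \<alpha>)"]) (use a True in auto)
        finally show ?thesis .
      next
        case False
        then show ?thesis by (cases w) (auto simp: c_eq)
      qed
    qed
  qed
  then have "Mx s \<eta> m = (\<lambda>w. SUP c\<in>J. ?h c w)" by auto
  moreover have "(\<lambda>w. SUP c\<in>J. ?h c w) \<in> borel_measurable PM"
  proof (rule borel_measurable_SUP[OF J])
    fix c assume c: "c \<in> J"
    obtain \<tau> k \<alpha> where c_eq: "c = (\<tau>, k, \<alpha>)" by (cases c)
    have a: "\<tau> \<in> {1..N}" "\<alpha> \<in> I k \<tau>" using c by (auto simp: J_def c_eq)
    have [measurable]: "snd \<in> borel_measurable PM"
    proof -
      have "snd \<in> M \<Otimes>\<^sub>M lborel \<rightarrow>\<^sub>M lborel" by (rule measurable_snd)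
      then have "snd \<in> completion (M \<Otimes>\<^sub>M lborel) \<rightarrow>\<^sub>M lborel" by (rule measurable_completion)
      moreover have "(completion (M \<Otimes>\<^sub>M lborel) \<rightarrow>\<^sub>M (lborel :: real measure)) = borel_measurable (completion (M \<Otimes>\<^sub>M lborel))"
        by (rule measurable_cong_sets) simp_all
      ultimately show ?thesis unfolding par_measure_def by blast
    qed
    have [measurable]: "Q k \<tau> \<alpha> \<times> UNIV \<in> sets PM" by (intro Times_sets cube_sets a) simp
    have "(\<lambda>w. emeasure m (Q k \<tau> \<alpha> \<times> tslab s (snd w) (\<eta> * dur k) (dur k))) \<in> borel_measurable PM"
      by (rule measurable_compose[OF _ measurable_slab[OF m[OF a] s]]) measurable
    then show "?h c \<in> borel_measurable PM" unfolding c_eq prod.case by measurable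
  qed
  ultimately show ?thesis by simp
qed

lemma slab_borel:
  "\<tau> \<in> {1..N} \<Longrightarrow> \<alpha> \<in> I k \<tau> \<Longrightarrow> Q k \<tau> \<alpha> \<times> tslab s t lo hi \<in> borel_of_qm (par_dist \<rho> p)"
  by (intro borel_Times cube_borel open_tslab)

lemma slab_sets: "\<tau> \<in> {1..N} \<Longrightarrow> \<alpha> \<in> I k \<tau> \<Longrightarrow> Q k \<tau> \<alpha> \<times> tslab s t lo hi \<in> sets PM"
  by (intro sets_borel_par slab_borel)

text \<open>The density is carried on the Borel sets alone. Outer measures are attained on
  measurable sets, and these are now exactly the Borel sets, so Borel regularity is
  immediate.\<close>

definition borel_density :: "('a \<times> real \<Rightarrow> ennreal) \<Rightarrow> ('a \<times> real) measure" where
  "borel_density g = distr (density PM g) (sigma UNIV {U. openin (qtopology (par_dist \<rho> p)) U}) (\<lambda>w. w)"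

lemma sets_borel_density: "sets (borel_density g) = borel_of_qm (par_dist \<rho> p)"
  by (simp add: borel_density_def borel_of_qm_def)

lemma emeasure_borel_density:
  assumes "A \<in> borel_of_qm (par_dist \<rho> p)"
  shows "emeasure (borel_density g) A = emeasure (density PM g) A"
proof -
  have "(\<lambda>w. w) \<in> density PM g \<rightarrow>\<^sub>M sigma UNIV {U. openin (qtopology (par_dist \<rho> p)) U}"
  proof (rule measurableI)
    fix A assume "A \<in> sets (sigma UNIV {U. openin (qtopology (par_dist \<rho> p)) U})"
    then have "A \<in> borel_of_qm (par_dist \<rho> p)" by (simp add: borel_of_qm_def)
    from sets_borel_par[OF this] show "(\<lambda>w. w) -` A \<inter> space (density PM g) \<in> sets (density PM g)" by (simp add: space_par)
  qed auto
  then show ?thesis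
    unfolding borel_density_def using assms by (subst emeasure_distr) (auto simp: borel_of_qm_def space_par)
qed

lemma borel_regular_borel_density: "borel_regular (par_dist \<rho> p) (borel_density g)"
  unfolding borel_regular_def
proof (intro conjI allI impI)
  show sp: "space (borel_density g) = UNIV" by (simp add: borel_density_def)
  show "U \<in> sets (borel_density g)" if "openin (qtopology (par_dist \<rho> p)) U" for U
    using that by (auto simp: sets_borel_density borel_of_qm_def)
  fix A :: "('a \<times> real) set"
  obtain E where "E \<in> sets (borel_density g)" "A \<subseteq> E" "outer_measure_of (borel_density g) A = emeasure (borel_density g) E"
    using outer_measure_of_attain[of A "borel_density g"] sp by auto
  then show "\<exists>E\<in>borel_of_qm (par_dist \<rho> p). A \<subseteq> E \<and> outer_measure_of (borel_density g) A = emeasure (borel_density g) E"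
    by (auto simp: sets_borel_density)
qed

lemma Mx_borel_density: "Mx s \<eta> (borel_density g) = Mx s \<eta> (density PM g)"
  unfolding Mx_def fun_eq_iff
  by (intro allI SUP_cong refl) (auto simp: emeasure_borel_density slab_borel)

text \<open>Lebesgue differentiation up to a constant: near a density point of a level set of \<open>g\<close> there is
  a slab most of which lies in the level set.\<close>

lemma le_Mx_level:
  assumes s: "s = 1 \<or> s = -1" and [measurable]: "g \<in> borel_measurable PM" and c: "0 < (c::real)"
  defines "D \<equiv> {w. ennreal c < g w \<and> g w \<le> 2 * ennreal c \<and> 4 * Mx s (1/2) (density PM g) w < g w}"
  shows "D \<in> sets PM \<and> emeasure PM D = 0"
proof
  have [measurable]: "Mx s (1/2) (density PM g) \<in> borel_measurable PM"
    using s by (intro borel_measurable_Mx) (auto intro: slab_sets)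
  have "D = {w \<in> space PM. ennreal c < g w \<and> g w \<le> 2 * ennreal c \<and> 4 * Mx s (1/2) (density PM g) w < g w}"
    by (simp add: D_def space_par)
  then show Ds: "D \<in> sets PM" by simp
  show "emeasure PM D = 0"
  proof (rule ccontr)
    assume "emeasure PM D \<noteq> 0"
    then have D0: "0 < emeasure PM D" by (simp add: zero_less_iff_neq_zero)
    obtain \<tau> where \<tau>: "\<tau> \<in> {1..N}" using adjacent_cube by (metis zero_less_one)
    \<comment> \<open>With \<sigma> = 8 a box lasts between 4 and 8 times \<open>dur k\<close>, so
      slabs starting from most of its points stay inside it.\<close>
    interpret G: shift_grid PM "boxes \<tau>" fst shf "box 8 \<tau>" by (rule shift_grid_boxes[OF \<tau>]) simp
    obtain P where P: "P \<in> boxes \<tau>" "ennreal (31/32) * emeasure PM (box 8 \<tau> P) < emeasure PM (D \<inter> box 8 \<tau> P)"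
      using G.density_box[OF Ds D0 zero_less_one, of "31/32" 0] by auto
    obtain k \<alpha> j where P_eq: "P = (k, \<alpha>, j)" "\<alpha> \<in> I k \<tau>" using P(1) by (auto simp: boxes_def)
    let ?b = "tl 8 k" and ?v = "cvol k \<tau> \<alpha>"
    have b: "4 * dur k < ?b" "0 < ?b" using tl_bounds(2)[of 8 k] tl_pos[of 8 k] by auto
    have v: "0 < ?v" by (rule cvol_pos[OF \<tau> P_eq(2)])
    \<comment> \<open>The last strip of length \<open>dur k\<close> in direction \<open>s\<close>,
      from which a slab might leave the box. It makes up less than a quarter of the box, so
      \<open>D\<close> also meets the rest.\<close>
    define lo where "lo = (if s = 1 then (real_of_int j + 1) * ?b - dur k else real_of_int j * ?b)"
    let ?bad = "Q k \<tau> \<alpha> \<times> {lo ..< lo + dur k}"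
    have bad: "emeasure PM ?bad = ennreal (?v * dur k)"
      using \<tau> P_eq(2) v dur_pos[of k] by (simp add: emeasure_Times cube_sets emeasure_cube ennreal_mult)
    have bads: "?bad \<in> sets PM" by (intro Times_sets cube_sets \<tau> P_eq) simp
    have mP: "emeasure PM (box 8 \<tau> P) = ennreal (?v * ?b)" unfolding P_eq by (rule emeasure_box[OF \<tau> P_eq(2)])
    have "\<not> D \<inter> box 8 \<tau> P \<subseteq> ?bad"
    proof
      assume "D \<inter> box 8 \<tau> P \<subseteq> ?bad"
      then have le: "emeasure PM (D \<inter> box 8 \<tau> P) \<le> ennreal (?v * dur k)" unfolding bad[symmetric] by (intro emeasure_mono bads)
      have "ennreal (31/32) * ennreal (?v * ?b) < ennreal (?v * dur k)" by (rule less_le_trans[OF P(2)[unfolded mP] le])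
      then have "31/32 * (?v * ?b) < ?v * dur k" using v b dur_pos[of k] by (simp add: ennreal_mult[symmetric] ennreal_less_iff del: ennreal_divide_numeral)
      then have "?v * (31/32 * ?b) < ?v * dur k" by simp
      then have "31/32 * ?b < dur k" using v by simp
      then show False using b by simp
    qed
    then obtain w where "w \<in> D" "w \<in> box 8 \<tau> P" "w \<notin> ?bad" by blast
    then obtain x t where w: "(x, t) \<in> D" "(x, t) \<in> box 8 \<tau> P" "(x, t) \<notin> ?bad" by (cases w) blast
    have x: "x \<in> Q k \<tau> \<alpha>" and t: "real_of_int j * ?b \<le> t" "t < (real_of_int j + 1) * ?b" using w(2) by (auto simp: P_eq)
    let ?S = "Q k \<tau> \<alpha> \<times> tslab s t (1/2 * dur k) (dur k)"
    have Ss: "?S \<in> sets PM" by (rule slab_sets[OF \<tau> P_eq(2)])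
    have SP: "?S \<subseteq> box 8 \<tau> P"
      using s x t w(3) dur_pos[of k] by (auto simp: P_eq lo_def tslab_plus tslab_minus)
    have mS: "emeasure PM ?S = ennreal (?v * (1/2 * dur k))"
      using emeasure_slab[OF \<tau> P_eq(2) s, of "1/2" t] by simp
    \<comment> \<open>The complement of \<open>D\<close> in the box has measure at most 1/32 of a
      box of at most 8 durations, a quarter of \<open>dur k\<close> in time, which is half of the
      slab. So half of the slab carries values above \<open>c\<close>, and since
      \<open>g \<le> 2 c\<close> on \<open>D\<close>, the factor 4 results.\<close>
    have mSD: "ennreal (?v * (1/4 * dur k)) \<le> emeasure PM (D \<inter> ?S)"
    proof -
      have "box 8 \<tau> P - D = box 8 \<tau> P - (D \<inter> box 8 \<tau> P)" by auto
      then have "emeasure PM (box 8 \<tau> P - D) = emeasure PM (box 8 \<tau> P - (D \<inter> box 8 \<tau> P))" by (simp only:)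
      also have "\<dots> = emeasure PM (box 8 \<tau> P) - emeasure PM (D \<inter> box 8 \<tau> P)"
      proof (rule emeasure_Diff)
        show "emeasure PM (D \<inter> box 8 \<tau> P) \<noteq> \<infinity>"
          using emeasure_mono[of "D \<inter> box 8 \<tau> P" "box 8 \<tau> P" PM] sets_box[OF \<tau> P(1), of 8] mP by (auto simp: top_unique)
        show "box 8 \<tau> P \<in> sets PM" "D \<inter> box 8 \<tau> P \<in> sets PM" using Ds sets_box[OF \<tau> P(1), of 8] by (auto simp only: sets.Int)
      qed blast
      also have "\<dots> \<le> ennreal (?v * ?b) - ennreal (31/32 * (?v * ?b))"
        using P(2) v b unfolding mP by (intro ennreal_minus_mono) (auto simp: ennreal_mult'[symmetric] simp del: ennreal_divide_numeral)
      also have "\<dots> = ennreal (1/32 * (?v * ?b))" using v b by (subst ennreal_minus) auto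
      finally have 1: "emeasure PM (box 8 \<tau> P - D) \<le> ennreal (1/32 * (?v * ?b))" .
      have "?b \<le> 8 * dur k" using tl_bounds(1)[of 8 k] by simp
      then have 2: "1/32 * (?v * ?b) \<le> ?v * (1/4 * dur k)" using v by simp
      have "emeasure PM ?S \<le> emeasure PM (D \<inter> ?S) + emeasure PM (box 8 \<tau> P - D)"
        using Ds Ss sets_box[OF \<tau> P(1), of 8] SP
        by (intro order_trans[OF emeasure_mono emeasure_subadditive]) auto
      also have "\<dots> \<le> emeasure PM (D \<inter> ?S) + ennreal (?v * (1/4 * dur k))"
        by (intro add_left_mono order_trans[OF 1] ennreal_leI 2)
      finally have "ennreal (?v * (1/4 * dur k)) + ennreal (?v * (1/4 * dur k)) \<le> ennreal (?v * (1/4 * dur k)) + emeasure PM (D \<inter> ?S)"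
        using v dur_pos[of k] unfolding mS by (simp add: ennreal_plus[symmetric] add.commute field_simps del: ennreal_plus)
      then show ?thesis by (metis ennreal_add_left_cancel_le ennreal_neq_top infinity_ennreal_def)
    qed
    have "ennreal c * ennreal (?v * (1/4 * dur k)) \<le> ennreal c * emeasure PM (D \<inter> ?S)" by (intro mult_left_mono mSD) simp
    also have "\<dots> = (\<integral>\<^sup>+z. ennreal c * indicator (D \<inter> ?S) z \<partial>PM)"
      using Ds Ss by (intro nn_integral_cmult_indicator[symmetric]) auto
    also have "\<dots> \<le> (\<integral>\<^sup>+z\<in>?S. g z \<partial>PM)"
      by (rule nn_integral_mono) (auto split: split_indicator simp: D_def less_imp_le)
    also have "\<dots> = emeasure (density PM g) ?S" using Ss by (subst emeasure_density) auto
    also have "\<dots> = emeasure (density PM g) ?S / emeasure PM ?S * emeasure PM ?S"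
      unfolding mS using v dur_pos[of k] by (intro ennreal_divide_mult_cancel[symmetric]) auto
    also have "\<dots> \<le> Mx s (1/2) (density PM g) (x, t) * emeasure PM ?S"
      unfolding Mx_def by (intro mult_right_mono SUP_upper2[of "(\<tau>, k, \<alpha>)"]) (use \<tau> P_eq x in auto)
    also have "\<dots> = (2 * Mx s (1/2) (density PM g) (x, t)) * ennreal (?v * (1/4 * dur k))"
    proof -
      have "ennreal (?v * (1/2 * dur k)) = 2 * ennreal (?v * (1/4 * dur k))"
        using v dur_pos[of k] by (simp add: ennreal_mult'[symmetric] ennreal_numeral[symmetric] del: ennreal_numeral)
      then show ?thesis unfolding mS by (simp add: ac_simps)
    qed
    finally have "ennreal c \<le> 2 * Mx s (1/2) (density PM g) (x, t)"
      by (rule ennreal_mult_right_le_cancel) (use v dur_pos[of k] in auto)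
    then have "2 * ennreal c \<le> 2 * (2 * Mx s (1/2) (density PM g) (x, t))" by (rule mult_left_mono) simp
    then have "2 * ennreal c \<le> 4 * Mx s (1/2) (density PM g) (x, t)" by (simp add: mult.assoc[symmetric])
    then show False using w(1) by (auto simp: D_def)
  qed
qed

text \<open>The level sets between 2^n and 2^(n+1), for integer n, exhaust the positive finite
  values, and each contributes a null set.\<close>

lemma le_Mx:
  assumes s: "s = 1 \<or> s = -1" and g: "g \<in> borel_measurable PM" and fin: "AE w in PM. g w < \<infinity>"
  shows "AE w in PM. g w \<le> 4 * Mx s (1/2) (density PM g) w"
proof -
  define D where "D c = {w. ennreal c < g w \<and> g w \<le> 2 * ennreal c \<and> 4 * Mx s (1/2) (density PM g) w < g w}" for c
  have "AE w in PM. \<forall>n::int. w \<notin> D (2 powi n)"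
  proof (subst AE_all_countable, rule allI)
    fix n :: int
    have "(0::real) < 2 powi n" by (simp add: zero_less_power_int)
    from le_Mx_level[OF s g this] have "D (2 powi n) \<in> null_sets PM" unfolding D_def by auto
    then show "AE w in PM. w \<notin> D (2 powi n)" by (rule AE_not_in)
  qed
  with fin show ?thesis
  proof eventually_elim
    case (elim w)
    show ?case
    proof (rule ccontr)
      assume neg: "\<not> ?thesis"
      obtain r where r: "g w = ennreal r" "0 \<le> r" using elim(1) by (cases "g w") auto
      have "g w \<noteq> 0" using neg by auto
      then have r0: "0 < r" using r by (auto simp: less_le)
      define n where "n = \<lceil>log 2 r\<rceil> - 1"
      have "real_of_int n < log 2 r" "log 2 r \<le> real_of_int n + 1" unfolding n_def by linarith+
      then have "2 powr real_of_int n < r" "r \<le> 2 powr (real_of_int n + 1)" using r0 by (simp_all add: less_log_iff log_le_iff)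
      then have "2 powi n < r" "r \<le> 2 * 2 powi n" by (simp_all add: powr_add powr_real_of_int')
      moreover have "(0::real) < 2 powi n" by (simp add: zero_less_power_int)
      ultimately have "w \<in> D (2 powi n)"
        using neg r unfolding D_def by (auto simp: ennreal_less_iff not_le ennreal_mult'[symmetric] ennreal_numeral[symmetric] ennreal_leI simp del: ennreal_numeral)
      then show False using elim(2) by blast
    qed
  qed
qed

end

section \<open>Logarithms of maximal functions on opposite cylinders\<close>

lemma elog_finite: "0 < y \<Longrightarrow> y < \<infinity> \<Longrightarrow> elog y = ereal (ln (enn2real y))"
  by (auto simp: elog_def)

lemma elog_combination_finite:
  assumes "ereal f = - (ereal \<alpha> * elog y1) + ereal \<beta> * elog y2 + ereal b" "0 < \<alpha>" "0 < \<beta>"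
  shows "(0 < y1 \<and> y1 < \<infinity>) \<and> (0 < y2 \<and> y2 < \<infinity>) \<and> f = - \<alpha> * ln (enn2real y1) + \<beta> * ln (enn2real y2) + b"
proof -
  have "y1 \<noteq> 0 \<and> y1 \<noteq> \<infinity> \<and> y2 \<noteq> 0 \<and> y2 \<noteq> \<infinity>"
    using assms by (cases "y1 = 0"; cases "y1 = \<infinity>"; cases "y2 = 0"; cases "y2 = \<infinity>") (simp_all add: elog_def)
  then have y: "0 < y1" "y1 < \<infinity>" "0 < y2" "y2 < \<infinity>" by (auto simp: zero_less_iff_neq_zero less_top)
  show ?thesis using assms(1) y unfolding elog_finite[OF y(1,2)] elog_finite[OF y(3,4)] by simp
qed

lemma ennreal_le_divide_imp:
  assumes "ennreal a * X \<le> ennreal b" "0 < a" "0 \<le> b"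
  shows "X \<le> ennreal (b / a)"
proof -
  have "X = ennreal (1 / a) * (ennreal a * X)"
    using assms(2) by (simp add: mult.assoc[symmetric] ennreal_mult[symmetric])
  also have "\<dots> \<le> ennreal (1 / a) * ennreal b" by (intro mult_left_mono assms) simp
  also have "\<dots> = ennreal (b / a)" using assms(2,3) by (simp add: ennreal_mult[symmetric])
  finally show ?thesis .
qed

lemma ennreal_le_mult_INF:
  assumes "\<And>w. w \<in> R \<Longrightarrow> X \<le> ennreal c * g w" "0 < c"
  shows "X \<le> ennreal c * (INF w\<in>R. g w)"
proof -
  have eq: "Z = ennreal c * (ennreal (1 / c) * Z)" "Z = ennreal (1 / c) * (ennreal c * Z)" for Z
    using assms(2) by (simp_all add: mult.assoc[symmetric] ennreal_mult[symmetric])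
  have "ennreal (1 / c) * X \<le> (INF w\<in>R. g w)"
  proof (rule INF_greatest)
    fix w assume "w \<in> R"
    then have "ennreal (1 / c) * X \<le> ennreal (1 / c) * (ennreal c * g w)" by (intro mult_left_mono assms) simp_all
    then show "ennreal (1 / c) * X \<le> g w" using eq(2)[of "g w"] by simp
  qed
  then have "ennreal c * (ennreal (1 / c) * X) \<le> ennreal c * (INF w\<in>R. g w)" by (rule mult_left_mono) simp
  then show ?thesis using eq(1)[of X] by simp
qed

lemma AE_imp_ex:
  assumes "AE z in m. P z" "R \<in> sets m" "0 < emeasure m R"
  shows "\<exists>z\<in>R. P z"
proof (rule ccontr)
  assume "\<not> (\<exists>z\<in>R. P z)"
  then have "AE z in m. z \<notin> R" using assms(1) by (auto elim!: eventually_mono)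
  then show False using AE_iff_null_sets[OF assms(2)] assms(3) by (simp add: null_sets_def)
qed

text \<open>Counting levels turns the integral of a logarithm into a sum of measures of superlevel
  sets at geometrically growing heights.\<close>

lemma ln_le_count:
  assumes X: "0 < X"
  shows "ennreal (max 0 (ln X)) \<le> (\<Sum>n. indicator {n. exp (real n) < X} n)"
proof -
  define n0 where "n0 = nat \<lceil>ln X\<rceil>"
  have lt: "exp (real n) < X" if "n < n0" for n
  proof -
    have "real n < ln X" using that unfolding n0_def by linarith
    then show ?thesis using exp_less_mono[of "real n" "ln X"] X by simp
  qed
  have "ennreal (max 0 (ln X)) \<le> ennreal (real n0)" unfolding n0_def by (intro ennreal_leI) linarith
  also have "\<dots> = (\<Sum>n\<in>{..<n0}. indicator {n. exp (real n) < X} n)"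
    using lt by (simp add: ennreal_of_nat_eq_real_of_nat[symmetric])
  also have "\<dots> \<le> (\<Sum>n. indicator {n. exp (real n) < X} n)" by (rule sum_le_suminf) auto
  finally show ?thesis .
qed

text \<open>In part (ii) the function is given only up to null sets, so its measurability comes from
  completeness.\<close>

lemma borel_measurable_completion_AE:
  fixes f g :: "'x \<Rightarrow> real"
  assumes g: "g \<in> borel_measurable (completion m)" and ae: "AE x in completion m. f x = g x"
  shows "f \<in> borel_measurable (completion m)"
proof (rule measurableI)
  fix S :: "real set" assume S: "S \<in> sets borel"
  have G: "g -` S \<inter> space (completion m) \<in> sets (completion m)" by (rule measurable_sets[OF g S])
  show "f -` S \<inter> space (completion m) \<in> sets (completion m)"
  proof (rule completion.in_sets_AE[OF _ G])
    show "AE x in completion m. (x \<in> g -` S \<inter> space (completion m)) = (x \<in> f -` S \<inter> space (completion m))"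
      using ae by eventually_elim simp
  qed auto
qed simp

context homogeneous_dyadic
begin

lemma cyl_plus_eq: "cyl_plus \<rho> p \<gamma> x t l = qb x l \<times> tslab 1 t (\<gamma> * l powr p) (l powr p)"
  and cyl_minus_eq: "cyl_minus \<rho> p \<gamma> x t l = qb x l \<times> tslab (-1) t (\<gamma> * l powr p) (l powr p)"
  by (simp_all add: cyl_plus_def cyl_minus_def tslab_plus tslab_minus)

lemma emeasure_cyl:
  assumes "0 < l" "s = 1 \<or> s = -1" "lo \<le> hi"
  shows "emeasure PM (qb x l \<times> tslab s t lo hi) = ennreal (vol x l * (hi - lo))"
  using assms vol_pos[OF assms(1), of x]
  by (simp add: emeasure_Times sets_ball emeasure_ball emeasure_tslab[OF assms(2,3)] ennreal_mult)

text \<open>What has to be extracted from the \<sigma>-algebra of \<open>\<nu>\<close>: it makes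
  slabs over cubes and grid boxes measurable.\<close>

definition box_measurable :: "('a \<times> real) measure \<Rightarrow> bool" where
  "box_measurable \<nu> \<longleftrightarrow> (\<forall>A a b. A \<in> borel_of_qm \<rho> \<longrightarrow> A \<times> {a<..<b} \<in> sets \<nu>)"

text \<open>Over a ball of radius l only time intervals of length l^p are given. Shorter ones are
  intersections of two of these; longer ones are countable unions of pieces of length at most L,
  which advance by L/2 so that no end point is missed.\<close>

lemma ball_interval_sets:
  assumes cyl: "{cyl_minus \<rho> p 0 x t l | x t l. 0 < l} \<subseteq> sets \<nu>" and l: "0 < l"
  shows "qb x l \<times> {a<..<b} \<in> sets \<nu>"
proof -
  define L where "L = l powr p"
  have L: "0 < L" "0 < L / 2" using l by (simp_all add: L_def)
  have base: "qb x l \<times> {t - L<..<t} \<in> sets \<nu>" for t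
  proof -
    have "cyl_minus \<rho> p 0 x t l \<in> sets \<nu>" using cyl l by blast
    then show ?thesis by (simp add: cyl_minus_def L_def)
  qed
  have short: "qb x l \<times> {a<..<b} \<in> sets \<nu>" if "b - a \<le> L" for a b
  proof -
    have "qb x l \<times> {a<..<b} = (qb x l \<times> {b - L<..<b}) \<inter> (qb x l \<times> {a + L - L<..<a + L})" using that by auto
    then show ?thesis using sets.Int[OF base[of b] base[of "a + L"]] by simp
  qed
  have "qb x l \<times> {a<..<b} = (\<Union>i::int. qb x l \<times> {max a (i * (L/2)) <..< min b (i * (L/2) + L)})"
  proof (intro equalityI subsetI)
    fix w assume w: "w \<in> qb x l \<times> {a<..<b}"
    define i where "i = \<lceil>snd w / (L/2)\<rceil> - 1"
    have i: "of_int i < snd w / (L/2)" "snd w / (L/2) \<le> of_int i + 1" unfolding i_def by linarith+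
    have "of_int i * (L/2) < snd w" using i(1) pos_less_divide_eq[OF L(2), of "of_int i" "snd w"] by blast
    moreover have "snd w \<le> (of_int i + 1) * (L/2)" using i(2) pos_divide_le_eq[OF L(2), of "snd w" "of_int i + 1"] by blast
    then have "snd w < of_int i * (L/2) + L" using L unfolding distrib_right by linarith
    ultimately have "w \<in> qb x l \<times> {max a (i * (L/2)) <..< min b (i * (L/2) + L)}" using w by (auto simp: mem_Times_iff)
    then show "w \<in> (\<Union>i::int. qb x l \<times> {max a (i * (L/2)) <..< min b (i * (L/2) + L)})" by (rule UN_I[OF UNIV_I])
  qed auto
  moreover have "(\<Union>i::int. qb x l \<times> {max a (i * (L/2)) <..< min b (i * (L/2) + L)}) \<in> sets \<nu>"
  proof (rule sets.countable_UN)
    show "range (\<lambda>i::int. qb x l \<times> {max a (i * (L/2)) <..< min b (i * (L/2) + L)}) \<subseteq> sets \<nu>"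
      using L by (intro image_subsetI short) linarith
  qed
  ultimately show ?thesis by simp
qed

text \<open>Centres of generation n are within C0 \<delta>^n of every point, so an open set is a
  countable union of balls about centres of one dyadic system; an induction with the interval fixed
  reaches the Borel sets.\<close>

lemma box_measurableI:
  assumes sp: "space \<nu> = UNIV" and cyl: "{cyl_minus \<rho> p 0 x t l | x t l. 0 < l} \<subseteq> sets \<nu>"
  shows "box_measurable \<nu>"
  unfolding box_measurable_def
proof (intro allI impI)
  fix A and a b :: real assume A: "A \<in> borel_of_qm \<rho>"
  obtain \<tau> where \<tau>: "\<tau> \<in> {1..N}" using adjacent_cube by (metis zero_less_one)
  have op: "U \<times> {a<..<b} \<in> sets \<nu>" if U: "openin (qtopology \<rho>) U" for U
  proof -
    define J where "J = {c \<in> (SIGMA k:UNIV. I k \<tau>). qb (ctr (fst c) \<tau> (snd c)) (C0 * rad (fst c)) \<subseteq> U}"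
    have J: "countable J"
      by (rule countable_subset[of _ "SIGMA k:UNIV. I k \<tau>"]) (auto simp: J_def intro!: countable_SIGMA countable_cubes[OF \<tau>])
    have "U = (\<Union>c\<in>J. qb (ctr (fst c) \<tau> (snd c)) (C0 * rad (fst c)))"
    proof (intro equalityI subsetI)
      fix x assume "x \<in> U"
      then obtain r where r: "0 < r" "qb x r \<subseteq> U" using U unfolding openin_qtopology by blast
      have "0 < r / (2 * K0 * C0)" using r K0 C0 by simp
      then obtain n where "\<delta> ^ n < r / (2 * K0 * C0)" using real_arch_pow_inv[OF _ \<delta>(2)] by blast
      then have n: "K0 * (C0 * rad (int n) + C0 * rad (int n)) \<le> r" using K0 C0 by (simp add: rad_nat field_simps)
      obtain \<alpha> where \<alpha>: "\<alpha> \<in> I (int n) \<tau>" "\<rho> x (ctr (int n) \<tau> \<alpha>) < C0 * rad (int n)" using center_near[OF \<tau>, of "int n" x] by blast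
      have "qb (ctr (int n) \<tau> \<alpha>) (C0 * rad (int n)) \<subseteq> qb x (K0 * (C0 * rad (int n) + C0 * rad (int n)))"
        by (rule ball_trans) (use \<alpha>(2) in \<open>simp add: dist_sym[of x]\<close>)
      also have "\<dots> \<subseteq> U" using ball_mono[OF n] r(2) by blast
      finally have "(int n, \<alpha>) \<in> J" using \<alpha>(1) by (simp add: J_def)
      moreover have "x \<in> qb (ctr (int n) \<tau> \<alpha>) (C0 * rad (int n))" using \<alpha>(2) by (simp add: qball_def dist_sym[of x])
      ultimately show "x \<in> (\<Union>c\<in>J. qb (ctr (fst c) \<tau> (snd c)) (C0 * rad (fst c)))" by (intro UN_I[of "(int n, \<alpha>)"]) simp_all
    next
      fix x assume "x \<in> (\<Union>c\<in>J. qb (ctr (fst c) \<tau> (snd c)) (C0 * rad (fst c)))"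
      then show "x \<in> U" unfolding J_def by blast
    qed
    then have "U \<times> {a<..<b} = (\<Union>c\<in>J. qb (ctr (fst c) \<tau> (snd c)) (C0 * rad (fst c))) \<times> {a<..<b}" by simp
    also have "\<dots> = (\<Union>c\<in>J. qb (ctr (fst c) \<tau> (snd c)) (C0 * rad (fst c)) \<times> {a<..<b})" by blast
    also have "\<dots> \<in> sets \<nu>"
      using C0 rad_pos by (intro sets.countable_UN'' J ball_interval_sets[OF cyl]) simp
    finally show ?thesis .
  qed
  show "A \<times> {a<..<b} \<in> sets \<nu>"
    using A unfolding borel_of_qm_def
  proof (induction rule: sigma_sets.induct)
    case (Basic U)
    then show ?case using op by simp
  next
    case Empty
    then show ?case by simp
  next
    case (Compl U)
    have "openin (qtopology \<rho>) (UNIV :: 'a set)" unfolding openin_qtopology by (auto intro: exI[of _ 1])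
    then have "UNIV \<times> {a<..<b} - U \<times> {a<..<b} \<in> sets \<nu>" using Compl.IH op by (intro sets.Diff)
    moreover have "(UNIV - U) \<times> {a<..<b} = UNIV \<times> {a<..<b} - U \<times> {a<..<b}" by blast
    ultimately show ?case by simp
  next
    case (Union U)
    have "(\<Union>i. U i \<times> {a<..<b}) \<in> sets \<nu>" using Union.IH by (intro sets.countable_UN) auto
    moreover have "(\<Union>i. U i) \<times> {a<..<b} = (\<Union>i. U i \<times> {a<..<b})" by blast
    ultimately show ?case by simp
  qed
qed

lemma box_measurable_slab:
  assumes "box_measurable \<nu>" "A \<in> borel_of_qm \<rho>" "s = 1 \<or> s = -1"
  shows "A \<times> tslab s t lo hi \<in> sets \<nu>"
  using assms unfolding box_measurable_def by (auto simp: tslab_plus tslab_minus)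

lemma box_measurable_box:
  assumes \<nu>: "box_measurable \<nu>" and \<tau>: "\<tau> \<in> {1..N}" and P: "P \<in> boxes \<tau>"
  shows "box \<sigma> \<tau> P \<in> sets \<nu>"
proof -
  obtain k \<alpha> j where P_eq: "P = (k, \<alpha>, j)" "\<alpha> \<in> I k \<tau>" using P by (auto simp: boxes_def)
  have halfopen: "{a..<b} = (\<Inter>n. {a - 1 / real (Suc n)<..<b})" for a b :: real
  proof (intro equalityI subsetI)
    fix y assume "y \<in> {a..<b}"
    then have "a - 1 / real (Suc n) < y \<and> y < b" for n using less_le_trans[of "a - 1 / real (Suc n)" a y] by simp
    then show "y \<in> (\<Inter>n. {a - 1 / real (Suc n)<..<b})" unfolding INT_iff greaterThanLessThan_iff by blast
  next
    fix y assume y: "y \<in> (\<Inter>n. {a - 1 / real (Suc n)<..<b})"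
    have "\<not> y < a"
    proof
      assume "y < a"
      then obtain n where "1 / real (Suc n) < a - y" using nat_approx_posE[of "a - y"] by auto
      moreover have "a - 1 / real (Suc n) < y" using INT_D[OF y UNIV_I, of n] unfolding greaterThanLessThan_iff by (rule conjunct1)
      ultimately show False by linarith
    qed
    then show "y \<in> {a..<b}" using INT_D[OF y UNIV_I, of 0] by simp
  qed
  have "Q k \<tau> \<alpha> \<times> {a..<b} \<in> sets \<nu>" for a b
  proof -
    have "Q k \<tau> \<alpha> \<times> {a..<b} = (\<Inter>n. Q k \<tau> \<alpha> \<times> {a - 1 / real (Suc n)<..<b})" unfolding halfopen by blast
    also have "\<dots> \<in> sets \<nu>"
      using \<nu> cube_borel[OF \<tau> P_eq(2)] by (intro sets.countable_INT) (auto simp: box_measurable_def)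
    finally show ?thesis .
  qed
  then show ?thesis by (simp add: P_eq)
qed

text \<open>A monotone geodesic ending at x has a penultimate point at distance between s and Kt s
  from x, where s = r / (Kt + 1). A starting point at distance at least s exists since the diameter
  is infinite. The result links radii with actual distances, which is needed to read off the
  generation of a cube from its diameter.\<close>

lemma near_point: "\<exists>Kg\<ge>1. \<forall>x. \<forall>r>0. \<exists>w. \<rho> x w < r \<and> r / Kg \<le> \<rho> x w"
proof -
  obtain Kt where Kt: "0 < Kt" and geo: "\<forall>s>0. \<forall>x y. \<rho> x y \<ge> s \<longrightarrow>
        (\<exists>(m::nat) xs. xs 0 = x \<and> xs m = y \<and>
           (\<forall>i<m. \<rho> (xs i) (xs (Suc i)) \<le> Kt * s \<and> \<rho> (xs (Suc i)) (xs m) \<le> \<rho> (xs i) (xs m) - s))"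
    using monotone_geodesic unfolding monotone_geodesic_def by (elim exE conjE)
  have "\<exists>w. \<rho> x w < r \<and> r / (Kt + 1) \<le> \<rho> x w" if r: "0 < r" for x r
  proof -
    define s where "s = r / (Kt + 1)"
    have s: "0 < s" "Kt * s < r" using r Kt by (auto simp: s_def field_simps)
    have "\<exists>y. s \<le> \<rho> y x"
    proof (rule ccontr)
      assume "\<not> (\<exists>y. s \<le> \<rho> y x)"
      then have lt: "\<rho> y x < s" for y by (auto simp: not_le)
      have le: "\<rho> u v \<le> K0 * (s + s)" for u v
      proof -
        have "\<rho> u v \<le> K0 * (\<rho> u x + \<rho> x v)" by (rule dist_tri)
        also have "\<dots> \<le> K0 * (s + s)" using K0 lt[of u] lt[of v] by (intro mult_left_mono) (auto simp: dist_sym[of x v])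
        finally show ?thesis .
      qed
      have "qdiam \<rho> UNIV \<le> ennreal (K0 * (s + s))" unfolding qdiam_def by (intro SUP_least ennreal_leI le)
      then show False using standing by (simp add: standing_assms_def top_unique)
    qed
    then obtain y where y: "s \<le> \<rho> y x" by blast
    obtain m xs where xs: "xs 0 = y" "xs m = x" and
      step: "\<forall>i<m. \<rho> (xs i) (xs (Suc i)) \<le> Kt * s \<and> \<rho> (xs (Suc i)) (xs m) \<le> \<rho> (xs i) (xs m) - s"
      using geo[rule_format, OF s(1) y] by (elim exE conjE)
    have "m \<noteq> 0" using xs y s dist_eq_0[of x x] by (cases m) auto
    then obtain n where n: "m = Suc n" by (cases m) auto
    have "\<rho> (xs n) x \<le> Kt * s" "0 \<le> \<rho> (xs n) x - s"
      using step[rule_format, of n] xs dist_eq_0[of x x] by (auto simp: n)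
    then show ?thesis using s by (intro exI[of _ "xs n"]) (auto simp: dist_sym[of x] s_def[symmetric])
  qed
  then show ?thesis using Kt by (intro exI[of _ "Kt + 1"]) simp
qed

text \<open>The adjacent systems control the diameter of the cube, whereas \<open>dur k'\<close>
  depends on its generation. \<open>near_point\<close>, once in the given ball and once in the inner
  ball of the cube, bounds \<open>rad k'\<close> from below and from above.\<close>

lemma comparison_cube:
  assumes H: "0 < H"
  shows "\<exists>D\<ge>1. \<forall>x k. \<exists>\<tau>\<in>{1..N}. \<exists>k'. \<exists>\<alpha>\<in>I k' \<tau>. qb x (H * rad k) \<subseteq> Q k' \<tau> \<alpha> \<and> 4 * dur k \<le> dur k' \<and>
    cvol k' \<tau> \<alpha> * dur k' \<le> D * (vol x (rad k) * dur k)"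
proof -
  obtain Kg where Kg: "1 \<le> Kg" "\<forall>x. \<forall>r>0. \<exists>w. \<rho> x w < r \<and> r / Kg \<le> \<rho> x w" using near_point by (elim exE conjE)
  obtain Cs where Cs: "0 < Cs" "\<forall>x. \<forall>r>0. \<exists>\<tau>\<in>{1..N}. \<exists>k. \<exists>\<alpha>\<in>I k \<tau>. qb x r \<subseteq> Q k \<tau> \<alpha> \<and> qdiam \<rho> (Q k \<tau> \<alpha>) \<le> ennreal (Cs * r)"
    using adjacent_cube by (elim exE conjE)
  define c where "c = K0 * C1"
  have c: "0 < c" using K0 C1 by (simp add: c_def)
  \<comment> \<open>So large that a point of the ball at distance at least G rad k / Kg from x
    forces rad k' \<ge> 4 rad k, hence dur k' \<ge> 4 dur k.\<close>
  define G where "G = max H (8 * c * Kg)"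
  have G: "0 < G" "H \<le> G" "8 * c * Kg \<le> G" using H by (auto simp: G_def)
  \<comment> \<open>The inner ball of radius c1 rad k' contains a point at distance at least c1 rad
    k' / Kg from its centre, and the diameter is at most Cs G rad k; hence rad k' \<le> E rad
    k.\<close>
  define E where "E = Cs * G * Kg / c1"
  have E: "0 < E" using Cs G Kg c1 by (simp add: E_def)
  obtain D0 where D0: "1 \<le> D0" "\<forall>x. \<forall>r>0. vol x ((2 * c * E) * r) \<le> D0 * vol x r" using vol_scale[of "2 * c * E"] by (elim exE conjE)
  have main: "\<exists>\<tau>\<in>{1..N}. \<exists>k'. \<exists>\<alpha>\<in>I k' \<tau>. qb x (H * rad k) \<subseteq> Q k' \<tau> \<alpha> \<and> 4 * dur k \<le> dur k' \<and>
    cvol k' \<tau> \<alpha> * dur k' \<le> max 1 (D0 * E powr p) * (vol x (rad k) * dur k)" for x k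
  proof -
    have rk: "0 < rad k" by (rule rad_pos)
    have Gr: "0 < G * rad k" using G rk by simp
    obtain \<tau> k' \<alpha> where \<tau>: "\<tau> \<in> {1..N}" and \<alpha>: "\<alpha> \<in> I k' \<tau>" and sub: "qb x (G * rad k) \<subseteq> Q k' \<tau> \<alpha>"
      and diam: "qdiam \<rho> (Q k' \<tau> \<alpha>) \<le> ennreal (Cs * (G * rad k))"
      using Cs(2)[rule_format, OF Gr, of x] by (elim bexE exE conjE)
    have rk': "0 < rad k'" by (rule rad_pos)
    obtain w where w: "\<rho> x w < G * rad k" "G * rad k / Kg \<le> \<rho> x w" using Kg(2)[rule_format, OF Gr, of x] by (elim exE conjE)
    have xQ: "x \<in> Q k' \<tau> \<alpha>" "w \<in> Q k' \<tau> \<alpha>" using sub w(1) Gr dist_eq_0[of x x] by (auto simp: qball_def)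
    have "\<rho> x w < 2 * K0 * C1 * rad k'" by (rule cube_in_ball[OF \<tau> \<alpha> xQ])
    then have 1: "G * rad k / Kg < 2 * c * rad k'" using w(2) by (simp add: c_def mult.assoc)
    have "8 * c \<le> G / Kg" using G(3) Kg(1) by (simp add: pos_le_divide_eq)
    then have "8 * c * rad k \<le> G / Kg * rad k" using rk by (intro mult_right_mono) auto
    then have "2 * c * (4 * rad k) < 2 * c * rad k'" using 1 by simp
    then have four: "4 * rad k \<le> rad k'" using c by simp
    have "4 * dur k \<le> 4 powr p * rad k powr p"
      using powr_mono[of 1 p "4::real"] p rk by (auto simp: dur_rad intro!: mult_right_mono)
    also have "\<dots> = (4 * rad k) powr p" using rk by (simp add: powr_mult)
    also have "\<dots> \<le> dur k'" unfolding dur_rad using four rk p by (intro powr_mono2) auto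
    finally have dur4: "4 * dur k \<le> dur k'" .
    have cr: "0 < c1 * rad k'" using c1 rk' by simp
    obtain v where v: "\<rho> (ctr k' \<tau> \<alpha>) v < c1 * rad k'" "c1 * rad k' / Kg \<le> \<rho> (ctr k' \<tau> \<alpha>) v"
      using Kg(2)[rule_format, OF cr, of "ctr k' \<tau> \<alpha>"] by (elim exE conjE)
    have "v \<in> Q k' \<tau> \<alpha>" using cube_inner[OF \<tau> \<alpha>] v(1) by (auto simp: qball_def)
    then have "ennreal (\<rho> (ctr k' \<tau> \<alpha>) v) \<le> qdiam \<rho> (Q k' \<tau> \<alpha>)"
      unfolding qdiam_def by (intro SUP_upper2[OF center_in_cube[OF \<tau> \<alpha>]] SUP_upper2) auto
    also note diam
    finally have "\<rho> (ctr k' \<tau> \<alpha>) v \<le> Cs * (G * rad k)" using Cs(1) Gr by (simp add: ennreal_le_iff)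
    then have "c1 * rad k' / Kg \<le> Cs * (G * rad k)" using v(2) by linarith
    then have up: "rad k' \<le> E * rad k" using Kg(1) c1 by (simp add: E_def field_simps)
    have "Q k' \<tau> \<alpha> \<subseteq> qb x (2 * c * E * rad k)"
    proof
      fix y assume "y \<in> Q k' \<tau> \<alpha>"
      then have "\<rho> x y < 2 * K0 * C1 * rad k'" by (rule cube_in_ball[OF \<tau> \<alpha> xQ(1)])
      also have "\<dots> \<le> 2 * c * (E * rad k)" unfolding c_def mult.assoc using up K0 C1 by (intro mult_left_mono) (auto simp: mult.assoc)
      finally show "y \<in> qb x (2 * c * E * rad k)" by (simp add: qball_def mult.assoc)
    qed
    then have "emeasure M (Q k' \<tau> \<alpha>) \<le> emeasure M (qb x (2 * c * E * rad k))"
      using c E rk by (intro emeasure_mono sets_ball) auto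
    then have "cvol k' \<tau> \<alpha> \<le> vol x (2 * c * E * rad k)"
      using c E rk vol_pos[of "2 * c * E * rad k" x] by (simp add: emeasure_cube[OF \<tau> \<alpha>] emeasure_ball ennreal_le_iff)
    also have "\<dots> \<le> D0 * vol x (rad k)" using D0(2) rk by blast
    finally have cv: "cvol k' \<tau> \<alpha> \<le> D0 * vol x (rad k)" .
    have "dur k' \<le> (E * rad k) powr p" unfolding dur_rad using up rk' p by (intro powr_mono2) auto
    also have "\<dots> = E powr p * dur k" using E rk by (simp add: dur_rad powr_mult)
    finally have du: "dur k' \<le> E powr p * dur k" .
    have v0: "0 < vol x (rad k)" by (rule vol_pos[OF rk])
    have "cvol k' \<tau> \<alpha> * dur k' \<le> (D0 * vol x (rad k)) * (E powr p * dur k)"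
      using cv du D0(1) v0 dur_pos[of k'] by (intro mult_mono) auto
    also have "\<dots> = (D0 * E powr p) * (vol x (rad k) * dur k)" by (simp only: mult.assoc mult.left_commute)
    also have "\<dots> \<le> max 1 (D0 * E powr p) * (vol x (rad k) * dur k)"
      using v0 dur_pos[of k] by (intro mult_right_mono) auto
    finally have vd: "cvol k' \<tau> \<alpha> * dur k' \<le> max 1 (D0 * E powr p) * (vol x (rad k) * dur k)" .
    have "qb x (H * rad k) \<subseteq> qb x (G * rad k)" using G(2) rk by (intro ball_mono mult_right_mono) auto
    then show ?thesis using \<tau> \<alpha> sub dur4 vd by blast
  qed
  show ?thesis by (rule exI[of _ "max 1 (D0 * E powr p)"]) (use main in simp)
qed

text \<open>The slab issuing from w over the comparison cube contains \<open>S\<close> and is among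
  the competitors in \<open>Mx\<close>.\<close>

lemma emeasure_le_Mx:
  assumes H: "0 < H"
  shows "\<exists>D\<ge>1. \<forall>\<nu> s x k w S. box_measurable \<nu> \<longrightarrow> s = 1 \<or> s = -1 \<longrightarrow> fst w \<in> qb x (H * rad k) \<longrightarrow>
    S \<subseteq> qb x (H * rad k) \<times> tslab s (snd w) 0 (4 * dur k) \<longrightarrow>
    emeasure \<nu> S \<le> ennreal (D * (vol x (rad k) * dur k)) * Mx s 0 \<nu> w"
proof -
  obtain D where D: "1 \<le> D" "\<forall>x k. \<exists>\<tau>\<in>{1..N}. \<exists>k'. \<exists>\<alpha>\<in>I k' \<tau>. qb x (H * rad k) \<subseteq> Q k' \<tau> \<alpha> \<and> 4 * dur k \<le> dur k' \<and>
    cvol k' \<tau> \<alpha> * dur k' \<le> D * (vol x (rad k) * dur k)" using comparison_cube[OF H] by (elim exE conjE)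
  show ?thesis
  proof (rule exI[of _ D], intro conjI D(1) allI impI)
    fix \<nu> :: "('a \<times> real) measure" and s x k and w :: "'a \<times> real" and S
    assume \<nu>: "box_measurable \<nu>" and s: "s = 1 \<or> s = -1" and w: "fst w \<in> qb x (H * rad k)"
      and S: "S \<subseteq> qb x (H * rad k) \<times> tslab s (snd w) 0 (4 * dur k)"
    obtain \<tau> k' \<alpha> where \<tau>: "\<tau> \<in> {1..N}" and \<alpha>: "\<alpha> \<in> I k' \<tau>" and sub: "qb x (H * rad k) \<subseteq> Q k' \<tau> \<alpha>"
      and dur: "4 * dur k \<le> dur k'" and cd: "cvol k' \<tau> \<alpha> * dur k' \<le> D * (vol x (rad k) * dur k)"
      using D(2)[rule_format, of x k] by (elim bexE exE conjE)
    let ?T = "Q k' \<tau> \<alpha> \<times> tslab s (snd w) (0 * dur k') (dur k')"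
    have mT: "emeasure PM ?T = ennreal (cvol k' \<tau> \<alpha> * ((1 - 0) * dur k'))" by (rule emeasure_slab[OF \<tau> \<alpha> s]) simp
    have T0: "0 < emeasure PM ?T" "emeasure PM ?T < \<infinity>" unfolding mT using cvol_pos[OF \<tau> \<alpha>] dur_pos[of k'] by auto
    have "S \<subseteq> ?T" using S sub dur by (fastforce simp: tslab_def)
    then have "emeasure \<nu> S \<le> emeasure \<nu> ?T" by (intro emeasure_mono box_measurable_slab[OF \<nu> cube_borel[OF \<tau> \<alpha>] s])
    also have "\<dots> = emeasure \<nu> ?T / emeasure PM ?T * emeasure PM ?T" by (rule ennreal_divide_mult_cancel[OF T0, symmetric])
    also have "\<dots> \<le> Mx s 0 \<nu> w * ennreal (D * (vol x (rad k) * dur k))"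
    proof (rule mult_mono)
      show "emeasure \<nu> ?T / emeasure PM ?T \<le> Mx s 0 \<nu> w"
        unfolding Mx_def by (rule SUP_upper2[of "(\<tau>, k', \<alpha>)"]) (use \<tau> \<alpha> sub w in auto)
      show "emeasure PM ?T \<le> ennreal (D * (vol x (rad k) * dur k))" unfolding mT using cd by (intro ennreal_leI) simp
    qed auto
    finally show "emeasure \<nu> S \<le> ennreal (D * (vol x (rad k) * dur k)) * Mx s 0 \<nu> w" by (simp only: mult.commute)
  qed
qed

text \<open>In the grids with \<sigma> = 1 a slab average is dominated by a sum of \<open>cc\<close>
  shifted box averages of \<open>\<nu>\<close> restricted to \<open>S\<close>, so one of these
  exceeds h / cc. Then \<open>weak_type\<close> is applied to each system and each shift, with
  \<open>S\<close> as the set \<open>W\<close>, and only the mass of \<open>S\<close> appears on the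
  right.\<close>

lemma small_scales_weak_type:
  assumes si: "si = 1 \<or> si = (-1::int)"
  shows "\<exists>W\<ge>0. \<forall>\<nu> S E h. box_measurable \<nu> \<longrightarrow> S \<in> sets \<nu> \<longrightarrow> E \<in> sets PM \<longrightarrow> 0 < h \<longrightarrow>
    (\<forall>z\<in>E. \<exists>\<tau>\<in>{1..N}. \<exists>k. \<exists>\<alpha>\<in>I k \<tau>. fst z \<in> Q k \<tau> \<alpha> \<and> Q k \<tau> \<alpha> \<times> tslab (of_int si) (snd z) (0 * dur k) (dur k) \<subseteq> S \<and>
       ennreal h < emeasure \<nu> (Q k \<tau> \<alpha> \<times> tslab (of_int si) (snd z) (0 * dur k) (dur k))
         / emeasure PM (Q k \<tau> \<alpha> \<times> tslab (of_int si) (snd z) (0 * dur k) (dur k))) \<longrightarrow>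
    ennreal h * emeasure PM E \<le> ennreal W * emeasure \<nu> S"
proof -
  define cc where "cc = real (card (lag 0 1))"
  have "0 \<in> lag 0 1" by (simp add: lag_def)
  then have cc: "0 < cc" using finite_lag[of 0 1] by (auto simp: cc_def card_gt_0_iff)
  define J where "J = {1..N} \<times> lag 0 1"
  have J: "finite J" by (simp add: J_def finite_lag)
  define W where "W = (\<Sum>c\<in>J. real_of_int (2 * \<bar>si * snd c\<bar> + 1))"
  have W: "0 \<le> W" unfolding W_def by (intro sum_nonneg) auto
  have s: "real_of_int si = 1 \<or> real_of_int si = -1" using si by auto
  have main: "ennreal h * emeasure PM E \<le> ennreal (cc * W) * emeasure \<nu> S"
    if \<nu>: "box_measurable \<nu>" and S: "S \<in> sets \<nu>" and E: "E \<in> sets PM" and h: "0 < h" and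
    ex: "\<forall>z\<in>E. \<exists>\<tau>\<in>{1..N}. \<exists>k. \<exists>\<alpha>\<in>I k \<tau>. fst z \<in> Q k \<tau> \<alpha> \<and> Q k \<tau> \<alpha> \<times> tslab (of_int si) (snd z) (0 * dur k) (dur k) \<subseteq> S \<and>
       ennreal h < emeasure \<nu> (Q k \<tau> \<alpha> \<times> tslab (of_int si) (snd z) (0 * dur k) (dur k))
         / emeasure PM (Q k \<tau> \<alpha> \<times> tslab (of_int si) (snd z) (0 * dur k) (dur k))" for \<nu> S E h
  proof -
    define F where "F c = {P \<in> boxes (fst c). ennreal (h / cc) * emeasure PM (box 1 (fst c) P) \<le> emeasure \<nu> (box 1 (fst c) (shf (si * snd c) P) \<inter> S)}" for c
    have Fs: "(\<Union>P\<in>F c. box 1 (fst c) P) \<in> sets PM" and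
      Fw: "ennreal (h / cc) * emeasure PM (\<Union>P\<in>F c. box 1 (fst c) P) \<le> ennreal (real_of_int (2 * \<bar>si * snd c\<bar> + 1)) * emeasure \<nu> S" if c: "c \<in> J" for c
    proof -
      have \<tau>: "fst c \<in> {1..N}" using c by (auto simp: J_def)
      interpret G: shift_grid PM "boxes (fst c)" fst shf "box 1 (fst c)" by (rule shift_grid_boxes[OF \<tau>]) simp
      have F: "F c \<subseteq> boxes (fst c)" by (auto simp: F_def)
      show "(\<Union>P\<in>F c. box 1 (fst c) P) \<in> sets PM" by (rule G.sets_UN_bx[OF F])
      show "ennreal (h / cc) * emeasure PM (\<Union>P\<in>F c. box 1 (fst c) P) \<le> ennreal (real_of_int (2 * \<bar>si * snd c\<bar> + 1)) * emeasure \<nu> S"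
        by (rule G.weak_type[OF F box_measurable_box[OF \<nu> \<tau>] S]) (simp_all add: F_def)
    qed
    have "E \<subseteq> (\<Union>c\<in>J. \<Union>P\<in>F c. box 1 (fst c) P)"
    proof
      fix z assume zE: "z \<in> E"
      obtain \<tau> k \<alpha> where \<tau>: "\<tau> \<in> {1..N}" and \<alpha>: "\<alpha> \<in> I k \<tau>" and z: "fst z \<in> Q k \<tau> \<alpha>"
        and sub: "Q k \<tau> \<alpha> \<times> tslab (of_int si) (snd z) (0 * dur k) (dur k) \<subseteq> S"
        and gt: "ennreal h < emeasure \<nu> (Q k \<tau> \<alpha> \<times> tslab (of_int si) (snd z) (0 * dur k) (dur k))
         / emeasure PM (Q k \<tau> \<alpha> \<times> tslab (of_int si) (snd z) (0 * dur k) (dur k))"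
        using ex[rule_format, OF zE] by (elim bexE exE conjE)
      let ?T = "Q k \<tau> \<alpha> \<times> tslab (of_int si) (snd z) (0 * dur k) (dur k)"
      obtain \<alpha>' j where j: "\<alpha>' \<in> I k \<tau>" "z \<in> box 1 \<tau> (k, \<alpha>', j)" using cover_box[OF \<tau>, of k z 1] by (elim bexE exE)
      have "\<alpha>' = \<alpha>" using disjoint_family_onD[OF cubes_disjoint[OF \<tau>, of k] j(1) \<alpha>] j(2) z by (cases z) auto
      then have t: "snd z \<in> {real_of_int j * tl 1 k ..< (real_of_int j + 1) * tl 1 k}" and zb: "z \<in> box 1 \<tau> (k, \<alpha>, j)"
        using j(2) by (cases z, auto)+
      let ?P = "(k, \<alpha>, j)"
      have P: "?P \<in> boxes \<tau>" using \<alpha> by (simp add: boxes_def)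
      have Ps: "shf i ?P \<in> boxes \<tau>" for i using \<alpha> by (simp add: boxes_def)
      let ?m = "density \<nu> (indicator S)"
      have mbox: "emeasure ?m (box 1 \<tau> (shf i ?P)) = emeasure \<nu> (box 1 \<tau> (shf i ?P) \<inter> S)" for i
        using emeasure_restricted[OF S box_measurable_box[OF \<nu> \<tau> Ps[of i]]] by (simp only: Int_commute)
      have Ts: "?T \<in> sets \<nu>" by (rule box_measurable_slab[OF \<nu> cube_borel[OF \<tau> \<alpha>] s])
      have mT: "emeasure ?m ?T = emeasure \<nu> ?T"
        unfolding emeasure_restricted[OF S Ts] using sub by (intro arg_cong[where f="emeasure \<nu>"]) blast
      have "emeasure ?m ?T / emeasure PM ?T \<le> ennreal (1 / (1 - 0)) * (\<Sum>i\<in>lag 0 1. emeasure ?m (box 1 \<tau> (shf (si * i) ?P)) / emeasure PM (box 1 \<tau> ?P))"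
        by (rule slab_le[OF _ si _ _ \<tau> \<alpha> t]) (simp_all add: box_measurable_box[OF \<nu> \<tau>])
      then have gt': "ennreal h < (\<Sum>i\<in>lag 0 1. emeasure \<nu> (box 1 \<tau> (shf (si * i) ?P) \<inter> S) / emeasure PM (box 1 \<tau> ?P))"
        using gt unfolding mT mbox by simp
      have "\<exists>i\<in>lag 0 1. ennreal (h / cc) < emeasure \<nu> (box 1 \<tau> (shf (si * i) ?P) \<inter> S) / emeasure PM (box 1 \<tau> ?P)"
      proof (rule ccontr)
        assume "\<not> ?thesis"
        then have "(\<Sum>i\<in>lag 0 1. emeasure \<nu> (box 1 \<tau> (shf (si * i) ?P) \<inter> S) / emeasure PM (box 1 \<tau> ?P)) \<le> (\<Sum>i\<in>lag 0 1. ennreal (h / cc))"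
          by (intro sum_mono) (auto simp: not_less)
        also have "\<dots> = ennreal cc * ennreal (h / cc)" by (simp add: cc_def ennreal_of_nat_eq_real_of_nat)
        also have "\<dots> = ennreal h" using cc h by (simp add: ennreal_mult[symmetric])
        finally show False using gt' by simp
      qed
      then obtain i where i: "i \<in> lag 0 1" "ennreal (h / cc) < emeasure \<nu> (box 1 \<tau> (shf (si * i) ?P) \<inter> S) / emeasure PM (box 1 \<tau> ?P)" by blast
      have b: "0 < emeasure PM (box 1 \<tau> ?P)" "emeasure PM (box 1 \<tau> ?P) < \<infinity>"
        unfolding emeasure_box[OF \<tau> \<alpha>] using cvol_pos[OF \<tau> \<alpha>] tl_pos[of 1 k] by auto
      have "ennreal (h / cc) * emeasure PM (box 1 \<tau> ?P) \<le> emeasure \<nu> (box 1 \<tau> (shf (si * i) ?P) \<inter> S)"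
        by (rule ennreal_less_divide_imp[OF i(2) b])
      then have "?P \<in> F (\<tau>, i)" using P by (simp add: F_def del: shf.simps box.simps)
      then show "z \<in> (\<Union>c\<in>J. \<Union>P\<in>F c. box 1 (fst c) P)"
        using zb \<tau> i(1) by (intro UN_I[of "(\<tau>, i)"] UN_I[of ?P]) (simp_all add: J_def del: box.simps)
    qed
    then have "emeasure PM E \<le> emeasure PM (\<Union>c\<in>J. \<Union>P\<in>F c. box 1 (fst c) P)"
      by (rule emeasure_mono) (rule sets.finite_UN[OF J Fs])
    also have "\<dots> \<le> (\<Sum>c\<in>J. emeasure PM (\<Union>P\<in>F c. box 1 (fst c) P))"
      by (intro emeasure_subadditive_finite J image_subsetI Fs)
    finally have "ennreal (h / cc) * emeasure PM E \<le> ennreal (h / cc) * (\<Sum>c\<in>J. emeasure PM (\<Union>P\<in>F c. box 1 (fst c) P))"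
      by (rule mult_left_mono) simp
    also have "\<dots> \<le> (\<Sum>c\<in>J. ennreal (real_of_int (2 * \<bar>si * snd c\<bar> + 1)) * emeasure \<nu> S)"
      unfolding sum_distrib_left by (intro sum_mono Fw)
    also have "\<dots> = ennreal W * emeasure \<nu> S"
      unfolding W_def sum_distrib_right[symmetric] by (subst sum_ennreal) auto
    finally have le: "ennreal (h / cc) * emeasure PM E \<le> ennreal W * emeasure \<nu> S" .
    have "ennreal h * emeasure PM E = ennreal cc * (ennreal (h / cc) * emeasure PM E)"
      using cc h by (simp add: mult.assoc[symmetric] ennreal_mult[symmetric])
    also have "\<dots> \<le> ennreal cc * (ennreal W * emeasure \<nu> S)" by (intro mult_left_mono le) simp
    also have "\<dots> = ennreal (cc * W) * emeasure \<nu> S" using cc W by (simp add: ennreal_mult mult.assoc)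
    finally show ?thesis .
  qed
  have "0 \<le> cc * W" using cc W by simp
  then show ?thesis by (intro exI[of _ "cc * W"] conjI allI impI main)
qed

end

lemma choice_pos3:
  assumes h: "\<forall>x t l. 0 < l \<longrightarrow> (\<exists>y>0. P x t l y)"
  shows "\<exists>Y. \<forall>x t l. 0 < (l::real) \<longrightarrow> (0::real) < Y x t l \<and> P x t l (Y x t l)"
proof (rule exI[of _ "\<lambda>x t l. SOME y. 0 < y \<and> P x t l y"], intro allI impI)
  fix x t and l :: real assume "0 < l"
  then have "\<exists>y. 0 < y \<and> P x t l y" by (rule h[rule_format])
  then show "0 < (SOME y. 0 < y \<and> P x t l y) \<and> P x t l (SOME y. 0 < y \<and> P x t l y)" by (rule someI_ex)
qed

lemma nn_set_integral_affine_bound: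
  fixes g h :: "'x \<Rightarrow> real"
  assumes R: "R \<in> sets m" and g [measurable]: "g \<in> borel_measurable m" and v: "emeasure m R \<le> ennreal v"
    and nn: "0 \<le> v" "0 \<le> \<kappa>" "0 \<le> B" "0 \<le> A"
    and h: "AE z in m. z \<in> R \<longrightarrow> h z \<le> \<kappa> * max 0 (g z) + B"
    and int: "(\<integral>\<^sup>+z\<in>R. ennreal (max 0 (g z)) \<partial>m) \<le> ennreal (A * v)"
  shows "(\<integral>\<^sup>+z\<in>R. ennreal (max 0 (h z)) \<partial>m) \<le> ennreal ((\<kappa> * A + B) * v)"
proof -
  note [measurable] = R
  have "(\<integral>\<^sup>+z\<in>R. ennreal (max 0 (h z)) \<partial>m) \<le> (\<integral>\<^sup>+z. ennreal \<kappa> * (ennreal (max 0 (g z)) * indicator R z) + ennreal B * indicator R z \<partial>m)"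
  proof (rule nn_integral_mono_AE)
    show "AE z in m. ennreal (max 0 (h z)) * indicator R z \<le> ennreal \<kappa> * (ennreal (max 0 (g z)) * indicator R z) + ennreal B * indicator R z"
      using h
    proof eventually_elim
      case (elim z)
      have nn': "0 \<le> \<kappa> * max 0 (g z)" using nn by simp
      show ?case
      proof (cases "z \<in> R")
        case True
        then have "max 0 (h z) \<le> \<kappa> * max 0 (g z) + B" using elim nn nn' by auto
        then have "ennreal (max 0 (h z)) \<le> ennreal (\<kappa> * max 0 (g z) + B)" by (rule ennreal_leI)
        also have "\<dots> = ennreal \<kappa> * ennreal (max 0 (g z)) + ennreal B"
          using nn nn' by (simp only: ennreal_plus ennreal_mult max.cobounded1)
        finally show ?thesis using True by simp
      qed simp
    qed
  qed
  also have "\<dots> = ennreal \<kappa> * (\<integral>\<^sup>+z\<in>R. ennreal (max 0 (g z)) \<partial>m) + ennreal B * emeasure m R"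
    by (simp add: nn_integral_add nn_integral_cmult)
  also have "\<dots> \<le> ennreal \<kappa> * ennreal (A * v) + ennreal B * ennreal v"
    by (intro add_mono mult_left_mono int v) simp_all
  also have "\<dots> = ennreal ((\<kappa> * A + B) * v)"
    using nn by (simp add: ennreal_mult[symmetric] ennreal_plus[symmetric] algebra_simps del: ennreal_plus)
  finally show ?thesis .
qed

lemma tslab_mono: "a \<le> lo \<Longrightarrow> hi \<le> b \<Longrightarrow> q \<in> tslab s t lo hi \<Longrightarrow> q \<in> tslab s t a b"
  by (auto simp: tslab_def)

lemma tslab_add:
  assumes "q \<in> tslab s t lo hi" "r \<in> tslab s q lo' hi'"
  shows "r \<in> tslab s t (lo + lo') (hi + hi')"
proof -
  have "s * (r - t) = s * (q - t) + s * (r - q)" by (simp add: algebra_simps)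
  then show ?thesis using assms by (simp add: tslab_def)
qed

lemma tslab_opposite: "w \<in> tslab (-s) t lo hi \<Longrightarrow> t \<in> tslab s w lo hi"
  by (simp add: tslab_def algebra_simps)

context homogeneous_dyadic
begin

lemma ex_rad:
  assumes l: "0 < l"
  shows "\<exists>k. rad (k + 1) \<le> l \<and> l < rad k"
proof -
  define q where "q = ln l / ln \<delta>"
  have d: "ln \<delta> < 0" using \<delta> by simp
  then have q: "q * ln \<delta> = ln l" by (simp add: q_def)
  have re: "rad j = exp (of_int j * ln \<delta>)" for j
  proof -
    have "rad j = \<delta> powr of_int j" unfolding rad_def using \<delta> by (intro powr_real_of_int'[symmetric]) auto
    then show ?thesis using \<delta> by (simp add: powr_def)
  qed
  define k where "k = \<lceil>q\<rceil> - 1"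
  have k: "of_int k < q" "q \<le> of_int (k + 1)" unfolding k_def by linarith+
  have "q * ln \<delta> < of_int k * ln \<delta>" by (rule mult_strict_right_mono_neg[OF k(1) d])
  moreover have "of_int (k + 1) * ln \<delta> \<le> q * ln \<delta>" using k(2) d by (intro mult_right_mono_neg) auto
  ultimately have "exp (of_int (k + 1) * ln \<delta>) \<le> exp (ln l)" "exp (ln l) < exp (of_int k * ln \<delta>)"
    unfolding q by (simp_all only: exp_le_cancel_iff exp_less_cancel_iff)
  then show ?thesis using l unfolding re by (intro exI[of _ k]) simp
qed

lemma log_bound:
  assumes si: "si = 1 \<or> si = (-1::int)" and s_eq: "s = real_of_int si" and \<nu>: "box_measurable \<nu>"
    and fin: "AE w in PM. 0 < Mx s 0 \<nu> w \<and> Mx s 0 \<nu> w < \<infinity>"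
  shows "\<exists>A\<ge>0. \<forall>x t l. 0 < l \<longrightarrow> (\<exists>y>0.
    (\<forall>w\<in>qb x l \<times> tslab (-s) t (1/2 * l powr p) (l powr p). ennreal y \<le> Mx s 0 \<nu> w) \<and>
    (\<integral>\<^sup>+z\<in>qb x l \<times> tslab s t (1/2 * l powr p) (l powr p). ennreal (max 0 (ln (enn2real (Mx s 0 \<nu> z) / y))) \<partial>PM)
      \<le> ennreal (A * (vol x l * l powr p)))"
proof -
  have s: "s = 1 \<or> s = -1" "- s = 1 \<or> - s = -1" using si s_eq by auto
  define m where "m = Mx s 0 \<nu>"
  have m [measurable]: "m \<in> borel_measurable PM"
    unfolding m_def using s(1) by (intro borel_measurable_Mx box_measurable_slab[OF \<nu>] cube_borel) auto
  define avg where "avg \<tau> k \<alpha> r = emeasure \<nu> (Q k \<tau> \<alpha> \<times> tslab s r (0 * dur k) (dur k)) / emeasure PM (Q k \<tau> \<alpha> \<times> tslab s r (0 * dur k) (dur k))"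
    for \<tau> k \<alpha> r
  have m_avg: "\<exists>\<tau>\<in>{1..N}. \<exists>k. \<exists>\<alpha>\<in>I k \<tau>. fst z \<in> Q k \<tau> \<alpha> \<and> h < avg \<tau> k \<alpha> (snd z)" if "h < m z" for z h
  proof -
    have "h < (SUP (\<tau>, k, \<alpha>) \<in> {(\<tau>, k, \<alpha>). \<tau> \<in> {1..N} \<and> \<alpha> \<in> I k \<tau> \<and> fst z \<in> Q k \<tau> \<alpha>}. avg \<tau> k \<alpha> (snd z))"
      using that unfolding m_def Mx_def avg_def .
    then obtain c where c: "c \<in> {(\<tau>, k, \<alpha>). \<tau> \<in> {1..N} \<and> \<alpha> \<in> I k \<tau> \<and> fst z \<in> Q k \<tau> \<alpha>}" "h < (case c of (\<tau>, k, \<alpha>) \<Rightarrow> avg \<tau> k \<alpha> (snd z))"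
      unfolding less_SUP_iff by blast
    obtain \<tau> k \<alpha> where "c = (\<tau>, k, \<alpha>)" by (cases c)
    then show ?thesis using c by (intro bexI[of _ \<tau>] exI[of _ k] bexI[of _ \<alpha>]) auto
  qed
  \<comment> \<open>One triangle inequality for a point of the ball and a cube through it, whose
    points are less than 2 K0 C1 times its scale apart.\<close>
  define H where "H = K0 * (1 + 2 * K0 * C1)"
  have "1 * 1 \<le> H" unfolding H_def using K0 C1 by (intro mult_mono) auto
  then have H: "1 \<le> H" "0 < H" by auto
  have in_ball: "Q j \<tau> \<alpha> \<subseteq> qb x (H * r)"
    if "\<tau> \<in> {1..N}" "\<alpha> \<in> I j \<tau>" "y \<in> Q j \<tau> \<alpha>" "y \<in> qb x r" "rad j \<le> r" for j \<tau> \<alpha> x y r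
  proof
    fix q assume "q \<in> Q j \<tau> \<alpha>"
    then have "\<rho> y q < 2 * K0 * C1 * rad j" by (rule cube_in_ball[OF that(1,2,3)])
    also have "\<dots> \<le> 2 * K0 * C1 * r" using that(5) K0 C1 by (intro mult_left_mono) auto
    finally have "\<rho> x y + \<rho> y q < r + 2 * K0 * C1 * r" using that(4) by (simp add: qball_def)
    then have "K0 * (\<rho> x y + \<rho> y q) < K0 * (r + 2 * K0 * C1 * r)" using K0 by (intro mult_strict_left_mono) auto
    also have "\<dots> = H * r" by (simp add: H_def algebra_simps)
    finally show "q \<in> qb x (H * r)" using dist_tri[of x q y] by (simp add: qball_def)
  qed
  obtain D1 where D1: "1 \<le> D1" "\<forall>\<nu> s x k w S. box_measurable \<nu> \<longrightarrow> s = 1 \<or> s = -1 \<longrightarrow> fst w \<in> qb x (H * rad k) \<longrightarrow>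
    S \<subseteq> qb x (H * rad k) \<times> tslab s (snd w) 0 (4 * dur k) \<longrightarrow>
    emeasure \<nu> S \<le> ennreal (D1 * (vol x (rad k) * dur k)) * Mx s 0 \<nu> w"
    using emeasure_le_Mx[OF H(2)] by (elim exE conjE)
  obtain D2 where D2: "1 \<le> D2" "\<forall>x. \<forall>r>0. vol x (1 / \<delta> * r) \<le> D2 * vol x r" using vol_scale[of "1 / \<delta>"] by (elim exE conjE)
  obtain D3 where D3: "1 \<le> D3" "\<forall>x y r. 0 < r \<longrightarrow> \<rho> x y \<le> H / c1 * r \<longrightarrow> vol x (H / c1 * r) \<le> D3 * vol y r"
    using vol_compare[of "H / c1"] by (elim exE conjE)
  obtain W where W: "0 \<le> W" "\<forall>\<nu> S E h. box_measurable \<nu> \<longrightarrow> S \<in> sets \<nu> \<longrightarrow> E \<in> sets PM \<longrightarrow> 0 < h \<longrightarrow>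
    (\<forall>z\<in>E. \<exists>\<tau>\<in>{1..N}. \<exists>k. \<exists>\<alpha>\<in>I k \<tau>. fst z \<in> Q k \<tau> \<alpha> \<and> Q k \<tau> \<alpha> \<times> tslab s (snd z) (0 * dur k) (dur k) \<subseteq> S \<and>
       ennreal h < emeasure \<nu> (Q k \<tau> \<alpha> \<times> tslab s (snd z) (0 * dur k) (dur k))
         / emeasure PM (Q k \<tau> \<alpha> \<times> tslab s (snd z) (0 * dur k) (dur k))) \<longrightarrow>
    ennreal h * emeasure PM E \<le> ennreal W * emeasure \<nu> S"
    using small_scales_weak_type[OF si] unfolding s_eq by (elim exE conjE)
  define \<Lambda> where "\<Lambda> = D1 * D3"
  have "1 * 1 \<le> \<Lambda>" unfolding \<Lambda>_def using D1(1) D3(1) by (intro mult_mono) auto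
  then have \<Lambda>: "1 \<le> \<Lambda>" "0 < \<Lambda>" by auto
  \<comment> \<open>Expresses \<open>W * cst\<close>, given at the scale \<open>rad k\<close>, as a
    multiple of vol x l times l^p; \<open>rad k\<close> exceeds l by at most the factor 1 /
    \<delta>.\<close>
  define B where "B = W * (D1 * (D2 * (1 / \<delta>) powr p))"
  have B: "0 \<le> B" using W(1) D1(1) D2(1) by (simp add: B_def)
  define q where "q = exp (-1 :: real)"
  have q: "0 < q" "q < 1" by (simp_all add: q_def)
  have main: "\<exists>y>0. (\<forall>w\<in>qb x l \<times> tslab (-s) t (1/2 * l powr p) (l powr p). ennreal y \<le> m w) \<and>
    (\<integral>\<^sup>+z\<in>qb x l \<times> tslab s t (1/2 * l powr p) (l powr p). ennreal (max 0 (ln (enn2real (m z) / y))) \<partial>PM)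
      \<le> ennreal ((ln \<Lambda> + B * (1 / (1 - q))) * (vol x l * l powr p))" if l: "0 < l" for x t l
  proof -
    define L where "L = l powr p"
    have L: "0 < L" using l by (simp add: L_def)
    obtain k where k: "rad (k + 1) \<le> l" "l < rad k" using ex_rad[OF l] by (elim exE conjE)
    have v: "0 < vol x l" by (rule vol_pos[OF l])
    have "rad 1 = \<delta>" by (simp add: rad_def)
    then have "rad k * \<delta> \<le> l" using k(1) unfolding rad_add by simp
    then have rk: "rad k \<le> 1 / \<delta> * l" using pos_le_divide_eq[OF \<delta>(1), of "rad k" l] by simp
    have d1: "dur (k + 1) \<le> L" unfolding dur_rad L_def using k(1) rad_pos[of "k + 1"] p by (intro powr_mono2) auto
    have d0: "L \<le> dur k" unfolding dur_rad L_def using k(2) l p by (intro powr_mono2) auto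
    have "dur k \<le> (1 / \<delta> * l) powr p" unfolding dur_rad using rk rad_pos[of k] p by (intro powr_mono2) auto
    also have "\<dots> = (1 / \<delta>) powr p * L" unfolding L_def by (rule powr_mult)
    finally have d2: "dur k \<le> (1 / \<delta>) powr p * L" .
    have "vol x (rad k) \<le> vol x (1 / \<delta> * l)"
      using rad_pos[of k] l \<delta> by (intro vol_mono ball_mono rk) auto
    also have "\<dots> \<le> D2 * vol x l" using D2(2) l by blast
    finally have vk: "vol x (rad k) \<le> D2 * vol x l" .
    define Rp where "Rp = qb x l \<times> tslab s t (1/2 * L) L"
    define Rm where "Rm = qb x l \<times> tslab (-s) t (1/2 * L) L"
    \<comment> \<open>Contains all slabs of generations finer than k that issue from
      \<open>Rp\<close>: they last at most dur (k + 1) \<le> L, so they end before time 2 L.\<close>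
    define S1 where "S1 = qb x (H * rad k) \<times> tslab s t (1/2 * L) (2 * L)"
    have Hk: "0 < H * rad k" using H(2) rad_pos[of k] by simp
    have "qb x (H * rad k) \<in> borel_of_qm \<rho>"
      unfolding borel_of_qm_def using open_ball[OF Hk] by (intro sigma_sets.Basic) simp
    then have S1: "S1 \<in> sets \<nu>" unfolding S1_def by (rule box_measurable_slab[OF \<nu> _ s(1)])
    have Rps [measurable]: "Rp \<in> sets PM" and Rms: "Rm \<in> sets PM" unfolding Rp_def Rm_def by (rule sets_qb_tslab[OF l])+
    have mRp: "emeasure PM Rp = ennreal (vol x l * (L - 1/2 * L))" unfolding Rp_def by (rule emeasure_cyl[OF l s(1)]) (use L in simp)
    have mRm: "emeasure PM Rm = ennreal (vol x l * (L - 1/2 * L))" unfolding Rm_def by (rule emeasure_cyl[OF l s(2)]) (use L in simp)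
    have pos: "0 < emeasure PM Rp" "0 < emeasure PM Rm" unfolding mRp mRm using v L by simp_all
    have Rm_ball: "fst w \<in> qb x (H * rad j)" if "w \<in> Rm" "j \<le> k" for w j
    proof -
      have "l \<le> rad j" using k(2) rad_mono[OF that(2)] by simp
      also have "\<dots> \<le> H * rad j" using H(1) rad_pos[of j] by simp
      finally show ?thesis using ball_mono[of l "H * rad j" x] that(1) by (auto simp: Rm_def)
    qed
    define cst where "cst = D1 * (vol x (rad k) * dur k)"
    have vk0: "0 < vol x (rad k)" by (rule vol_pos[OF rad_pos])
    have cst: "0 < cst" using D1(1) vk0 dur_pos[of k] by (simp add: cst_def)
    have "vol x (rad k) * dur k \<le> (D2 * vol x l) * ((1 / \<delta>) powr p * L)"
      using vk d2 D2(1) v dur_pos[of k] by (intro mult_mono) auto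
    then have "W * cst \<le> W * (D1 * ((D2 * vol x l) * ((1 / \<delta>) powr p * L)))"
      unfolding cst_def using W(1) D1(1) by (intro mult_left_mono) auto
    also have "\<dots> = B * (vol x l * L)" by (simp only: B_def ac_simps)
    finally have Wc: "W * cst \<le> B * (vol x l * L)" .
    \<comment> \<open>\<open>t\<close> is less than L after w, so all of \<open>S1\<close> lies
      within 3 L \<le> 4 dur k after w; this is why \<open>emeasure_le_Mx\<close> allows four
      durations.\<close>
    have f1: "emeasure \<nu> S1 \<le> ennreal cst * m w" if w: "w \<in> Rm" for w
    proof -
      have tw: "t \<in> tslab s (snd w) (1/2 * L) L" by (rule tslab_opposite) (use w in \<open>auto simp: Rm_def\<close>)
      have "S1 \<subseteq> qb x (H * rad k) \<times> tslab s (snd w) 0 (4 * dur k)"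
      proof
        fix z assume z: "z \<in> S1"
        have "snd z \<in> tslab s (snd w) (1/2 * L + 1/2 * L) (L + 2 * L)"
          by (rule tslab_add[OF tw]) (use z in \<open>auto simp: S1_def\<close>)
        then have "snd z \<in> tslab s (snd w) 0 (4 * dur k)" by (rule tslab_mono[rotated 2]) (use L d0 in simp_all)
        then show "z \<in> qb x (H * rad k) \<times> tslab s (snd w) 0 (4 * dur k)" using z by (auto simp: S1_def mem_Times_iff)
      qed
      then show ?thesis unfolding cst_def m_def by (rule D1(2)[rule_format, OF \<nu> s(1) Rm_ball[OF w order_refl]])
    qed
    \<comment> \<open>A slab of a coarse generation j issuing from a point of \<open>Rp\<close> ends
      at most 2 L + dur j \<le> 4 dur j after every w in \<open>Rm\<close>; its average is therefore
      seen by the maximal function at w.\<close>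
    have f2: "avg \<tau> j \<alpha> (snd z) \<le> ennreal \<Lambda> * m w"
      if w: "w \<in> Rm" and z: "z \<in> Rp" and j: "j \<le> k" and \<tau>: "\<tau> \<in> {1..N}" and \<alpha>: "\<alpha> \<in> I j \<tau>" and zQ: "fst z \<in> Q j \<tau> \<alpha>" for w z j \<tau> \<alpha>
    proof -
      have tw: "t \<in> tslab s (snd w) (1/2 * L) L" by (rule tslab_opposite) (use w in \<open>auto simp: Rm_def\<close>)
      have tz: "snd z \<in> tslab s t (1/2 * L) L" using z by (auto simp: Rp_def)
      let ?T = "Q j \<tau> \<alpha> \<times> tslab s (snd z) (0 * dur j) (dur j)"
      have lj: "l \<le> rad j" using k(2) rad_mono[OF j] by simp
      have Lj: "L \<le> dur j" using d0 dur_mono[OF j] by simp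
      have zb: "fst z \<in> qb x (rad j)" using z ball_mono[OF lj, of x] by (auto simp: Rp_def)
      have Qb: "Q j \<tau> \<alpha> \<subseteq> qb x (H * rad j)" by (rule in_ball[OF \<tau> \<alpha> zQ zb order_refl])
      have "?T \<subseteq> qb x (H * rad j) \<times> tslab s (snd w) 0 (4 * dur j)"
      proof
        fix y assume y: "y \<in> ?T"
        have "snd y \<in> tslab s (snd w) (1/2 * L + 1/2 * L + 0 * dur j) (L + L + dur j)"
          by (rule tslab_add[OF tslab_add[OF tw tz]]) (use y in \<open>simp add: mem_Times_iff\<close>)
        then have "snd y \<in> tslab s (snd w) 0 (4 * dur j)" by (rule tslab_mono[rotated 2]) (use L Lj in simp_all)
        then show "y \<in> qb x (H * rad j) \<times> tslab s (snd w) 0 (4 * dur j)" using y Qb by (auto simp: mem_Times_iff)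
      qed
      then have 1: "emeasure \<nu> ?T \<le> ennreal (D1 * (vol x (rad j) * dur j)) * m w"
        unfolding m_def by (rule D1(2)[rule_format, OF \<nu> s(1) Rm_ball[OF w j]])
      have cr: "0 < c1 * rad j" using c1 rad_pos[of j] by simp
      have He: "H / c1 * (c1 * rad j) = H * rad j" using c1 by simp
      have "\<rho> x (ctr j \<tau> \<alpha>) \<le> H / c1 * (c1 * rad j)"
        unfolding He using Qb center_in_cube[OF \<tau> \<alpha>] by (auto simp: qball_def)
      then have "vol x (H * rad j) \<le> D3 * vol (ctr j \<tau> \<alpha>) (c1 * rad j)"
        using D3(2)[rule_format, OF cr] unfolding He by blast
      also have "\<dots> \<le> D3 * cvol j \<tau> \<alpha>" using D3(1) cvol_ge[OF \<tau> \<alpha>] by (intro mult_left_mono) auto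
      finally have "vol x (H * rad j) \<le> D3 * cvol j \<tau> \<alpha>" .
      moreover have "vol x (rad j) \<le> vol x (H * rad j)"
        using H rad_pos[of j] by (intro vol_mono ball_mono) auto
      ultimately have "vol x (rad j) * dur j \<le> D3 * cvol j \<tau> \<alpha> * dur j"
        using dur_pos[of j] by (intro mult_right_mono) auto
      then have "D1 * (vol x (rad j) * dur j) \<le> D1 * (D3 * cvol j \<tau> \<alpha> * dur j)" using D1(1) by (intro mult_left_mono) auto
      also have "\<dots> = cvol j \<tau> \<alpha> * ((1 - 0) * dur j) * \<Lambda>" by (simp only: \<Lambda>_def diff_zero mult_1_left ac_simps)
      finally have "ennreal (D1 * (vol x (rad j) * dur j)) \<le> ennreal (cvol j \<tau> \<alpha> * ((1 - 0) * dur j) * \<Lambda>)" by (rule ennreal_leI)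
      also have "\<dots> = emeasure PM ?T * ennreal \<Lambda>"
        unfolding emeasure_slab[OF \<tau> \<alpha> s(1) zero_le_one]
        using cvol_pos[OF \<tau> \<alpha>] dur_pos[of j] \<Lambda> by (intro ennreal_mult) auto
      finally have "ennreal (D1 * (vol x (rad j) * dur j)) * m w \<le> emeasure PM ?T * ennreal \<Lambda> * m w" by (rule mult_right_mono) simp
      with 1 have 2: "emeasure \<nu> ?T \<le> emeasure PM ?T * (ennreal \<Lambda> * m w)" unfolding mult.assoc by (rule order_trans)
      have "0 < emeasure PM ?T"
        unfolding emeasure_slab[OF \<tau> \<alpha> s(1) zero_le_one] using cvol_pos[OF \<tau> \<alpha>] dur_pos[of j] by simp
      then show ?thesis unfolding avg_def using 2 by (rule divide_le_posI_ennreal)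
    qed
    have small: "Q j \<tau> \<alpha> \<times> tslab s (snd z) (0 * dur j) (dur j) \<subseteq> S1"
      if z: "z \<in> Rp" and j: "\<not> j \<le> k" and \<tau>: "\<tau> \<in> {1..N}" and \<alpha>: "\<alpha> \<in> I j \<tau>" and zQ: "fst z \<in> Q j \<tau> \<alpha>" for z j \<tau> \<alpha>
    proof
      fix y assume y: "y \<in> Q j \<tau> \<alpha> \<times> tslab s (snd z) (0 * dur j) (dur j)"
      have tz: "snd z \<in> tslab s t (1/2 * L) L" using z by (auto simp: Rp_def)
      have jk: "k + 1 \<le> j" using j by simp
      have dj: "dur j \<le> L" using dur_mono[OF jk] d1 by simp
      have "snd y \<in> tslab s t (1/2 * L + 0 * dur j) (L + dur j)"
        by (rule tslab_add[OF tz]) (use y in \<open>simp add: mem_Times_iff\<close>)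
      then have 1: "snd y \<in> tslab s t (1/2 * L) (2 * L)" by (rule tslab_mono[rotated 2]) (use dj in simp_all)
      have zb: "fst z \<in> qb x (rad k)" using z ball_mono[OF less_imp_le[OF k(2)], of x] by (auto simp: Rp_def)
      have "Q j \<tau> \<alpha> \<subseteq> qb x (H * rad k)" by (rule in_ball[OF \<tau> \<alpha> zQ zb rad_mono]) (use j in simp)
      then show "y \<in> S1" using 1 y by (auto simp: S1_def mem_Times_iff)
    qed
    define Y where "Y = (INF w\<in>Rm. m w)"
    have g1: "emeasure \<nu> S1 \<le> ennreal cst * Y" unfolding Y_def by (rule ennreal_le_mult_INF[OF f1 cst])
    have g2: "avg \<tau> j \<alpha> (snd z) \<le> ennreal \<Lambda> * Y"
      if "z \<in> Rp" "j \<le> k" "\<tau> \<in> {1..N}" "\<alpha> \<in> I j \<tau>" "fst z \<in> Q j \<tau> \<alpha>" for z j \<tau> \<alpha>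
      unfolding Y_def by (rule ennreal_le_mult_INF[OF f2[OF _ that] \<Lambda>(2)])
    have fin': "AE w in PM. 0 < m w \<and> m w < \<infinity>" using fin by (simp only: m_def)
    have "Y < \<infinity>"
    proof -
      obtain w where "w \<in> Rm" "0 < m w \<and> m w < \<infinity>" using AE_imp_ex[OF fin' Rms pos(2)] by (elim bexE)
      then show ?thesis unfolding Y_def by (meson INF_lower le_less_trans)
    qed
    \<comment> \<open>If \<open>Y\<close> were 0, every average at points of \<open>Rp\<close> would
      vanish, at large scales by \<open>g2\<close> and at small ones by \<open>g1\<close>, although
      \<open>m\<close> is positive almost everywhere.\<close>
    moreover have "Y \<noteq> 0"
    proof
      assume Y0: "Y = 0"
      obtain z where z: "z \<in> Rp" "0 < m z \<and> m z < \<infinity>" using AE_imp_ex[OF fin' Rps pos(1)] by (elim bexE)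
      obtain \<tau> j \<alpha> where c: "\<tau> \<in> {1..N}" "\<alpha> \<in> I j \<tau>" "fst z \<in> Q j \<tau> \<alpha>" "0 < avg \<tau> j \<alpha> (snd z)"
        using m_avg[OF z(2)[THEN conjunct1]] by (elim bexE exE conjE)
      have "avg \<tau> j \<alpha> (snd z) = 0"
      proof (cases "j \<le> k")
        case True
        then show ?thesis using g2[OF z(1) True c(1-3)] by (simp add: Y0)
      next
        case False
        have "emeasure \<nu> (Q j \<tau> \<alpha> \<times> tslab s (snd z) (0 * dur j) (dur j)) \<le> emeasure \<nu> S1"
          by (rule emeasure_mono[OF small[OF z(1) False c(1-3)] S1])
        also have "\<dots> \<le> 0" using g1 by (simp add: Y0)
        finally show ?thesis by (simp add: avg_def)
      qed
      then show False using c(4) by simp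
    qed
    ultimately obtain y where y: "Y = ennreal y" "0 < y" by (cases Y) auto
    have y_le: "\<forall>w\<in>Rm. ennreal y \<le> m w" unfolding y(1)[symmetric] Y_def by (auto intro: INF_lower)
    \<comment> \<open>Above the height \<open>\<Lambda> * y\<close> no large scale contributes, so
      the weak type bound on \<open>S1\<close> applies; heights growing like exp n give measures
      decaying like q^n.\<close>
    define E where "E n = {z \<in> Rp. ennreal (\<Lambda> * y * exp (real n)) < m z}" for n
    have E_eq: "E n = Rp \<inter> {z \<in> space PM. ennreal (\<Lambda> * y * exp (real n)) < m z}" for n by (auto simp: E_def space_par)
    have Es [measurable]: "E n \<in> sets PM" for n unfolding E_eq by measurable
    have h0: "0 < \<Lambda> * y * exp (real n)" for n using \<Lambda> y by simp
    have weak: "emeasure PM (E n) \<le> ennreal (B * (vol x l * L) * q ^ n)" for n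
    proof -
      have "ennreal (\<Lambda> * y * exp (real n)) * emeasure PM (E n) \<le> ennreal W * emeasure \<nu> S1"
      proof (rule W(2)[rule_format, OF \<nu> S1 Es h0])
        fix z assume z: "z \<in> E n"
        have zR: "z \<in> Rp" and zm: "ennreal (\<Lambda> * y * exp (real n)) < m z" using z by (simp_all add: E_def)
        obtain \<tau> j \<alpha> where c: "\<tau> \<in> {1..N}" "\<alpha> \<in> I j \<tau>" "fst z \<in> Q j \<tau> \<alpha>" "ennreal (\<Lambda> * y * exp (real n)) < avg \<tau> j \<alpha> (snd z)"
          using m_avg[OF zm] by (elim bexE exE conjE)
        have "\<not> j \<le> k"
        proof
          assume "j \<le> k"
          then have "avg \<tau> j \<alpha> (snd z) \<le> ennreal \<Lambda> * Y" by (rule g2[OF zR _ c(1-3)])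
          also have "\<dots> = ennreal (\<Lambda> * y)" using \<Lambda> y by (simp add: ennreal_mult)
          also have "\<dots> \<le> ennreal (\<Lambda> * y * exp (real n))" using \<Lambda> y by (intro ennreal_leI) simp
          finally show False using c(4) by simp
        qed
        note sm = small[OF zR this c(1-3)]
        show "\<exists>\<tau>\<in>{1..N}. \<exists>k. \<exists>\<alpha>\<in>I k \<tau>. fst z \<in> Q k \<tau> \<alpha> \<and> Q k \<tau> \<alpha> \<times> tslab s (snd z) (0 * dur k) (dur k) \<subseteq> S1 \<and>
           ennreal (\<Lambda> * y * exp (real n)) < emeasure \<nu> (Q k \<tau> \<alpha> \<times> tslab s (snd z) (0 * dur k) (dur k))
             / emeasure PM (Q k \<tau> \<alpha> \<times> tslab s (snd z) (0 * dur k) (dur k))"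
          by (rule bexI[of _ \<tau>], rule exI[of _ j], rule bexI[of _ \<alpha>], intro conjI c(3) sm c(4)[unfolded avg_def], rule c(2), rule c(1))
      qed
      also have "\<dots> \<le> ennreal W * (ennreal cst * Y)" by (intro mult_left_mono g1) simp
      also have "\<dots> = ennreal (W * cst * y)" using W(1) cst y by (simp add: ennreal_mult mult.assoc)
      finally have "emeasure PM (E n) \<le> ennreal (W * cst * y / (\<Lambda> * y * exp (real n)))"
        by (rule ennreal_le_divide_imp[OF _ h0]) (use W(1) cst y in simp)
      also have "\<dots> \<le> ennreal (B * (vol x l * L) * q ^ n)"
      proof (rule ennreal_leI)
        have qn: "q ^ n * exp (real n) = 1"
          unfolding q_def exp_of_nat_mult[symmetric] by (simp add: exp_add[symmetric])
        have "W * cst * y \<le> B * (vol x l * L) * y" using Wc y by (intro mult_right_mono) auto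
        also have "\<dots> \<le> B * (vol x l * L) * y * \<Lambda>"
        proof -
          have "0 \<le> B * (vol x l * L) * y" using B v L y by simp
          then have "B * (vol x l * L) * y * 1 \<le> B * (vol x l * L) * y * \<Lambda>" by (rule mult_left_mono[OF \<Lambda>(1)])
          then show ?thesis by (simp only: mult_1_right)
        qed
        also have "\<dots> = B * (vol x l * L) * y * \<Lambda> * (q ^ n * exp (real n))" unfolding qn by simp
        also have "\<dots> = B * (vol x l * L) * q ^ n * (\<Lambda> * y * exp (real n))" by (simp only: mult.assoc mult.left_commute mult.commute)
        finally show "W * cst * y / (\<Lambda> * y * exp (real n)) \<le> B * (vol x l * L) * q ^ n"
          unfolding pos_divide_le_eq[OF h0] .
      qed
      finally show ?thesis .
    qed
    have "(\<integral>\<^sup>+z\<in>Rp. ennreal (max 0 (ln (enn2real (m z) / y))) \<partial>PM) \<le> (\<integral>\<^sup>+z. ennreal (ln \<Lambda>) * indicator Rp z + (\<Sum>n. indicator (E n) z) \<partial>PM)"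
    proof (rule nn_integral_mono_AE)
      show "AE z in PM. ennreal (max 0 (ln (enn2real (m z) / y))) * indicator Rp z \<le> ennreal (ln \<Lambda>) * indicator Rp z + (\<Sum>n. indicator (E n) z)"
        using fin'
      proof eventually_elim
        case (elim z)
        show ?case
        proof (cases "z \<in> Rp")
          case True
          obtain r where r: "m z = ennreal r" "0 < r" using elim by (cases "m z") auto
          define X where "X = r / (\<Lambda> * y)"
          have X: "0 < X" using r \<Lambda> y by (simp add: X_def)
          have "r / y = \<Lambda> * X" using \<Lambda> by (simp add: X_def)
          then have "ln (r / y) = ln \<Lambda> + ln X" using \<Lambda> X by (simp add: ln_mult)
          moreover have "0 \<le> ln \<Lambda>" using \<Lambda> by simp
          ultimately have "max 0 (ln (r / y)) \<le> ln \<Lambda> + max 0 (ln X)" by linarith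
          then have "ennreal (max 0 (ln (r / y))) \<le> ennreal (ln \<Lambda> + max 0 (ln X))" by (rule ennreal_leI)
          also have "\<dots> = ennreal (ln \<Lambda>) + ennreal (max 0 (ln X))" using \<Lambda> by (intro ennreal_plus) auto
          also have "\<dots> \<le> ennreal (ln \<Lambda>) + (\<Sum>n. indicator {n. exp (real n) < X} n)" by (intro add_left_mono ln_le_count X)
          also have "(\<lambda>n. indicator {n. exp (real n) < X} n) = (\<lambda>n. indicator (E n) z :: ennreal)"
          proof
            fix n
            have "exp (real n) < X \<longleftrightarrow> exp (real n) * (\<Lambda> * y) < r" unfolding X_def by (rule pos_less_divide_eq) (use \<Lambda> y in simp)
            also have "\<dots> \<longleftrightarrow> ennreal (\<Lambda> * y * exp (real n)) < m z"
              unfolding r(1) using \<Lambda> y by (subst ennreal_less_iff) (auto simp: mult.commute)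
            finally show "indicator {n. exp (real n) < X} n = (indicator (E n) z :: ennreal)"
              using True by (simp add: E_def indicator_def)
          qed
          finally show ?thesis using True r by simp
        qed simp
      qed
    qed
    also have "\<dots> = ennreal (ln \<Lambda>) * emeasure PM Rp + (\<Sum>n. emeasure PM (E n))"
      by (simp add: nn_integral_add nn_integral_suminf nn_integral_cmult)
    also have "\<dots> \<le> ennreal (ln \<Lambda>) * ennreal (vol x l * L) + (\<Sum>n. ennreal (B * (vol x l * L) * q ^ n))"
      unfolding mRp using v L by (intro add_mono mult_left_mono suminf_le summableI weak ennreal_leI) auto
    also have "(\<Sum>n. ennreal (B * (vol x l * L) * q ^ n)) = ennreal (B * (vol x l * L) * (1 / (1 - q)))"
      using B v L q by (intro suminf_ennreal_eq sums_mult geometric_sums) auto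
    also have "ennreal (ln \<Lambda>) * ennreal (vol x l * L) + \<dots> = ennreal ((ln \<Lambda> + B * (1 / (1 - q))) * (vol x l * L))"
    proof -
      have "ennreal (ln \<Lambda>) * ennreal (vol x l * L) = ennreal (ln \<Lambda> * (vol x l * L))" using \<Lambda> v L by (intro ennreal_mult[symmetric]) auto
      moreover have "ennreal (ln \<Lambda> * (vol x l * L)) + ennreal (B * (vol x l * L) * (1 / (1 - q)))
        = ennreal (ln \<Lambda> * (vol x l * L) + B * (vol x l * L) * (1 / (1 - q)))"
        using \<Lambda> v L B q by (intro ennreal_plus[symmetric]) auto
      moreover have "ln \<Lambda> * (vol x l * L) + B * (vol x l * L) * (1 / (1 - q)) = (ln \<Lambda> + B * (1 / (1 - q))) * (vol x l * L)"
      proof -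
        have "a * b + c * b * d = (a + c * d) * b" for a b c d :: real by (simp add: algebra_simps)
        then show ?thesis .
      qed
      ultimately show ?thesis by simp
    qed
    finally show ?thesis using y(2) y_le unfolding Rp_def Rm_def L_def by (intro exI[of _ y]) simp
  qed
  have "0 \<le> ln \<Lambda> + B * (1 / (1 - q))" using \<Lambda> B q by simp
  then show ?thesis using main unfolding m_def by (intro exI[of _ "ln \<Lambda> + B * (1 / (1 - q))"]) simp
qed

end

section \<open>Logarithmic potentials belong to parabolic BMO\<close>

context homogeneous_dyadic
begin

lemma PB_imp_L1_loc:
  assumes PB: "PB 1 (1/2) A a u"
  shows "u \<in> L1_loc \<rho> p M"
  unfolding L1_loc_def mem_Collect_eq
proof (intro conjI allI)
  show um: "u \<in> borel_measurable PM" by (rule PB_measurable[OF PB])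
  note [measurable] = um
  fix x t
  \<comment> \<open>With r^p = 1/4 the time interval of the small cylinder is the later slab, from
    1/2 to 1, of the unit cylinder centred at t - 3/4, and the earlier slab of the one centred at t
    + 3/4.\<close>
  define r :: real where "r = (1/4) powr (1/p)"
  have r: "0 < r" "r \<le> 1" "r powr p = 1/4" using p by (simp_all add: r_def powr_powr powr_le1)
  define S where "S = cyl \<rho> p x t r"
  define R1 where "R1 = qb x 1 \<times> tslab 1 (t - 3/4) (1/2 * 1 powr p) (1 powr p)"
  define R2 where "R2 = qb x 1 \<times> tslab (-1) (t + 3/4) (1/2 * 1 powr p) (1 powr p)"
  have S_eq: "S = qb x r \<times> {t - 1/4 <..< t + 1/4}" by (simp add: S_def cyl_def r(3))
  have S12: "S \<subseteq> R1" "S \<subseteq> R2" unfolding S_eq R1_def R2_def tslab_plus tslab_minus using ball_mono[OF r(2), of x] by auto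
  have Ss [measurable]: "S \<in> sets PM" unfolding S_eq by (intro Times_sets sets_ball r) simp
  have R12 [measurable]: "R1 \<in> sets PM" "R2 \<in> sets PM" unfolding R1_def R2_def by (auto intro: sets_qb_tslab)
  define a1 where "a1 = a x (t - 3/4) 1"
  define a2 where "a2 = a x (t + 3/4) 1"
  have i1: "(\<integral>\<^sup>+z\<in>R1. ennreal (max 0 (u z - a1)) \<partial>PM) < \<infinity>"
    using PB_upper[OF PB zero_less_one, of x "t - 3/4"] unfolding R1_def a1_def by (rule le_less_trans) simp
  have i2: "(\<integral>\<^sup>+z\<in>R2. ennreal (max 0 (a2 - u z)) \<partial>PM) < \<infinity>"
    using PB_lower[OF PB zero_less_one, of x "t + 3/4"] unfolding R2_def a2_def by (rule le_less_trans) simp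
  have "emeasure PM S \<le> emeasure PM R1" by (rule emeasure_mono[OF S12(1) R12(1)])
  also have "\<dots> < \<infinity>" unfolding R1_def by (subst emeasure_cyl) simp_all
  finally have mS: "emeasure PM S < \<infinity>" .
  have "(\<integral>\<^sup>+z. ennreal (norm (indicator S z *\<^sub>R u z)) \<partial>PM)
    \<le> (\<integral>\<^sup>+z. (ennreal (max 0 (u z - a1)) * indicator R1 z + ennreal (max 0 (a2 - u z)) * indicator R2 z) + ennreal (\<bar>a1\<bar> + \<bar>a2\<bar>) * indicator S z \<partial>PM)"
  proof (rule nn_integral_mono)
    fix z
    have "\<bar>u z\<bar> \<le> (max 0 (u z - a1) + max 0 (a2 - u z)) + (\<bar>a1\<bar> + \<bar>a2\<bar>)" by linarith
    then have "ennreal \<bar>u z\<bar> \<le> ennreal ((max 0 (u z - a1) + max 0 (a2 - u z)) + (\<bar>a1\<bar> + \<bar>a2\<bar>))" by (rule ennreal_leI)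
    also have "\<dots> = ennreal (max 0 (u z - a1)) + ennreal (max 0 (a2 - u z)) + ennreal (\<bar>a1\<bar> + \<bar>a2\<bar>)"
      by (subst ennreal_plus, simp, simp, subst ennreal_plus, simp, simp, rule refl)
    finally have le: "ennreal \<bar>u z\<bar> \<le> ennreal (max 0 (u z - a1)) + ennreal (max 0 (a2 - u z)) + ennreal (\<bar>a1\<bar> + \<bar>a2\<bar>)" .
    show "ennreal (norm (indicator S z *\<^sub>R u z)) \<le> (ennreal (max 0 (u z - a1)) * indicator R1 z + ennreal (max 0 (a2 - u z)) * indicator R2 z) + ennreal (\<bar>a1\<bar> + \<bar>a2\<bar>) * indicator S z"
    proof (cases "z \<in> S")
      case True
      then have "z \<in> R1" "z \<in> R2" using S12 by blast+
      then show ?thesis using True le by simp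
    qed simp
  qed
  also have "\<dots> = ((\<integral>\<^sup>+z\<in>R1. ennreal (max 0 (u z - a1)) \<partial>PM) + (\<integral>\<^sup>+z\<in>R2. ennreal (max 0 (a2 - u z)) \<partial>PM)) + ennreal (\<bar>a1\<bar> + \<bar>a2\<bar>) * emeasure PM S"
    by (simp add: nn_integral_add nn_integral_cmult)
  also have "\<dots> < \<infinity>"
  proof -
    have "ennreal (\<bar>a1\<bar> + \<bar>a2\<bar>) * emeasure PM S < \<infinity>" using mS by (simp add: ennreal_mult_less_top del: ennreal_plus)
    then show ?thesis using i1 i2 by (simp add: less_top[symmetric] del: ennreal_plus)
  qed
  finally have "integrable PM (\<lambda>z. indicator S z *\<^sub>R u z)" by (intro integrableI_bounded) auto
  then show "\<exists>r>0. set_integrable PM (cyl \<rho> p x t r) u"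
    using r(1) unfolding S_def set_integrable_def by blast
qed

text \<open>Definition \<open>PBMO_plus\<close> lets the constants depend on the cylinder as a set only; the centre,
  the time and the radius powers are recovered from that set up to a change of centre that leaves
  the ball unchanged.\<close>

lemma PB_imp_PBMO:
  assumes \<gamma>: "0 < \<gamma>" "\<gamma> < 1" and A: "0 \<le> A" and PB: "PB 1 \<gamma> A a u" and loc: "u \<in> L1_loc \<rho> p M"
  shows "u \<in> PBMO_plus \<rho> p M"
proof -
  define rep where "rep S = (SOME c. case c of (x, t, l) \<Rightarrow> 0 < l \<and> cyl \<rho> p x t l = S)" for S
  define a' where "a' S = (case rep S of (x, t, l) \<Rightarrow> a x t l)" for S
  have key: "\<exists>x'. a' (cyl \<rho> p x t l) = a x' t l \<and> qb x l = qb x' l" if l: "0 < l" for x t l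
  proof -
    obtain x' t' l' where r: "rep (cyl \<rho> p x t l) = (x', t', l')" by (cases "rep (cyl \<rho> p x t l)")
    have "case rep (cyl \<rho> p x t l) of (x', t', l') \<Rightarrow> 0 < l' \<and> cyl \<rho> p x' t' l' = cyl \<rho> p x t l"
      unfolding rep_def by (rule someI[of _ "(x, t, l)"]) (simp add: l)
    then have c: "0 < l'" "cyl \<rho> p x' t' l' = cyl \<rho> p x t l" by (simp_all add: r)
    have L: "0 < l powr p" "0 < l' powr p" using l c by auto
    have ne: "x \<in> qb x l" "x' \<in> qb x' l'" using l c(1) by (simp_all add: qball_def dist_eq_0[THEN iffD2, OF refl])
    have nI: "t \<in> {t - l powr p<..<t + l powr p}" "t' \<in> {t' - l' powr p<..<t' + l' powr p}" using L by auto
    have e: "qb x' l' = qb x l \<and> {t' - l' powr p<..<t' + l' powr p} = {t - l powr p<..<t + l powr p}"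
      using c(2) ne nI unfolding cyl_def times_eq_iff by blast
    have "t' - l' powr p = t - l powr p"
      using arg_cong[OF e[THEN conjunct2], of Inf] L by (simp add: cInf_greaterThanLessThan)
    moreover have "t' + l' powr p = t + l powr p"
      using arg_cong[OF e[THEN conjunct2], of Sup] L by (simp add: cSup_greaterThanLessThan)
    ultimately have t: "t' = t" "l' powr p = l powr p" by linarith+
    have "l' = (l' powr p) powr (1 / p)" using c p by (simp add: powr_powr)
    also have "\<dots> = l" unfolding t(2) using l p by (simp add: powr_powr)
    finally have "l' = l" .
    then show ?thesis using r t(1) e by (intro exI[of _ x']) (simp add: a'_def)
  qed
  have quot: "X / emeasure PM (qb x l \<times> tslab s t (\<gamma> * l powr p) (l powr p)) \<le> ennreal (A / (1 - \<gamma>))"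
    if l: "0 < l" and s: "s = 1 \<or> s = -1" and X: "X \<le> ennreal (A * vol x l * l powr p)" for X x t l s
  proof -
    have L: "0 < l powr p" using l by simp
    have v: "0 < vol x l" by (rule vol_pos[OF l])
    have m: "emeasure PM (qb x l \<times> tslab s t (\<gamma> * l powr p) (l powr p)) = ennreal (vol x l * (l powr p - \<gamma> * l powr p))"
      by (rule emeasure_cyl[OF l s]) (use \<gamma> L in simp)
    have d: "vol x l * (l powr p - \<gamma> * l powr p) = (1 - \<gamma>) * (vol x l * l powr p)" by (simp add: algebra_simps)
    have eq: "A * vol x l * l powr p = vol x l * (l powr p - \<gamma> * l powr p) * (A / (1 - \<gamma>))"
      unfolding d using \<gamma> by simp
    have V: "0 < vol x l * (l powr p - \<gamma> * l powr p)" unfolding d using v L \<gamma> by simp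
    have nn: "0 \<le> A / (1 - \<gamma>)" using \<gamma> A by simp
    have le: "X \<le> ennreal (vol x l * (l powr p - \<gamma> * l powr p)) * ennreal (A / (1 - \<gamma>))"
      using X unfolding eq ennreal_mult[OF less_imp_le[OF V] nn] .
    have "0 < ennreal (vol x l * (l powr p - \<gamma> * l powr p))" using V by (intro iffD2[OF ennreal_less_zero_iff])
    then show ?thesis unfolding m using le by (rule divide_le_posI_ennreal)
  qed
  have bound: "(\<integral>\<^sup>+ z \<in> cyl_plus \<rho> p \<gamma> x t l. ennreal (max 0 (u z - a' (cyl \<rho> p x t l))) \<partial>PM) / emeasure PM (cyl_plus \<rho> p \<gamma> x t l)
    + (\<integral>\<^sup>+ z \<in> cyl_minus \<rho> p \<gamma> x t l. ennreal (max 0 (a' (cyl \<rho> p x t l) - u z)) \<partial>PM) / emeasure PM (cyl_minus \<rho> p \<gamma> x t l)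
    \<le> ennreal (A / (1 - \<gamma>)) + ennreal (A / (1 - \<gamma>))" if l: "0 < l" for x t l
  proof -
    obtain x' where x': "a' (cyl \<rho> p x t l) = a x' t l" "qb x l = qb x' l" using key[OF l, of x t] by (elim exE conjE)
    show ?thesis
      unfolding x' cyl_plus_eq cyl_minus_eq
      by (intro add_mono quot l PB_upper[OF PB l] PB_lower[OF PB l]) simp_all
  qed
  have "(SUP (x, t, l) \<in> UNIV \<times> UNIV \<times> {0<..}.
     (\<integral>\<^sup>+ z \<in> cyl_plus \<rho> p \<gamma> x t l. ennreal (max 0 (u z - a' (cyl \<rho> p x t l))) \<partial>PM) / emeasure PM (cyl_plus \<rho> p \<gamma> x t l)
    + (\<integral>\<^sup>+ z \<in> cyl_minus \<rho> p \<gamma> x t l. ennreal (max 0 (a' (cyl \<rho> p x t l) - u z)) \<partial>PM) / emeasure PM (cyl_minus \<rho> p \<gamma> x t l))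
    \<le> ennreal (A / (1 - \<gamma>)) + ennreal (A / (1 - \<gamma>))"
    by (rule SUP_least) (use bound in auto)
  also have "\<dots> < \<infinity>" by simp
  finally have "\<exists>a. (SUP (x, t, l) \<in> UNIV \<times> UNIV \<times> {0<..}.
     (\<integral>\<^sup>+ z \<in> cyl_plus \<rho> p \<gamma> x t l. ennreal (max 0 (u z - a (cyl \<rho> p x t l))) \<partial>PM) / emeasure PM (cyl_plus \<rho> p \<gamma> x t l)
    + (\<integral>\<^sup>+ z \<in> cyl_minus \<rho> p \<gamma> x t l. ennreal (max 0 (a (cyl \<rho> p x t l) - u z)) \<partial>PM) / emeasure PM (cyl_minus \<rho> p \<gamma> x t l)) < \<infinity>"
    by (rule exI[of _ a'])
  then show ?thesis
    unfolding PBMO_plus_def mem_Collect_eq using \<gamma>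
    by (intro conjI loc exI[of _ \<gamma>]) simp_all
qed

text \<open>\<open>log_bound\<close> provides lower bounds \<open>Y1\<close> for \<open>m1\<close>
  on the later part and \<open>Y2\<close> for \<open>m2\<close> on the earlier part. With the
  constant - \<alpha> ln Y1 + \<beta> ln Y2, the excess of \<open>u\<close> on the later part comes
  only from ln (m2 / Y2), and its deficit on the earlier part only from ln (m1 / Y1), up to the
  bound of \<open>b\<close>.\<close>

lemma log_potential_PBMO:
  assumes \<alpha>: "0 < \<alpha>" and \<beta>: "0 < \<beta>" and b: "b \<in> L_infty M"
    and \<nu>1: "box_measurable \<nu>1" and \<nu>2: "box_measurable \<nu>2"
    and repr: "log_repr M u \<alpha> (max_minus p M \<delta> N I Q 0 \<nu>1) \<beta> (max_plus p M \<delta> N I Q 0 \<nu>2) b"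
  shows "u \<in> PBMO_plus \<rho> p M"
proof -
  define m1 where "m1 = Mx (-1) 0 \<nu>1"
  define m2 where "m2 = Mx 1 0 \<nu>2"
  have m1 [measurable]: "m1 \<in> borel_measurable PM"
    unfolding m1_def by (intro borel_measurable_Mx box_measurable_slab[OF \<nu>1] cube_borel) auto
  have m2 [measurable]: "m2 \<in> borel_measurable PM"
    unfolding m2_def by (intro borel_measurable_Mx box_measurable_slab[OF \<nu>2] cube_borel) auto
  have bm [measurable]: "b \<in> borel_measurable PM" using b by (simp add: L_infty_def)
  obtain B0 where "AE z in PM. \<bar>b z\<bar> \<le> B0" using b unfolding L_infty_def by blast
  then have Bb: "AE z in PM. \<bar>b z\<bar> \<le> \<bar>B0\<bar>" by (auto elim!: eventually_mono)
  have "AE z in PM. ereal (u z) = - (ereal \<alpha> * elog (m1 z)) + ereal \<beta> * elog (m2 z) + ereal (b z)"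
    using repr unfolding log_repr_def max_minus_eq_Mx max_plus_eq_Mx m1_def m2_def .
  then have ae: "AE z in PM. (0 < m1 z \<and> m1 z < \<infinity>) \<and> (0 < m2 z \<and> m2 z < \<infinity>) \<and>
      u z = - \<alpha> * ln (enn2real (m1 z)) + \<beta> * ln (enn2real (m2 z)) + b z"
    by (rule eventually_mono) (rule elog_combination_finite[OF _ \<alpha> \<beta>])
  have gm: "(\<lambda>z. - \<alpha> * ln (enn2real (m1 z)) + \<beta> * ln (enn2real (m2 z)) + b z) \<in> borel_measurable PM" by measurable
  have "AE z in PM. u z = - \<alpha> * ln (enn2real (m1 z)) + \<beta> * ln (enn2real (m2 z)) + b z"
    using ae by eventually_elim blast
  then have um: "u \<in> borel_measurable PM" using gm unfolding par_measure_def by (rule borel_measurable_completion_AE[rotated])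
  have f1: "AE z in PM. 0 < Mx (-1) 0 \<nu>1 z \<and> Mx (-1) 0 \<nu>1 z < \<infinity>" using ae unfolding m1_def by eventually_elim blast
  have f2: "AE z in PM. 0 < Mx 1 0 \<nu>2 z \<and> Mx 1 0 \<nu>2 z < \<infinity>" using ae unfolding m2_def by eventually_elim blast
  have e1: "- 1 = real_of_int (- 1)" and e2: "1 = real_of_int 1" by simp_all
  obtain A1 where A1: "0 \<le> A1" and h1: "\<forall>x t l. 0 < l \<longrightarrow> (\<exists>y>0.
    (\<forall>w\<in>qb x l \<times> tslab 1 t (1/2 * l powr p) (l powr p). ennreal y \<le> m1 w) \<and>
    (\<integral>\<^sup>+z\<in>qb x l \<times> tslab (-1) t (1/2 * l powr p) (l powr p). ennreal (max 0 (ln (enn2real (m1 z) / y))) \<partial>PM)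
      \<le> ennreal (A1 * (vol x l * l powr p)))"
    using log_bound[OF disjI2[OF refl] e1 \<nu>1 f1] unfolding minus_minus m1_def[symmetric] by (elim exE conjE)
  obtain A2 where A2: "0 \<le> A2" and h2: "\<forall>x t l. 0 < l \<longrightarrow> (\<exists>y>0.
    (\<forall>w\<in>qb x l \<times> tslab (-1) t (1/2 * l powr p) (l powr p). ennreal y \<le> m2 w) \<and>
    (\<integral>\<^sup>+z\<in>qb x l \<times> tslab 1 t (1/2 * l powr p) (l powr p). ennreal (max 0 (ln (enn2real (m2 z) / y))) \<partial>PM)
      \<le> ennreal (A2 * (vol x l * l powr p)))"
    using log_bound[OF disjI1[OF refl] e2 \<nu>2 f2] unfolding m2_def[symmetric] by (elim exE conjE)
  obtain Y1 where Y1: "\<forall>x t l. 0 < l \<longrightarrow> 0 < Y1 x t l \<and>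
    (\<forall>w\<in>qb x l \<times> tslab 1 t (1/2 * l powr p) (l powr p). ennreal (Y1 x t l) \<le> m1 w) \<and>
    (\<integral>\<^sup>+z\<in>qb x l \<times> tslab (-1) t (1/2 * l powr p) (l powr p). ennreal (max 0 (ln (enn2real (m1 z) / Y1 x t l))) \<partial>PM)
      \<le> ennreal (A1 * (vol x l * l powr p))"
    using choice_pos3[OF h1] by (elim exE)
  obtain Y2 where Y2: "\<forall>x t l. 0 < l \<longrightarrow> 0 < Y2 x t l \<and>
    (\<forall>w\<in>qb x l \<times> tslab (-1) t (1/2 * l powr p) (l powr p). ennreal (Y2 x t l) \<le> m2 w) \<and>
    (\<integral>\<^sup>+z\<in>qb x l \<times> tslab 1 t (1/2 * l powr p) (l powr p). ennreal (max 0 (ln (enn2real (m2 z) / Y2 x t l))) \<partial>PM)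
      \<le> ennreal (A2 * (vol x l * l powr p))"
    using choice_pos3[OF h2] by (elim exE)
  define a where "a x t l = - \<alpha> * ln (Y1 x t l) + \<beta> * ln (Y2 x t l)" for x t l
  define A where "A = \<alpha> * A1 + \<beta> * A2 + \<bar>B0\<bar>"
  have A: "0 \<le> A" "\<alpha> * A1 + \<bar>B0\<bar> \<le> A" "\<beta> * A2 + \<bar>B0\<bar> \<le> A" using \<alpha> \<beta> A1 A2 by (simp_all add: A_def)
  have lnq: "ln (enn2real X / y) = ln (enn2real X) - ln y" if X: "0 < X \<and> X < \<infinity>" and y: "0 < y" for X y
  proof -
    obtain r where "X = ennreal r" "0 < r" using X by (cases X) auto
    then show ?thesis using y by (simp add: ln_div)
  qed
  have lnle: "ln y \<le> ln (enn2real X)" if le: "ennreal y \<le> X" and y: "0 < y" and X: "X < \<infinity>" for X y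
  proof -
    obtain r where r: "X = ennreal r" "0 \<le> r" using X by (cases X) auto
    then have "y \<le> r" using le by (simp add: ennreal_le_iff)
    then show ?thesis using y r by simp
  qed
  have "PB 1 (1/2) A a u"
    unfolding PB_def
  proof (intro conjI allI impI um)
    fix x t and l :: real assume l: "0 < l"
    define v where "v = vol x l * l powr p"
    have v: "0 \<le> v" using vol_pos[OF l, of x] by (simp add: v_def)
    have mR: "emeasure PM (qb x l \<times> tslab s t (1/2 * l powr p) (l powr p)) \<le> ennreal v" if s: "s = 1 \<or> s = -1" for s
    proof -
      have "emeasure PM (qb x l \<times> tslab s t (1/2 * l powr p) (l powr p)) = ennreal (vol x l * (l powr p - 1/2 * l powr p))"
        by (rule emeasure_cyl[OF l s]) simp
      also have "\<dots> \<le> ennreal v" unfolding v_def using vol_pos[OF l, of x] by (intro ennreal_leI mult_left_mono) auto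
      finally show ?thesis .
    qed
    note y1 = Y1[rule_format, OF l, of x t, THEN conjunct1] and y2 = Y2[rule_format, OF l, of x t, THEN conjunct1]
    note lo1 = Y1[rule_format, OF l, of x t, THEN conjunct2, THEN conjunct1] and lo2 = Y2[rule_format, OF l, of x t, THEN conjunct2, THEN conjunct1]
    note in1 = Y1[rule_format, OF l, of x t, THEN conjunct2, THEN conjunct2] and in2 = Y2[rule_format, OF l, of x t, THEN conjunct2, THEN conjunct2]
    have "(\<integral>\<^sup>+z\<in>qb x l \<times> tslab 1 t (1/2 * l powr p) (l powr p). ennreal (max 0 (u z - a x t l)) \<partial>PM) \<le> ennreal ((\<beta> * A2 + \<bar>B0\<bar>) * v)"
    proof (rule nn_set_integral_affine_bound[OF sets_qb_tslab[OF l] _ mR v _ _ A2 _ in2[folded v_def]])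
      show "AE z in PM. z \<in> qb x l \<times> tslab 1 t (1/2 * l powr p) (l powr p) \<longrightarrow> u z - a x t l \<le> \<beta> * max 0 (ln (enn2real (m2 z) / Y2 x t l)) + \<bar>B0\<bar>"
        using ae Bb
      proof eventually_elim
        case (elim z)
        note e = elim(1) and bz = elim(2)
        show ?case
        proof
        assume z: "z \<in> qb x l \<times> tslab 1 t (1/2 * l powr p) (l powr p)"
        have "ln (Y1 x t l) \<le> ln (enn2real (m1 z))" using lnle[OF lo1[rule_format, OF z] y1] e by blast
        then have 1: "\<alpha> * ln (Y1 x t l) \<le> \<alpha> * ln (enn2real (m1 z))" using \<alpha> by (intro mult_left_mono) auto
        have "ln (enn2real (m2 z)) - ln (Y2 x t l) \<le> max 0 (ln (enn2real (m2 z) / Y2 x t l))" using lnq[OF _ y2] e by simp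
        then have 2: "\<beta> * ln (enn2real (m2 z)) - \<beta> * ln (Y2 x t l) \<le> \<beta> * max 0 (ln (enn2real (m2 z) / Y2 x t l))"
          unfolding right_diff_distrib[symmetric] using \<beta> by (intro mult_left_mono) auto
        show "u z - a x t l \<le> \<beta> * max 0 (ln (enn2real (m2 z) / Y2 x t l)) + \<bar>B0\<bar>"
          using 1 2 e bz unfolding a_def by linarith
        qed
      qed
    qed (use \<beta> in auto)
    also have "\<dots> \<le> ennreal (A * vol x l * l powr p)" unfolding mult.assoc v_def[symmetric] using A v by (intro ennreal_leI mult_right_mono) auto
    finally show "(\<integral>\<^sup>+z\<in>qb x l \<times> tslab 1 t (1/2 * l powr p) (l powr p). ennreal (max 0 (u z - a x t l)) \<partial>PM) \<le> ennreal (A * vol x l * l powr p)" .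
    have "(\<integral>\<^sup>+z\<in>qb x l \<times> tslab (-1) t (1/2 * l powr p) (l powr p). ennreal (max 0 (a x t l - u z)) \<partial>PM) \<le> ennreal ((\<alpha> * A1 + \<bar>B0\<bar>) * v)"
    proof (rule nn_set_integral_affine_bound[OF sets_qb_tslab[OF l] _ mR v _ _ A1 _ in1[folded v_def]])
      show "AE z in PM. z \<in> qb x l \<times> tslab (-1) t (1/2 * l powr p) (l powr p) \<longrightarrow> a x t l - u z \<le> \<alpha> * max 0 (ln (enn2real (m1 z) / Y1 x t l)) + \<bar>B0\<bar>"
        using ae Bb
      proof eventually_elim
        case (elim z)
        note e = elim(1) and bz = elim(2)
        show ?case
        proof
        assume z: "z \<in> qb x l \<times> tslab (-1) t (1/2 * l powr p) (l powr p)"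
        have "ln (Y2 x t l) \<le> ln (enn2real (m2 z))" using lnle[OF lo2[rule_format, OF z] y2] e by blast
        then have 1: "\<beta> * ln (Y2 x t l) \<le> \<beta> * ln (enn2real (m2 z))" using \<beta> by (intro mult_left_mono) auto
        have "ln (enn2real (m1 z)) - ln (Y1 x t l) \<le> max 0 (ln (enn2real (m1 z) / Y1 x t l))" using lnq[OF _ y1] e by simp
        then have 2: "\<alpha> * ln (enn2real (m1 z)) - \<alpha> * ln (Y1 x t l) \<le> \<alpha> * max 0 (ln (enn2real (m1 z) / Y1 x t l))"
          unfolding right_diff_distrib[symmetric] using \<alpha> by (intro mult_left_mono) auto
        show "a x t l - u z \<le> \<alpha> * max 0 (ln (enn2real (m1 z) / Y1 x t l)) + \<bar>B0\<bar>"
          using 1 2 e bz unfolding a_def by linarith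
        qed
      qed
    qed (use \<alpha> in auto)
    also have "\<dots> \<le> ennreal (A * vol x l * l powr p)" unfolding mult.assoc v_def[symmetric] using A v by (intro ennreal_leI mult_right_mono) auto
    finally show "(\<integral>\<^sup>+z\<in>qb x l \<times> tslab (-1) t (1/2 * l powr p) (l powr p). ennreal (max 0 (a x t l - u z)) \<partial>PM) \<le> ennreal (A * vol x l * l powr p)" .
  qed
  then show ?thesis by (intro PB_imp_PBMO[of "1/2" A a u] PB_imp_L1_loc A(1)) simp_all
qed

end

section \<open>The iteration that produces the two weights\<close>

lemma ennreal_add_power_le: "((x::ennreal) + y) ^ n \<le> 2 ^ n * (x ^ n + y ^ n)"
proof -
  have "x + y \<le> 2 * max x y" by (simp add: mult_2 add_mono)
  then have "(x + y) ^ n \<le> (2 * max x y) ^ n" by (rule power_mono) simp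
  also have "\<dots> = 2 ^ n * max x y ^ n" by (rule power_mult_distrib)
  also have "max x y ^ n \<le> x ^ n + y ^ n"
    by (cases "x \<le> y") (simp_all add: max_def add_increasing add_increasing2)
  finally show ?thesis by (simp add: mult_left_mono)
qed

context pbmo_grid
begin

lemma lag_ge: "i \<in> lag (1/2) \<sigma> \<Longrightarrow> 2 \<le> i"
proof -
  assume i: "i \<in> lag (1/2) \<sigma>"
  have "5 \<le> (1/2) / \<sigma>" using \<sigma> by (simp add: field_simps)
  then show ?thesis using i unfolding lag_def mem_Collect_eq by linarith
qed

lemma Mx_density_le_mp:
  assumes si: "si = 1 \<or> si = -1" and [measurable]: "g \<in> borel_measurable PM"
  shows "Mx (of_int si) (1/2) (density PM g) w \<le> ennreal (2 * \<sigma>) * (\<Sum>(\<tau>, i)\<in>{1..N} \<times> lag (1/2) \<sigma>. mp \<tau> (si * i) g w)"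
  unfolding Mx_def
proof (rule SUP_least, clarify)
  fix \<tau> k \<alpha> assume a: "\<tau> \<in> {1..N}" "\<alpha> \<in> I k \<tau>" "fst w \<in> Q k \<tau> \<alpha>"
  interpret G: shift_grid PM "boxes \<tau>" fst shf "box \<sigma> \<tau>" by (rule shift_grid_boxes[OF a(1) \<sigma>(1)])
  define j where "j = \<lfloor>snd w / tl \<sigma> k\<rfloor>"
  have t: "snd w \<in> {real_of_int j * tl \<sigma> k ..< (real_of_int j + 1) * tl \<sigma> k}"
    using floor_divide_lower[OF tl_pos[of \<sigma> k]] floor_divide_upper[OF tl_pos[of \<sigma> k]] by (auto simp: j_def)
  have P: "(k, \<alpha>, j) \<in> boxes \<tau>" "w \<in> box \<sigma> \<tau> (k, \<alpha>, j)" using a t by (cases w; auto simp: boxes_def)+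
  have "emeasure (density PM g) (Q k \<tau> \<alpha> \<times> tslab (of_int si) (snd w) (1/2 * dur k) (dur k))
      / emeasure PM (Q k \<tau> \<alpha> \<times> tslab (of_int si) (snd w) (1/2 * dur k) (dur k))
    \<le> ennreal (\<sigma> / (1 - 1/2)) * (\<Sum>i\<in>lag (1/2) \<sigma>. emeasure (density PM g) (box \<sigma> \<tau> (shf (si * i) (k, \<alpha>, j))) / emeasure PM (box \<sigma> \<tau> (k, \<alpha>, j)))"
    by (rule slab_le[OF \<sigma>(1) si _ _ a(1,2) t]) (auto intro: sets_box a(1))
  also have "\<dots> \<le> ennreal (\<sigma> / (1 - 1/2)) * (\<Sum>i\<in>lag (1/2) \<sigma>. mp \<tau> (si * i) g w)"
  proof (intro mult_left_mono sum_mono)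
    fix i
    have "box \<sigma> \<tau> (shf (si * i) (k, \<alpha>, j)) \<in> sets PM" by (rule G.sets_bx[OF G.sh_in[OF P(1)]])
    then show "emeasure (density PM g) (box \<sigma> \<tau> (shf (si * i) (k, \<alpha>, j))) / emeasure PM (box \<sigma> \<tau> (k, \<alpha>, j)) \<le> mp \<tau> (si * i) g w"
      using G.mop_ge[OF P, of g "si * i"] unfolding mp_def by (subst emeasure_density) auto
  qed simp
  also have "(\<Sum>i\<in>lag (1/2) \<sigma>. mp \<tau> (si * i) g w) \<le> (\<Sum>\<tau>\<in>{1..N}. \<Sum>i\<in>lag (1/2) \<sigma>. mp \<tau> (si * i) g w)"
    using a(1) by (intro member_le_sum[of \<tau> "{1..N}" "\<lambda>\<tau>. \<Sum>i\<in>lag (1/2) \<sigma>. mp \<tau> (si * i) g w"]) auto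
  also have "\<dots> = (\<Sum>(\<tau>, i)\<in>{1..N} \<times> lag (1/2) \<sigma>. mp \<tau> (si * i) g w)" by (rule sum.cartesian_product)
  finally show "emeasure (density PM g) (Q k \<tau> \<alpha> \<times> tslab (of_int si) (snd w) (1/2 * dur k) (dur k))
      / emeasure PM (Q k \<tau> \<alpha> \<times> tslab (of_int si) (snd w) (1/2 * dur k) (dur k))
    \<le> ennreal (2 * \<sigma>) * (\<Sum>(\<tau>, i)\<in>{1..N} \<times> lag (1/2) \<sigma>. mp \<tau> (si * i) g w)"
    by (simp add: mult_left_mono mult_right_mono mult.commute)
qed

lemma mp_measurable: "\<tau> \<in> {1..N} \<Longrightarrow> mp \<tau> i g \<in> borel_measurable PM"
proof -
  assume "\<tau> \<in> {1..N}"
  then interpret G: shift_grid PM "boxes \<tau>" fst shf "box \<sigma> \<tau>" by (rule shift_grid_boxes[OF _ \<sigma>(1)])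
  show ?thesis unfolding mp_def by (rule G.borel_measurable_mop)
qed

lemma mp_suminf_le:
  assumes \<tau>: "\<tau> \<in> {1..N}" and [measurable]: "e \<in> borel_measurable PM" "\<And>n. \<phi> n \<in> borel_measurable PM"
  shows "mp \<tau> i (\<lambda>w. e w * (\<Sum>n. c n * \<phi> n w)) z \<le> (\<Sum>n. c n * mp \<tau> i (\<lambda>w. e w * \<phi> n w) z)"
proof -
  interpret G: shift_grid PM "boxes \<tau>" fst shf "box \<sigma> \<tau>" by (rule shift_grid_boxes[OF \<tau> \<sigma>(1)])
  have "(\<lambda>w. e w * (\<Sum>n. c n * \<phi> n w)) = (\<lambda>w. \<Sum>n. c n * (e w * \<phi> n w))"
    by (simp add: ennreal_suminf_cmult[symmetric] mult.left_commute)
  then have "mp \<tau> i (\<lambda>w. e w * (\<Sum>n. c n * \<phi> n w)) z \<le> (\<Sum>n. mp \<tau> i (\<lambda>w. c n * (e w * \<phi> n w)) z)"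
    unfolding mp_def using G.mop_suminf[of "\<lambda>n w. c n * (e w * \<phi> n w)" i z] by simp
  also have "\<dots> \<le> (\<Sum>n. c n * mp \<tau> i (\<lambda>w. e w * \<phi> n w) z)"
    unfolding mp_def by (intro suminf_le G.mop_cmult) auto
  finally show ?thesis .
qed

text \<open>Rubio de Francia's iteration: \<open>\<Phi> = \<Sum>n. K\<^sup>-\<^sup>n T\<^sup>n \<phi>0\<close> satisfies \<open>T \<Phi> \<le> K \<Phi>\<close> as \<open>T\<close> is bounded on
  \<open>L\<^sup>8\<close>.\<close>

lemma factorization:
  assumes PB: "PB 1 \<gamma> A a f" and A: "0 \<le> A"
  shows "\<exists>\<kappa>>0. \<exists>K>0. \<exists>\<Phi>\<in>borel_measurable PM. (\<forall>z. 0 < \<Phi> z) \<and> (AE z in PM. \<Phi> z < \<infinity>) \<and>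
     (\<forall>z. Mx (-1) (1/2) (density PM (\<lambda>w. ennreal (exp (- (\<kappa> * f w))) * \<Phi> w)) z \<le> ennreal K * (ennreal (exp (- (\<kappa> * f z))) * \<Phi> z)) \<and>
     (\<forall>z. Mx 1 (1/2) (density PM (\<lambda>w. ennreal (exp (\<kappa> * f w)) * \<Phi> w)) z \<le> ennreal K * (ennreal (exp (\<kappa> * f z)) * \<Phi> z))"
proof -
  note [measurable] = PB_measurable[OF PB]
  have PB1: "PB (of_int 1) \<gamma> A a f" using PB by simp
  define F where "F = {1..N} \<times> lag (1/2) \<sigma>"
  have fF: "finite F" by (simp add: F_def finite_lag)
  obtain \<kappa> where \<kappa>: "0 < \<kappa>" and bnd: "\<forall>i\<ge>2. \<exists>C::real. 0 \<le> C \<and> (\<forall>\<tau>\<in>{1..N}. \<forall>g\<in>borel_measurable PM.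
     (\<integral>\<^sup>+z. (ennreal (exp (\<kappa> * f z)) * mp \<tau> (- 1 * i) g z) ^ 8 \<partial>PM) \<le> ennreal C * (\<integral>\<^sup>+z. (ennreal (exp (\<kappa> * f z)) * g z) ^ 8 \<partial>PM) \<and>
     (\<integral>\<^sup>+z. (ennreal (exp (- (\<kappa> * f z))) * mp \<tau> (1 * i) g z) ^ 8 \<partial>PM) \<le> ennreal C * (\<integral>\<^sup>+z. (ennreal (exp (- (\<kappa> * f z))) * g z) ^ 8 \<partial>PM))"
    using strong_bound_mp[OF PB1 disjI1[OF refl] A] by (elim exE conjE)
  define E where "E z = ennreal (exp (\<kappa> * f z))" for z
  define E' where "E' z = ennreal (exp (- (\<kappa> * f z)))" for z
  have [measurable]: "E \<in> borel_measurable PM" "E' \<in> borel_measurable PM" by (simp_all add: E_def[abs_def] E'_def[abs_def])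
  have EE: "E z * E' z = 1" "E' z * E z = 1" for z
    by (simp_all add: E_def E'_def ennreal_mult[symmetric] exp_add[symmetric])
  have EE1: "E z * (E' z * y) = y" "E' z * (E z * y) = y" for z y
    by (simp_all only: mult.assoc[symmetric] EE mult_1)
  have "\<forall>i\<in>lag (1/2) \<sigma>. \<exists>C::real. 0 \<le> C \<and> (\<forall>\<tau>\<in>{1..N}. \<forall>g\<in>borel_measurable PM.
     (\<integral>\<^sup>+z. (E z * mp \<tau> (- 1 * i) g z) ^ 8 \<partial>PM) \<le> ennreal C * (\<integral>\<^sup>+z. (E z * g z) ^ 8 \<partial>PM) \<and>
     (\<integral>\<^sup>+z. (E' z * mp \<tau> (1 * i) g z) ^ 8 \<partial>PM) \<le> ennreal C * (\<integral>\<^sup>+z. (E' z * g z) ^ 8 \<partial>PM))"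
    unfolding E_def E'_def by (intro ballI bnd[rule_format] lag_ge)
  from bchoice[OF this] obtain C where C: "\<forall>i\<in>lag (1/2) \<sigma>. (0::real) \<le> C i \<and> (\<forall>\<tau>\<in>{1..N}. \<forall>g\<in>borel_measurable PM.
     (\<integral>\<^sup>+z. (E z * mp \<tau> (- 1 * i) g z) ^ 8 \<partial>PM) \<le> ennreal (C i) * (\<integral>\<^sup>+z. (E z * g z) ^ 8 \<partial>PM) \<and>
     (\<integral>\<^sup>+z. (E' z * mp \<tau> (1 * i) g z) ^ 8 \<partial>PM) \<le> ennreal (C i) * (\<integral>\<^sup>+z. (E' z * g z) ^ 8 \<partial>PM))" ..
  \<comment> \<open>Conjugation with its weight makes each maximal operator bounded on the same
    unweighted L^8. As the sum of both, \<open>T\<close> dominates either one, so one function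
    serves both weights.\<close>
  define T where "T \<phi> z = ennreal (2 * \<sigma>) * (\<Sum>(\<tau>, i)\<in>F. E z * mp \<tau> (- 1 * i) (\<lambda>w. E' w * \<phi> w) z + E' z * mp \<tau> (1 * i) (\<lambda>w. E w * \<phi> w) z)" for \<phi> z
  have Tm: "T \<phi> \<in> borel_measurable PM" for \<phi>
  proof -
    have *: "(\<lambda>z. E z * mp \<tau> (- 1 * i) (\<lambda>w. E' w * \<phi> w) z + E' z * mp \<tau> (1 * i) (\<lambda>w. E w * \<phi> w) z) \<in> borel_measurable PM"
      if "(\<tau>, i) \<in> F" for \<tau> i
    proof -
      have "\<tau> \<in> {1..N}" using that by (simp add: F_def)
      note [measurable] = mp_measurable[OF this]
      show ?thesis by measurable
    qed
    show ?thesis unfolding T_def[abs_def]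
    proof (intro borel_measurable_times_ennreal borel_measurable_const borel_measurable_sum)
      fix c assume "c \<in> F"
      then show "(\<lambda>z. case c of (\<tau>, i) \<Rightarrow> E z * mp \<tau> (- 1 * i) (\<lambda>w. E' w * \<phi> w) z + E' z * mp \<tau> (1 * i) (\<lambda>w. E w * \<phi> w) z) \<in> borel_measurable PM"
        using * by (cases c) simp
    qed
  qed
  define CT where "CT = (2 * \<sigma>) ^ 8 * (real (card F) ^ 8 * (\<Sum>(\<tau>, i)\<in>F. 2 ^ 8 * (2 * C i)))"
  have CT: "0 \<le> CT" unfolding CT_def using C \<sigma>(1) by (intro mult_nonneg_nonneg sum_nonneg) (auto simp: F_def)
  have T8: "(\<integral>\<^sup>+z. T \<phi> z ^ 8 \<partial>PM) \<le> ennreal CT * (\<integral>\<^sup>+z. \<phi> z ^ 8 \<partial>PM)" if [measurable]: "\<phi> \<in> borel_measurable PM" for \<phi>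
  proof -
    let ?x = "\<lambda>(\<tau>, i) z. E z * mp \<tau> (- 1 * i) (\<lambda>w. E' w * \<phi> w) z" and ?y = "\<lambda>(\<tau>, i) z. E' z * mp \<tau> (1 * i) (\<lambda>w. E w * \<phi> w) z"
    have m: "?x c \<in> borel_measurable PM" "?y c \<in> borel_measurable PM" if "c \<in> F" for c
    proof -
      obtain \<tau> i where c: "c = (\<tau>, i)" by (cases c)
      have "\<tau> \<in> {1..N}" using that by (simp add: F_def c)
      note [measurable] = mp_measurable[OF this]
      show "?x c \<in> borel_measurable PM" "?y c \<in> borel_measurable PM" by (simp_all add: c)
    qed
    have T_eq: "T \<phi> z = ennreal (2 * \<sigma>) * (\<Sum>c\<in>F. ?x c z + ?y c z)" for z
      unfolding T_def by (intro arg_cong[where f="\<lambda>y. ennreal (2 * \<sigma>) * y"] sum.cong) auto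
    have "T \<phi> z ^ 8 \<le> ennreal (2 * \<sigma>) ^ 8 * (of_nat (card F) ^ 8 * (\<Sum>c\<in>F. 2 ^ 8 * (?x c z ^ 8 + ?y c z ^ 8)))" for z
      unfolding T_eq power_mult_distrib
      by (intro mult_left_mono order_trans[OF ennreal_sum_power_le[OF fF]] sum_mono ennreal_add_power_le) auto
    then have "(\<integral>\<^sup>+z. T \<phi> z ^ 8 \<partial>PM) \<le> (\<integral>\<^sup>+z. ennreal (2 * \<sigma>) ^ 8 * (of_nat (card F) ^ 8 * (\<Sum>c\<in>F. 2 ^ 8 * (?x c z ^ 8 + ?y c z ^ 8))) \<partial>PM)"
      by (intro nn_integral_mono)
    also have "\<dots> = ennreal (2 * \<sigma>) ^ 8 * (of_nat (card F) ^ 8 * (\<Sum>c\<in>F. 2 ^ 8 * ((\<integral>\<^sup>+z. ?x c z ^ 8 \<partial>PM) + (\<integral>\<^sup>+z. ?y c z ^ 8 \<partial>PM))))"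
    proof -
      note [measurable] = m
      have "(\<integral>\<^sup>+z. (\<Sum>c\<in>F. 2 ^ 8 * (?x c z ^ 8 + ?y c z ^ 8)) \<partial>PM) = (\<Sum>c\<in>F. \<integral>\<^sup>+z. 2 ^ 8 * (?x c z ^ 8 + ?y c z ^ 8) \<partial>PM)"
        by (intro nn_integral_sum borel_measurable_times_ennreal borel_measurable_const borel_measurable_add borel_measurable_power_ennreal m)
      also have "\<dots> = (\<Sum>c\<in>F. 2 ^ 8 * ((\<integral>\<^sup>+z. ?x c z ^ 8 \<partial>PM) + (\<integral>\<^sup>+z. ?y c z ^ 8 \<partial>PM)))"
      proof (intro sum.cong refl)
        fix c assume "c \<in> F"
        note mc = m[OF this]
        have "(\<integral>\<^sup>+z. 2 ^ 8 * (?x c z ^ 8 + ?y c z ^ 8) \<partial>PM) = 2 ^ 8 * (\<integral>\<^sup>+z. ?x c z ^ 8 + ?y c z ^ 8 \<partial>PM)"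
          using mc by (intro nn_integral_cmult borel_measurable_add borel_measurable_power_ennreal)
        also have "(\<integral>\<^sup>+z. ?x c z ^ 8 + ?y c z ^ 8 \<partial>PM) = (\<integral>\<^sup>+z. ?x c z ^ 8 \<partial>PM) + (\<integral>\<^sup>+z. ?y c z ^ 8 \<partial>PM)"
          using mc by (intro nn_integral_add borel_measurable_power_ennreal)
        finally show "(\<integral>\<^sup>+z. 2 ^ 8 * (?x c z ^ 8 + ?y c z ^ 8) \<partial>PM) = 2 ^ 8 * ((\<integral>\<^sup>+z. ?x c z ^ 8 \<partial>PM) + (\<integral>\<^sup>+z. ?y c z ^ 8 \<partial>PM))" .
      qed
      finally have S: "(\<integral>\<^sup>+z. (\<Sum>c\<in>F. 2 ^ 8 * (?x c z ^ 8 + ?y c z ^ 8)) \<partial>PM) = (\<Sum>c\<in>F. 2 ^ 8 * ((\<integral>\<^sup>+z. ?x c z ^ 8 \<partial>PM) + (\<integral>\<^sup>+z. ?y c z ^ 8 \<partial>PM)))" .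
      have sm: "(\<lambda>z. \<Sum>c\<in>F. 2 ^ 8 * (?x c z ^ 8 + ?y c z ^ 8)) \<in> borel_measurable PM"
        by (intro borel_measurable_sum borel_measurable_times_ennreal borel_measurable_const borel_measurable_add borel_measurable_power_ennreal m)
      have "(\<integral>\<^sup>+z. of_nat (card F) ^ 8 * (\<Sum>c\<in>F. 2 ^ 8 * (?x c z ^ 8 + ?y c z ^ 8)) \<partial>PM)
         = of_nat (card F) ^ 8 * (\<integral>\<^sup>+z. (\<Sum>c\<in>F. 2 ^ 8 * (?x c z ^ 8 + ?y c z ^ 8)) \<partial>PM)"
        by (rule nn_integral_cmult[OF sm])
      moreover have "(\<integral>\<^sup>+z. ennreal (2 * \<sigma>) ^ 8 * (of_nat (card F) ^ 8 * (\<Sum>c\<in>F. 2 ^ 8 * (?x c z ^ 8 + ?y c z ^ 8))) \<partial>PM)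
         = ennreal (2 * \<sigma>) ^ 8 * (\<integral>\<^sup>+z. of_nat (card F) ^ 8 * (\<Sum>c\<in>F. 2 ^ 8 * (?x c z ^ 8 + ?y c z ^ 8)) \<partial>PM)"
        by (intro nn_integral_cmult borel_measurable_times_ennreal borel_measurable_const sm)
      ultimately show ?thesis by (simp only: S)
    qed
    also have "\<dots> \<le> ennreal (2 * \<sigma>) ^ 8 * (of_nat (card F) ^ 8 * (\<Sum>(\<tau>, i)\<in>F. 2 ^ 8 * (ennreal (2 * C i) * (\<integral>\<^sup>+z. \<phi> z ^ 8 \<partial>PM))))"
    proof (intro mult_left_mono sum_mono)
      fix c assume c: "c \<in> F"
      obtain \<tau> i where c_eq: "c = (\<tau>, i)" by (cases c)
      have ti: "\<tau> \<in> {1..N}" "i \<in> lag (1/2) \<sigma>" using c by (auto simp: F_def c_eq)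
      have Ci: "0 \<le> C i" using C ti(2) by blast
      have m1: "(\<lambda>w. E' w * \<phi> w) \<in> borel_measurable PM" by measurable
      have m2: "(\<lambda>w. E w * \<phi> w) \<in> borel_measurable PM" by measurable
      note Cti = C[THEN bspec, OF ti(2), THEN conjunct2, THEN bspec, OF ti(1), THEN bspec]
      have "(\<integral>\<^sup>+z. ?x c z ^ 8 \<partial>PM) \<le> ennreal (C i) * (\<integral>\<^sup>+z. \<phi> z ^ 8 \<partial>PM)"
        using Cti[OF m1, THEN conjunct1] unfolding c_eq prod.case EE1 .
      moreover have "(\<integral>\<^sup>+z. ?y c z ^ 8 \<partial>PM) \<le> ennreal (C i) * (\<integral>\<^sup>+z. \<phi> z ^ 8 \<partial>PM)"
        using Cti[OF m2, THEN conjunct2] unfolding c_eq prod.case EE1 .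
      ultimately have "(\<integral>\<^sup>+z. ?x c z ^ 8 \<partial>PM) + (\<integral>\<^sup>+z. ?y c z ^ 8 \<partial>PM) \<le> ennreal (C i) * (\<integral>\<^sup>+z. \<phi> z ^ 8 \<partial>PM) + ennreal (C i) * (\<integral>\<^sup>+z. \<phi> z ^ 8 \<partial>PM)"
        by (rule add_mono)
      also have "\<dots> = ennreal (2 * C i) * (\<integral>\<^sup>+z. \<phi> z ^ 8 \<partial>PM)"
        using Ci by (simp add: distrib_right[symmetric] ennreal_plus[symmetric] del: ennreal_plus)
      finally show "2 ^ 8 * ((\<integral>\<^sup>+z. ?x c z ^ 8 \<partial>PM) + (\<integral>\<^sup>+z. ?y c z ^ 8 \<partial>PM)) \<le> (case c of (\<tau>, i) \<Rightarrow> 2 ^ 8 * (ennreal (2 * C i) * (\<integral>\<^sup>+z. \<phi> z ^ 8 \<partial>PM)))"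
        unfolding c_eq prod.case by (intro mult_left_mono) auto
    qed auto
    also have "\<dots> = ennreal CT * (\<integral>\<^sup>+z. \<phi> z ^ 8 \<partial>PM)"
    proof -
      have 1: "(\<Sum>(\<tau>, i)\<in>F. 2 ^ 8 * (ennreal (2 * C i) * (\<integral>\<^sup>+z. \<phi> z ^ 8 \<partial>PM))) = (\<Sum>(\<tau>, i)\<in>F. ennreal (2 ^ 8 * (2 * C i))) * (\<integral>\<^sup>+z. \<phi> z ^ 8 \<partial>PM)"
        unfolding sum_distrib_right
      proof (intro sum.cong refl)
        fix c assume "c \<in> F"
        then have Ci: "0 \<le> C (snd c)" using C by (auto simp: F_def)
        show "(case c of (\<tau>, i) \<Rightarrow> 2 ^ 8 * (ennreal (2 * C i) * (\<integral>\<^sup>+z. \<phi> z ^ 8 \<partial>PM))) = (case c of (\<tau>, i) \<Rightarrow> ennreal (2 ^ 8 * (2 * C i))) * (\<integral>\<^sup>+z. \<phi> z ^ 8 \<partial>PM)"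
          using Ci by (cases c) (simp add: ennreal_mult mult.assoc)
      qed
      have 2: "(\<Sum>(\<tau>, i)\<in>F. ennreal (2 ^ 8 * (2 * C i))) = ennreal (\<Sum>(\<tau>, i)\<in>F. 2 ^ 8 * (2 * C i))"
        by (subst sum_ennreal[symmetric]) (use C in \<open>auto simp: F_def intro!: sum.cong\<close>)
      have S0: "0 \<le> (\<Sum>(\<tau>, i)\<in>F. 2 ^ 8 * (2 * C i))" using C by (intro sum_nonneg) (auto simp: F_def)
      have "ennreal CT = ennreal (2 * \<sigma>) ^ 8 * (of_nat (card F) ^ 8 * ennreal (\<Sum>(\<tau>, i)\<in>F. 2 ^ 8 * (2 * C i)))"
        unfolding CT_def using S0 \<sigma>(1)
        by (subst ennreal_mult, simp, simp, subst ennreal_mult, simp, simp) (simp add: ennreal_power ennreal_of_nat_eq_real_of_nat)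
      then show ?thesis unfolding 1 2 by (simp only: mult.assoc)
    qed
    finally show ?thesis .
  qed
  obtain h where h: "h \<in> borel_measurable PM" "integral\<^sup>N PM h \<noteq> \<infinity>" "\<And>x. 0 < h x \<and> h x < \<infinity>"
  proof -
    obtain \<tau> where \<tau>: "\<tau> \<in> {1..N}" using adjacent_cube by (metis zero_less_one)
    interpret G: shift_grid PM "boxes \<tau>" fst shf "box \<sigma> \<tau>" by (rule shift_grid_boxes[OF \<tau> \<sigma>(1)])
    interpret sigma_finite_measure PM by (rule G.sigma_finite_L)
    show thesis using Ex_finite_integrable_function that by (auto simp: space_par)
  qed
  \<comment> \<open>A strictly positive start makes \<open>\<Phi>\<close> positive everywhere; the
    minimum with 1 makes its eighth power integrable, being at most \<open>h\<close>.\<close>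
  define \<phi> where "\<phi> n = (T ^^ n) (\<lambda>z. min 1 (h z))" for n
  have \<phi>m [measurable]: "\<phi> n \<in> borel_measurable PM" for n
    using h(1) Tm by (cases n) (simp_all add: \<phi>_def)
  have \<phi>S: "\<phi> (Suc n) = T (\<phi> n)" for n by (simp add: \<phi>_def)
  define J where "J = (\<integral>\<^sup>+z. h z \<partial>PM)"
  have J: "J < \<infinity>" using h(2) by (simp add: J_def less_top)
  have \<phi>8: "(\<integral>\<^sup>+z. \<phi> n z ^ 8 \<partial>PM) \<le> ennreal (CT ^ n) * J" for n
  proof (induction n)
    case 0
    have "min 1 (h z) ^ 8 \<le> h z" for z
    proof -
      have "min 1 (h z) ^ 8 \<le> min 1 (h z) ^ 1" by (intro power_decreasing) auto
      also have "\<dots> \<le> h z" by simp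
      finally show ?thesis .
    qed
    then show ?case by (auto simp: \<phi>_def J_def intro!: nn_integral_mono)
  next
    case (Suc n)
    have "(\<integral>\<^sup>+z. \<phi> (Suc n) z ^ 8 \<partial>PM) \<le> ennreal CT * (\<integral>\<^sup>+z. \<phi> n z ^ 8 \<partial>PM)" unfolding \<phi>S by (rule T8[OF \<phi>m])
    also have "\<dots> \<le> ennreal CT * (ennreal (CT ^ n) * J)" by (intro mult_left_mono Suc) simp
    finally show ?case using CT by (simp add: ennreal_mult mult.assoc)
  qed
  \<comment> \<open>CT / K \<le> 1/2 lets the integrals of the eighth powers sum up, and K > 1 lets
    the coefficients themselves sum up.\<close>
  define K where "K = 2 * (CT + 1)"
  have K: "0 < K" "1 < K" using CT by (simp_all add: K_def)
  have K2: "CT / K \<le> 1 / 2"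
  proof -
    have "1 / 2 * K = CT + 1" by (simp add: K_def)
    then have "CT \<le> 1 / 2 * K" by simp
    then show ?thesis using pos_divide_le_eq[OF K(1), of CT "1 / 2"] by blast
  qed
  define c where "c n = ennreal ((1 / K) ^ n)" for n
  define \<Phi> where "\<Phi> z = (\<Sum>n. c n * \<phi> n z)" for z
  have \<Phi>m [measurable]: "\<Phi> \<in> borel_measurable PM" unfolding \<Phi>_def[abs_def] by measurable
  have cK: "c n = ennreal K * c (Suc n)" for n
  proof -
    have "K * (1 / K) ^ Suc n = (K * (1 / K)) * (1 / K) ^ n" by (simp only: power_Suc mult.assoc)
    also have "\<dots> = (1 / K) ^ n" using K by simp
    finally have "ennreal (K * (1 / K) ^ Suc n) = c n" unfolding c_def by (rule arg_cong)
    moreover have "ennreal (K * (1 / K) ^ Suc n) = ennreal K * c (Suc n)" unfolding c_def using K by (intro ennreal_mult) auto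
    ultimately show ?thesis by simp
  qed
  have T\<Phi>: "T \<Phi> z \<le> ennreal K * \<Phi> z" for z
  proof -
    have "T \<Phi> z \<le> (\<Sum>n. c n * T (\<phi> n) z)"
    proof -
      have "E z * mp \<tau> (- 1 * i) (\<lambda>w. E' w * \<Phi> w) z + E' z * mp \<tau> (1 * i) (\<lambda>w. E w * \<Phi> w) z
         \<le> (\<Sum>n. c n * (E z * mp \<tau> (- 1 * i) (\<lambda>w. E' w * \<phi> n w) z + E' z * mp \<tau> (1 * i) (\<lambda>w. E w * \<phi> n w) z))"
        if "(\<tau>, i) \<in> F" for \<tau> i
      proof -
        have \<tau>: "\<tau> \<in> {1..N}" using that by (simp add: F_def)
        have "E z * mp \<tau> (- 1 * i) (\<lambda>w. E' w * \<Phi> w) z + E' z * mp \<tau> (1 * i) (\<lambda>w. E w * \<Phi> w) z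
          \<le> E z * (\<Sum>n. c n * mp \<tau> (- 1 * i) (\<lambda>w. E' w * \<phi> n w) z) + E' z * (\<Sum>n. c n * mp \<tau> (1 * i) (\<lambda>w. E w * \<phi> n w) z)"
          unfolding \<Phi>_def by (intro add_mono mult_left_mono mp_suminf_le[OF \<tau>]) auto
        also have "\<dots> = (\<Sum>n. E z * (c n * mp \<tau> (- 1 * i) (\<lambda>w. E' w * \<phi> n w) z)) + (\<Sum>n. E' z * (c n * mp \<tau> (1 * i) (\<lambda>w. E w * \<phi> n w) z))"
          by (simp only: ennreal_suminf_cmult)
        also have "\<dots> = (\<Sum>n. E z * (c n * mp \<tau> (- 1 * i) (\<lambda>w. E' w * \<phi> n w) z) + E' z * (c n * mp \<tau> (1 * i) (\<lambda>w. E w * \<phi> n w) z))"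
          by (rule suminf_add[OF summableI summableI])
        also have "\<dots> = (\<Sum>n. c n * (E z * mp \<tau> (- 1 * i) (\<lambda>w. E' w * \<phi> n w) z + E' z * mp \<tau> (1 * i) (\<lambda>w. E w * \<phi> n w) z))"
          by (simp only: distrib_left mult.left_commute)
        finally show ?thesis .
      qed
      then have "T \<Phi> z \<le> ennreal (2 * \<sigma>) * (\<Sum>(\<tau>, i)\<in>F. \<Sum>n. c n * (E z * mp \<tau> (- 1 * i) (\<lambda>w. E' w * \<phi> n w) z + E' z * mp \<tau> (1 * i) (\<lambda>w. E w * \<phi> n w) z))"
        unfolding T_def by (intro mult_left_mono sum_mono) auto
      also have "\<dots> = (\<Sum>n. ennreal (2 * \<sigma>) * (\<Sum>(\<tau>, i)\<in>F. c n * (E z * mp \<tau> (- 1 * i) (\<lambda>w. E' w * \<phi> n w) z + E' z * mp \<tau> (1 * i) (\<lambda>w. E w * \<phi> n w) z)))"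
        by (simp only: case_prod_unfold ennreal_suminf_cmult suminf_sum[OF summableI])
      also have "\<dots> = (\<Sum>n. c n * T (\<phi> n) z)"
        unfolding T_def by (simp only: sum_distrib_left case_prod_unfold mult.left_commute)
      finally show ?thesis .
    qed
    also have "\<dots> = ennreal K * (\<Sum>n. c (Suc n) * \<phi> (Suc n) z)"
      by (simp only: cK[symmetric] \<phi>S mult.assoc[symmetric] ennreal_suminf_cmult[symmetric])
    also have "\<dots> \<le> ennreal K * \<Phi> z"
    proof (intro mult_left_mono suminf_le_const[OF summableI])
      fix n
      have "(\<Sum>i<n. c (Suc i) * \<phi> (Suc i) z) \<le> (\<Sum>i<Suc n. c i * \<phi> i z)"
        by (simp only: sum.lessThan_Suc_shift) (rule add_increasing, simp_all)
      also have "\<dots> \<le> \<Phi> z" unfolding \<Phi>_def by (intro sum_le_suminf summableI) auto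
      finally show "(\<Sum>i<n. c (Suc i) * \<phi> (Suc i) z) \<le> \<Phi> z" .
    qed simp
    finally show ?thesis .
  qed
  have pos: "0 < \<Phi> z" for z
  proof -
    have "0 < c 0 * \<phi> 0 z" using h(3)[of z] by (simp add: c_def \<phi>_def)
    also have "\<dots> \<le> \<Phi> z" unfolding \<Phi>_def using sum_le_suminf[of "\<lambda>n. c n * \<phi> n z" "{0}"] by simp
    finally show ?thesis .
  qed
  \<comment> \<open>By y \<le> 1 + y^8 the series for \<open>\<Phi>\<close> is dominated by the
    coefficients plus the series of eighth powers, whose integral is finite; this takes the place of
    the triangle inequality in L^8.\<close>
  have fin: "AE z in PM. \<Phi> z < \<infinity>"
  proof -
    have "(\<integral>\<^sup>+z. (\<Sum>n. c n * \<phi> n z ^ 8) \<partial>PM) = (\<Sum>n. c n * (\<integral>\<^sup>+z. \<phi> n z ^ 8 \<partial>PM))"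
      by (subst nn_integral_suminf) (auto simp: nn_integral_cmult)
    also have "\<dots> \<le> (\<Sum>n. ennreal ((1/2) ^ n) * J)"
    proof (rule suminf_le)
      fix n
      have "c n * (\<integral>\<^sup>+z. \<phi> n z ^ 8 \<partial>PM) \<le> c n * (ennreal (CT ^ n) * J)" by (intro mult_left_mono \<phi>8) simp
      also have "\<dots> = ennreal ((CT / K) ^ n) * J"
      proof -
        have "c n * ennreal (CT ^ n) = ennreal ((1 / K) ^ n * CT ^ n)" unfolding c_def using CT K by (intro ennreal_mult[symmetric]) auto
        also have "(1 / K) ^ n * CT ^ n = (CT / K) ^ n" unfolding power_mult_distrib[symmetric] by simp
        finally show ?thesis by (simp only: mult.assoc[symmetric])
      qed
      also have "\<dots> \<le> ennreal ((1/2) ^ n) * J"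
        using K CT K2 by (intro mult_right_mono ennreal_leI power_mono) auto
      finally show "c n * (\<integral>\<^sup>+z. \<phi> n z ^ 8 \<partial>PM) \<le> ennreal ((1/2) ^ n) * J" .
    qed auto
    also have "\<dots> = ennreal 2 * J"
    proof -
      have "(\<lambda>n. (1/2) ^ n :: real) sums (1 / (1 - 1/2))" by (rule geometric_sums) simp
      then have "(\<Sum>n. ennreal ((1/2) ^ n)) = ennreal 2" by (intro suminf_ennreal_eq) auto
      then show ?thesis by (simp only: ennreal_suminf_multc)
    qed
    also have "\<dots> < \<infinity>" using J by (simp add: ennreal_mult_less_top)
    finally have "AE z in PM. (\<Sum>n. c n * \<phi> n z ^ 8) \<noteq> \<infinity>"
      by (intro nn_integral_PInf_AE) auto
    then show ?thesis
    proof eventually_elim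
      case (elim z)
      have "\<Phi> z \<le> (\<Sum>n. c n * 1 + c n * \<phi> n z ^ 8)"
        unfolding \<Phi>_def
      proof (rule suminf_le)
        fix n
        have "c n * \<phi> n z \<le> c n * (1 + \<phi> n z ^ 8)" by (intro mult_left_mono ennreal_le_1_plus_power) auto
        then show "c n * \<phi> n z \<le> c n * 1 + c n * \<phi> n z ^ 8" by (simp only: distrib_left)
      qed (rule summableI)+
      also have "\<dots> = (\<Sum>n. c n) + (\<Sum>n. c n * \<phi> n z ^ 8)" by (simp only: mult_1_right suminf_add[OF summableI summableI])
      also have "\<dots> < \<infinity>"
      proof -
        have "(\<lambda>n. (1/K) ^ n :: real) sums (1 / (1 - 1/K))" using K by (intro geometric_sums) auto
        then have "(\<Sum>n. c n) = ennreal (1 / (1 - 1/K))" unfolding c_def using K by (intro suminf_ennreal_eq) auto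
        then show ?thesis using elim by (simp add: less_top)
      qed
      finally show ?case .
    qed
  qed
  have le1: "Mx (-1) (1/2) (density PM (\<lambda>w. E' w * \<Phi> w)) z \<le> ennreal K * (E' z * \<Phi> z)" for z
  proof -
    have "Mx (of_int (-1)) (1/2) (density PM (\<lambda>w. E' w * \<Phi> w)) z \<le> ennreal (2 * \<sigma>) * (\<Sum>(\<tau>, i)\<in>F. mp \<tau> (- 1 * i) (\<lambda>w. E' w * \<Phi> w) z)"
      unfolding F_def by (rule Mx_density_le_mp) auto
    then have "E z * Mx (-1) (1/2) (density PM (\<lambda>w. E' w * \<Phi> w)) z \<le> E z * (ennreal (2 * \<sigma>) * (\<Sum>(\<tau>, i)\<in>F. mp \<tau> (- 1 * i) (\<lambda>w. E' w * \<Phi> w) z))"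
      by (intro mult_left_mono) auto
    also have "\<dots> = ennreal (2 * \<sigma>) * (\<Sum>(\<tau>, i)\<in>F. E z * mp \<tau> (- 1 * i) (\<lambda>w. E' w * \<Phi> w) z)"
      by (simp only: sum_distrib_left case_prod_unfold mult.left_commute)
    also have "\<dots> \<le> T \<Phi> z" unfolding T_def by (intro mult_left_mono sum_mono) (auto simp: add_increasing2)
    also have "\<dots> \<le> ennreal K * \<Phi> z" by (rule T\<Phi>)
    finally have "E' z * (E z * Mx (-1) (1/2) (density PM (\<lambda>w. E' w * \<Phi> w)) z) \<le> E' z * (ennreal K * \<Phi> z)" by (rule mult_left_mono) simp
    then show ?thesis by (simp only: EE1 mult.left_commute)
  qed
  have le2: "Mx 1 (1/2) (density PM (\<lambda>w. E w * \<Phi> w)) z \<le> ennreal K * (E z * \<Phi> z)" for z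
  proof -
    have "Mx (of_int 1) (1/2) (density PM (\<lambda>w. E w * \<Phi> w)) z \<le> ennreal (2 * \<sigma>) * (\<Sum>(\<tau>, i)\<in>F. mp \<tau> (1 * i) (\<lambda>w. E w * \<Phi> w) z)"
      unfolding F_def by (rule Mx_density_le_mp) auto
    then have "E' z * Mx 1 (1/2) (density PM (\<lambda>w. E w * \<Phi> w)) z \<le> E' z * (ennreal (2 * \<sigma>) * (\<Sum>(\<tau>, i)\<in>F. mp \<tau> (1 * i) (\<lambda>w. E w * \<Phi> w) z))"
      by (intro mult_left_mono) auto
    also have "\<dots> = ennreal (2 * \<sigma>) * (\<Sum>(\<tau>, i)\<in>F. E' z * mp \<tau> (1 * i) (\<lambda>w. E w * \<Phi> w) z)"
      by (simp only: sum_distrib_left case_prod_unfold mult.left_commute)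
    also have "\<dots> \<le> T \<Phi> z" unfolding T_def by (intro mult_left_mono sum_mono) (auto simp: add_increasing)
    also have "\<dots> \<le> ennreal K * \<Phi> z" by (rule T\<Phi>)
    finally have "E z * (E' z * Mx 1 (1/2) (density PM (\<lambda>w. E w * \<Phi> w)) z) \<le> E z * (ennreal K * \<Phi> z)" by (rule mult_left_mono) simp
    then show ?thesis by (simp only: EE1 mult.left_commute)
  qed
  show ?thesis
    using \<kappa> K(1) \<Phi>m pos fin le1 le2 unfolding E_def E'_def by blast
qed

end

section \<open>The representation of functions of parabolic BMO\<close>

context homogeneous_dyadic
begin

lemma PBMO_imp_PB:
  assumes f: "f \<in> PBMO_plus \<rho> p M"
  obtains \<gamma> A a where "0 < \<gamma>" "\<gamma> < 1" "0 \<le> A" "PB 1 \<gamma> A a f"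
proof -
  define avg where "avg \<gamma> a x t l =
      (\<integral>\<^sup>+ z \<in> cyl_plus \<rho> p \<gamma> x t l. ennreal (max 0 (f z - a (cyl \<rho> p x t l))) \<partial>PM) / emeasure PM (cyl_plus \<rho> p \<gamma> x t l)
    + (\<integral>\<^sup>+ z \<in> cyl_minus \<rho> p \<gamma> x t l. ennreal (max 0 (a (cyl \<rho> p x t l) - f z)) \<partial>PM) / emeasure PM (cyl_minus \<rho> p \<gamma> x t l)"
    for \<gamma> and a :: "('a \<times> real) set \<Rightarrow> real" and x t l
  have "\<exists>\<gamma>. 0 < \<gamma> \<and> \<gamma> < 1 \<and> (\<exists>a. (SUP (x, t, l) \<in> UNIV \<times> UNIV \<times> {0<..}. avg \<gamma> a x t l) < \<infinity>)"
    using f unfolding PBMO_plus_def avg_def mem_Collect_eq by (rule conjunct2)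
  then obtain \<gamma> a where \<gamma>: "0 < \<gamma>" "\<gamma> < 1" and fin: "(SUP (x, t, l) \<in> UNIV \<times> UNIV \<times> {0<..}. avg \<gamma> a x t l) < \<infinity>"
    by (elim exE conjE)
  obtain A where A: "(SUP (x, t, l) \<in> UNIV \<times> UNIV \<times> {0<..}. avg \<gamma> a x t l) = ennreal A" "0 \<le> A"
    using fin by (cases "SUP (x, t, l) \<in> UNIV \<times> UNIV \<times> {0<..}. avg \<gamma> a x t l") auto
  have le: "avg \<gamma> a x t l \<le> ennreal A" if "0 < l" for x t l
    unfolding A(1)[symmetric] by (rule SUP_upper2[of "(x, t, l)"]) (use that in auto)
  have f1: "f \<in> borel_measurable PM" using f unfolding PBMO_plus_def L1_loc_def by simp
  have key: "X \<le> ennreal (A * vol x l * l powr p)"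
    if l: "0 < l" and s: "s = 1 \<or> s = -1" and X: "X / emeasure PM (qb x l \<times> tslab s t (\<gamma> * l powr p) (l powr p)) \<le> ennreal A" for X x t l s
  proof -
    have L: "0 < l powr p" "\<gamma> * l powr p < l powr p" using l \<gamma> by auto
    have v: "0 < vol x l" by (rule vol_pos[OF l])
    let ?m = "ennreal (vol x l * (l powr p - \<gamma> * l powr p))"
    have m: "0 < ?m" "?m < \<infinity>" using v L by auto
    have X': "X / ?m \<le> ennreal A" using X unfolding emeasure_cyl[OF l s less_imp_le[OF L(2)]] .
    have "X = X / ?m * ?m" by (rule ennreal_divide_mult_cancel[OF m, symmetric])
    also have "\<dots> \<le> ennreal A * ?m" using X' by (rule mult_right_mono) simp
    also have "\<dots> = ennreal (A * (vol x l * (l powr p - \<gamma> * l powr p)))" using A(2) v L by (simp add: ennreal_mult)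
    also have "\<dots> \<le> ennreal (A * vol x l * l powr p)"
      using A(2) v L \<gamma> unfolding mult.assoc by (intro ennreal_leI mult_left_mono) auto
    finally show ?thesis .
  qed
  have "PB 1 \<gamma> A (\<lambda>x t l. a (cyl \<rho> p x t l)) f"
    unfolding PB_def
  proof (intro conjI allI impI f1)
    fix x t and l :: real assume l: "0 < l"
    have sum: "(\<integral>\<^sup>+ z \<in> qb x l \<times> tslab 1 t (\<gamma> * l powr p) (l powr p). ennreal (max 0 (f z - a (cyl \<rho> p x t l))) \<partial>PM) / emeasure PM (qb x l \<times> tslab 1 t (\<gamma> * l powr p) (l powr p))
    + (\<integral>\<^sup>+ z \<in> qb x l \<times> tslab (-1) t (\<gamma> * l powr p) (l powr p). ennreal (max 0 (a (cyl \<rho> p x t l) - f z)) \<partial>PM) / emeasure PM (qb x l \<times> tslab (-1) t (\<gamma> * l powr p) (l powr p)) \<le> ennreal A"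
      using le[OF l, of x t] unfolding avg_def cyl_plus_eq cyl_minus_eq .
    show "(\<integral>\<^sup>+ z \<in> qb x l \<times> tslab 1 t (\<gamma> * l powr p) (l powr p). ennreal (max 0 (f z - a (cyl \<rho> p x t l))) \<partial>PM) \<le> ennreal (A * vol x l * l powr p)"
      by (rule key[where x=x and t=t and s="1", OF l disjI1[OF refl] order_trans[OF _ sum]]) (simp add: add_increasing add_increasing2)
    show "(\<integral>\<^sup>+ z \<in> qb x l \<times> tslab (-1) t (\<gamma> * l powr p) (l powr p). ennreal (max 0 (a (cyl \<rho> p x t l) - f z)) \<partial>PM) \<le> ennreal (A * vol x l * l powr p)"
      by (rule key[where x=x and t=t and s="-1", OF l disjI2[OF refl] order_trans[OF _ sum]]) (simp add: add_increasing add_increasing2)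
  qed
  then show thesis by (rule that[OF \<gamma> A(2)])
qed

text \<open>By \<open>factorization\<close> from above and \<open>le_Mx\<close> from below, ln m1 =
  - \<kappa> f + ln \<Phi> and ln m2 = \<kappa> f + ln \<Phi> up to bounded errors. The unknown
  \<open>\<Phi>\<close> cancels in the difference.\<close>

lemma PBMO_representation:
  assumes f: "f \<in> PBMO_plus \<rho> p M"
  shows "\<exists>\<gamma> \<alpha> \<beta> b \<nu>1 \<nu>2. 0 < \<gamma> \<and> \<gamma> < 1 \<and> 0 < \<alpha> \<and> 0 < \<beta> \<and> b \<in> L_infty M \<and>
          borel_regular (par_dist \<rho> p) \<nu>1 \<and> borel_regular (par_dist \<rho> p) \<nu>2 \<and>
          log_repr M f \<alpha> (max_minus p M \<delta> N I Q \<gamma> \<nu>1) \<beta> (max_plus p M \<delta> N I Q \<gamma> \<nu>2) b"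
proof -
  obtain \<gamma> A a where \<gamma>: "0 < \<gamma>" "\<gamma> < 1" and A: "0 \<le> A" and PB: "PB 1 \<gamma> A a f"
    by (rule PBMO_imp_PB[OF f])
  interpret pbmo_grid \<rho> M K0 p \<delta> c0 C0 N I ctr Q \<gamma> by unfold_locales (rule \<gamma>)+
  note [measurable] = PB_measurable[OF PB]
  obtain \<kappa> K \<Phi> where \<kappa>: "0 < \<kappa>" and K: "0 < K" and \<Phi>m [measurable]: "\<Phi> \<in> borel_measurable PM" and pos: "\<forall>z. 0 < \<Phi> z"
    and fin: "AE z in PM. \<Phi> z < \<infinity>"
    and up1: "\<forall>z. Mx (-1) (1/2) (density PM (\<lambda>w. ennreal (exp (- (\<kappa> * f w))) * \<Phi> w)) z \<le> ennreal K * (ennreal (exp (- (\<kappa> * f z))) * \<Phi> z)"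
    and up2: "\<forall>z. Mx 1 (1/2) (density PM (\<lambda>w. ennreal (exp (\<kappa> * f w)) * \<Phi> w)) z \<le> ennreal K * (ennreal (exp (\<kappa> * f z)) * \<Phi> z)"
    using factorization[OF PB A] by (elim exE bexE conjE)
  define w1 where "w1 z = ennreal (exp (- (\<kappa> * f z))) * \<Phi> z" for z
  define w2 where "w2 z = ennreal (exp (\<kappa> * f z)) * \<Phi> z" for z
  have [measurable]: "w1 \<in> borel_measurable PM" "w2 \<in> borel_measurable PM" by (simp_all add: w1_def[abs_def] w2_def[abs_def])
  define m1 where "m1 = Mx (-1) (1/2) (density PM w1)"
  define m2 where "m2 = Mx 1 (1/2) (density PM w2)"
  have [measurable]: "m1 \<in> borel_measurable PM" "m2 \<in> borel_measurable PM"
    unfolding m1_def m2_def by (auto intro!: borel_measurable_Mx slab_sets)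
  have wfin: "AE z in PM. w1 z < \<infinity>" "AE z in PM. w2 z < \<infinity>"
    using fin by (auto simp: w1_def w2_def ennreal_mult_less_top elim!: eventually_mono)
  have lo1: "AE z in PM. w1 z \<le> 4 * m1 z" unfolding m1_def using wfin by (intro le_Mx) auto
  have lo2: "AE z in PM. w2 z \<le> 4 * m2 z" unfolding m2_def using wfin by (intro le_Mx) auto
  \<comment> \<open>The difference of the two logarithms is 2 \<kappa> f up to a bounded error; the
    same number also serves as \<open>\<beta>\<close>.\<close>
  define \<alpha> where "\<alpha> = 1 / (2 * \<kappa>)"
  have \<alpha>: "0 < \<alpha>" using \<kappa> by (simp add: \<alpha>_def)
  \<comment> \<open>The remainder itself, so that the representation holds wherever both logarithms
    are finite and only boundedness has to be shown.\<close>
  define b where "b z = f z + \<alpha> * ln (enn2real (m1 z)) - \<alpha> * ln (enn2real (m2 z))" for z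
  define B where "B = \<alpha> * (2 * \<bar>ln 4\<bar> + 2 * \<bar>ln K\<bar>)"
  have main: "AE z in PM. (0 < m1 z \<and> m1 z < \<infinity> \<and> 0 < m2 z \<and> m2 z < \<infinity>) \<and> \<bar>b z\<bar> \<le> B"
    using fin lo1 lo2
  proof eventually_elim
    case (elim z)
    obtain \<phi> where \<phi>: "\<Phi> z = ennreal \<phi>" "0 < \<phi>" using elim(1) pos[rule_format, of z] by (cases "\<Phi> z") auto
    have bounds: "(0 < m \<and> m < \<infinity>) \<and> \<bar>ln (enn2real m) - (e + ln \<phi>)\<bar> \<le> \<bar>ln 4\<bar> + \<bar>ln K\<bar>"
      if m: "ennreal (exp e) * \<Phi> z \<le> 4 * m" "m \<le> ennreal K * (ennreal (exp e) * \<Phi> z)" for m e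
    proof -
      have eq: "ennreal (exp e) * \<Phi> z = ennreal (exp e * \<phi>)" using \<phi> by (simp add: ennreal_mult)
      have Ke: "ennreal K * (ennreal (exp e) * \<Phi> z) = ennreal (K * (exp e * \<phi>))" unfolding eq using K \<phi> by (simp add: ennreal_mult)
      have e0: "0 < exp e * \<phi>" using \<phi> by simp
      have mfin: "m < \<infinity>" using m(2) unfolding Ke by (auto intro: le_less_trans)
      then obtain r where r: "m = ennreal r" "0 \<le> r" by (cases m) auto
      have 1: "exp e * \<phi> \<le> 4 * r" using m(1) r e0 unfolding eq
        by (simp add: ennreal_numeral[symmetric] ennreal_mult[symmetric] ennreal_le_iff del: ennreal_numeral)
      have 2: "r \<le> K * (exp e * \<phi>)" using m(2) r K e0 unfolding Ke by (simp add: ennreal_le_iff)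
      have r0: "0 < r" using 1 e0 by simp
      have "ln (exp e * \<phi>) \<le> ln (4 * r)" using 1 e0 r0 by simp
      then have 3: "e + ln \<phi> \<le> ln 4 + ln r" using \<phi> r0 by (simp add: ln_mult)
      have "ln r \<le> ln (K * (exp e * \<phi>))" using 2 e0 r0 K by simp
      then have 4: "ln r \<le> ln K + (e + ln \<phi>)" using \<phi> K by (simp add: ln_mult)
      have "0 < m" using r r0 by simp
      moreover have "\<bar>ln r - (e + ln \<phi>)\<bar> \<le> \<bar>ln 4\<bar> + \<bar>ln K\<bar>" using 3 4 by linarith
      ultimately show ?thesis using mfin r by simp
    qed
    have b1: "(0 < m1 z \<and> m1 z < \<infinity>) \<and> \<bar>ln (enn2real (m1 z)) - (- (\<kappa> * f z) + ln \<phi>)\<bar> \<le> \<bar>ln 4\<bar> + \<bar>ln K\<bar>"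
    proof (rule bounds)
      show "ennreal (exp (- (\<kappa> * f z))) * \<Phi> z \<le> 4 * m1 z" using elim(2) unfolding w1_def .
      show "m1 z \<le> ennreal K * (ennreal (exp (- (\<kappa> * f z))) * \<Phi> z)" using up1[rule_format, of z] unfolding m1_def w1_def[abs_def] .
    qed
    have b2: "(0 < m2 z \<and> m2 z < \<infinity>) \<and> \<bar>ln (enn2real (m2 z)) - (\<kappa> * f z + ln \<phi>)\<bar> \<le> \<bar>ln 4\<bar> + \<bar>ln K\<bar>"
    proof (rule bounds)
      show "ennreal (exp (\<kappa> * f z)) * \<Phi> z \<le> 4 * m2 z" using elim(3) unfolding w2_def .
      show "m2 z \<le> ennreal K * (ennreal (exp (\<kappa> * f z)) * \<Phi> z)" using up2[rule_format, of z] unfolding m2_def w2_def[abs_def] .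
    qed
    define d where "d = (ln (enn2real (m1 z)) - (- (\<kappa> * f z) + ln \<phi>)) - (ln (enn2real (m2 z)) - (\<kappa> * f z + ln \<phi>))"
    have "b z = f z + \<alpha> * (d - 2 * \<kappa> * f z)" by (simp add: b_def d_def algebra_simps)
    also have "\<dots> = \<alpha> * d" using \<kappa> by (simp add: \<alpha>_def field_simps)
    finally have "b z = \<alpha> * d" .
    moreover have "\<bar>d\<bar> \<le> 2 * \<bar>ln 4\<bar> + 2 * \<bar>ln K\<bar>" unfolding d_def using b1 b2 by linarith
    then have "\<alpha> * \<bar>d\<bar> \<le> B" unfolding B_def using \<alpha> by (intro mult_left_mono) auto
    ultimately have "\<bar>b z\<bar> \<le> B" using \<alpha> by (simp add: abs_mult)
    then show ?case using b1 b2 by blast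
  qed
  have bm: "b \<in> borel_measurable PM" unfolding b_def[abs_def] by measurable
  have "AE z in PM. \<bar>b z\<bar> \<le> B" using main by (auto elim: eventually_mono)
  then have bL: "b \<in> L_infty M" using bm by (auto simp: L_infty_def)
  have mm: "max_minus p M \<delta> N I Q (1/2) (borel_density w1) = m1" "max_plus p M \<delta> N I Q (1/2) (borel_density w2) = m2"
    by (simp_all add: max_minus_eq_Mx max_plus_eq_Mx Mx_borel_density m1_def m2_def)
  have "log_repr M f \<alpha> m1 \<alpha> m2 b"
    unfolding log_repr_def using main
  proof eventually_elim
    case (elim z)
    then have e: "elog (m1 z) = ereal (ln (enn2real (m1 z)))" "elog (m2 z) = ereal (ln (enn2real (m2 z)))"
      using elog_finite by blast+
    show ?case unfolding e by (simp add: b_def)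
  qed
  then have "log_repr M f \<alpha> (max_minus p M \<delta> N I Q (1/2) (borel_density w1)) \<alpha> (max_plus p M \<delta> N I Q (1/2) (borel_density w2)) b"
    unfolding mm .
  \<comment> \<open>The lag 1/2 of the maximal functions comes from \<open>factorization\<close> and
    \<open>le_Mx\<close>; it is independent of the lag \<open>\<gamma>\<close> of
    \<open>f\<close>.\<close>
  then show ?thesis
    using \<alpha> bL borel_regular_borel_density
    by (intro exI[of _ "1/2 :: real"] exI[of _ \<alpha>] exI[of _ b] exI[of _ "borel_density w1"] exI[of _ "borel_density w2"]) simp
qed

end

theorem theorem8p6:
  fixes \<rho> :: "'a \<Rightarrow> 'a \<Rightarrow> real" and M :: "'a measure" and K0 p \<delta> c0 C0 :: real
    and N :: nat and I :: "int \<Rightarrow> nat \<Rightarrow> 'i set"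
    and z :: "int \<Rightarrow> nat \<Rightarrow> 'i \<Rightarrow> 'a" and Q :: "int \<Rightarrow> nat \<Rightarrow> 'i \<Rightarrow> 'a set"
  assumes "quasi_metric \<rho> K0" and "doubling \<rho> M"
    and "standing_assms \<rho> M" and "monotone_geodesic \<rho>"
    and "1 < p" and "standing_assms (par_dist \<rho> p) (par_measure M)"
    and "0 < \<delta>" and "\<delta> < 1" and "96 * K0 ^ 6 * \<delta> \<le> 1"
    and "0 < c0" and "c0 \<le> C0" and "12 * K0 ^ 3 * C0 * \<delta> \<le> c0"
    and "adjacent_dyadic \<rho> K0 \<delta> c0 C0 N I z Q"
  shows
    "(\<forall>f \<in> PBMO_plus \<rho> p M.
        \<exists>\<gamma> \<alpha> \<beta> b \<nu>1 \<nu>2. 0 < \<gamma> \<and> \<gamma> < 1 \<and> 0 < \<alpha> \<and> 0 < \<beta> \<and> b \<in> L_infty M \<and>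
          borel_regular (par_dist \<rho> p) \<nu>1 \<and> borel_regular (par_dist \<rho> p) \<nu>2 \<and>
          log_repr M f \<alpha> (max_minus p M \<delta> N I Q \<gamma> \<nu>1) \<beta> (max_plus p M \<delta> N I Q \<gamma> \<nu>2) b)
     \<and>
     (\<forall>\<alpha> \<beta> b \<nu>1 \<nu>2.
        0 < \<alpha> \<longrightarrow> 0 < \<beta> \<longrightarrow> b \<in> L_infty M \<longrightarrow>
        (\<forall>\<nu>\<in>{\<nu>1, \<nu>2}.
           space \<nu> = UNIV \<and> locally_finite_measure \<rho> p \<nu> \<and>
           {cyl_minus \<rho> p 0 x t l | x t l. 0 < l} \<subseteq> sets \<nu> \<and>
           (AE w in par_measure M. max_minus p M \<delta> N I Q 0 \<nu> w < \<infinity>)) \<longrightarrow>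
        (\<forall>u. log_repr M u \<alpha> (max_minus p M \<delta> N I Q 0 \<nu>1) \<beta> (max_plus p M \<delta> N I Q 0 \<nu>2) b
           \<longrightarrow> u \<in> PBMO_plus \<rho> p M))"
proof -
  interpret homogeneous_dyadic \<rho> M K0 p \<delta> c0 C0 N I z Q
    by (rule homogeneous_dyadic.intro) (rule assms)+
  show ?thesis
  proof (intro conjI ballI allI impI)
    fix f assume "f \<in> PBMO_plus \<rho> p M"
    then show "\<exists>\<gamma> \<alpha> \<beta> b \<nu>1 \<nu>2. 0 < \<gamma> \<and> \<gamma> < 1 \<and> 0 < \<alpha> \<and> 0 < \<beta> \<and> b \<in> L_infty M \<and>
          borel_regular (par_dist \<rho> p) \<nu>1 \<and> borel_regular (par_dist \<rho> p) \<nu>2 \<and>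
          log_repr M f \<alpha> (max_minus p M \<delta> N I Q \<gamma> \<nu>1) \<beta> (max_plus p M \<delta> N I Q \<gamma> \<nu>2) b"
      by (rule PBMO_representation)
  next
    fix \<alpha> \<beta> b \<nu>1 \<nu>2 u
    assume \<alpha>: "0 < \<alpha>" and \<beta>: "0 < \<beta>" and b: "b \<in> L_infty M" and h: "\<forall>\<nu>\<in>{\<nu>1, \<nu>2}.
           space \<nu> = UNIV \<and> locally_finite_measure \<rho> p \<nu> \<and>
           {cyl_minus \<rho> p 0 x t l | x t l. 0 < l} \<subseteq> sets \<nu> \<and>
           (AE w in par_measure M. max_minus p M \<delta> N I Q 0 \<nu> w < \<infinity>)"
      and r: "log_repr M u \<alpha> (max_minus p M \<delta> N I Q 0 \<nu>1) \<beta> (max_plus p M \<delta> N I Q 0 \<nu>2) b"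
    have bm: "box_measurable \<nu>" if "\<nu> \<in> {\<nu>1, \<nu>2}" for \<nu>
      by (rule box_measurableI[OF bspec[OF h that, THEN conjunct1]
            bspec[OF h that, THEN conjunct2, THEN conjunct2, THEN conjunct1]])
    show "u \<in> PBMO_plus \<rho> p M"
      by (rule log_potential_PBMO[OF \<alpha> \<beta> b bm bm r]) simp_all
  qed
qed

end
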